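(* Let $p$ and $q$ be odd primes with $p\mid q+1$ and let $\alpha\in H^3(\mathbb{Z}/p\mathbb{Z},\mathbb{C}^* )\cong\mathbb{Z}/p\mathbb{Z}$. The modular category $\left(\operatorname{Vec}_{(\mathbb{F}_{q^2}, N)}^{p, \alpha}\right)^{\mathbb{Z}/p\mathbb{Z}}$ (defined in the context) has rank $p^2+\frac{q^2-1}{p}$. The following is a complete list of its simple objects (up to isomorphism) and their dimensions: (1) There are exactly $p$ invertible objects $(\mathbf{1},\chi)$, indexed by $\chi\in\widehat{\mathbb{Z}/p\mathbb{Z}}$. The object $(\mathbf{1},\chi)$ is the unit object $\mathbf{1}$ with equivariant structure $\chi(a)\operatorname{id}_{\mathbf{1}}:\mathbf{1}\to\mathbf{1}$, $a\in\mathbb{Z}/p\mathbb{Z}$. (2) There are exactly $\frac{q^2-1}{p}$ simple objects of dimension $p$, parametrized by the orbits of the nonzero elements of $\mathbb{F}_{q^2}$ under the $\mathbb{Z}/p\mathbb{Z}$-action. The object corresponding to an orbit $\mathcal{O}$ is $X_{\mathcal{O}}=\bigoplus_{a\in\mathcal{O}}a$ with equivariant structure $\operatorname{id}_{X_{\mathcal{O}}}$. (3) There are exactly $(p-1)p$ simple objects of dimension $q$, parametrized by pairs $(X_i,\chi)$ with $i\in(\mathbb{Z}/p\mathbb{Z})^*$ and $\chi\in\widehat{\mathbb{Z}/p\mathbb{Z}}$. The object corresponding to $(X_i,\chi)$ is $X_i$ with equivariant structure $\chi(a)\operatorname{id}_{X_i}:X_i\to X_i$, $a\in\mathbb{Z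}/p\mathbb{Z}$.
   Context: Fusion categories are over $\mathbb{C}$. A metric group is a pair $(A,t)$ with $A$ a finite abelian group and $t:A\to\mathbb{C}^*$ a non-degenerate quadratic form; it determines a pointed modular category $\mathcal{C}(A,t)$ with group of invertibles $A$ and self-braiding $c_{a,a}=t(a)\operatorname{id}_{a\otimes a}$, and $\operatorname{Aut}_\otimes^{\mathrm{br}}(\mathcal{C}(A,t))\cong \operatorname{Aut}(A,t)$, the group of automorphisms of $A$ preserving $t$. Let $N:\mathbb{F}_{q^2}\to\mathbb{F}_q$, $N(v)=v^{q+1}$, be the norm, viewed as a quadratic form on the 2-dimensional $\mathbb{F}_q$-vector space $\mathbb{F}_{q^2}$. The associated metric group is $(\mathbb{F}_{q^2},t)$, with $\mathbb{F}_{q^2}$ regarded as an additive group and $t(v)=e^{2\pi i N(v)/q}$. Let $1\neq c\in\mathbb{F}_{q^2}$ with $N(c)=1$ and $c^p=1$ (such $c$ exists since $p\mid q+1$). Then $\rho_c:v\mapsto cv$ preserves $t$ and has order $p$, so it generates a cyclic group of order $p$ of braided autoequivalences of $\mathcal{C}(\mathbb{F}_{q^2},t)$. A braided $\mathbb{Z}/p\mathbb{Z}$-crossed extension of $\mathcal{C}(\mathbb{F}_{q^2},t)$ associated with $\rho_c$ is a faithfully $\mathbb{Z}/p\mathbb{Z}$-graded braided $\mathbb{Z}/p\mathbb{Z}$-crossed fusion category whose trivial component is $\mathcal{C}(\mathbb{F}_{q^2},t)$, with the generator of $\mathbb{Z}/p\mathbb{Z}$ acting on the trivial component by $\rho_c$.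 Since $p$ is coprime to $q$, such extensions exist and, up to equivalence, are parametrized by (a torsor over) $H^3(\mathbb{Z}/p\mathbb{Z},\mathbb{C}^* )\cong\mathbb{Z}/p\mathbb{Z}$. The extension corresponding to $\alpha$ is denoted $\operatorname{Vec}_{(\mathbb{F}_{q^2},N)}^{p,\alpha}$, and $\left(\operatorname{Vec}_{(\mathbb{F}_{q^2},N)}^{p,\alpha}\right)^{\mathbb{Z}/p\mathbb{Z}}$ denotes its $\mathbb{Z}/p\mathbb{Z}$-equivariantization, a non-degenerate braided fusion category; it is integral and is modular with the unique spherical structure whose quantum dimensions equal the Frobenius–Perron dimensions. The simple objects of $\operatorname{Vec}_{(\mathbb{F}_{q^2},N)}^{p,\alpha}$ are the invertible objects $a\in\mathbb{F}_{q^2}$ (the trivial component) and, for each $i\in\{1,\dots,p-1\}$, one non-invertible simple object $X_i$ of dimension $q$, in the degree-$i$ component. The action of $\mathbb{Z}/p\mathbb{Z}$ fixes each $X_i$ up to isomorphism and acts on $\mathbb{F}_{q^2}$ through $v\mapsto cv$; the equivariant structures are written after identifying the image of $\mathbf{1}$, $X_{\mathcal{O}}$ or $X_i$ under the action with the object itself. $\widehat{\mathbb{Z}/p\mathbb{Z}}$ is the group of complex characters of $\mathbb{Z}/p\mathbb{Z}$. Rank means the number of isomorphism classes of simple objects. *)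

theory Defs
  imports
    Complex_Main
    "HOL-Computational_Algebra.Primes"
    "HOL-Algebra.Elementary_Groups"
    "Jordan_Normal_Form.VS_Connect"
    "Jordan_Normal_Form.Char_Poly"
begin

section \<open>Complex-linear abelian categories\<close>

record ('o, 'm) linear_cat =
  Obj :: "'o set"
  Arr :: "'m set"
  Dom :: "'m \<Rightarrow> 'o"
  Cod :: "'m \<Rightarrow> 'o"
  Idt :: "'o \<Rightarrow> 'm"
  Comp :: "'m \<Rightarrow> 'm \<Rightarrow> 'm"  (infixr "\<star>\<index>" 60)
  ZeroArr :: "'o \<Rightarrow> 'o \<Rightarrow> 'm"
  AddArr :: "'m \<Rightarrow> 'm \<Rightarrow> 'm"
  ScaleArr :: "complex \<Rightarrow> 'm \<Rightarrow> 'm"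

text \<open>Composition is in applicative order: \<open>g \<star> f\<close> is \<open>g\<close> after \<open>f\<close>.\<close>

definition Hom :: "('o, 'm, 'z) linear_cat_scheme \<Rightarrow> 'o \<Rightarrow> 'o \<Rightarrow> 'm set" where
  "Hom C X Y = {f \<in> Arr C. Dom C f = X \<and> Cod C f = Y}"

definition hom_space :: "('o, 'm, 'z) linear_cat_scheme \<Rightarrow> 'o \<Rightarrow> 'o \<Rightarrow> (complex, 'm) module" where
  "hom_space C X Y =
     \<lparr>carrier = Hom C X Y, monoid.mult = undefined, one = undefined,
      zero = ZeroArr C X Y, add = AddArr C, module.smult = ScaleArr C\<rparr>"

text \<open>The ring structure part of \<^const>\<open>hom_space\<close> is irrelevant: HOL-Algebra modules only use
  the additive group. The field of scalars is \<^const>\<open>class_ring\<close>, here at type \<^typ>\<open>complex\<close>.\<close>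

locale linear_category =
  fixes C :: "('o, 'm, 'z) linear_cat_scheme" (structure)
  assumes Dom_Obj: "f \<in> Arr C \<Longrightarrow> Dom C f \<in> Obj C"
    and Cod_Obj: "f \<in> Arr C \<Longrightarrow> Cod C f \<in> Obj C"
    and Idt_Hom: "X \<in> Obj C \<Longrightarrow> Idt C X \<in> Hom C X X"
    and Comp_Hom: "\<lbrakk>f \<in> Hom C X Y; g \<in> Hom C Y Z\<rbrakk> \<Longrightarrow> g \<star> f \<in> Hom C X Z"
    and Comp_Idt_right: "f \<in> Hom C X Y \<Longrightarrow> f \<star> Idt C X = f"
    and Comp_Idt_left: "f \<in> Hom C X Y \<Longrightarrow> Idt C Y \<star> f = f"
    and Comp_assoc: "\<lbrakk>f \<in> Hom C X Y; g \<in> Hom C Y Z; h \<in> Hom C Z W\<rbrakk> \<Longrightarrow> h \<star> (g \<star> f) = (h \<star> g) \<star> f"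
    and Hom_vectorspace:
      "\<lbrakk>X \<in> Obj C; Y \<in> Obj C\<rbrakk> \<Longrightarrow> vectorspace (class_ring :: complex ring) (hom_space C X Y)"
    and Comp_add_right: "\<lbrakk>f \<in> Hom C X Y; f' \<in> Hom C X Y; g \<in> Hom C Y Z\<rbrakk>
      \<Longrightarrow> g \<star> AddArr C f f' = AddArr C (g \<star> f) (g \<star> f')"
    and Comp_add_left: "\<lbrakk>f \<in> Hom C X Y; g \<in> Hom C Y Z; g' \<in> Hom C Y Z\<rbrakk>
      \<Longrightarrow> AddArr C g g' \<star> f = AddArr C (g \<star> f) (g' \<star> f)"
    and Comp_scale_right: "\<lbrakk>f \<in> Hom C X Y; g \<in> Hom C Y Z\<rbrakk>
      \<Longrightarrow> g \<star> ScaleArr C s f = ScaleArr C s (g \<star> f)"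
    and Comp_scale_left: "\<lbrakk>f \<in> Hom C X Y; g \<in> Hom C Y Z\<rbrakk>
      \<Longrightarrow> ScaleArr C s g \<star> f = ScaleArr C s (g \<star> f)"

definition hom_dim :: "('o, 'm, 'z) linear_cat_scheme \<Rightarrow> 'o \<Rightarrow> 'o \<Rightarrow> nat" where
  "hom_dim C X Y = vectorspace.dim (class_ring :: complex ring) (hom_space C X Y)"

definition inverse_pair :: "('o, 'm, 'z) linear_cat_scheme \<Rightarrow> 'm \<Rightarrow> 'm \<Rightarrow> bool" where
  "inverse_pair C f g \<longleftrightarrow> f \<in> Arr C \<and> g \<in> Hom C (Cod C f) (Dom C f) \<and>
     g \<star>\<^bsub>C\<^esub> f = Idt C (Dom C f) \<and> f \<star>\<^bsub>C\<^esub> g = Idt C (Cod C f)"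

definition Inv :: "('o, 'm, 'z) linear_cat_scheme \<Rightarrow> 'm \<Rightarrow> 'm" where
  "Inv C f = (THE g. inverse_pair C f g)"

definition Isos :: "('o, 'm, 'z) linear_cat_scheme \<Rightarrow> 'o \<Rightarrow> 'o \<Rightarrow> 'm set" where
  "Isos C X Y = {f \<in> Hom C X Y. \<exists>g. inverse_pair C f g}"

definition isomorphic :: "('o, 'm, 'z) linear_cat_scheme \<Rightarrow> 'o \<Rightarrow> 'o \<Rightarrow> bool" where
  "isomorphic C X Y \<longleftrightarrow> X \<in> Obj C \<and> Y \<in> Obj C \<and> Isos C X Y \<noteq> {}"

definition monic :: "('o, 'm, 'z) linear_cat_scheme \<Rightarrow> 'm \<Rightarrow> bool" where
  "monic C f \<longleftrightarrow> f \<in> Arr C \<and>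
     (\<forall>Z. \<forall>g \<in> Hom C Z (Dom C f). \<forall>h \<in> Hom C Z (Dom C f). f \<star>\<^bsub>C\<^esub> g = f \<star>\<^bsub>C\<^esub> h \<longrightarrow> g = h)"

definition epic :: "('o, 'm, 'z) linear_cat_scheme \<Rightarrow> 'm \<Rightarrow> bool" where
  "epic C f \<longleftrightarrow> f \<in> Arr C \<and>
     (\<forall>Z. \<forall>g \<in> Hom C (Cod C f) Z. \<forall>h \<in> Hom C (Cod C f) Z. g \<star>\<^bsub>C\<^esub> f = h \<star>\<^bsub>C\<^esub> f \<longrightarrow> g = h)"

definition is_kernel :: "('o, 'm, 'z) linear_cat_scheme \<Rightarrow> 'm \<Rightarrow> 'm \<Rightarrow> bool" where
  "is_kernel C k f \<longleftrightarrow> f \<in> Arr C \<and> k \<in> Arr C \<and> Cod C k = Dom C f \<and>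
     f \<star>\<^bsub>C\<^esub> k = ZeroArr C (Dom C k) (Cod C f) \<and>
     (\<forall>Z. \<forall>h \<in> Hom C Z (Dom C f). f \<star>\<^bsub>C\<^esub> h = ZeroArr C Z (Cod C f) \<longrightarrow>
        (\<exists>!u. u \<in> Hom C Z (Dom C k) \<and> k \<star>\<^bsub>C\<^esub> u = h))"

definition is_cokernel :: "('o, 'm, 'z) linear_cat_scheme \<Rightarrow> 'm \<Rightarrow> 'm \<Rightarrow> bool" where
  "is_cokernel C k f \<longleftrightarrow> f \<in> Arr C \<and> k \<in> Arr C \<and> Dom C k = Cod C f \<and>
     k \<star>\<^bsub>C\<^esub> f = ZeroArr C (Dom C f) (Cod C k) \<and>
     (\<forall>Z. \<forall>h \<in> Hom C (Cod C f) Z. h \<star>\<^bsub>C\<^esub> f = ZeroArr C (Dom C f) Z \<longrightarrow>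
        (\<exists>!u. u \<in> Hom C (Cod C k) Z \<and> u \<star>\<^bsub>C\<^esub> k = h))"

definition zero_object :: "('o, 'm, 'z) linear_cat_scheme \<Rightarrow> 'o \<Rightarrow> bool" where
  "zero_object C X \<longleftrightarrow> X \<in> Obj C \<and> Idt C X = ZeroArr C X X"

text \<open>\<open>X\<close> is the direct sum of the finite family \<open>F\<close>, with inclusions \<open>\<iota>\<close> and projections \<open>\<pi>\<close>.
  For \<open>I = {}\<close> this says that \<open>X\<close> is a zero object.\<close>

definition is_direct_sum ::
    "('o, 'm, 'z) linear_cat_scheme \<Rightarrow> 'i set \<Rightarrow> ('i \<Rightarrow> 'o) \<Rightarrow> 'o \<Rightarrow> ('i \<Rightarrow> 'm) \<Rightarrow> ('i \<Rightarrow> 'm) \<Rightarrow> bool" where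
  "is_direct_sum C I F X \<iota> \<pi> \<longleftrightarrow> finite I \<and> X \<in> Obj C \<and>
     (\<forall>i\<in>I. F i \<in> Obj C \<and> \<iota> i \<in> Hom C (F i) X \<and> \<pi> i \<in> Hom C X (F i)) \<and>
     (\<forall>i\<in>I. \<forall>j\<in>I. \<pi> i \<star>\<^bsub>C\<^esub> \<iota> j = (if i = j then Idt C (F i) else ZeroArr C (F j) (F i))) \<and>
     finsum (hom_space C X X) (\<lambda>i. \<iota> i \<star>\<^bsub>C\<^esub> \<pi> i) I = Idt C X"

definition simple :: "('o, 'm, 'z) linear_cat_scheme \<Rightarrow> 'o \<Rightarrow> bool" where
  "simple C X \<longleftrightarrow> X \<in> Obj C \<and> \<not> zero_object C X \<and>
     (\<forall>i. monic C i \<and> Cod C i = X \<longrightarrow> zero_object C (Dom C i) \<or> i \<in> Isos C (Dom C i) X)"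

definition iso_class :: "('o, 'm, 'z) linear_cat_scheme \<Rightarrow> 'o \<Rightarrow> 'o set" where
  "iso_class C X = {Y. isomorphic C X Y}"

definition simple_classes :: "('o, 'm, 'z) linear_cat_scheme \<Rightarrow> 'o set set" where
  "simple_classes C = {iso_class C X | X. simple C X}"

definition cat_rank :: "('o, 'm, 'z) linear_cat_scheme \<Rightarrow> nat" where
  "cat_rank C = card (simple_classes C)"

locale abelian_category = linear_category +
  assumes direct_sums: "(\<And>i::nat. i < n \<Longrightarrow> F i \<in> Obj C) \<Longrightarrow> \<exists>X \<iota> \<pi>. is_direct_sum C {..<n} F X \<iota> \<pi>"
    and kernels: "f \<in> Arr C \<Longrightarrow> \<exists>k. is_kernel C k f"
    and cokernels: "f \<in> Arr C \<Longrightarrow> \<exists>k. is_cokernel C k f"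
    and monic_normal: "monic C k \<Longrightarrow> \<exists>f. is_kernel C k f"
    and epic_normal: "epic C k \<Longrightarrow> \<exists>f. is_cokernel C k f"

section \<open>Fusion categories\<close>

record ('o, 'm) monoidal_cat = "('o, 'm) linear_cat" +
  TObj :: "'o \<Rightarrow> 'o \<Rightarrow> 'o"  (infixr "\<boxdot>\<index>" 70)
  TArr :: "'m \<Rightarrow> 'm \<Rightarrow> 'm"  (infixr "\<boxtimes>\<index>" 70)
  Unit :: "'o"
  Assoc :: "'o \<Rightarrow> 'o \<Rightarrow> 'o \<Rightarrow> 'm"
  LUnit :: "'o \<Rightarrow> 'm"
  RUnit :: "'o \<Rightarrow> 'm"

locale monoidal_linear_category = linear_category C
  for C :: "('o, 'm, 'z) monoidal_cat_scheme" (structure) +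
  assumes TObj_Obj: "\<lbrakk>X \<in> Obj C; Y \<in> Obj C\<rbrakk> \<Longrightarrow> X \<boxdot> Y \<in> Obj C"
    and TArr_Hom: "\<lbrakk>f \<in> Hom C X Y; g \<in> Hom C X' Y'\<rbrakk> \<Longrightarrow> f \<boxtimes> g \<in> Hom C (X \<boxdot> X') (Y \<boxdot> Y')"
    and TArr_Idt: "\<lbrakk>X \<in> Obj C; Y \<in> Obj C\<rbrakk> \<Longrightarrow> Idt C X \<boxtimes> Idt C Y = Idt C (X \<boxdot> Y)"
    and TArr_Comp: "\<lbrakk>f \<in> Hom C X Y; g \<in> Hom C Y Z; f' \<in> Hom C X' Y'; g' \<in> Hom C Y' Z'\<rbrakk>
      \<Longrightarrow> (g \<star> f) \<boxtimes> (g' \<star> f') = (g \<boxtimes> g') \<star> (f \<boxtimes> f')"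
    and TArr_add_left: "\<lbrakk>f \<in> Hom C X Y; f' \<in> Hom C X Y; g \<in> Hom C Z W\<rbrakk>
      \<Longrightarrow> AddArr C f f' \<boxtimes> g = AddArr C (f \<boxtimes> g) (f' \<boxtimes> g)"
    and TArr_add_right: "\<lbrakk>f \<in> Hom C X Y; g \<in> Hom C Z W; g' \<in> Hom C Z W\<rbrakk>
      \<Longrightarrow> f \<boxtimes> AddArr C g g' = AddArr C (f \<boxtimes> g) (f \<boxtimes> g')"
    and TArr_scale_left: "\<lbrakk>f \<in> Arr C; g \<in> Arr C\<rbrakk> \<Longrightarrow> ScaleArr C s f \<boxtimes> g = ScaleArr C s (f \<boxtimes> g)"
    and TArr_scale_right: "\<lbrakk>f \<in> Arr C; g \<in> Arr C\<rbrakk> \<Longrightarrow> f \<boxtimes> ScaleArr C s g = ScaleArr C s (f \<boxtimes> g)"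
    and Unit_Obj: "Unit C \<in> Obj C"
    and Assoc_Isos: "\<lbrakk>X \<in> Obj C; Y \<in> Obj C; Z \<in> Obj C\<rbrakk>
      \<Longrightarrow> Assoc C X Y Z \<in> Isos C ((X \<boxdot> Y) \<boxdot> Z) (X \<boxdot> (Y \<boxdot> Z))"
    and Assoc_natural: "\<lbrakk>f \<in> Hom C X X'; g \<in> Hom C Y Y'; h \<in> Hom C Z Z'\<rbrakk>
      \<Longrightarrow> Assoc C X' Y' Z' \<star> ((f \<boxtimes> g) \<boxtimes> h) = (f \<boxtimes> (g \<boxtimes> h)) \<star> Assoc C X Y Z"
    and LUnit_Isos: "X \<in> Obj C \<Longrightarrow> LUnit C X \<in> Isos C (Unit C \<boxdot> X) X"
    and LUnit_natural: "f \<in> Hom C X Y \<Longrightarrow> LUnit C Y \<star> (Idt C (Unit C) \<boxtimes> f) = f \<star> LUnit C X"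
    and RUnit_Isos: "X \<in> Obj C \<Longrightarrow> RUnit C X \<in> Isos C (X \<boxdot> Unit C) X"
    and RUnit_natural: "f \<in> Hom C X Y \<Longrightarrow> RUnit C Y \<star> (f \<boxtimes> Idt C (Unit C)) = f \<star> RUnit C X"
    and pentagon: "\<lbrakk>X \<in> Obj C; Y \<in> Obj C; Z \<in> Obj C; W \<in> Obj C\<rbrakk>
      \<Longrightarrow> (Idt C X \<boxtimes> Assoc C Y Z W) \<star> Assoc C X (Y \<boxdot> Z) W \<star> (Assoc C X Y Z \<boxtimes> Idt C W)
        = Assoc C X Y (Z \<boxdot> W) \<star> Assoc C (X \<boxdot> Y) Z W"
    and triangle: "\<lbrakk>X \<in> Obj C; Y \<in> Obj C\<rbrakk>
      \<Longrightarrow> (Idt C X \<boxtimes> LUnit C Y) \<star> Assoc C X (Unit C) Y = RUnit C X \<boxtimes> Idt C Y"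

text \<open>\<open>X'\<close> is a left dual of \<open>X\<close> (equivalently, \<open>X\<close> is a right dual of \<open>X'\<close>), with
  \<open>ev : X' \<otimes> X \<rightarrow> 1\<close> and \<open>coev : 1 \<rightarrow> X \<otimes> X'\<close>.\<close>

definition left_dual ::
    "('o, 'm, 'z) monoidal_cat_scheme \<Rightarrow> 'o \<Rightarrow> 'o \<Rightarrow> 'm \<Rightarrow> 'm \<Rightarrow> bool" where
  "left_dual C X X' ev coev \<longleftrightarrow> X \<in> Obj C \<and> X' \<in> Obj C \<and>
     ev \<in> Hom C (X' \<boxdot>\<^bsub>C\<^esub> X) (Unit C) \<and> coev \<in> Hom C (Unit C) (X \<boxdot>\<^bsub>C\<^esub> X') \<and>
     RUnit C X \<star>\<^bsub>C\<^esub> (Idt C X \<boxtimes>\<^bsub>C\<^esub> ev) \<star>\<^bsub>C\<^esub> Assoc C X X' X \<star>\<^bsub>C\<^esub> (coev \<boxtimes>\<^bsub>C\<^esub> Idt C X)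
       = LUnit C X \<and>
     LUnit C X' \<star>\<^bsub>C\<^esub> (ev \<boxtimes>\<^bsub>C\<^esub> Idt C X') \<star>\<^bsub>C\<^esub> Inv C (Assoc C X' X X') \<star>\<^bsub>C\<^esub> (Idt C X' \<boxtimes>\<^bsub>C\<^esub> coev)
       = RUnit C X'"

locale fusion_category = monoidal_linear_category C + abelian_category C
  for C :: "('o, 'm, 'z) monoidal_cat_scheme" (structure) +
  assumes Hom_fin_dim: "\<lbrakk>X \<in> Obj C; Y \<in> Obj C\<rbrakk>
      \<Longrightarrow> vectorspace.fin_dim (class_ring :: complex ring) (hom_space C X Y)"
    and semisimple: "X \<in> Obj C
      \<Longrightarrow> \<exists>(n::nat) F \<iota> \<pi>. (\<forall>i<n. simple C (F i)) \<and> is_direct_sum C {..<n} F X \<iota> \<pi>"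
    and finite_simple_classes: "finite (simple_classes C)"
    and simple_Unit: "simple C (Unit C)"
    and left_duals: "X \<in> Obj C \<Longrightarrow> \<exists>X' ev coev. left_dual C X X' ev coev"
    and right_duals: "X \<in> Obj C \<Longrightarrow> \<exists>X' ev coev. left_dual C X' X ev coev"

definition invertible_object :: "('o, 'm, 'z) monoidal_cat_scheme \<Rightarrow> 'o \<Rightarrow> bool" where
  "invertible_object C X \<longleftrightarrow> X \<in> Obj C \<and>
     (\<exists>Y \<in> Obj C. isomorphic C (X \<boxdot>\<^bsub>C\<^esub> Y) (Unit C) \<and> isomorphic C (Y \<boxdot>\<^bsub>C\<^esub> X) (Unit C))"

text \<open>\<^term>\<open>left_mult_matrix C X e n\<close> is the matrix of left multiplication by the class of \<open>X\<close> on the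
  Grothendieck ring, in the basis of classes of simple objects enumerated by \<open>e\<close>:
  the multiplicity of a simple \<open>Z\<close> in \<open>X \<otimes> Y\<close> is the dimension of \<open>Hom(Z, X \<otimes> Y)\<close>.\<close>

definition left_mult_matrix ::
    "('o, 'm, 'z) monoidal_cat_scheme \<Rightarrow> 'o \<Rightarrow> (nat \<Rightarrow> 'o) \<Rightarrow> nat \<Rightarrow> real mat" where
  "left_mult_matrix C X e n = mat n n (\<lambda>(i, j). real (hom_dim C (e i) (X \<boxdot>\<^bsub>C\<^esub> e j)))"

definition simple_enumeration :: "('o, 'm, 'z) linear_cat_scheme \<Rightarrow> nat \<Rightarrow> 'o" where
  "simple_enumeration C = (SOME e. (\<forall>i<cat_rank C. simple C (e i)) \<and>
     bij_betw (\<lambda>i. iso_class C (e i)) {..<cat_rank C} (simple_classes C))"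

text \<open>The Frobenius--Perron dimension is the largest non-negative eigenvalue of left multiplication.\<close>

definition FPdim :: "('o, 'm, 'z) monoidal_cat_scheme \<Rightarrow> 'o \<Rightarrow> real" where
  "FPdim C X = (GREATEST r. 0 \<le> r \<and>
     eigenvalue (left_mult_matrix C X (simple_enumeration C) (cat_rank C)) r)"

section \<open>Braided fusion categories and metric groups\<close>

record ('o, 'm) braided_cat = "('o, 'm) monoidal_cat" +
  Braid :: "'o \<Rightarrow> 'o \<Rightarrow> 'm"

locale braided_fusion_category = fusion_category C
  for C :: "('o, 'm, 'z) braided_cat_scheme" (structure) +
  assumes Braid_Isos: "\<lbrakk>X \<in> Obj C; Y \<in> Obj C\<rbrakk> \<Longrightarrow> Braid C X Y \<in> Isos C (X \<boxdot> Y) (Y \<boxdot> X)"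
    and Braid_natural: "\<lbrakk>f \<in> Hom C X X'; g \<in> Hom C Y Y'\<rbrakk>
      \<Longrightarrow> Braid C X' Y' \<star> (f \<boxtimes> g) = (g \<boxtimes> f) \<star> Braid C X Y"
    and hexagon_right: "\<lbrakk>X \<in> Obj C; Y \<in> Obj C; Z \<in> Obj C\<rbrakk>
      \<Longrightarrow> Assoc C Y Z X \<star> Braid C X (Y \<boxdot> Z) \<star> Assoc C X Y Z
        = (Idt C Y \<boxtimes> Braid C X Z) \<star> Assoc C Y X Z \<star> (Braid C X Y \<boxtimes> Idt C Z)"
    and hexagon_left: "\<lbrakk>X \<in> Obj C; Y \<in> Obj C; Z \<in> Obj C\<rbrakk>
      \<Longrightarrow> Inv C (Assoc C Z X Y) \<star> Braid C (X \<boxdot> Y) Z \<star> Inv C (Assoc C X Y Z)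
        = (Braid C X Z \<boxtimes> Idt C Y) \<star> Inv C (Assoc C X Z Y) \<star> (Idt C X \<boxtimes> Braid C Y Z)"

text \<open>\<open>C\<close> is the pointed braided fusion category \<open>\<C>(A, t)\<close> of a metric group \<open>(A, t)\<close>, the finite
  abelian group \<open>A\<close> being the additive group of the type \<open>'a\<close>: every simple object is invertible,
  \<open>\<delta>\<close> induces an isomorphism from \<open>A\<close> to the group of isomorphism classes of invertible objects,
  and the self-braiding of \<open>\<delta> a\<close> is the scalar \<open>t a\<close>. By Joyal and Street this determines \<open>C\<close> up to
  braided equivalence.\<close>

definition pointed_category_of_metric_group ::
    "('a::{ab_group_add, finite} \<Rightarrow> complex) \<Rightarrow> ('a \<Rightarrow> 'o) \<Rightarrow> ('o, 'm, 'z) braided_cat_scheme \<Rightarrow> bool" where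
  "pointed_category_of_metric_group t \<delta> C \<longleftrightarrow> braided_fusion_category C \<and>
     (\<forall>X. simple C X \<longrightarrow> invertible_object C X) \<and>
     bij_betw (\<lambda>a. iso_class C (\<delta> a)) UNIV {iso_class C X | X. invertible_object C X} \<and>
     (\<forall>a. \<delta> a \<in> Obj C) \<and>
     (\<forall>a b. isomorphic C (\<delta> a \<boxdot>\<^bsub>C\<^esub> \<delta> b) (\<delta> (a + b))) \<and>
     (\<forall>a. Braid C (\<delta> a) (\<delta> a) = ScaleArr C (t a) (Idt C (\<delta> a \<boxdot>\<^bsub>C\<^esub> \<delta> a)))"

text \<open>The norm \<open>N(v) = v ^ (q + 1)\<close> of the field with \<open>q\<^sup>2\<close> elements, \<open>q\<close> prime, takes values in
  the prime field. \<open>norm_residue\<close> is the representative of \<open>N(v)\<close> in \<open>{0..<q}\<close>.\<close>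

definition field_norm :: "nat \<Rightarrow> 'a::field \<Rightarrow> 'a" where
  "field_norm q v = v ^ (q + 1)"

definition norm_residue :: "nat \<Rightarrow> 'a::field \<Rightarrow> nat" where
  "norm_residue q v = (THE n. n < q \<and> of_nat n = field_norm q v)"

definition norm_quadratic_form :: "nat \<Rightarrow> 'a::field \<Rightarrow> complex" where
  "norm_quadratic_form q v = exp (2 * of_real pi * \<i> * of_nat (norm_residue q v) / of_nat q)"

section \<open>Braided G-crossed fusion categories\<close>

text \<open>\<open>Deg g\<close> is the set of objects of the component \<open>C\<^sub>g\<close>. The action consists of functors \<open>T\<^sub>g\<close>
  (\<open>ActO\<close> on objects, \<open>ActA\<close> on morphisms) with tensor structures
  \<open>ActT g X Y : T\<^sub>g X \<otimes> T\<^sub>g Y \<rightarrow> T\<^sub>g (X \<otimes> Y)\<close> and \<open>ActU g : 1 \<rightarrow> T\<^sub>g 1\<close>, and of monoidal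
  isomorphisms \<open>ActM g h X : T\<^sub>g (T\<^sub>h X) \<rightarrow> T\<^sub>g\<^sub>h X\<close> and \<open>ActI X : X \<rightarrow> T\<^sub>1 X\<close>. The crossed
  braiding is \<open>CBraid g X Y : X \<otimes> Y \<rightarrow> T\<^sub>g Y \<otimes> X\<close> for \<open>X\<close> in \<open>C\<^sub>g\<close>.\<close>

record ('g, 'o, 'm) crossed_cat = "('o, 'm) monoidal_cat" +
  Deg :: "'g \<Rightarrow> 'o set"
  ActO :: "'g \<Rightarrow> 'o \<Rightarrow> 'o"
  ActA :: "'g \<Rightarrow> 'm \<Rightarrow> 'm"
  ActT :: "'g \<Rightarrow> 'o \<Rightarrow> 'o \<Rightarrow> 'm"
  ActU :: "'g \<Rightarrow> 'm"
  ActM :: "'g \<Rightarrow> 'g \<Rightarrow> 'o \<Rightarrow> 'm"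
  ActI :: "'o \<Rightarrow> 'm"
  CBraid :: "'g \<Rightarrow> 'o \<Rightarrow> 'o \<Rightarrow> 'm"

locale graded_fusion_category = G: group G + fusion_category C
  for G :: "('g, 'w) monoid_scheme" and C :: "('g, 'o, 'm, 'z) crossed_cat_scheme" (structure) +
  assumes finite_G: "finite (carrier G)"
    and Deg_Obj: "g \<in> carrier G \<Longrightarrow> Deg C g \<subseteq> Obj C"
    and Deg_isomorphic: "\<lbrakk>g \<in> carrier G; X \<in> Deg C g; isomorphic C X Y\<rbrakk> \<Longrightarrow> Y \<in> Deg C g"
    and Deg_decomposition: "X \<in> Obj C
      \<Longrightarrow> \<exists>F \<iota> \<pi>. (\<forall>g\<in>carrier G. F g \<in> Deg C g) \<and> is_direct_sum C (carrier G) F X \<iota> \<pi>"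
    and Deg_orthogonal: "\<lbrakk>g \<in> carrier G; h \<in> carrier G; g \<noteq> h; X \<in> Deg C g; Y \<in> Deg C h\<rbrakk>
      \<Longrightarrow> Hom C X Y = {ZeroArr C X Y}"
    and Deg_TObj: "\<lbrakk>g \<in> carrier G; h \<in> carrier G; X \<in> Deg C g; Y \<in> Deg C h\<rbrakk>
      \<Longrightarrow> X \<boxdot> Y \<in> Deg C (g \<otimes>\<^bsub>G\<^esub> h)"

locale braided_crossed_category = graded_fusion_category G C
  for G :: "('g, 'w) monoid_scheme" and C :: "('g, 'o, 'm, 'z) crossed_cat_scheme" (structure) +
  \<comment> \<open>each \<open>T\<^sub>g\<close> is a linear functor\<close>
  assumes ActO_Obj: "\<lbrakk>g \<in> carrier G; X \<in> Obj C\<rbrakk> \<Longrightarrow> ActO C g X \<in> Obj C"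
    and ActA_Hom: "\<lbrakk>g \<in> carrier G; f \<in> Hom C X Y\<rbrakk> \<Longrightarrow> ActA C g f \<in> Hom C (ActO C g X) (ActO C g Y)"
    and ActA_Idt: "\<lbrakk>g \<in> carrier G; X \<in> Obj C\<rbrakk> \<Longrightarrow> ActA C g (Idt C X) = Idt C (ActO C g X)"
    and ActA_Comp: "\<lbrakk>g \<in> carrier G; f \<in> Hom C X Y; f' \<in> Hom C Y Z\<rbrakk>
      \<Longrightarrow> ActA C g (f' \<star> f) = ActA C g f' \<star> ActA C g f"
    and ActA_add: "\<lbrakk>g \<in> carrier G; f \<in> Hom C X Y; f' \<in> Hom C X Y\<rbrakk>
      \<Longrightarrow> ActA C g (AddArr C f f') = AddArr C (ActA C g f) (ActA C g f')"
    and ActA_scale: "\<lbrakk>g \<in> carrier G; f \<in> Arr C\<rbrakk>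
      \<Longrightarrow> ActA C g (ScaleArr C s f) = ScaleArr C s (ActA C g f)"
  \<comment> \<open>each \<open>T\<^sub>g\<close> is monoidal\<close>
    and ActT_Isos: "\<lbrakk>g \<in> carrier G; X \<in> Obj C; Y \<in> Obj C\<rbrakk>
      \<Longrightarrow> ActT C g X Y \<in> Isos C (ActO C g X \<boxdot> ActO C g Y) (ActO C g (X \<boxdot> Y))"
    and ActT_natural: "\<lbrakk>g \<in> carrier G; f \<in> Hom C X X'; f' \<in> Hom C Y Y'\<rbrakk>
      \<Longrightarrow> ActT C g X' Y' \<star> (ActA C g f \<boxtimes> ActA C g f') = ActA C g (f \<boxtimes> f') \<star> ActT C g X Y"
    and ActU_Isos: "g \<in> carrier G \<Longrightarrow> ActU C g \<in> Isos C (Unit C) (ActO C g (Unit C))"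
    and Act_Assoc: "\<lbrakk>g \<in> carrier G; X \<in> Obj C; Y \<in> Obj C; Z \<in> Obj C\<rbrakk>
      \<Longrightarrow> ActA C g (Assoc C X Y Z) \<star> ActT C g (X \<boxdot> Y) Z \<star> (ActT C g X Y \<boxtimes> Idt C (ActO C g Z))
        = ActT C g X (Y \<boxdot> Z) \<star> (Idt C (ActO C g X) \<boxtimes> ActT C g Y Z)
            \<star> Assoc C (ActO C g X) (ActO C g Y) (ActO C g Z)"
    and Act_LUnit: "\<lbrakk>g \<in> carrier G; X \<in> Obj C\<rbrakk>
      \<Longrightarrow> ActA C g (LUnit C X) \<star> ActT C g (Unit C) X \<star> (ActU C g \<boxtimes> Idt C (ActO C g X))
        = LUnit C (ActO C g X)"
    and Act_RUnit: "\<lbrakk>g \<in> carrier G; X \<in> Obj C\<rbrakk>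
      \<Longrightarrow> ActA C g (RUnit C X) \<star> ActT C g X (Unit C) \<star> (Idt C (ActO C g X) \<boxtimes> ActU C g)
        = RUnit C (ActO C g X)"
  \<comment> \<open>monoidal isomorphisms between \<open>T\<^sub>g T\<^sub>h\<close> and \<open>T\<^sub>g\<^sub>h\<close>\<close>
    and ActM_Isos: "\<lbrakk>g \<in> carrier G; h \<in> carrier G; X \<in> Obj C\<rbrakk>
      \<Longrightarrow> ActM C g h X \<in> Isos C (ActO C g (ActO C h X)) (ActO C (g \<otimes>\<^bsub>G\<^esub> h) X)"
    and ActM_natural: "\<lbrakk>g \<in> carrier G; h \<in> carrier G; f \<in> Hom C X Y\<rbrakk>
      \<Longrightarrow> ActM C g h Y \<star> ActA C g (ActA C h f) = ActA C (g \<otimes>\<^bsub>G\<^esub> h) f \<star> ActM C g h X"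
    and ActM_ActT: "\<lbrakk>g \<in> carrier G; h \<in> carrier G; X \<in> Obj C; Y \<in> Obj C\<rbrakk>
      \<Longrightarrow> ActM C g h (X \<boxdot> Y) \<star> ActA C g (ActT C h X Y) \<star> ActT C g (ActO C h X) (ActO C h Y)
        = ActT C (g \<otimes>\<^bsub>G\<^esub> h) X Y \<star> (ActM C g h X \<boxtimes> ActM C g h Y)"
    and ActM_ActU: "\<lbrakk>g \<in> carrier G; h \<in> carrier G\<rbrakk>
      \<Longrightarrow> ActM C g h (Unit C) \<star> ActA C g (ActU C h) \<star> ActU C g = ActU C (g \<otimes>\<^bsub>G\<^esub> h)"
  \<comment> \<open>monoidal isomorphism between the identity and \<open>T\<^sub>1\<close>\<close>
    and ActI_Isos: "X \<in> Obj C \<Longrightarrow> ActI C X \<in> Isos C X (ActO C \<one>\<^bsub>G\<^esub> X)"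
    and ActI_natural: "f \<in> Hom C X Y \<Longrightarrow> ActI C Y \<star> f = ActA C \<one>\<^bsub>G\<^esub> f \<star> ActI C X"
    and ActI_ActT: "\<lbrakk>X \<in> Obj C; Y \<in> Obj C\<rbrakk>
      \<Longrightarrow> ActI C (X \<boxdot> Y) = ActT C \<one>\<^bsub>G\<^esub> X Y \<star> (ActI C X \<boxtimes> ActI C Y)"
    and ActI_ActU: "ActI C (Unit C) = ActU C \<one>\<^bsub>G\<^esub>"
  \<comment> \<open>coherence of the action\<close>
    and ActM_assoc: "\<lbrakk>g \<in> carrier G; h \<in> carrier G; k \<in> carrier G; X \<in> Obj C\<rbrakk>
      \<Longrightarrow> ActM C (g \<otimes>\<^bsub>G\<^esub> h) k X \<star> ActM C g h (ActO C k X)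
        = ActM C g (h \<otimes>\<^bsub>G\<^esub> k) X \<star> ActA C g (ActM C h k X)"
    and ActM_one_right: "\<lbrakk>g \<in> carrier G; X \<in> Obj C\<rbrakk>
      \<Longrightarrow> ActM C g \<one>\<^bsub>G\<^esub> X \<star> ActA C g (ActI C X) = Idt C (ActO C g X)"
    and ActM_one_left: "\<lbrakk>g \<in> carrier G; X \<in> Obj C\<rbrakk>
      \<Longrightarrow> ActM C \<one>\<^bsub>G\<^esub> g X \<star> ActI C (ActO C g X) = Idt C (ActO C g X)"
    and Act_Deg: "\<lbrakk>g \<in> carrier G; h \<in> carrier G; X \<in> Deg C h\<rbrakk>
      \<Longrightarrow> ActO C g X \<in> Deg C (g \<otimes>\<^bsub>G\<^esub> h \<otimes>\<^bsub>G\<^esub> inv\<^bsub>G\<^esub> g)"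
  \<comment> \<open>the crossed braiding\<close>
    and CBraid_Isos: "\<lbrakk>g \<in> carrier G; X \<in> Deg C g; Y \<in> Obj C\<rbrakk>
      \<Longrightarrow> CBraid C g X Y \<in> Isos C (X \<boxdot> Y) (ActO C g Y \<boxdot> X)"
    and CBraid_natural: "\<lbrakk>g \<in> carrier G; X \<in> Deg C g; X' \<in> Deg C g; f \<in> Hom C X X'; f' \<in> Hom C Y Y'\<rbrakk>
      \<Longrightarrow> CBraid C g X' Y' \<star> (f \<boxtimes> f') = (ActA C g f' \<boxtimes> f) \<star> CBraid C g X Y"
    and CBraid_Act: "\<lbrakk>g \<in> carrier G; h \<in> carrier G; X \<in> Deg C h; Y \<in> Obj C\<rbrakk>
      \<Longrightarrow> (ActM C g h Y \<boxtimes> Idt C (ActO C g X)) \<star> Inv C (ActT C g (ActO C h Y) X)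
            \<star> ActA C g (CBraid C h X Y) \<star> ActT C g X Y
        = (ActM C (g \<otimes>\<^bsub>G\<^esub> h \<otimes>\<^bsub>G\<^esub> inv\<^bsub>G\<^esub> g) g Y \<boxtimes> Idt C (ActO C g X))
            \<star> CBraid C (g \<otimes>\<^bsub>G\<^esub> h \<otimes>\<^bsub>G\<^esub> inv\<^bsub>G\<^esub> g) (ActO C g X) (ActO C g Y)"
    and CBraid_TObj_right: "\<lbrakk>g \<in> carrier G; X \<in> Deg C g; Y \<in> Obj C; Z \<in> Obj C\<rbrakk>
      \<Longrightarrow> CBraid C g X (Y \<boxdot> Z) \<star> Assoc C X Y Z
        = (ActT C g Y Z \<boxtimes> Idt C X) \<star> Inv C (Assoc C (ActO C g Y) (ActO C g Z) X)
            \<star> (Idt C (ActO C g Y) \<boxtimes> CBraid C g X Z) \<star> Assoc C (ActO C g Y) X Z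
            \<star> (CBraid C g X Y \<boxtimes> Idt C Z)"
    and CBraid_TObj_left: "\<lbrakk>g \<in> carrier G; h \<in> carrier G; X \<in> Deg C g; Y \<in> Deg C h; Z \<in> Obj C\<rbrakk>
      \<Longrightarrow> CBraid C (g \<otimes>\<^bsub>G\<^esub> h) (X \<boxdot> Y) Z
        = (ActM C g h Z \<boxtimes> Idt C (X \<boxdot> Y)) \<star> Assoc C (ActO C g (ActO C h Z)) X Y
            \<star> (CBraid C g X (ActO C h Z) \<boxtimes> Idt C Y) \<star> Inv C (Assoc C X (ActO C h Z) Y)
            \<star> (Idt C X \<boxtimes> CBraid C h Y Z) \<star> Assoc C X Y Z"

definition faithfully_graded ::
    "('g, 'w) monoid_scheme \<Rightarrow> ('g, 'o, 'm, 'z) crossed_cat_scheme \<Rightarrow> bool" where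
  "faithfully_graded G C \<longleftrightarrow> (\<forall>g\<in>carrier G. \<exists>X\<in>Deg C g. \<not> zero_object C X)"

text \<open>The crossed braiding of the trivial component becomes a braiding after identifying
  \<open>T\<^sub>1 Y\<close> with \<open>Y\<close>.\<close>

definition trivial_component ::
    "('g, 'w) monoid_scheme \<Rightarrow> ('g, 'o, 'm, 'z) crossed_cat_scheme \<Rightarrow> ('o, 'm) braided_cat" where
  "trivial_component G C =
     \<lparr>Obj = Deg C \<one>\<^bsub>G\<^esub>,
      Arr = {f \<in> Arr C. Dom C f \<in> Deg C \<one>\<^bsub>G\<^esub> \<and> Cod C f \<in> Deg C \<one>\<^bsub>G\<^esub>},
      Dom = Dom C, Cod = Cod C, Idt = Idt C, Comp = Comp C,
      ZeroArr = ZeroArr C, AddArr = AddArr C, ScaleArr = ScaleArr C,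
      TObj = TObj C, TArr = TArr C, Unit = Unit C,
      Assoc = Assoc C, LUnit = LUnit C, RUnit = RUnit C,
      Braid = (\<lambda>X Y. (Inv C (ActI C Y) \<boxtimes>\<^bsub>C\<^esub> Idt C X) \<star>\<^bsub>C\<^esub> CBraid C \<one>\<^bsub>G\<^esub> X Y)\<rparr>"

section \<open>Equivariantization\<close>

text \<open>An equivariant object is a pair \<open>(X, u)\<close> with isomorphisms \<open>u g : T\<^sub>g X \<rightarrow> X\<close>. The family \<open>u\<close> is
  taken \<^const>\<open>extensional\<close> so that it is determined by its values on the group. Since a morphism of
  \<open>C\<close> may underlie several equivariant morphisms, the latter carry their source and target.\<close>

definition equivariant_objects ::
    "('g, 'w) monoid_scheme \<Rightarrow> ('g, 'o, 'm, 'z) crossed_cat_scheme \<Rightarrow> ('o \<times> ('g \<Rightarrow> 'm)) set" where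
  "equivariant_objects G C = {(X, u). X \<in> Obj C \<and> u \<in> extensional (carrier G) \<and>
     (\<forall>g\<in>carrier G. u g \<in> Isos C (ActO C g X) X) \<and>
     (\<forall>g\<in>carrier G. \<forall>h\<in>carrier G.
        u (g \<otimes>\<^bsub>G\<^esub> h) \<star>\<^bsub>C\<^esub> ActM C g h X = u g \<star>\<^bsub>C\<^esub> ActA C g (u h))}"

definition equivariant_arrows ::
    "('g, 'w) monoid_scheme \<Rightarrow> ('g, 'o, 'm, 'z) crossed_cat_scheme
      \<Rightarrow> (('o \<times> ('g \<Rightarrow> 'm)) \<times> 'm \<times> ('o \<times> ('g \<Rightarrow> 'm))) set" where
  "equivariant_arrows G C = {((X, u), f, (Y, v)).
     (X, u) \<in> equivariant_objects G C \<and> (Y, v) \<in> equivariant_objects G C \<and> f \<in> Hom C X Y \<and>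
     (\<forall>g\<in>carrier G. f \<star>\<^bsub>C\<^esub> u g = v g \<star>\<^bsub>C\<^esub> ActA C g f)}"

definition equivariant_tensor ::
    "('g, 'w) monoid_scheme \<Rightarrow> ('g, 'o, 'm, 'z) crossed_cat_scheme
      \<Rightarrow> 'o \<times> ('g \<Rightarrow> 'm) \<Rightarrow> 'o \<times> ('g \<Rightarrow> 'm) \<Rightarrow> 'o \<times> ('g \<Rightarrow> 'm)" where
  "equivariant_tensor G C = (\<lambda>(X, u) (Y, v).
     (X \<boxdot>\<^bsub>C\<^esub> Y, \<lambda>g\<in>carrier G. (u g \<boxtimes>\<^bsub>C\<^esub> v g) \<star>\<^bsub>C\<^esub> Inv C (ActT C g X Y)))"

definition unit_structure ::
    "('g, 'w) monoid_scheme \<Rightarrow> ('g, 'o, 'm, 'z) crossed_cat_scheme \<Rightarrow> 'g \<Rightarrow> 'm" where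
  "unit_structure G C = (\<lambda>g\<in>carrier G. Inv C (ActU C g))"

text \<open>The braiding of \<open>(X, u)\<close> and \<open>(Y, v)\<close> is \<open>(v g \<otimes> id) c\<close> on the summand of \<open>X\<close> of degree \<open>g\<close>; it
  does not depend on the chosen decomposition of \<open>X\<close>.\<close>

definition degree_decomposition ::
    "('g, 'w) monoid_scheme \<Rightarrow> ('g, 'o, 'm, 'z) crossed_cat_scheme
      \<Rightarrow> 'o \<Rightarrow> ('g \<Rightarrow> 'o) \<times> ('g \<Rightarrow> 'm) \<times> ('g \<Rightarrow> 'm)" where
  "degree_decomposition G C X = (SOME (F, \<iota>, \<pi>).
     (\<forall>g\<in>carrier G. F g \<in> Deg C g) \<and> is_direct_sum C (carrier G) F X \<iota> \<pi>)"

definition equivariant_braiding ::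
    "('g, 'w) monoid_scheme \<Rightarrow> ('g, 'o, 'm, 'z) crossed_cat_scheme
      \<Rightarrow> 'o \<times> ('g \<Rightarrow> 'm) \<Rightarrow> 'o \<times> ('g \<Rightarrow> 'm) \<Rightarrow> 'm" where
  "equivariant_braiding G C = (\<lambda>(X, u) (Y, v). case degree_decomposition G C X of (F, \<iota>, \<pi>) \<Rightarrow>
     finsum (hom_space C (X \<boxdot>\<^bsub>C\<^esub> Y) (Y \<boxdot>\<^bsub>C\<^esub> X))
       (\<lambda>g. (v g \<boxtimes>\<^bsub>C\<^esub> \<iota> g) \<star>\<^bsub>C\<^esub> CBraid C g (F g) Y \<star>\<^bsub>C\<^esub> (\<pi> g \<boxtimes>\<^bsub>C\<^esub> Idt C Y)) (carrier G))"

definition equivariantization ::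
    "('g, 'w) monoid_scheme \<Rightarrow> ('g, 'o, 'm, 'z) crossed_cat_scheme
      \<Rightarrow> ('o \<times> ('g \<Rightarrow> 'm), ('o \<times> ('g \<Rightarrow> 'm)) \<times> 'm \<times> ('o \<times> ('g \<Rightarrow> 'm))) braided_cat" where
  "equivariantization G C = (let tensor = equivariant_tensor G C; unit = (Unit C, unit_structure G C) in
     \<lparr>Obj = equivariant_objects G C,
      Arr = equivariant_arrows G C,
      Dom = (\<lambda>(x, f, y). x),
      Cod = (\<lambda>(x, f, y). y),
      Idt = (\<lambda>x. (x, Idt C (fst x), x)),
      Comp = (\<lambda>(y', g, z) (x, f, y). (x, g \<star>\<^bsub>C\<^esub> f, z)),
      ZeroArr = (\<lambda>x y. (x, ZeroArr C (fst x) (fst y), y)),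
      AddArr = (\<lambda>(x, f, y) (x', f', y'). (x, AddArr C f f', y)),
      ScaleArr = (\<lambda>s (x, f, y). (x, ScaleArr C s f, y)),
      TObj = tensor,
      TArr = (\<lambda>(x, f, y) (x', f', y'). (tensor x x', f \<boxtimes>\<^bsub>C\<^esub> f', tensor y y')),
      Unit = unit,
      Assoc = (\<lambda>x y z. (tensor (tensor x y) z, Assoc C (fst x) (fst y) (fst z), tensor x (tensor y z))),
      LUnit = (\<lambda>x. (tensor unit x, LUnit C (fst x), x)),
      RUnit = (\<lambda>x. (tensor x unit, RUnit C (fst x), x)),
      Braid = (\<lambda>x y. (tensor x y, equivariant_braiding G C x y, tensor y x))\<rparr>)"

definition characters :: "('g, 'w) monoid_scheme \<Rightarrow> ('g \<Rightarrow> complex) set" where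
  "characters G = hom G (units_of (class_ring :: complex ring)) \<inter> extensional (carrier G)"

text \<open>The equivariant structure \<open>\<chi>(g) id\<close> on \<open>X\<close>, where \<open>T\<^sub>g X\<close> is identified with \<open>X\<close> along \<open>u g\<close>.\<close>

definition twisted_structure ::
    "('g, 'w) monoid_scheme \<Rightarrow> ('g, 'o, 'm, 'z) crossed_cat_scheme
      \<Rightarrow> ('g \<Rightarrow> complex) \<Rightarrow> ('g \<Rightarrow> 'm) \<Rightarrow> 'g \<Rightarrow> 'm" where
  "twisted_structure G C \<chi> u = (\<lambda>g\<in>carrier G. ScaleArr C (\<chi> g) (u g))"

section \<open>The crossed extensions of the norm form\<close>

text \<open>\<open>C\<close> is a braided \<open>\<int>/p\<close>-crossed extension of \<open>\<C>(\<F>, t)\<close>, where \<open>\<F>\<close> is the field \<open>'a\<close> with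
  \<open>q\<^sup>2\<close> elements and \<open>t\<close> comes from the norm, such that the generator of \<open>\<int>/p\<close> acts on the trivial
  component by multiplication with \<open>c\<close>. As braided autoequivalences of \<open>\<C>(\<F>, t)\<close> up to isomorphism
  are the automorphisms of \<open>(\<F>, t)\<close>, this is a condition on isomorphism classes of objects.
  The categories with this property are, up to equivalence, the \<open>Vec\<close> categories attached to the
  classes \<open>\<alpha>\<close> in the third cohomology group of \<open>\<int>/p\<close>.\<close>

definition norm_crossed_extension ::
    "nat \<Rightarrow> nat \<Rightarrow> 'a::{field, finite} \<Rightarrow> ('a \<Rightarrow> 'o) \<Rightarrow> (int, 'o, 'm, 'z) crossed_cat_scheme \<Rightarrow> bool" where
  "norm_crossed_extension p q c \<delta> C \<longleftrightarrow>
     braided_crossed_category (integer_mod_group p) C \<and>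
     faithfully_graded (integer_mod_group p) C \<and>
     pointed_category_of_metric_group (norm_quadratic_form q) \<delta>
       (trivial_component (integer_mod_group p) C) \<and>
     (\<forall>v. isomorphic C (ActO C 1 (\<delta> v)) (\<delta> (c * v)))"

definition nonzero_orbits :: "nat \<Rightarrow> 'a::field \<Rightarrow> 'a set set" where
  "nonzero_orbits p c = {(\<lambda>k. c ^ nat k * v) ` carrier (integer_mod_group p) | v. v \<noteq> 0}"

definition simple_classes_of_dim :: "('o, 'm, 'z) monoidal_cat_scheme \<Rightarrow> real \<Rightarrow> 'o set set" where
  "simple_classes_of_dim C d = {iso_class C X | X. simple C X \<and> FPdim C X = d}"

definition invertible_classes :: "('o, 'm, 'z) monoidal_cat_scheme \<Rightarrow> 'o set set" where
  "invertible_classes C = {iso_class C X | X. invertible_object C X}"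

end

theory Submission
  imports Defs
begin

text \<open>
  Let \<open>X\<close> be simple of degree \<open>i \<noteq> 0\<close> in the crossed extension. The crossed braidings give
  \<open>\<delta>(c\<^sup>i a) \<otimes> X \<cong> X \<otimes> \<delta> a \<cong> \<delta> a \<otimes> X\<close>, and \<open>c\<^sup>i - 1\<close> is invertible, so tensoring with any \<open>\<delta> a\<close> fixes \<open>X\<close>. Hence
  there is only one simple object \<open>X\<^sub>i\<close> of degree \<open>i\<close>, and \<open>X\<^sub>i \<otimes> X\<^sub>-\<^sub>i\<close> is the sum of all \<open>\<delta> a\<close>. The multiplicities
  of \<open>X\<^sub>i\<^sub>+\<^sub>j\<close> in \<open>X\<^sub>i \<otimes> X\<^sub>j\<close> and of \<open>X\<^sub>i\<close> in \<open>X\<^sub>i\<^sub>+\<^sub>j \<otimes> X\<^sub>-\<^sub>j\<close> agree by duality and have product \<open>q\<^sup>2\<close>, so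
  both are \<open>q\<close>: the weight with \<open>\<delta> a \<mapsto> 1\<close> and \<open>X\<^sub>i \<mapsto> q\<close> is multiplicative.

  In the equivariantization, averaging over the group turns an inclusion of \<open>\<one>\<close>, \<open>X\<^sub>i\<close> or \<open>\<delta> a\<close> into an
  object \<open>Y\<close> into an equivariant inclusion of a twisted \<open>\<one>\<close> or \<open>X\<^sub>i\<close>, or of an orbit sum. So every
  object is a direct sum of the objects in the list, for which Schur's lemma holds by inspection. The
  weight of the underlying object is positive and multiplicative and therefore is the Frobenius--Perron
  dimension.
\<close>

section \<open>Vector spaces\<close>

text \<open>The equivariantization is at hand only as a linear category with a tensor product;
  kernels and semisimplicity in it are not given. Its simple objects are therefore found by a
  criterion on a finite family of representatives, and summands are split off through idempotents
  instead of images of arrows. The locale \<open>schur_basis\<close> states the criterion. The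
  extension meets it by Schur's lemma, the equivariantization by averaging, and multiplicities and
  additive weights are developed once for both. Since p is prime, every \<open>c ^ i\<close> with 0
  < i < p differs from 1, so each nonzero degree behaves like degree 1 and each nonzero orbit is
  free. Existence of equivariant structures is a separate matter. On X_i a cocycle has to be
  trivialised, which for a cyclic group comes down to extracting a p-th root of a complex number; an
  orbit sum receives its structure as an induced object. Finally p divides q + 1, so p and q are
  different and the dimensions p and q separate the two families.\<close>

lemma (in abelian_monoid) finsum_Sigma:
  assumes "finite I" "\<And>i. i \<in> I \<Longrightarrow> finite (B i)" "\<And>i j. i \<in> I \<Longrightarrow> j \<in> B i \<Longrightarrow> f i j \<in> carrier G"
  shows "finsum G (\<lambda>(i, j). f i j) (Sigma I B) = finsum G (\<lambda>i. finsum G (f i) (B i)) I"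
  using assms
proof (induction I rule: finite_induct)
  case (insert i I)
  have S: "Sigma (insert i I) B = Pair i ` B i \<union> Sigma I B"
    by auto
  have "finsum G (\<lambda>(i, j). f i j) (Sigma (insert i I) B)
      = finsum G (\<lambda>(i, j). f i j) (Pair i ` B i) \<oplus> finsum G (\<lambda>(i, j). f i j) (Sigma I B)"
    unfolding S using insert by (intro finsum_Un_disjoint) auto
  also have "finsum G (\<lambda>(i, j). f i j) (Pair i ` B i) = finsum G (f i) (B i)"
    using insert by (subst finsum_reindex) (auto simp: inj_on_def cong: finsum_cong)
  finally show ?case
    using insert by (simp add: Pi_def)
qed simp

lemma (in linear_map) map_finsum:
  assumes "g \<in> I \<rightarrow> carrier V"
  shows "T (finsum V g I) = finsum W (\<lambda>i. T (g i)) I"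
  using assms
\<comment> \<open>Over an infinite index set both sums are zero by convention, and \<open>T\<close>
  preserves zero.\<close>
proof (induction I rule: infinite_finite_induct)
  case (insert i I)
  then have "g \<in> I \<rightarrow> carrier V" "g i \<in> carrier V"
    by auto
  with insert show ?case
    by (subst V.module.M.finsum_insert; (subst W.module.M.finsum_insert)?) (auto simp: Pi_def)
qed simp_all

section \<open>Bases given as indexed families\<close>

context vectorspace
begin

text \<open>Independence of a family is stronger than independence of its range, because two equal
  members already satisfy a relation. Injectivity is therefore part of the conclusion, and the index
  set has as many elements as the image.\<close>

lemma lin_indpt_indexed:
  assumes I: "finite I" and b: "b \<in> I \<rightarrow> carrier V"
    and indep: "\<And>a. a \<in> I \<rightarrow> carrier K \<Longrightarrow> (\<Oplus>\<^bsub>V\<^esub>i\<in>I. a i \<odot>\<^bsub>V\<^esub> b i) = \<zero>\<^bsub>V\<^esub> \<Longrightarrow> \<forall>i\<in>I. a i = \<zero>\<^bsub>K\<^esub>"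
  shows "inj_on b I" "lin_indpt (b ` I)"
proof -
  show inj: "inj_on b I"
  proof (rule inj_onI, rule ccontr)
    fix i j assume ij: "i \<in> I" "j \<in> I" "b i = b j" "i \<noteq> j"
    \<comment> \<open>Coefficients 1 and -1 at the two colliding indices: the relation that refutes
      a repeated member.\<close>
    define a where "a k = (if k = i then \<one>\<^bsub>K\<^esub> else if k = j then \<ominus>\<^bsub>K\<^esub> \<one>\<^bsub>K\<^esub> else \<zero>\<^bsub>K\<^esub>)" for k
    have bc: "b k \<in> carrier V" if "k \<in> I" for k using b that by auto
    have a: "a \<in> I \<rightarrow> carrier K" by (auto simp: a_def)
    have I': "I = insert i (insert j (I - {i, j}))" using ij by auto
    have "(\<Oplus>\<^bsub>V\<^esub>k\<in>I - {i, j}. a k \<odot>\<^bsub>V\<^esub> b k) = (\<Oplus>\<^bsub>V\<^esub>k\<in>I - {i, j}. \<zero>\<^bsub>V\<^esub>)"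
      using bc by (intro M.finsum_cong') (auto simp: a_def)
    then have 0: "(\<Oplus>\<^bsub>V\<^esub>k\<in>I - {i, j}. a k \<odot>\<^bsub>V\<^esub> b k) = \<zero>\<^bsub>V\<^esub>" by simp
    have "(\<Oplus>\<^bsub>V\<^esub>k\<in>I. a k \<odot>\<^bsub>V\<^esub> b k)
        = a i \<odot>\<^bsub>V\<^esub> b i \<oplus>\<^bsub>V\<^esub> (a j \<odot>\<^bsub>V\<^esub> b j \<oplus>\<^bsub>V\<^esub> (\<Oplus>\<^bsub>V\<^esub>k\<in>I - {i, j}. a k \<odot>\<^bsub>V\<^esub> b k))"
      apply (subst I')
      using I ij bc a by (subst M.finsum_insert; (subst M.finsum_insert)?) (auto simp: Pi_def)
    also have "\<dots> = \<zero>\<^bsub>V\<^esub>"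
      unfolding 0 using ij bc by (simp add: a_def smult_l_minus M.r_neg)
    finally have "a i = \<zero>\<^bsub>K\<^esub>" using indep[OF a] ij(1) by blast
    then show False by (simp add: a_def)
  qed
  show "lin_indpt (b ` I)"
  proof (rule finite_lin_indpt2)
    fix a assume a: "a \<in> b ` I \<rightarrow> carrier K" and 0: "lincomb a (b ` I) = \<zero>\<^bsub>V\<^esub>"
    have "(\<Oplus>\<^bsub>V\<^esub>i\<in>I. a (b i) \<odot>\<^bsub>V\<^esub> b i) = \<zero>\<^bsub>V\<^esub>"
      using 0 a b inj unfolding lincomb_def by (subst (asm) M.finsum_reindex) auto
    then have "\<forall>i\<in>I. a (b i) = \<zero>\<^bsub>K\<^esub>"
      using a by (intro indep) auto
    then show "\<forall>v\<in>b ` I. a v = \<zero>\<^bsub>K\<^esub>" by auto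
  qed (use I b in auto)
qed

text \<open>Families are used instead of sets because the basis of a direct sum is naturally indexed
  by pairs of a summand and a basis vector of that summand.\<close>

lemma dim_indexed_basis:
  assumes I: "finite I" and b: "b \<in> I \<rightarrow> carrier V"
    and indep: "\<And>a. a \<in> I \<rightarrow> carrier K \<Longrightarrow> (\<Oplus>\<^bsub>V\<^esub>i\<in>I. a i \<odot>\<^bsub>V\<^esub> b i) = \<zero>\<^bsub>V\<^esub> \<Longrightarrow> \<forall>i\<in>I. a i = \<zero>\<^bsub>K\<^esub>"
    and gen: "\<And>v. v \<in> carrier V \<Longrightarrow> \<exists>a\<in>I \<rightarrow> carrier K. v = (\<Oplus>\<^bsub>V\<^esub>i\<in>I. a i \<odot>\<^bsub>V\<^esub> b i)"
  shows "fin_dim" "dim = card I"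
proof -
  note li = lin_indpt_indexed[OF I b indep]
  have "carrier V \<subseteq> span (b ` I)"
  proof
    fix v assume "v \<in> carrier V"
    then obtain a where a: "a \<in> I \<rightarrow> carrier K" "v = (\<Oplus>\<^bsub>V\<^esub>i\<in>I. a i \<odot>\<^bsub>V\<^esub> b i)"
      using gen by blast
    have "v = lincomb (a \<circ> inv_into I b) (b ` I)"
      unfolding lincomb_def using a b li(1)
      by (subst M.finsum_reindex) (auto simp: Pi_def intro!: M.finsum_cong')
    moreover have "a \<circ> inv_into I b \<in> b ` I \<rightarrow> carrier K"
      using a li(1) by auto
    ultimately show "v \<in> span (b ` I)"
      unfolding span_def using I by blast
  qed
  moreover have bI: "b ` I \<subseteq> carrier V" using b by auto
  ultimately have gs: "gen_set (b ` I)"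
    using span_is_subset2 by blast
  then show "fin_dim" unfolding fin_dim_def using I bI by blast
  have "basis (b ` I)" unfolding basis_def using gs li bI by blast
  then show "dim = card I"
    using dim_basis[of "b ` I"] I card_image[OF li(1)] by simp
qed

lemma obtain_indexed_basis:
  assumes fin_dim
  obtains B where "finite B" "B \<subseteq> carrier V" "card B = dim"
    "\<And>a. a \<in> B \<rightarrow> carrier K \<Longrightarrow> (\<Oplus>\<^bsub>V\<^esub>v\<in>B. a v \<odot>\<^bsub>V\<^esub> v) = \<zero>\<^bsub>V\<^esub> \<Longrightarrow> \<forall>v\<in>B. a v = \<zero>\<^bsub>K\<^esub>"
    "\<And>v. v \<in> carrier V \<Longrightarrow> \<exists>a\<in>B \<rightarrow> carrier K. v = (\<Oplus>\<^bsub>V\<^esub>v\<in>B. a v \<odot>\<^bsub>V\<^esub> v)"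
proof -
  obtain B where B: "finite B" "basis B" using finite_basis_exists[OF assms] by blast
  show thesis
  proof
    show "finite B" "B \<subseteq> carrier V" "card B = dim"
      using B dim_basis by (auto simp: basis_def)
  next
    fix a assume a: "a \<in> B \<rightarrow> carrier K" "(\<Oplus>\<^bsub>V\<^esub>v\<in>B. a v \<odot>\<^bsub>V\<^esub> v) = \<zero>\<^bsub>V\<^esub>"
    then show "\<forall>v\<in>B. a v = \<zero>\<^bsub>K\<^esub>"
      using B unfolding basis_def lin_dep_def lincomb_def by auto
  next
    fix v assume "v \<in> carrier V"
    then have "v \<in> span B" using B by (auto simp: basis_def)
    then show "\<exists>a\<in>B \<rightarrow> carrier K. v = (\<Oplus>\<^bsub>V\<^esub>v\<in>B. a v \<odot>\<^bsub>V\<^esub> v)"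
      using B finite_span[of B] unfolding basis_def lincomb_def by auto
  qed
qed

end

text \<open>The image of a basis under an injective linear map stays independent, so its size is
  bounded by the dimension of the target.\<close>

lemma (in linear_map) dim_le_of_inj:
  assumes "V.fin_dim" "W.fin_dim" "inj_on T (carrier V)"
  shows "V.dim \<le> W.dim"
proof -
  obtain B where B: "finite B" "B \<subseteq> carrier V" "card B = V.dim"
    "\<And>a. a \<in> B \<rightarrow> carrier K \<Longrightarrow> (\<Oplus>\<^bsub>V\<^esub>v\<in>B. a v \<odot>\<^bsub>V\<^esub> v) = \<zero>\<^bsub>V\<^esub> \<Longrightarrow> \<forall>v\<in>B. a v = \<zero>\<^bsub>K\<^esub>"
    by (rule V.obtain_indexed_basis[OF assms(1)]) (rule that; assumption)
  have TB: "T \<in> B \<rightarrow> carrier W" using B by auto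
  have indep: "\<forall>v\<in>B. a v = \<zero>\<^bsub>K\<^esub>"
    if a: "a \<in> B \<rightarrow> carrier K" "(\<Oplus>\<^bsub>W\<^esub>v\<in>B. a v \<odot>\<^bsub>W\<^esub> T v) = \<zero>\<^bsub>W\<^esub>" for a
  proof (rule B(4)[OF a(1)])
    have c: "(\<lambda>v. a v \<odot>\<^bsub>V\<^esub> v) \<in> B \<rightarrow> carrier V" using a B by auto
    have "T (\<Oplus>\<^bsub>V\<^esub>v\<in>B. a v \<odot>\<^bsub>V\<^esub> v) = (\<Oplus>\<^bsub>W\<^esub>v\<in>B. a v \<odot>\<^bsub>W\<^esub> T v)"
      unfolding map_finsum[OF c] using a(1) B(2)
      by (intro W.module.M.finsum_cong' refl) (auto simp: subset_iff Pi_iff)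
    then show "(\<Oplus>\<^bsub>V\<^esub>v\<in>B. a v \<odot>\<^bsub>V\<^esub> v) = \<zero>\<^bsub>V\<^esub>"
      using a(2) V.module.M.finsum_closed[OF c] by (intro inj_onD[OF assms(3)]) simp_all
  qed
  note W.lin_indpt_indexed[OF B(1) TB indep]
  then show ?thesis
    using W.li_le_dim(2)[OF assms(2), of "T ` B"] TB B(3) card_image[of T B] by auto
qed

text \<open>The vectors \<open>e i w\<close>, for \<open>w\<close> in a basis of \<open>W i\<close>,
  form a basis of \<open>V\<close>: \<open>p j\<close> isolates the j-th block of a relation, and
  \<open>ep\<close> together with the expansions of the \<open>p i v\<close> gives
  generation.\<close>

lemma (in vectorspace) dim_direct_sum:
  assumes I: "finite I"
    and e: "\<And>i. i \<in> I \<Longrightarrow> linear_map K (W i) V (e i)"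
    and p: "\<And>i. i \<in> I \<Longrightarrow> linear_map K V (W i) (p i)"
    and pe: "\<And>i j w. i \<in> I \<Longrightarrow> j \<in> I \<Longrightarrow> w \<in> carrier (W j) \<Longrightarrow> p i (e j w) = (if i = j then w else \<zero>\<^bsub>W i\<^esub>)"
    and ep: "\<And>v. v \<in> carrier V \<Longrightarrow> v = (\<Oplus>\<^bsub>V\<^esub>i\<in>I. e i (p i v))"
    and fd: "\<And>i. i \<in> I \<Longrightarrow> vectorspace.fin_dim K (W i)"
  shows "fin_dim" "dim = (\<Sum>i\<in>I. vectorspace.dim K (W i))"
proof -
  have vsW: "vectorspace K (W i)" if "i \<in> I" for i
    using e[OF that] by (simp add: linear_map_def)
  \<comment> \<open>All properties of a chosen basis are packed into one predicate, so that a single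
    choice yields bases of all summands at once.\<close>
  define P where "P i B \<longleftrightarrow> finite B \<and> B \<subseteq> carrier (W i) \<and> card B = vectorspace.dim K (W i)
    \<and> (\<forall>a. a \<in> B \<rightarrow> carrier K \<longrightarrow> (\<Oplus>\<^bsub>W i\<^esub>v\<in>B. a v \<odot>\<^bsub>W i\<^esub> v) = \<zero>\<^bsub>W i\<^esub> \<longrightarrow> (\<forall>v\<in>B. a v = \<zero>\<^bsub>K\<^esub>))
    \<and> (\<forall>v. v \<in> carrier (W i) \<longrightarrow> (\<exists>a\<in>B \<rightarrow> carrier K. v = (\<Oplus>\<^bsub>W i\<^esub>v\<in>B. a v \<odot>\<^bsub>W i\<^esub> v)))" for i B
  have "\<exists>B. P i B" if "i \<in> I" for i
    by (rule vectorspace.obtain_indexed_basis[OF vsW fd, OF that that]) (auto simp: P_def)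
  then have "\<forall>i\<in>I. \<exists>B. P i B" by blast
  then obtain B where PB: "\<forall>i\<in>I. P i (B i)" by (rule bchoice[THEN exE])
  have B: "\<And>i. i \<in> I \<Longrightarrow> finite (B i)" "\<And>i. i \<in> I \<Longrightarrow> B i \<subseteq> carrier (W i)"
    "\<And>i. i \<in> I \<Longrightarrow> card (B i) = vectorspace.dim K (W i)"
    "\<And>i a. i \<in> I \<Longrightarrow> a \<in> B i \<rightarrow> carrier K \<Longrightarrow> (\<Oplus>\<^bsub>W i\<^esub>v\<in>B i. a v \<odot>\<^bsub>W i\<^esub> v) = \<zero>\<^bsub>W i\<^esub>
        \<Longrightarrow> (\<forall>v\<in>B i. a v = \<zero>\<^bsub>K\<^esub>)"
    "\<And>i v. i \<in> I \<Longrightarrow> v \<in> carrier (W i) \<Longrightarrow> (\<exists>a\<in>B i \<rightarrow> carrier K. v = (\<Oplus>\<^bsub>W i\<^esub>v\<in>B i. a v \<odot>\<^bsub>W i\<^esub> v))"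
    using PB by (simp_all add: P_def)
  have aW: "abelian_monoid (W i)" if "i \<in> I" for i
    using vsW[OF that] by (simp add: vectorspace_def Module.module_def abelian_group_def)
  have smW: "k \<odot>\<^bsub>W i\<^esub> w \<in> carrier (W i)" if "i \<in> I" "k \<in> carrier K" "w \<in> carrier (W i)" for i k w
    using vsW[OF that(1)] that Module.module.smult_closed[of K "W i" k w] by (simp add: vectorspace_def)
  have Bc: "w \<in> carrier (W i)" if "i \<in> I" "w \<in> B i" for i w
    using B(2)[OF that(1)] that(2) by blast
  have eW: "e i w \<in> carrier V" if "i \<in> I" "w \<in> carrier (W i)" for i w
    using e[OF that(1)] that(2) by (meson linear_map.T_im)
  have pV: "p i v \<in> carrier (W i)" if "i \<in> I" "v \<in> carrier V" for i v
    using p[OF that(1)] that(2) by (meson linear_map.T_im)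
  \<comment> \<open>A linear combination over pairs is regrouped by summands; each inner sum is
    formed in \<open>W i\<close> and then included into \<open>V\<close>.\<close>
  have sum: "(\<Oplus>\<^bsub>V\<^esub>x\<in>Sigma I B. a x \<odot>\<^bsub>V\<^esub> e (fst x) (snd x))
      = (\<Oplus>\<^bsub>V\<^esub>i\<in>I. e i (\<Oplus>\<^bsub>W i\<^esub>w\<in>B i. a (i, w) \<odot>\<^bsub>W i\<^esub> w))"
    if a: "a \<in> Sigma I B \<rightarrow> carrier K" for a
  proof -
    have ac: "a (i, w) \<in> carrier K" if "i \<in> I" "w \<in> B i" for i w
      using a that by blast
    have "(\<Oplus>\<^bsub>V\<^esub>x\<in>Sigma I B. a x \<odot>\<^bsub>V\<^esub> e (fst x) (snd x))
        = finsum V (\<lambda>(i, w). a (i, w) \<odot>\<^bsub>V\<^esub> e i w) (Sigma I B)"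
      by (rule arg_cong[where f = "\<lambda>f. finsum V f (Sigma I B)"]) auto
    also have "\<dots> = (\<Oplus>\<^bsub>V\<^esub>i\<in>I. (\<Oplus>\<^bsub>V\<^esub>w\<in>B i. a (i, w) \<odot>\<^bsub>V\<^esub> e i w))"
      using I B(1) ac Bc eW by (intro M.finsum_Sigma) simp_all
    also have "\<dots> = (\<Oplus>\<^bsub>V\<^esub>i\<in>I. e i (\<Oplus>\<^bsub>W i\<^esub>w\<in>B i. a (i, w) \<odot>\<^bsub>W i\<^esub> w))"
    proof (rule M.finsum_cong')
      fix i assume i: "i \<in> I"
      have c: "(\<lambda>w. a (i, w) \<odot>\<^bsub>W i\<^esub> w) \<in> B i \<rightarrow> carrier (W i)" using ac Bc smW i by blast
      show "(\<Oplus>\<^bsub>V\<^esub>w\<in>B i. a (i, w) \<odot>\<^bsub>V\<^esub> e i w) = e i (\<Oplus>\<^bsub>W i\<^esub>w\<in>B i. a (i, w) \<odot>\<^bsub>W i\<^esub> w)"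
        unfolding linear_map.map_finsum[OF e[OF i] c]
        using ac[OF i] Bc[OF i] eW[OF i] module_hom_smult[OF linear_map.T_hom[OF e[OF i]]]
        by (intro M.finsum_cong' refl) auto
    next
      show "(\<lambda>i. e i (\<Oplus>\<^bsub>W i\<^esub>w\<in>B i. a (i, w) \<odot>\<^bsub>W i\<^esub> w)) \<in> I \<rightarrow> carrier V"
      proof
        fix i assume i: "i \<in> I"
        have "(\<Oplus>\<^bsub>W i\<^esub>w\<in>B i. a (i, w) \<odot>\<^bsub>W i\<^esub> w) \<in> carrier (W i)"
        proof (rule abelian_monoid.finsum_closed[OF aW[OF i]], rule Pi_I)
          fix w assume "w \<in> B i"
          then show "a (i, w) \<odot>\<^bsub>W i\<^esub> w \<in> carrier (W i)"
            using a B(2)[OF i] i by (intro smW) blast+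
        qed
        then show "e i (\<Oplus>\<^bsub>W i\<^esub>w\<in>B i. a (i, w) \<odot>\<^bsub>W i\<^esub> w) \<in> carrier V"
          by (rule eW[OF i])
      qed
    qed simp
    finally show ?thesis .
  qed
  have b: "(\<lambda>x. e (fst x) (snd x)) \<in> Sigma I B \<rightarrow> carrier V"
    using eW Bc by auto
  have indep: "\<forall>x\<in>Sigma I B. a x = \<zero>\<^bsub>K\<^esub>"
    if a: "a \<in> Sigma I B \<rightarrow> carrier K" "(\<Oplus>\<^bsub>V\<^esub>x\<in>Sigma I B. a x \<odot>\<^bsub>V\<^esub> e (fst x) (snd x)) = \<zero>\<^bsub>V\<^esub>" for a
  proof -
    have "\<forall>w\<in>B j. a (j, w) = \<zero>\<^bsub>K\<^esub>" if j: "j \<in> I" for j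
    proof (rule B(4)[OF j])
      let ?s = "\<lambda>i. \<Oplus>\<^bsub>W i\<^esub>w\<in>B i. a (i, w) \<odot>\<^bsub>W i\<^esub> w"
      have s: "?s i \<in> carrier (W i)" if "i \<in> I" for i
      proof (rule abelian_monoid.finsum_closed[OF aW[OF that]], rule Pi_I)
        fix w assume "w \<in> B i"
        then show "a (i, w) \<odot>\<^bsub>W i\<^esub> w \<in> carrier (W i)"
          using a(1) B(2)[OF that] that by (intro smW) blast+
      qed
      \<comment> \<open>Applying \<open>p j\<close> to the vanishing total leaves only the j-th
        block.\<close>
      have "\<zero>\<^bsub>W j\<^esub> = p j (\<Oplus>\<^bsub>V\<^esub>i\<in>I. e i (?s i))"
        using a(2) unfolding sum[OF a(1)] by (simp only: linear_map.T0_is_0[OF p[OF j]])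
      also have "\<dots> = (\<Oplus>\<^bsub>W j\<^esub>i\<in>I. p j (e i (?s i)))"
        using s eW by (intro linear_map.map_finsum[OF p[OF j]]) auto
      also have "\<dots> = (\<Oplus>\<^bsub>W j\<^esub>i\<in>I. if j = i then ?s j else \<zero>\<^bsub>W j\<^esub>)"
        using s pe j abelian_monoid.zero_closed[OF aW[OF j]]
        by (intro abelian_monoid.finsum_cong'[OF aW[OF j] refl]) simp_all
      also have "\<dots> = ?s j"
        using abelian_monoid.finsum_singleton[OF aW[OF j] j I, of "\<lambda>_. ?s j"] s[OF j] by simp
      finally show "?s j = \<zero>\<^bsub>W j\<^esub>" by (rule sym)
      show "(\<lambda>w. a (j, w)) \<in> B j \<rightarrow> carrier K" using a j by auto
    qed
    then show ?thesis by auto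
  qed
  have gen: "\<exists>a\<in>Sigma I B \<rightarrow> carrier K. v = (\<Oplus>\<^bsub>V\<^esub>x\<in>Sigma I B. a x \<odot>\<^bsub>V\<^esub> e (fst x) (snd x))"
    if v: "v \<in> carrier V" for v
  proof -
    have "\<exists>a\<in>B i \<rightarrow> carrier K. p i v = (\<Oplus>\<^bsub>W i\<^esub>w\<in>B i. a w \<odot>\<^bsub>W i\<^esub> w)" if "i \<in> I" for i
      using B(5)[OF that] pV that v by blast
    then have "\<forall>i\<in>I. \<exists>a. a \<in> B i \<rightarrow> carrier K \<and> p i v = (\<Oplus>\<^bsub>W i\<^esub>w\<in>B i. a w \<odot>\<^bsub>W i\<^esub> w)"
      by blast
    then obtain a where "\<forall>i\<in>I. a i \<in> B i \<rightarrow> carrier K \<and> p i v = (\<Oplus>\<^bsub>W i\<^esub>w\<in>B i. a i w \<odot>\<^bsub>W i\<^esub> w)"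
      by (rule bchoice[THEN exE])
    then have a: "\<And>i. i \<in> I \<Longrightarrow> a i \<in> B i \<rightarrow> carrier K"
      "\<And>i. i \<in> I \<Longrightarrow> p i v = (\<Oplus>\<^bsub>W i\<^esub>w\<in>B i. a i w \<odot>\<^bsub>W i\<^esub> w)"
      by blast+
    let ?a = "\<lambda>(i, w). a i w"
    have A: "?a \<in> Sigma I B \<rightarrow> carrier K" using a(1) by fastforce
    have "v = (\<Oplus>\<^bsub>V\<^esub>i\<in>I. e i (p i v))" by (rule ep[OF v])
    also have "\<dots> = (\<Oplus>\<^bsub>V\<^esub>i\<in>I. e i (\<Oplus>\<^bsub>W i\<^esub>w\<in>B i. ?a (i, w) \<odot>\<^bsub>W i\<^esub> w))"
      using a(2)[symmetric] eW pV v by (intro M.finsum_cong') auto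
    finally show ?thesis using sum[OF A] A by (intro bexI[of _ ?a]) auto
  qed
  note d = dim_indexed_basis[OF finite_SigmaI[OF I B(1)] b indep gen]
  show "fin_dim" by (rule d(1))
  have "card (Sigma I B) = (\<Sum>i\<in>I. card (B i))"
    using I B(1) by (intro card_SigmaI) blast+
  also have "\<dots> = (\<Sum>i\<in>I. vectorspace.dim K (W i))"
    by (rule sum.cong[OF refl B(3)])
  finally show "dim = (\<Sum>i\<in>I. vectorspace.dim K (W i))"
    using d(2) by (rule trans[rotated])
qed

section \<open>Linear categories\<close>

context linear_category
begin

text \<open>As a rewrite rule this turns typed arrows into conditions on \<open>Arr\<close>,
  \<open>Dom\<close> and \<open>Cod\<close>, the form in which composability is checked
  throughout.\<close>

lemma Hom_iff [simp]: "f \<in> Hom C X Y \<longleftrightarrow> f \<in> Arr C \<and> Dom C f = X \<and> Cod C f = Y"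
  by (auto simp: Hom_def)

declare Dom_Obj [simp] Cod_Obj [simp]

lemma idt_arr [simp]: "X \<in> Obj C \<Longrightarrow> Idt C X \<in> Arr C" "X \<in> Obj C \<Longrightarrow> Dom C (Idt C X) = X"
  "X \<in> Obj C \<Longrightarrow> Cod C (Idt C X) = X"
  using Idt_Hom[of X] by auto

lemma comp_arr [simp]:
  assumes "f \<in> Arr C" "g \<in> Arr C" "Cod C f = Dom C g"
  shows "g \<star> f \<in> Arr C" "Dom C (g \<star> f) = Dom C f" "Cod C (g \<star> f) = Cod C g"
  using Comp_Hom[of f "Dom C f" "Cod C f" g "Cod C g"] assms by auto

lemma comp_idt_right [simp]: "f \<in> Arr C \<Longrightarrow> Dom C f = X \<Longrightarrow> f \<star> Idt C X = f"
  using Comp_Idt_right[of f X "Cod C f"] by auto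

lemma comp_idt_left [simp]: "f \<in> Arr C \<Longrightarrow> Cod C f = X \<Longrightarrow> Idt C X \<star> f = f"
  using Comp_Idt_left[of f "Dom C f" X] by auto

text \<open>Oriented so that composites have right-nested normal forms. Where two inner factors have
  to meet, the regrouping is stated explicitly.\<close>

lemma comp_assoc [simp]:
  "f \<in> Arr C \<Longrightarrow> g \<in> Arr C \<Longrightarrow> h \<in> Arr C \<Longrightarrow> Cod C f = Dom C g \<Longrightarrow> Cod C g = Dom C h
    \<Longrightarrow> (h \<star> g) \<star> f = h \<star> g \<star> f"
  using Comp_assoc[of f "Dom C f" "Cod C f" g "Cod C g" h "Cod C h"] by auto

lemma hom_space_simps [simp]:
  "carrier (hom_space C X Y) = Hom C X Y" "zero (hom_space C X Y) = ZeroArr C X Y"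
  "add (hom_space C X Y) = AddArr C" "module.smult (hom_space C X Y) = ScaleArr C"
  by (simp_all add: hom_space_def)

lemma hom_module: "X \<in> Obj C \<Longrightarrow> Y \<in> Obj C \<Longrightarrow> Module.module (class_ring :: complex ring) (hom_space C X Y)"
  using Hom_vectorspace by (simp add: vectorspace_def)

lemma hom_abelian_group: "X \<in> Obj C \<Longrightarrow> Y \<in> Obj C \<Longrightarrow> abelian_group (hom_space C X Y)"
  using hom_module by (simp add: Module.module_def)

lemma hom_abelian_monoid: "X \<in> Obj C \<Longrightarrow> Y \<in> Obj C \<Longrightarrow> abelian_monoid (hom_space C X Y)"
  using hom_abelian_group by (simp add: abelian_group_def)

lemma zero_arr [simp]:
  assumes "X \<in> Obj C" "Y \<in> Obj C"
  shows "ZeroArr C X Y \<in> Arr C" "Dom C (ZeroArr C X Y) = X" "Cod C (ZeroArr C X Y) = Y"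
  using abelian_monoid.zero_closed[OF hom_abelian_monoid[OF assms]] by auto

lemma add_arr [simp]:
  assumes "f \<in> Arr C" "g \<in> Arr C" "Dom C g = Dom C f" "Cod C g = Cod C f"
  shows "AddArr C f g \<in> Arr C" "Dom C (AddArr C f g) = Dom C f" "Cod C (AddArr C f g) = Cod C f"
  using abelian_monoid.a_closed[OF hom_abelian_monoid, of "Dom C f" "Cod C f" f g] assms by auto

lemma scale_arr [simp]:
  assumes "f \<in> Arr C"
  shows "ScaleArr C a f \<in> Arr C" "Dom C (ScaleArr C a f) = Dom C f" "Cod C (ScaleArr C a f) = Cod C f"
  using Module.module.smult_closed[OF hom_module, of "Dom C f" "Cod C f" a f] assms by auto

lemma add_comm: "f \<in> Arr C \<Longrightarrow> g \<in> Arr C \<Longrightarrow> Dom C g = Dom C f \<Longrightarrow> Cod C g = Cod C f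
    \<Longrightarrow> AddArr C f g = AddArr C g f"
  using abelian_monoid.a_comm[OF hom_abelian_monoid, of "Dom C f" "Cod C f" f g] by auto

lemma add_assoc: "f \<in> Arr C \<Longrightarrow> g \<in> Arr C \<Longrightarrow> h \<in> Arr C \<Longrightarrow> Dom C g = Dom C f \<Longrightarrow> Cod C g = Cod C f
    \<Longrightarrow> Dom C h = Dom C f \<Longrightarrow> Cod C h = Cod C f \<Longrightarrow> AddArr C (AddArr C f g) h = AddArr C f (AddArr C g h)"
  using abelian_monoid.a_assoc[OF hom_abelian_monoid, of "Dom C f" "Cod C f" f g h] by auto

lemma add_zero_left [simp]:
  "f \<in> Arr C \<Longrightarrow> Dom C f = X \<Longrightarrow> Cod C f = Y \<Longrightarrow> AddArr C (ZeroArr C X Y) f = f"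
  using abelian_monoid.l_zero[OF hom_abelian_monoid, of "Dom C f" "Cod C f" f] by auto

lemma add_zero_right [simp]:
  "f \<in> Arr C \<Longrightarrow> Dom C f = X \<Longrightarrow> Cod C f = Y \<Longrightarrow> AddArr C f (ZeroArr C X Y) = f"
  using abelian_monoid.r_zero[OF hom_abelian_monoid, of "Dom C f" "Cod C f" f] by auto

lemma scale_one [simp]: "f \<in> Arr C \<Longrightarrow> ScaleArr C 1 f = f"
  using Module.module.smult_one[OF hom_module, of "Dom C f" "Cod C f" f] by auto

lemma scale_scale [simp]: "f \<in> Arr C \<Longrightarrow> ScaleArr C a (ScaleArr C b f) = ScaleArr C (a * b) f"
  using Module.module.smult_assoc1[OF hom_module, of "Dom C f" "Cod C f" a b f] by auto

lemma scale_zero [simp]: "f \<in> Arr C \<Longrightarrow> ScaleArr C 0 f = ZeroArr C (Dom C f) (Cod C f)"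
  using Module.module.smult_l_null[OF hom_module, of "Dom C f" "Cod C f" f] by auto

lemma scale_zero_arr [simp]: "X \<in> Obj C \<Longrightarrow> Y \<in> Obj C \<Longrightarrow> ScaleArr C a (ZeroArr C X Y) = ZeroArr C X Y"
  using Module.module.smult_r_null[OF hom_module, of X Y a] by auto

lemma scale_add_left: "f \<in> Arr C \<Longrightarrow> ScaleArr C (a + b) f = AddArr C (ScaleArr C a f) (ScaleArr C b f)"
  using Module.module.smult_l_distr[OF hom_module, of "Dom C f" "Cod C f" a b f] by auto

lemma scale_add_right: "f \<in> Arr C \<Longrightarrow> g \<in> Arr C \<Longrightarrow> Dom C g = Dom C f \<Longrightarrow> Cod C g = Cod C f
    \<Longrightarrow> ScaleArr C a (AddArr C f g) = AddArr C (ScaleArr C a f) (ScaleArr C a g)"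
  using Module.module.smult_r_distr[OF hom_module, of "Dom C f" "Cod C f" a f g] by auto

lemma comp_scale_right [simp]:
  "f \<in> Arr C \<Longrightarrow> g \<in> Arr C \<Longrightarrow> Cod C f = Dom C g \<Longrightarrow> g \<star> ScaleArr C a f = ScaleArr C a (g \<star> f)"
  using Comp_scale_right[of f "Dom C f" "Cod C f" g "Cod C g" a] by auto

lemma comp_scale_left [simp]:
  "f \<in> Arr C \<Longrightarrow> g \<in> Arr C \<Longrightarrow> Cod C f = Dom C g \<Longrightarrow> ScaleArr C a g \<star> f = ScaleArr C a (g \<star> f)"
  using Comp_scale_left[of f "Dom C f" "Cod C f" g "Cod C g" a] by auto

lemma comp_add_right:
  "f \<in> Arr C \<Longrightarrow> f' \<in> Arr C \<Longrightarrow> g \<in> Arr C \<Longrightarrow> Dom C f' = Dom C f \<Longrightarrow> Cod C f' = Cod C f \<Longrightarrow> Cod C f = Dom C g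
    \<Longrightarrow> g \<star> AddArr C f f' = AddArr C (g \<star> f) (g \<star> f')"
  using Comp_add_right[of f "Dom C f" "Cod C f" f' g "Cod C g"] by auto

lemma comp_add_left:
  "f \<in> Arr C \<Longrightarrow> g \<in> Arr C \<Longrightarrow> g' \<in> Arr C \<Longrightarrow> Dom C g' = Dom C g \<Longrightarrow> Cod C g' = Cod C g \<Longrightarrow> Cod C f = Dom C g
    \<Longrightarrow> AddArr C g g' \<star> f = AddArr C (g \<star> f) (g' \<star> f)"
  using Comp_add_left[of f "Dom C f" "Cod C f" g "Cod C g" g'] by auto

text \<open>The zero arrow is 0 times itself, and linearity of composition pulls the scalar
  out.\<close>

lemma comp_zero_right [simp]:
  assumes "g \<in> Arr C" "Dom C g = Y" "X \<in> Obj C"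
  shows "g \<star> ZeroArr C X Y = ZeroArr C X (Cod C g)"
proof -
  have "g \<star> ZeroArr C X Y = g \<star> ScaleArr C 0 (ZeroArr C X Y)"
    using assms by (subst scale_zero_arr) auto
  also have "\<dots> = ScaleArr C 0 (g \<star> ZeroArr C X Y)"
    using assms by (intro comp_scale_right) auto
  also have "\<dots> = ZeroArr C X (Cod C g)"
    using assms by (subst scale_zero) auto
  finally show ?thesis .
qed

lemma comp_zero_left [simp]:
  assumes "f \<in> Arr C" "Cod C f = Y" "Z \<in> Obj C"
  shows "ZeroArr C Y Z \<star> f = ZeroArr C (Dom C f) Z"
proof -
  have "ZeroArr C Y Z \<star> f = ScaleArr C 0 (ZeroArr C Y Z) \<star> f"
    using assms by (subst scale_zero_arr) auto
  also have "\<dots> = ScaleArr C 0 (ZeroArr C Y Z \<star> f)"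
    using assms by (intro comp_scale_left) auto
  also have "\<dots> = ZeroArr C (Dom C f) Z"
    using assms by (subst scale_zero) auto
  finally show ?thesis .
qed

lemma add_minus_self [simp]: "f \<in> Arr C \<Longrightarrow> AddArr C f (ScaleArr C (-1) f) = ZeroArr C (Dom C f) (Cod C f)"
  using scale_add_left[of f 1 "-1"] by simp

text \<open>Differences are written as sums with a (-1)-multiple, since hom spaces come with
  addition and scaling as their operations.\<close>

lemma eq_if_diff_zero:
  assumes "f \<in> Arr C" "g \<in> Arr C" "Dom C g = Dom C f" "Cod C g = Cod C f"
    and "AddArr C f (ScaleArr C (-1) g) = ZeroArr C (Dom C f) (Cod C f)"
  shows "f = g"
proof -
  have "f = AddArr C f (AddArr C (ScaleArr C (-1) g) g)"
    using assms add_comm[of "ScaleArr C (-1) g" g] by simp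
  also have "\<dots> = AddArr C (AddArr C f (ScaleArr C (-1) g)) g"
    using assms by (subst add_assoc) auto
  also have "\<dots> = g" using assms by simp
  finally show ?thesis .
qed

lemma scale_cancel: "f \<in> Arr C \<Longrightarrow> f \<noteq> ZeroArr C (Dom C f) (Cod C f) \<Longrightarrow> ScaleArr C a f = ScaleArr C b f \<Longrightarrow> a = b"
proof (rule ccontr)
  assume f: "f \<in> Arr C" "f \<noteq> ZeroArr C (Dom C f) (Cod C f)" "ScaleArr C a f = ScaleArr C b f" "a \<noteq> b"
  have "ScaleArr C (a - b) f = AddArr C (ScaleArr C a f) (ScaleArr C (-1) (ScaleArr C b f))"
    using scale_add_left[of f a "-b"] f(1) by simp
  also have "\<dots> = ZeroArr C (Dom C f) (Cod C f)"
    unfolding f(3) using f(1) by (subst add_minus_self) auto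
  finally have "ScaleArr C (inverse (a - b)) (ScaleArr C (a - b) f) = ZeroArr C (Dom C f) (Cod C f)"
    using f(1) by simp
  then show False using f by simp
qed

lemma scale_eq_zero_iff:
  assumes "f \<in> Arr C" "Dom C f = X" "Cod C f = Y"
  shows "ScaleArr C a f = ZeroArr C X Y \<longleftrightarrow> a = 0 \<or> f = ZeroArr C X Y"
proof (cases "f = ZeroArr C X Y")
  case True
  moreover have "X \<in> Obj C" "Y \<in> Obj C" using assms by auto
  ultimately show ?thesis by simp
next
  case False
  with assms show ?thesis using scale_cancel[of f a 0] by auto
qed

section \<open>Isomorphisms and zero objects\<close>

definition iso_arr where
  "iso_arr f \<longleftrightarrow> f \<in> Arr C \<and> (\<exists>g. inverse_pair C f g)"

text \<open>Membership in a typed set of isomorphisms splits into a property of the arrow and two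
  equations, in line with the treatment of \<open>Hom\<close>.\<close>

lemma Isos_iff [simp]: "f \<in> Isos C X Y \<longleftrightarrow> iso_arr f \<and> Dom C f = X \<and> Cod C f = Y"
  by (auto simp: Isos_def iso_arr_def)

lemma inverse_pair_unique:
  assumes "inverse_pair C f g" "inverse_pair C f h"
  shows "g = h"
proof -
  have "g = g \<star> (f \<star> h)" using assms by (simp add: inverse_pair_def)
  also have "\<dots> = (g \<star> f) \<star> h" using assms by (intro comp_assoc[symmetric]) (auto simp: inverse_pair_def)
  also have "\<dots> = h" using assms by (simp add: inverse_pair_def)
  finally show ?thesis .
qed

lemma inverse_pair_Inv: "iso_arr f \<Longrightarrow> inverse_pair C f (Inv C f)"
  unfolding iso_arr_def Inv_def using inverse_pair_unique by (metis theI')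

lemma Inv_eqI: "inverse_pair C f g \<Longrightarrow> Inv C f = g"
  unfolding Inv_def using inverse_pair_unique by blast

lemma iso_arrD [simp]: "iso_arr f \<Longrightarrow> f \<in> Arr C"
  by (simp add: iso_arr_def)

lemma Inv_simps [simp]:
  assumes "iso_arr f"
  shows "Inv C f \<in> Arr C" "Dom C (Inv C f) = Cod C f" "Cod C (Inv C f) = Dom C f"
    "Inv C f \<star> f = Idt C (Dom C f)" "f \<star> Inv C f = Idt C (Cod C f)"
  using inverse_pair_Inv[OF assms] by (auto simp: inverse_pair_def)

lemma inverse_pairI:
  "f \<in> Arr C \<Longrightarrow> g \<in> Arr C \<Longrightarrow> Dom C g = Cod C f \<Longrightarrow> Cod C g = Dom C f \<Longrightarrow> g \<star> f = Idt C (Dom C f)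
    \<Longrightarrow> f \<star> g = Idt C (Cod C f) \<Longrightarrow> inverse_pair C f g"
  by (simp add: inverse_pair_def)

lemma iso_arrI:
  "f \<in> Arr C \<Longrightarrow> g \<in> Arr C \<Longrightarrow> Dom C g = Cod C f \<Longrightarrow> Cod C g = Dom C f \<Longrightarrow> g \<star> f = Idt C (Dom C f)
    \<Longrightarrow> f \<star> g = Idt C (Cod C f) \<Longrightarrow> iso_arr f"
  unfolding iso_arr_def using inverse_pairI by blast

lemma Inv_comp_cancel [simp]:
  assumes "iso_arr f" "g \<in> Arr C"
  shows "Cod C g = Dom C f \<Longrightarrow> Inv C f \<star> f \<star> g = g" "Cod C g = Cod C f \<Longrightarrow> f \<star> Inv C f \<star> g = g"
proof -
  show "Inv C f \<star> f \<star> g = g" if "Cod C g = Dom C f"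
    using assms that by (subst comp_assoc[symmetric]) (simp_all del: comp_assoc)
  show "f \<star> Inv C f \<star> g = g" if "Cod C g = Cod C f"
    using assms that by (subst comp_assoc[symmetric]) (simp_all del: comp_assoc)
qed

lemma iso_arr_Inv [simp]: "iso_arr f \<Longrightarrow> iso_arr (Inv C f)"
  by (rule iso_arrI[of _ f]) auto

lemma iso_arr_Idt [simp]: "X \<in> Obj C \<Longrightarrow> iso_arr (Idt C X)"
  by (rule iso_arrI[of _ "Idt C X"]) auto

lemma Inv_Idt [simp]: "X \<in> Obj C \<Longrightarrow> Inv C (Idt C X) = Idt C X"
  by (rule Inv_eqI, rule inverse_pairI) auto

lemma iso_arr_comp [simp]: "iso_arr f \<Longrightarrow> iso_arr g \<Longrightarrow> Cod C f = Dom C g \<Longrightarrow> iso_arr (g \<star> f)"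
  by (rule iso_arrI[of _ "Inv C f \<star> Inv C g"]) auto

lemma iso_arr_scale [simp]: "iso_arr f \<Longrightarrow> a \<noteq> 0 \<Longrightarrow> iso_arr (ScaleArr C a f)"
  by (rule iso_arrI[of _ "ScaleArr C (inverse a) (Inv C f)"]) auto

lemma Inv_scale [simp]: "iso_arr f \<Longrightarrow> a \<noteq> 0 \<Longrightarrow> Inv C (ScaleArr C a f) = ScaleArr C (inverse a) (Inv C f)"
  by (rule Inv_eqI, rule inverse_pairI) auto

lemma iso_cancel_left:
  "iso_arr f \<Longrightarrow> g \<in> Arr C \<Longrightarrow> h \<in> Arr C \<Longrightarrow> Cod C g = Dom C f \<Longrightarrow> Cod C h = Dom C f \<Longrightarrow> f \<star> g = f \<star> h \<longleftrightarrow> g = h"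
  by (metis Inv_comp_cancel(1))

lemma iso_cancel_right:
  assumes "iso_arr f" "g \<in> Arr C" "h \<in> Arr C" "Dom C g = Cod C f" "Dom C h = Cod C f"
  shows "g \<star> f = h \<star> f \<longleftrightarrow> g = h"
proof
  assume "g \<star> f = h \<star> f"
  then have "(g \<star> f) \<star> Inv C f = (h \<star> f) \<star> Inv C f" by simp
  then show "g = h" using assms by simp
qed simp

lemma isomorphicI: "iso_arr f \<Longrightarrow> isomorphic C (Dom C f) (Cod C f)"
  by (auto simp: isomorphic_def Isos_iff)

lemma isomorphicE:
  assumes "isomorphic C X Y"
  obtains f where "iso_arr f" "Dom C f = X" "Cod C f = Y" "X \<in> Obj C" "Y \<in> Obj C"
proof -
  obtain f where "f \<in> Isos C X Y" "X \<in> Obj C" "Y \<in> Obj C"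
    using assms unfolding isomorphic_def by blast
  then show thesis using that[of f] by simp
qed

lemma isomorphic_refl [simp]: "X \<in> Obj C \<Longrightarrow> isomorphic C X X"
  using isomorphicI[of "Idt C X"] by simp

lemma isomorphic_sym: "isomorphic C X Y \<Longrightarrow> isomorphic C Y X"
proof (erule isomorphicE)
  fix f assume "iso_arr f" "Dom C f = X" "Cod C f = Y"
  then show "isomorphic C Y X" using isomorphicI[of "Inv C f"] by simp
qed

lemma isomorphic_trans: "isomorphic C X Y \<Longrightarrow> isomorphic C Y Z \<Longrightarrow> isomorphic C X Z"
proof (elim isomorphicE)
  fix f g assume "iso_arr f" "Dom C f = X" "Cod C f = Y" "iso_arr g" "Dom C g = Y" "Cod C g = Z"
  then show "isomorphic C X Z" using isomorphicI[of "g \<star> f"] by simp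
qed

lemma isomorphic_Obj: "isomorphic C X Y \<Longrightarrow> X \<in> Obj C" "isomorphic C X Y \<Longrightarrow> Y \<in> Obj C"
  by (auto simp: isomorphic_def)

lemma iso_class_eq_iff: "X \<in> Obj C \<Longrightarrow> iso_class C X = iso_class C Y \<longleftrightarrow> isomorphic C X Y"
proof
  assume X: "X \<in> Obj C" and "iso_class C X = iso_class C Y"
  then have "X \<in> iso_class C Y" using isomorphic_refl[OF X] by (auto simp: iso_class_def)
  then show "isomorphic C X Y" using isomorphic_sym by (simp add: iso_class_def)
next
  assume XY: "isomorphic C X Y"
  have "isomorphic C X Z \<longleftrightarrow> isomorphic C Y Z" for Z
    using isomorphic_trans[OF XY, of Z] isomorphic_trans[OF isomorphic_sym[OF XY], of Z] by blast
  then show "iso_class C X = iso_class C Y" by (simp add: iso_class_def)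
qed

lemma zero_object_arr:
  assumes "zero_object C X" "f \<in> Arr C"
  shows "Dom C f = X \<Longrightarrow> f = ZeroArr C X (Cod C f)" "Cod C f = X \<Longrightarrow> f = ZeroArr C (Dom C f) X"
  using assms comp_idt_right[of f X] comp_idt_left[of f X] comp_zero_right[of f X X]
    comp_zero_left[of f X X] by (auto simp: zero_object_def)

lemma zero_object_iso: "isomorphic C X Y \<Longrightarrow> zero_object C X \<longleftrightarrow> zero_object C Y"
proof -
  have "zero_object C Y" if XY: "isomorphic C X Y" and X: "zero_object C X" for X Y
  proof -
    obtain f where f: "iso_arr f" "Dom C f = X" "Cod C f = Y" "X \<in> Obj C" "Y \<in> Obj C"
      using XY by (rule isomorphicE)
    have fz: "f = ZeroArr C X Y" using zero_object_arr(1)[OF X, of f] f by simp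
    have "Idt C Y = f \<star> Inv C f" using f by simp
    also have "\<dots> = ZeroArr C Y Y" using f by (subst fz) auto
    finally show ?thesis using f by (simp add: zero_object_def)
  qed
  then show "isomorphic C X Y \<Longrightarrow> zero_object C X \<longleftrightarrow> zero_object C Y"
    using isomorphic_sym by blast
qed

text \<open>The identity of \<open>Dom C f\<close> factors as \<open>g\<close> after
  \<open>f\<close>; as soon as one factor or the object in the middle vanishes, so does that
  identity.\<close>

lemma retract_of_zero:
  assumes "f \<in> Arr C" "g \<in> Arr C" "Cod C f = Dom C g" "Cod C g = Dom C f" "g \<star> f = Idt C (Dom C f)"
    and "f = ZeroArr C (Dom C f) (Cod C f) \<or> g = ZeroArr C (Dom C g) (Cod C g) \<or> zero_object C (Dom C g)"
  shows "zero_object C (Dom C f)"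
proof -
  have "f = ZeroArr C (Dom C f) (Cod C f) \<or> g = ZeroArr C (Dom C g) (Cod C g)"
    using assms zero_object_arr(1)[of "Dom C g" g] by auto
  then have "g \<star> f = ZeroArr C (Dom C f) (Dom C f)"
    using assms by (metis Cod_Obj Dom_Obj comp_zero_left comp_zero_right)
  then show ?thesis using assms by (simp add: zero_object_def)
qed

end

section \<open>Direct sums\<close>

text \<open>Source and target may lie in different categories. Besides maps between hom spaces of
  one category, this covers the passage from equivariant arrows to the underlying ones.\<close>

lemma linear_map_hom_spacesI:
  assumes "vectorspace (class_ring :: complex ring) (hom_space C X Y)"
    and "vectorspace (class_ring :: complex ring) (hom_space D X' Y')"
    and "\<And>f. f \<in> Hom C X Y \<Longrightarrow> T f \<in> Hom D X' Y'"
    and "\<And>f g. f \<in> Hom C X Y \<Longrightarrow> g \<in> Hom C X Y \<Longrightarrow> T (AddArr C f g) = AddArr D (T f) (T g)"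
    and "\<And>a f. f \<in> Hom C X Y \<Longrightarrow> T (ScaleArr C a f) = ScaleArr D a (T f)"
  shows "linear_map (class_ring :: complex ring) (hom_space C X Y) (hom_space D X' Y') T"
  using assms unfolding linear_map_def mod_hom_def mod_hom_axioms_def LinearCombinations.module_hom_def vectorspace_def
  by (auto simp: hom_space_def)

section \<open>Finite sums of arrows; calculus of inclusions and projections\<close>

context linear_category
begin

abbreviation hsum where "hsum X Y F I \<equiv> finsum (hom_space C X Y) F I"

lemma hsum_arr [simp]:
  assumes "X \<in> Obj C" "Y \<in> Obj C" "\<And>i. i \<in> I \<Longrightarrow> F i \<in> Hom C X Y"
  shows "hsum X Y F I \<in> Arr C" "Dom C (hsum X Y F I) = X" "Cod C (hsum X Y F I) = Y"
  using abelian_monoid.finsum_closed[OF hom_abelian_monoid[OF assms(1,2)], of F I] assms(3)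
  by (simp_all add: Pi_iff)

lemma hsum_empty [simp]: "X \<in> Obj C \<Longrightarrow> Y \<in> Obj C \<Longrightarrow> hsum X Y F {} = ZeroArr C X Y"
  using abelian_monoid.finsum_empty[OF hom_abelian_monoid] by simp

lemma hsum_insert:
  assumes "X \<in> Obj C" "Y \<in> Obj C" "finite I" "i \<notin> I" "\<And>j. j \<in> insert i I \<Longrightarrow> F j \<in> Hom C X Y"
  shows "hsum X Y F (insert i I) = AddArr C (F i) (hsum X Y F I)"
  using abelian_monoid.finsum_insert[OF hom_abelian_monoid[OF assms(1,2)] assms(3,4), of F] assms(5)
  by (simp add: Pi_iff)

lemma hsum_cong:
  assumes "X \<in> Obj C" "Y \<in> Obj C" "\<And>i. i \<in> I \<Longrightarrow> F i = F' i" "\<And>i. i \<in> I \<Longrightarrow> F' i \<in> Hom C X Y"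
  shows "hsum X Y F I = hsum X Y F' I"
  using assms by (intro abelian_monoid.finsum_cong'[OF hom_abelian_monoid[OF assms(1,2)]]) (simp_all add: Pi_iff)

lemma hsum_zero:
  assumes "X \<in> Obj C" "Y \<in> Obj C" "\<And>i. i \<in> I \<Longrightarrow> F i = ZeroArr C X Y"
  shows "hsum X Y F I = ZeroArr C X Y"
  using hsum_cong[OF assms(1,2), of I F "\<lambda>_. ZeroArr C X Y"] assms
    abelian_monoid.finsum_zero[OF hom_abelian_monoid[OF assms(1,2)], of I] by simp

lemma hsum_single:
  assumes "X \<in> Obj C" "Y \<in> Obj C" "finite I" "j \<in> I" "F j \<in> Hom C X Y"
    "\<And>i. i \<in> I \<Longrightarrow> i \<noteq> j \<Longrightarrow> F i = ZeroArr C X Y"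
  shows "hsum X Y F I = F j"
proof -
  have "hsum X Y F (insert j (I - {j})) = AddArr C (F j) (hsum X Y F (I - {j}))"
    using assms by (intro hsum_insert) (auto simp del: insert_Diff_single)
  also have "hsum X Y F (I - {j}) = ZeroArr C X Y"
    using assms by (intro hsum_zero) auto
  finally show ?thesis using assms by (simp add: insert_absorb)
qed

lemma hsum_reindex:
  assumes "X \<in> Obj C" "Y \<in> Obj C" "inj_on h J" "\<And>j. j \<in> J \<Longrightarrow> F (h j) \<in> Hom C X Y"
  shows "hsum X Y F (h ` J) = hsum X Y (\<lambda>j. F (h j)) J"
  using abelian_monoid.finsum_reindex[OF hom_abelian_monoid[OF assms(1,2)], of F h J] assms(3,4)
  by (simp add: Pi_iff)

lemma hsum_add:
  assumes "X \<in> Obj C" "Y \<in> Obj C" "\<And>i. i \<in> I \<Longrightarrow> F i \<in> Hom C X Y" "\<And>i. i \<in> I \<Longrightarrow> F' i \<in> Hom C X Y"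
  shows "hsum X Y (\<lambda>i. AddArr C (F i) (F' i)) I = AddArr C (hsum X Y F I) (hsum X Y F' I)"
  using abelian_monoid.finsum_addf[OF hom_abelian_monoid[OF assms(1,2)], of F I F'] assms(3,4)
  by (simp add: Pi_iff)

lemma hsum_swap:
  assumes "X \<in> Obj C" "Y \<in> Obj C" "finite A" "finite B"
    and "\<And>a b. a \<in> A \<Longrightarrow> b \<in> B \<Longrightarrow> F a b \<in> Hom C X Y"
  shows "hsum X Y (\<lambda>a. hsum X Y (F a) B) A = hsum X Y (\<lambda>b. hsum X Y (\<lambda>a. F a b) A) B"
  using assms(3,5)
proof (induction A rule: finite_induct)
  case empty
  then show ?case using assms by (simp add: hsum_zero)
next
  case (insert a A)
  note [simp] = assms(1,2,4)
  have F [simp]: "F a' b \<in> Arr C" "Dom C (F a' b) = X" "Cod C (F a' b) = Y" if "a' = a \<or> a' \<in> A" "b \<in> B" for a' b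
    using insert.prems[of a' b] that by auto
  have "hsum X Y (\<lambda>b. hsum X Y (\<lambda>a. F a b) (insert a A)) B = hsum X Y (\<lambda>b. AddArr C (F a b) (hsum X Y (\<lambda>a. F a b) A)) B"
  proof (rule hsum_cong)
    fix b assume "b \<in> B"
    then show "hsum X Y (\<lambda>a. F a b) (insert a A) = AddArr C (F a b) (hsum X Y (\<lambda>a. F a b) A)"
      using insert(1,2) by (intro hsum_insert) auto
  qed simp_all
  also have "\<dots> = AddArr C (hsum X Y (F a) B) (hsum X Y (\<lambda>b. hsum X Y (\<lambda>a. F a b) A) B)"
    by (rule hsum_add) simp_all
  also have "hsum X Y (\<lambda>b. hsum X Y (\<lambda>a. F a b) A) B = hsum X Y (\<lambda>a. hsum X Y (F a) B) A"
    using insert.IH by simp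
  also have "AddArr C (hsum X Y (F a) B) \<dots> = hsum X Y (\<lambda>a. hsum X Y (F a) B) (insert a A)"
    using insert(1,2) by (intro hsum_insert[symmetric]) auto
  finally show ?case by (rule sym)
qed

lemma linear_map_comp_left:
  assumes "g \<in> Hom C Y Z" "X \<in> Obj C"
  shows "linear_map (class_ring :: complex ring) (hom_space C X Y) (hom_space C X Z) (\<lambda>f. g \<star> f)"
  using assms by (intro linear_map_hom_spacesI Hom_vectorspace) (auto intro: comp_add_right)

lemma linear_map_comp_right:
  assumes "g \<in> Hom C X Y" "Z \<in> Obj C"
  shows "linear_map (class_ring :: complex ring) (hom_space C Y Z) (hom_space C X Z) (\<lambda>f. f \<star> g)"
  using assms by (intro linear_map_hom_spacesI Hom_vectorspace) (auto intro: comp_add_left)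

lemma comp_hsum_right:
  assumes "g \<in> Arr C" "Dom C g = Y" "X \<in> Obj C" "\<And>i. i \<in> I \<Longrightarrow> F i \<in> Hom C X Y"
  shows "g \<star> hsum X Y F I = hsum X (Cod C g) (\<lambda>i. g \<star> F i) I"
  using linear_map.map_finsum[OF linear_map_comp_left[of g Y "Cod C g" X], of F I] assms
  by (simp add: Pi_iff)

lemma comp_hsum_left:
  assumes "g \<in> Arr C" "Cod C g = Y" "Z \<in> Obj C" "\<And>i. i \<in> I \<Longrightarrow> F i \<in> Hom C Y Z"
  shows "hsum Y Z F I \<star> g = hsum (Dom C g) Z (\<lambda>i. F i \<star> g) I"
  using linear_map.map_finsum[OF linear_map_comp_right[of g "Dom C g" Y Z], of F I] assms
  by (simp add: Pi_iff)

lemma hsum_scale_sum: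
  assumes "f \<in> Arr C" "finite I"
  shows "hsum (Dom C f) (Cod C f) (\<lambda>i. ScaleArr C (a i) f) I = ScaleArr C (\<Sum>i\<in>I. a i) f"
  using assms(2)
proof (induction I rule: finite_induct)
  case empty
  then show ?case using assms by simp
next
  case (insert i I)
  then show ?case
    using assms(1) by (subst hsum_insert) (auto simp: scale_add_left)
qed

lemma direct_sumD:
  assumes "is_direct_sum C I F X \<iota> \<pi>"
  shows "finite I" "X \<in> Obj C" "\<And>i. i \<in> I \<Longrightarrow> F i \<in> Obj C"
    "\<And>i. i \<in> I \<Longrightarrow> \<iota> i \<in> Arr C" "\<And>i. i \<in> I \<Longrightarrow> Dom C (\<iota> i) = F i" "\<And>i. i \<in> I \<Longrightarrow> Cod C (\<iota> i) = X"
    "\<And>i. i \<in> I \<Longrightarrow> \<pi> i \<in> Arr C" "\<And>i. i \<in> I \<Longrightarrow> Dom C (\<pi> i) = X" "\<And>i. i \<in> I \<Longrightarrow> Cod C (\<pi> i) = F i"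
    "\<And>i. i \<in> I \<Longrightarrow> \<pi> i \<star> \<iota> i = Idt C (F i)"
    "\<And>i j. i \<in> I \<Longrightarrow> j \<in> I \<Longrightarrow> i \<noteq> j \<Longrightarrow> \<pi> i \<star> \<iota> j = ZeroArr C (F j) (F i)"
    "hsum X X (\<lambda>i. \<iota> i \<star> \<pi> i) I = Idt C X"
  using assms unfolding is_direct_sum_def by simp_all

lemma direct_sumI:
  assumes "finite I" "X \<in> Obj C" "\<And>i. i \<in> I \<Longrightarrow> F i \<in> Obj C"
    "\<And>i. i \<in> I \<Longrightarrow> \<iota> i \<in> Hom C (F i) X" "\<And>i. i \<in> I \<Longrightarrow> \<pi> i \<in> Hom C X (F i)"
    "\<And>i. i \<in> I \<Longrightarrow> \<pi> i \<star> \<iota> i = Idt C (F i)"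
    "\<And>i j. i \<in> I \<Longrightarrow> j \<in> I \<Longrightarrow> i \<noteq> j \<Longrightarrow> \<pi> i \<star> \<iota> j = ZeroArr C (F j) (F i)"
    "hsum X X (\<lambda>i. \<iota> i \<star> \<pi> i) I = Idt C X"
  shows "is_direct_sum C I F X \<iota> \<pi>"
  using assms unfolding is_direct_sum_def by simp

lemma direct_sum_cong: "is_direct_sum C I F X \<iota> \<pi> \<Longrightarrow> (\<And>i. i \<in> I \<Longrightarrow> F i = F' i) \<Longrightarrow> is_direct_sum C I F' X \<iota> \<pi>"
  by (simp add: is_direct_sum_def)

lemma direct_sum_expand:
  assumes ds: "is_direct_sum C I F X \<iota> \<pi>" and f: "f \<in> Arr C" "Cod C f = X"
  shows "hsum (Dom C f) X (\<lambda>i. \<iota> i \<star> \<pi> i \<star> f) I = f"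
proof -
  note d [simp] = direct_sumD[OF ds]
  have "f = hsum X X (\<lambda>i. \<iota> i \<star> \<pi> i) I \<star> f" using f by simp
  also have "\<dots> = hsum (Dom C f) X (\<lambda>i. (\<iota> i \<star> \<pi> i) \<star> f) I"
    using f by (intro comp_hsum_left) auto
  also have "\<dots> = hsum (Dom C f) X (\<lambda>i. \<iota> i \<star> \<pi> i \<star> f) I"
    using f by (intro hsum_cong) auto
  finally show ?thesis by (rule sym)
qed

lemma direct_sum_expand':
  assumes ds: "is_direct_sum C I F X \<iota> \<pi>" and f: "f \<in> Arr C" "Dom C f = X"
  shows "hsum X (Cod C f) (\<lambda>i. f \<star> \<iota> i \<star> \<pi> i) I = f"
proof -
  note d [simp] = direct_sumD[OF ds]
  have "f = f \<star> hsum X X (\<lambda>i. \<iota> i \<star> \<pi> i) I" using f by simp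
  also have "\<dots> = hsum X (Cod C f) (\<lambda>i. f \<star> \<iota> i \<star> \<pi> i) I"
    using f by (intro comp_hsum_right) auto
  finally show ?thesis by (rule sym)
qed

lemma direct_sum_ext:
  assumes ds: "is_direct_sum C I F X \<iota> \<pi>" and "f \<in> Arr C" "g \<in> Arr C" "Cod C f = X" "Cod C g = X" "Dom C g = Dom C f"
    and eq: "\<And>i. i \<in> I \<Longrightarrow> \<pi> i \<star> f = \<pi> i \<star> g"
  shows "f = g"
proof -
  note d [simp] = direct_sumD[OF ds]
  have "f = hsum (Dom C f) X (\<lambda>i. \<iota> i \<star> \<pi> i \<star> f) I"
    using assms direct_sum_expand[OF ds, of f] by simp
  also have "\<dots> = hsum (Dom C f) X (\<lambda>i. \<iota> i \<star> \<pi> i \<star> g) I"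
    using assms by (intro hsum_cong) auto
  also have "\<dots> = g"
    using assms direct_sum_expand[OF ds, of g] by simp
  finally show ?thesis .
qed

lemma direct_sum_ext':
  assumes ds: "is_direct_sum C I F X \<iota> \<pi>" and "f \<in> Arr C" "g \<in> Arr C" "Dom C f = X" "Dom C g = X" "Cod C g = Cod C f"
    and eq: "\<And>i. i \<in> I \<Longrightarrow> f \<star> \<iota> i = g \<star> \<iota> i"
  shows "f = g"
proof -
  note d [simp] = direct_sumD[OF ds]
  have *: "f \<star> \<iota> i \<star> \<pi> i = g \<star> \<iota> i \<star> \<pi> i" if "i \<in> I" for i
    using comp_assoc[of "\<pi> i" "\<iota> i" f] comp_assoc[of "\<pi> i" "\<iota> i" g] eq[OF that] assms(2-6) that
    by (simp del: comp_assoc)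
  have "f = hsum X (Cod C f) (\<lambda>i. f \<star> \<iota> i \<star> \<pi> i) I"
    using assms direct_sum_expand'[OF ds, of f] by simp
  also have "\<dots> = hsum X (Cod C f) (\<lambda>i. g \<star> \<iota> i \<star> \<pi> i) I"
    using assms * by (intro hsum_cong) auto
  also have "\<dots> = g"
    using assms direct_sum_expand'[OF ds, of g] by simp
  finally show ?thesis .
qed

lemma direct_sum_change_summands:
  assumes ds: "is_direct_sum C I F X \<iota> \<pi>"
    and \<theta>: "\<And>i. i \<in> I \<Longrightarrow> iso_arr (\<theta> i)" "\<And>i. i \<in> I \<Longrightarrow> Dom C (\<theta> i) = F i" "\<And>i. i \<in> I \<Longrightarrow> Cod C (\<theta> i) = F' i"
  shows "is_direct_sum C I F' X (\<lambda>i. \<iota> i \<star> Inv C (\<theta> i)) (\<lambda>i. \<theta> i \<star> \<pi> i)"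
proof (rule direct_sumI)
  note d [simp] = direct_sumD[OF ds] and \<theta> [simp]
  show "F' i \<in> Obj C" if "i \<in> I" for i using \<theta>(1,3)[OF that] Cod_Obj[of "\<theta> i"] by simp
  show "(\<theta> i \<star> \<pi> i) \<star> \<iota> i \<star> Inv C (\<theta> i) = Idt C (F' i)" if i: "i \<in> I" for i
  proof -
    have "(\<theta> i \<star> \<pi> i) \<star> \<iota> i \<star> Inv C (\<theta> i) = \<theta> i \<star> (\<pi> i \<star> \<iota> i) \<star> Inv C (\<theta> i)"
      using i by (simp del: d(10,11))
    then show ?thesis using i by simp
  qed
  show "(\<theta> i \<star> \<pi> i) \<star> \<iota> j \<star> Inv C (\<theta> j) = ZeroArr C (F' j) (F' i)" if i: "i \<in> I" "j \<in> I" "i \<noteq> j" for i j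
  proof -
    have "F' i \<in> Obj C" "F' j \<in> Obj C"
      using i \<theta>(1,3)[OF i(1)] \<theta>(1,3)[OF i(2)] Cod_Obj[of "\<theta> i"] Cod_Obj[of "\<theta> j"] by simp_all
    moreover have "(\<theta> i \<star> \<pi> i) \<star> \<iota> j \<star> Inv C (\<theta> j) = \<theta> i \<star> (\<pi> i \<star> \<iota> j) \<star> Inv C (\<theta> j)"
      using i by (simp del: d(10,11))
    ultimately show ?thesis using i by simp
  qed
  have "hsum X X (\<lambda>i. (\<iota> i \<star> Inv C (\<theta> i)) \<star> \<theta> i \<star> \<pi> i) I = hsum X X (\<lambda>i. \<iota> i \<star> \<pi> i) I"
    by (intro hsum_cong) auto
  then show "hsum X X (\<lambda>i. (\<iota> i \<star> Inv C (\<theta> i)) \<star> \<theta> i \<star> \<pi> i) I = Idt C X" by simp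
qed (use direct_sumD[OF ds] \<theta> in auto)

lemma direct_sum_reindex:
  assumes ds: "is_direct_sum C I F X \<iota> \<pi>" and h: "bij_betw h J I"
  shows "is_direct_sum C J (\<lambda>j. F (h j)) X (\<lambda>j. \<iota> (h j)) (\<lambda>j. \<pi> (h j))"
proof (rule direct_sumI)
  note d [simp] = direct_sumD[OF ds]
  have hI [simp]: "h j \<in> I" if "j \<in> J" for j using bij_betwE[OF h] that by blast
  have hinj: "h i \<noteq> h j" if "i \<in> J" "j \<in> J" "i \<noteq> j" for i j
    using h that by (meson bij_betw_def inj_onD)
  show "finite J" using bij_betw_finite[OF h] by simp
  show "X \<in> Obj C" by simp
  fix j assume j: "j \<in> J"
  show "F (h j) \<in> Obj C" "\<iota> (h j) \<in> Hom C (F (h j)) X" "\<pi> (h j) \<in> Hom C X (F (h j))"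
    "\<pi> (h j) \<star> \<iota> (h j) = Idt C (F (h j))" using j by simp_all
next
  note d [simp] = direct_sumD[OF ds]
  fix i j assume ij: "i \<in> J" "j \<in> J" "i \<noteq> j"
  then have "h i \<noteq> h j" "h i \<in> I" "h j \<in> I"
    using h bij_betwE[OF h] by (meson bij_betw_def inj_onD)+
  then show "\<pi> (h i) \<star> \<iota> (h j) = ZeroArr C (F (h j)) (F (h i))" by simp
next
  note d [simp] = direct_sumD[OF ds]
  have hI [simp]: "h j \<in> I" if "j \<in> J" for j using bij_betwE[OF h] that by blast
  have "hsum X X (\<lambda>i. \<iota> i \<star> \<pi> i) (h ` J) = hsum X X (\<lambda>j. \<iota> (h j) \<star> \<pi> (h j)) J"
    using h by (intro hsum_reindex) (auto simp: bij_betw_def)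
  then show "hsum X X (\<lambda>j. \<iota> (h j) \<star> \<pi> (h j)) J = Idt C X"
    using h by (simp add: bij_betw_def)
qed

lemma direct_sum_single:
  assumes "iso_arr \<theta>"
  shows "is_direct_sum C {i} (\<lambda>_. Dom C \<theta>) (Cod C \<theta>) (\<lambda>_. \<theta>) (\<lambda>_. Inv C \<theta>)"
proof (rule direct_sumI)
  show "hsum (Cod C \<theta>) (Cod C \<theta>) (\<lambda>i. \<theta> \<star> Inv C \<theta>) {i} = Idt C (Cod C \<theta>)"
    using assms by (subst hsum_single[of _ _ _ i]) simp_all
qed (use assms in auto)

lemma direct_sum_singleD:
  assumes ds: "is_direct_sum C {i} F X \<iota> \<pi>"
  shows "iso_arr (\<iota> i)"
proof (rule iso_arrI[of _ "\<pi> i"])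
  note d [simp] = direct_sumD[OF ds]
  have "hsum X X (\<lambda>i. \<iota> i \<star> \<pi> i) {i} = \<iota> i \<star> \<pi> i" by (rule hsum_single) simp_all
  then show "\<iota> i \<star> \<pi> i = Idt C (Cod C (\<iota> i))" by simp
qed (use direct_sumD[OF ds] in simp_all)

section \<open>Dimensions of hom spaces\<close>

abbreviation hom_fin where
  "hom_fin X Y \<equiv> vectorspace.fin_dim (class_ring :: complex ring) (hom_space C X Y)"

text \<open>Composition with the inclusions and projections exhibits Hom(Z, X) as the direct sum of
  the spaces Hom(Z, F i).\<close>

lemma hom_dim_direct_sum:
  assumes ds: "is_direct_sum C I F X \<iota> \<pi>" and Z: "Z \<in> Obj C" and fd: "\<And>i. i \<in> I \<Longrightarrow> hom_fin Z (F i)"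
  shows "hom_fin Z X" "hom_dim C Z X = (\<Sum>i\<in>I. hom_dim C Z (F i))"
proof -
  note d [simp] = direct_sumD[OF ds]
  have V: "vectorspace (class_ring :: complex ring) (hom_space C Z X)"
    using Z by (intro Hom_vectorspace) simp_all
  have e: "linear_map (class_ring :: complex ring) (hom_space C Z (F i)) (hom_space C Z X) (\<lambda>f. \<iota> i \<star> f)"
    if "i \<in> I" for i using that Z by (intro linear_map_comp_left) simp_all
  have p: "linear_map (class_ring :: complex ring) (hom_space C Z X) (hom_space C Z (F i)) (\<lambda>f. \<pi> i \<star> f)"
    if "i \<in> I" for i using that Z by (intro linear_map_comp_left) simp_all
  have pe: "\<pi> i \<star> \<iota> j \<star> w = (if i = j then w else \<zero>\<^bsub>hom_space C Z (F i)\<^esub>)"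
    if "i \<in> I" "j \<in> I" "w \<in> carrier (hom_space C Z (F j))" for i j w
  proof -
    have "\<pi> i \<star> \<iota> j \<star> w = (\<pi> i \<star> \<iota> j) \<star> w" using that by (intro comp_assoc[symmetric]) simp_all
    then show ?thesis using that by (cases "i = j") (simp_all del: comp_assoc)
  qed
  have ep: "v = hsum Z X (\<lambda>i. \<iota> i \<star> \<pi> i \<star> v) I" if "v \<in> carrier (hom_space C Z X)" for v
    using direct_sum_expand[OF ds, of v] that by simp
  note r = vectorspace.dim_direct_sum[OF V d(1) e p pe ep fd]
  show "hom_fin Z X" by (rule r(1))
  show "hom_dim C Z X = (\<Sum>i\<in>I. hom_dim C Z (F i))" unfolding hom_dim_def by (rule r(2))
qed

lemma hom_dim_direct_sum':
  assumes ds: "is_direct_sum C I F X \<iota> \<pi>" and Z: "Z \<in> Obj C" and fd: "\<And>i. i \<in> I \<Longrightarrow> hom_fin (F i) Z"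
  shows "hom_fin X Z" "hom_dim C X Z = (\<Sum>i\<in>I. hom_dim C (F i) Z)"
proof -
  note d [simp] = direct_sumD[OF ds]
  have V: "vectorspace (class_ring :: complex ring) (hom_space C X Z)"
    using Z by (intro Hom_vectorspace) simp_all
  have e: "linear_map (class_ring :: complex ring) (hom_space C (F i) Z) (hom_space C X Z) (\<lambda>f. f \<star> \<pi> i)"
    if "i \<in> I" for i using that Z by (intro linear_map_comp_right) simp_all
  have p: "linear_map (class_ring :: complex ring) (hom_space C X Z) (hom_space C (F i) Z) (\<lambda>f. f \<star> \<iota> i)"
    if "i \<in> I" for i using that Z by (intro linear_map_comp_right) simp_all
  have pe: "(w \<star> \<pi> j) \<star> \<iota> i = (if i = j then w else \<zero>\<^bsub>hom_space C (F i) Z\<^esub>)"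
    if "i \<in> I" "j \<in> I" "w \<in> carrier (hom_space C (F j) Z)" for i j w
    using that Z by (cases "i = j") simp_all
  have ep: "v = hsum X Z (\<lambda>i. (v \<star> \<iota> i) \<star> \<pi> i) I" if "v \<in> carrier (hom_space C X Z)" for v
  proof -
    have "hsum X Z (\<lambda>i. (v \<star> \<iota> i) \<star> \<pi> i) I = hsum X Z (\<lambda>i. v \<star> \<iota> i \<star> \<pi> i) I"
      using that Z by (intro hsum_cong) simp_all
    then show ?thesis using direct_sum_expand'[OF ds, of v] that by simp
  qed
  note r = vectorspace.dim_direct_sum[OF V d(1) e p pe ep fd]
  show "hom_fin X Z" by (rule r(1))
  show "hom_dim C X Z = (\<Sum>i\<in>I. hom_dim C (F i) Z)" unfolding hom_dim_def by (rule r(2))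
qed

lemma hom_dim_le:
  assumes "linear_map (class_ring :: complex ring) (hom_space C X Y) (hom_space C X' Y') T"
    and "inj_on T (Hom C X Y)" "hom_fin X Y" "hom_fin X' Y'"
  shows "hom_dim C X Y \<le> hom_dim C X' Y'"
  unfolding hom_dim_def using linear_map.dim_le_of_inj[OF assms(1,3,4)] assms(2) by simp

lemma hom_dim_zero:
  assumes "X \<in> Obj C" "Y \<in> Obj C" "Hom C X Y = {ZeroArr C X Y}"
  shows "hom_fin X Y" "hom_dim C X Y = 0"
proof -
  have V: "vectorspace (class_ring :: complex ring) (hom_space C X Y)"
    using assms by (intro Hom_vectorspace)
  note d = vectorspace.dim_indexed_basis[OF V, of "{} :: nat set" "\<lambda>_. undefined"]
  have gen: "\<exists>a\<in>{} \<rightarrow> carrier class_ring. v = hsum X Y (\<lambda>i. a i \<odot>\<^bsub>hom_space C X Y\<^esub> undefined) {}"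
    if "v \<in> carrier (hom_space C X Y)" for v
    using that assms by (auto simp del: Hom_iff)
  show "hom_fin X Y" by (rule d(1)[OF _ _ _ gen]) simp_all
  show "hom_dim C X Y = 0" unfolding hom_dim_def by (subst d(2)[OF _ _ _ gen]) simp_all
qed

lemma hom_dim_one:
  assumes "f \<in> Hom C X Y" "f \<noteq> ZeroArr C X Y" "\<And>g. g \<in> Hom C X Y \<Longrightarrow> \<exists>a. g = ScaleArr C a f"
  shows "hom_fin X Y" "hom_dim C X Y = 1"
proof -
  have XY [simp]: "X \<in> Obj C" "Y \<in> Obj C" using assms(1) by auto
  have V: "vectorspace (class_ring :: complex ring) (hom_space C X Y)"
    by (intro Hom_vectorspace) simp_all
  have s: "hsum X Y (\<lambda>i. a i \<odot>\<^bsub>hom_space C X Y\<^esub> f) {()} = ScaleArr C (a ()) f" for a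
    using assms(1) by (subst hsum_single) simp_all
  note d = vectorspace.dim_indexed_basis[OF V, of "{()}" "\<lambda>_. f"]
  have gen: "\<exists>a\<in>{()} \<rightarrow> carrier class_ring. v = hsum X Y (\<lambda>i. a i \<odot>\<^bsub>hom_space C X Y\<^esub> f) {()}"
    if v: "v \<in> carrier (hom_space C X Y)" for v
  proof -
    obtain a where "v = ScaleArr C a f" using assms(3)[of v] v by auto
    then show ?thesis unfolding s by (intro bexI[of _ "\<lambda>_. a"]) simp_all
  qed
  have li: "\<forall>i\<in>{()}. a i = \<zero>\<^bsub>class_ring\<^esub>"
    if "hsum X Y (\<lambda>i. a i \<odot>\<^bsub>hom_space C X Y\<^esub> f) {()} = \<zero>\<^bsub>hom_space C X Y\<^esub>" for a
    using that assms(1,2) unfolding s by (simp add: scale_eq_zero_iff)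
  have f: "(\<lambda>_. f) \<in> {()} \<rightarrow> carrier (hom_space C X Y)" using assms(1) by simp
  show "hom_fin X Y" by (rule d(1)[OF _ f li gen]) simp_all
  show "hom_dim C X Y = 1" unfolding hom_dim_def by (subst d(2)[OF _ f li gen]) simp_all
qed

lemma monic_comp_nonzero:
  assumes "monic C m" "f \<in> Hom C Z (Dom C m)" "f \<noteq> ZeroArr C Z (Dom C m)"
  shows "m \<star> f \<noteq> ZeroArr C Z (Cod C m)"
proof
  assume "m \<star> f = ZeroArr C Z (Cod C m)"
  moreover have m: "m \<in> Arr C" using assms(1) by (simp add: monic_def)
  moreover have Z: "Z \<in> Obj C" "Dom C m \<in> Obj C" using assms(2) m by auto
  ultimately have "m \<star> f = m \<star> ZeroArr C Z (Dom C m)" by simp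
  then have "f = ZeroArr C Z (Dom C m)"
    using assms(1,2) Z unfolding monic_def by (metis Hom_iff zero_arr)
  with assms(3) show False by simp
qed

lemma split_monic:
  assumes "f \<in> Arr C" "g \<in> Arr C" "Dom C g = Cod C f" "Cod C g = Dom C f" "g \<star> f = Idt C (Dom C f)"
  shows "monic C f"
  unfolding monic_def
proof (intro conjI allI ballI impI)
  fix Z h k assume h: "h \<in> Hom C Z (Dom C f)" "k \<in> Hom C Z (Dom C f)" "f \<star> h = f \<star> k"
  have "h = (g \<star> f) \<star> h" using assms h by (simp del: comp_assoc)
  also have "\<dots> = g \<star> f \<star> h" using assms h by (intro comp_assoc) simp_all
  also have "\<dots> = g \<star> f \<star> k" by (simp only: h(3))
  also have "\<dots> = (g \<star> f) \<star> k" using assms h by (intro comp_assoc[symmetric]) auto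
  also have "\<dots> = k" using assms h by (simp del: comp_assoc)
  finally show "h = k" .
qed (use assms in simp)

text \<open>From m r m = m the monomorphism m can be cancelled, so the one-sided inverse r is
  two-sided.\<close>

lemma monic_split_epic_iso:
  assumes m: "monic C m" and r: "r \<in> Arr C" "Dom C r = Cod C m" "Cod C r = Dom C m" "m \<star> r = Idt C (Cod C m)"
  shows "iso_arr m"
proof (rule iso_arrI[of _ r])
  have mA: "m \<in> Arr C" using m by (simp add: monic_def)
  have "m \<star> r \<star> m = (m \<star> r) \<star> m" using mA r by (intro comp_assoc[symmetric]) simp_all
  also have "\<dots> = m \<star> Idt C (Dom C m)" using mA r by (simp del: comp_assoc)
  finally have e: "m \<star> (r \<star> m) = m \<star> Idt C (Dom C m)" .
  have "r \<star> m \<in> Hom C (Dom C m) (Dom C m)" "Idt C (Dom C m) \<in> Hom C (Dom C m) (Dom C m)"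
    using mA r by simp_all
  then show "r \<star> m = Idt C (Dom C m)"
    using m e unfolding monic_def by blast
qed (use assms in \<open>simp_all add: monic_def\<close>)

lemma direct_sum_nonempty:
  assumes ds: "is_direct_sum C I F X \<iota> \<pi>" and "\<not> zero_object C X"
  shows "I \<noteq> {}"
proof
  assume "I = {}"
  then show False using direct_sumD[OF ds] assms(2) by (simp add: zero_object_def)
qed

lemma direct_sum_copair:
  assumes ds: "is_direct_sum C I F X \<iota> \<pi>" and Y: "Y \<in> Obj C" and \<phi>: "\<And>i. i \<in> I \<Longrightarrow> \<phi> i \<in> Hom C (F i) Y"
  obtains f where "f \<in> Hom C X Y" "\<And>i. i \<in> I \<Longrightarrow> f \<star> \<iota> i = \<phi> i"
proof
  note d [simp] = direct_sumD[OF ds] and Y [simp]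
  have [simp]: "\<phi> i \<in> Arr C" "Dom C (\<phi> i) = F i" "Cod C (\<phi> i) = Y" if "i \<in> I" for i
    using \<phi>[OF that] by simp_all
  let ?f = "hsum X Y (\<lambda>i. \<phi> i \<star> \<pi> i) I"
  have "?f \<in> Arr C" "Dom C ?f = X" "Cod C ?f = Y" by (rule hsum_arr; simp)+
  then show "?f \<in> Hom C X Y" by simp
  fix j assume j: "j \<in> I"
  have "?f \<star> \<iota> j = hsum (F j) Y (\<lambda>i. (\<phi> i \<star> \<pi> i) \<star> \<iota> j) I"
    using comp_hsum_left[of "\<iota> j" X Y I "\<lambda>i. \<phi> i \<star> \<pi> i"] j by simp
  also have "\<dots> = (\<phi> j \<star> \<pi> j) \<star> \<iota> j"
    by (rule hsum_single) (use j in simp_all)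
  finally show "?f \<star> \<iota> j = \<phi> j" using j by simp
qed

text \<open>The isomorphism is pinned down on the inclusions. This explicit description is what
  later makes identities between such isomorphisms verifiable summand by summand.\<close>

lemma direct_sum_iso:
  assumes ds: "is_direct_sum C I F X \<iota> \<pi>" and ds': "is_direct_sum C I F' X' \<iota>' \<pi>'"
    and \<theta>: "\<And>i. i \<in> I \<Longrightarrow> iso_arr (\<theta> i)" "\<And>i. i \<in> I \<Longrightarrow> Dom C (\<theta> i) = F i" "\<And>i. i \<in> I \<Longrightarrow> Cod C (\<theta> i) = F' i"
  obtains f where "iso_arr f" "Dom C f = X" "Cod C f = X'" "\<And>i. i \<in> I \<Longrightarrow> f \<star> \<iota> i = \<iota>' i \<star> \<theta> i"
proof -
  note d [simp] = direct_sumD(1-9)[OF ds] and d' [simp] = direct_sumD(1-9)[OF ds'] and \<theta> [simp]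
  obtain f where f: "f \<in> Hom C X X'" and fi: "\<And>i. i \<in> I \<Longrightarrow> f \<star> \<iota> i = \<iota>' i \<star> \<theta> i"
    by (rule direct_sum_copair[OF ds d'(2), of "\<lambda>i. \<iota>' i \<star> \<theta> i"]) simp_all
  obtain f' where f': "f' \<in> Hom C X' X" and f'i: "\<And>i. i \<in> I \<Longrightarrow> f' \<star> \<iota>' i = \<iota> i \<star> Inv C (\<theta> i)"
    by (rule direct_sum_copair[OF ds' d(2), of "\<lambda>i. \<iota> i \<star> Inv C (\<theta> i)"]) simp_all
  have 1: "f' \<star> f = Idt C X"
  proof (rule direct_sum_ext'[OF ds])
    fix i assume i: "i \<in> I"
    have "(f' \<star> f) \<star> \<iota> i = f' \<star> \<iota>' i \<star> \<theta> i" using f f' i fi by simp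
    also have "\<dots> = (f' \<star> \<iota>' i) \<star> \<theta> i" using f' i by simp
    also have "\<dots> = \<iota> i" unfolding f'i[OF i] using i by simp
    finally show "(f' \<star> f) \<star> \<iota> i = Idt C X \<star> \<iota> i" using i by simp
  qed (use f f' in simp_all)
  have 2: "f \<star> f' = Idt C X'"
  proof (rule direct_sum_ext'[OF ds'])
    fix i assume i: "i \<in> I"
    have "(f \<star> f') \<star> \<iota>' i = f \<star> \<iota> i \<star> Inv C (\<theta> i)" using f f' i f'i by simp
    also have "\<dots> = (f \<star> \<iota> i) \<star> Inv C (\<theta> i)" using f i by simp
    also have "\<dots> = \<iota>' i" unfolding fi[OF i] using i by simp
    finally show "(f \<star> f') \<star> \<iota>' i = Idt C X' \<star> \<iota>' i" using i by simp
  qed (use f f' in simp_all)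
  have "iso_arr f" using 1 2 f f' by (intro iso_arrI[of f f']) simp_all
  then show thesis using that f fi by simp
qed

text \<open>The orthogonal idempotents \<open>\<iota> i \<star> \<pi> i\<close> are linearly
  independent endomorphisms of \<open>X\<close>. This bounds the length of an orthogonal family, so
  that a longest one exists.\<close>

lemma orthonormal_bound:
  assumes X: "X \<in> Obj C" and fin: "hom_fin X X"
    and F: "\<And>i. i < n \<Longrightarrow> \<not> zero_object C (F i)"
    and \<iota>: "\<And>i. i < n \<Longrightarrow> \<iota> i \<in> Hom C (F i) X" and \<pi>: "\<And>i. i < n \<Longrightarrow> \<pi> i \<in> Hom C X (F i)"
    and \<pi>\<iota>: "\<And>i. i < n \<Longrightarrow> \<pi> i \<star> \<iota> i = Idt C (F i)"
    and orth: "\<And>i j. i < n \<Longrightarrow> j < n \<Longrightarrow> i \<noteq> j \<Longrightarrow> \<pi> i \<star> \<iota> j = ZeroArr C (F j) (F i)"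
  shows "n \<le> hom_dim C X X"
proof -
  note V = Hom_vectorspace[OF X X]
  have [simp]: "\<iota> i \<in> Arr C" "Dom C (\<iota> i) = F i" "Cod C (\<iota> i) = X" "\<pi> i \<in> Arr C" "Dom C (\<pi> i) = X" "Cod C (\<pi> i) = F i"
    if "i < n" for i using \<iota>[OF that] \<pi>[OF that] by simp_all
  have FO [simp]: "F i \<in> Obj C" if "i < n" for i
    using Dom_Obj[of "\<iota> i"] that by simp
  have b: "(\<lambda>i. \<iota> i \<star> \<pi> i) \<in> {..<n} \<rightarrow> carrier (hom_space C X X)" by simp
  have li: "\<forall>i\<in>{..<n}. a i = \<zero>\<^bsub>class_ring\<^esub>"
    if a: "hsum X X (\<lambda>i. a i \<odot>\<^bsub>hom_space C X X\<^esub> (\<iota> i \<star> \<pi> i)) {..<n} = \<zero>\<^bsub>hom_space C X X\<^esub>" for a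
  proof
    fix j assume "j \<in> {..<n}"
    then have j: "j < n" by simp
    \<comment> \<open>Composing the relation with \<open>\<iota> j\<close> removes every term but
      the j-th.\<close>
    have "hsum (F j) X (\<lambda>i. ScaleArr C (a i) (\<iota> i \<star> \<pi> i) \<star> \<iota> j) {..<n} = ScaleArr C (a j) (\<iota> j \<star> \<pi> j) \<star> \<iota> j"
    proof (rule hsum_single)
      fix i assume i: "i \<in> {..<n}" "i \<noteq> j"
      then show "ScaleArr C (a i) (\<iota> i \<star> \<pi> i) \<star> \<iota> j = ZeroArr C (F j) X"
        using j orth[of i j] X by simp
    qed (use j X in simp_all)
    also have "hsum (F j) X (\<lambda>i. ScaleArr C (a i) (\<iota> i \<star> \<pi> i) \<star> \<iota> j) {..<n}
        = hsum X X (\<lambda>i. ScaleArr C (a i) (\<iota> i \<star> \<pi> i)) {..<n} \<star> \<iota> j"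
      using comp_hsum_left[of "\<iota> j" X X "{..<n}" "\<lambda>i. ScaleArr C (a i) (\<iota> i \<star> \<pi> i)"] j X by simp
    also have "hsum X X (\<lambda>i. ScaleArr C (a i) (\<iota> i \<star> \<pi> i)) {..<n} = ZeroArr C X X" using a by simp
    finally have "ZeroArr C (F j) X = ScaleArr C (a j) (\<iota> j)" using j X \<pi>\<iota>[OF j] by simp
    moreover have "\<iota> j \<noteq> ZeroArr C (F j) X"
    proof
      assume z: "\<iota> j = ZeroArr C (F j) X"
      have "Idt C (F j) = \<pi> j \<star> \<iota> j" using \<pi>\<iota>[OF j] by simp
      also have "\<dots> = ZeroArr C (F j) (F j)" unfolding z using j by simp
      finally show False using F[OF j] j by (simp add: zero_object_def)
    qed
    ultimately show "a j = \<zero>\<^bsub>class_ring\<^esub>" using scale_eq_zero_iff[of "\<iota> j" "F j" X "a j"] j by simp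
  qed
  note l = vectorspace.lin_indpt_indexed[OF V finite_lessThan b li]
  have "card ((\<lambda>i. \<iota> i \<star> \<pi> i) ` {..<n}) \<le> vectorspace.dim (class_ring :: complex ring) (hom_space C X X)"
    using b by (intro vectorspace.li_le_dim(2)[OF V fin _ l(2)]) auto
  then show ?thesis using card_image[OF l(1)] by (simp add: hom_dim_def)
qed

text \<open>A maximal orthogonal family of summands \<open>s j\<close> exhausts \<open>X\<close>: otherwise the complementary idempotent
  would split off another one.\<close>

lemma decomposition_by_idempotents:
  assumes X: "X \<in> Obj C" and s: "\<And>j. j \<in> J \<Longrightarrow> s j \<in> Obj C"
    and bound: "\<And>(n::nat) k \<iota> \<pi>. (\<And>i. i < n \<Longrightarrow> k i \<in> J) \<Longrightarrow> (\<And>i. i < n \<Longrightarrow> \<iota> i \<in> Hom C (s (k i)) X)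
      \<Longrightarrow> (\<And>i. i < n \<Longrightarrow> \<pi> i \<in> Hom C X (s (k i))) \<Longrightarrow> (\<And>i. i < n \<Longrightarrow> \<pi> i \<star> \<iota> i = Idt C (s (k i)))
      \<Longrightarrow> (\<And>i j. i < n \<Longrightarrow> j < n \<Longrightarrow> i \<noteq> j \<Longrightarrow> \<pi> i \<star> \<iota> j = ZeroArr C (s (k j)) (s (k i))) \<Longrightarrow> n \<le> (N::nat)"
    and split: "\<And>e. e \<in> Hom C X X \<Longrightarrow> e \<star> e = e \<Longrightarrow> e \<noteq> ZeroArr C X X
      \<Longrightarrow> \<exists>j f r. j \<in> J \<and> f \<in> Hom C (s j) X \<and> r \<in> Hom C X (s j) \<and> r \<star> f = Idt C (s j) \<and> e \<star> f = f \<and> r \<star> e = r"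
  shows "\<exists>(n::nat) k \<iota> \<pi>. (\<forall>i<n. k i \<in> J) \<and> is_direct_sum C {..<n} (\<lambda>i. s (k i)) X \<iota> \<pi>"
proof -
  \<comment> \<open>\<open>P n\<close> says that there are n orthogonal summands of \<open>X\<close>
    taken from the family \<open>s\<close>. The bound \<open>N\<close> guarantees a largest such
    n.\<close>
  define P where "P n \<longleftrightarrow> (\<exists>k \<iota> \<pi>. (\<forall>i<n. k i \<in> J \<and> \<iota> i \<in> Hom C (s (k i)) X \<and> \<pi> i \<in> Hom C X (s (k i)) \<and>
    \<pi> i \<star> \<iota> i = Idt C (s (k i))) \<and> (\<forall>i<n. \<forall>j<n. i \<noteq> j \<longrightarrow> \<pi> i \<star> \<iota> j = ZeroArr C (s (k j)) (s (k i))))" for n :: nat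
  have P0: "P 0" by (simp add: P_def)
  have PN: "n \<le> N" if Pn: "P n" for n
  proof -
    obtain k \<iota> \<pi> where *: "\<forall>i<n. k i \<in> J \<and> \<iota> i \<in> Hom C (s (k i)) X \<and> \<pi> i \<in> Hom C X (s (k i)) \<and>
      \<pi> i \<star> \<iota> i = Idt C (s (k i))" "\<forall>i<n. \<forall>j<n. i \<noteq> j \<longrightarrow> \<pi> i \<star> \<iota> j = ZeroArr C (s (k j)) (s (k i))"
      using Pn unfolding P_def by blast
    show ?thesis by (rule bound[of n k \<iota> \<pi>]) (use * in blast)+
  qed
  define n where "n = (GREATEST n. P n)"
  have Pn: "P n" unfolding n_def by (rule GreatestI_nat[of P 0 N]) (use P0 PN in blast)+
  have nmax: "\<not> P (Suc n)"
  proof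
    assume "P (Suc n)"
    then have "Suc n \<le> (GREATEST n. P n)" by (rule Greatest_le_nat[of P _ N]) (use PN in blast)
    then have "Suc n \<le> n" by (simp add: n_def)
    then show False by simp
  qed
  obtain k \<iota> \<pi> where k: "\<forall>i<n. k i \<in> J \<and> \<iota> i \<in> Hom C (s (k i)) X \<and> \<pi> i \<in> Hom C X (s (k i)) \<and>
      \<pi> i \<star> \<iota> i = Idt C (s (k i))" and orth: "\<forall>i<n. \<forall>j<n. i \<noteq> j \<longrightarrow> \<pi> i \<star> \<iota> j = ZeroArr C (s (k j)) (s (k i))"
    using Pn unfolding P_def by blast
  have [simp]: "\<iota> i \<in> Arr C" "Dom C (\<iota> i) = s (k i)" "Cod C (\<iota> i) = X" "\<pi> i \<in> Arr C" "Dom C (\<pi> i) = X"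
    "Cod C (\<pi> i) = s (k i)" "\<pi> i \<star> \<iota> i = Idt C (s (k i))" "k i \<in> J" "s (k i) \<in> Obj C" if "i < n" for i
    using k s that by simp_all
  note [simp] = X
  \<comment> \<open>The idempotent onto the sum of the chosen summands; it fixes every chosen
    inclusion and projection.\<close>
  define h where "h = hsum X X (\<lambda>i. \<iota> i \<star> \<pi> i) {..<n}"
  have h [simp]: "h \<in> Arr C" "Dom C h = X" "Cod C h = X" unfolding h_def by (rule hsum_arr; simp)+
  have h\<iota>: "h \<star> \<iota> j = \<iota> j" if j: "j < n" for j
  proof -
    have "h \<star> \<iota> j = hsum (s (k j)) X (\<lambda>i. (\<iota> i \<star> \<pi> i) \<star> \<iota> j) {..<n}"
      unfolding h_def using comp_hsum_left[of "\<iota> j" X X "{..<n}" "\<lambda>i. \<iota> i \<star> \<pi> i"] j by simp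
    also have "\<dots> = (\<iota> j \<star> \<pi> j) \<star> \<iota> j"
      by (rule hsum_single) (use j orth in simp_all)
    finally show ?thesis using j by simp
  qed
  have \<pi>h: "\<pi> j \<star> h = \<pi> j" if j: "j < n" for j
  proof -
    have "\<pi> j \<star> h = hsum X (s (k j)) (\<lambda>i. \<pi> j \<star> \<iota> i \<star> \<pi> i) {..<n}"
      unfolding h_def using comp_hsum_right[of "\<pi> j" X X "{..<n}" "\<lambda>i. \<iota> i \<star> \<pi> i"] j by simp
    also have "\<dots> = \<pi> j \<star> \<iota> j \<star> \<pi> j"
    proof (rule hsum_single)
      fix i assume i: "i \<in> {..<n}" "i \<noteq> j"
      have "\<pi> j \<star> \<iota> i \<star> \<pi> i = (\<pi> j \<star> \<iota> i) \<star> \<pi> i" using i j by (intro comp_assoc[symmetric]) simp_all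
      also have "\<dots> = ZeroArr C X (s (k j))" using orth i j by (simp del: comp_assoc)
      finally show "\<pi> j \<star> \<iota> i \<star> \<pi> i = ZeroArr C X (s (k j))" .
    qed (use j in simp_all)
    also have "\<dots> = (\<pi> j \<star> \<iota> j) \<star> \<pi> j" using j by (intro comp_assoc[symmetric]) simp_all
    finally show ?thesis using j by (simp del: comp_assoc)
  qed
  have hh: "h \<star> h = h"
  proof -
    have "h \<star> h = hsum X X (\<lambda>i. h \<star> \<iota> i \<star> \<pi> i) {..<n}"
      using comp_hsum_right[of h X X "{..<n}" "\<lambda>i. \<iota> i \<star> \<pi> i"] by (simp add: h_def[symmetric])
    also have "\<dots> = hsum X X (\<lambda>i. \<iota> i \<star> \<pi> i) {..<n}"
    proof (rule hsum_cong)
      fix i assume i: "i \<in> {..<n}"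
      have "h \<star> \<iota> i \<star> \<pi> i = (h \<star> \<iota> i) \<star> \<pi> i" using i by (intro comp_assoc[symmetric]) simp_all
      then show "h \<star> \<iota> i \<star> \<pi> i = \<iota> i \<star> \<pi> i" using i h\<iota> by simp
    qed simp_all
    finally show ?thesis by (simp add: h_def)
  qed
  \<comment> \<open>The complementary idempotent 1 - h annihilates the chosen family on both sides.
    If it is nonzero, a summand split off from it extends the family.\<close>
  define e where "e = AddArr C (Idt C X) (ScaleArr C (-1) h)"
  have e [simp]: "e \<in> Arr C" "Dom C e = X" "Cod C e = X" by (simp_all add: e_def)
  have e\<iota>: "e \<star> \<iota> j = ZeroArr C (s (k j)) X" if "j < n" for j
    unfolding e_def using that h\<iota>[OF that] by (simp add: comp_add_left)
  have \<pi>e: "\<pi> j \<star> e = ZeroArr C X (s (k j))" if "j < n" for j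
    unfolding e_def using that \<pi>h[OF that] by (simp add: comp_add_right)
  have he: "h \<star> e = ZeroArr C X X"
    unfolding e_def using hh by (simp add: comp_add_right)
  have ee: "e \<star> e = e"
  proof -
    have "e \<star> e = AddArr C e (ScaleArr C (-1) (h \<star> e))"
      by (subst (1) e_def) (simp add: comp_add_left)
    then show ?thesis by (simp add: he)
  qed
  have "e = ZeroArr C X X"
  proof (rule ccontr)
    assume "e \<noteq> ZeroArr C X X"
    then obtain j f r where j: "j \<in> J" and f: "f \<in> Hom C (s j) X" and r: "r \<in> Hom C X (s j)"
      and rf: "r \<star> f = Idt C (s j)" and ef: "e \<star> f = f" and re: "r \<star> e = r"
      using split[of e] ee by auto
    \<comment> \<open>Because \<open>e\<close> fixes \<open>f\<close> and \<open>r\<close>, while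
      \<open>\<pi> i \<star> e\<close> and \<open>e \<star> \<iota> i\<close> vanish, the new
      summand is orthogonal to the old ones.\<close>
    have \<pi>f: "\<pi> i \<star> f = ZeroArr C (s j) (s (k i))" if "i < n" for i
    proof -
      have "\<pi> i \<star> f = (\<pi> i \<star> e) \<star> f" using that f ef by simp
      then show ?thesis using that f \<pi>e[OF that] j s by (simp del: comp_assoc)
    qed
    have r\<iota>: "r \<star> \<iota> i = ZeroArr C (s (k i)) (s j)" if "i < n" for i
    proof -
      have "r \<star> \<iota> i = (r \<star> e) \<star> \<iota> i" unfolding re ..
      also have "\<dots> = r \<star> e \<star> \<iota> i" using that r by simp
      finally show ?thesis using that r e\<iota>[OF that] by simp
    qed
    have "P (Suc n)"
      unfolding P_def
    proof (intro exI conjI allI impI)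
      let ?k = "k(n := j)" and ?i = "\<iota>(n := f)" and ?p = "\<pi>(n := r)"
      fix i assume "i < Suc n"
      then have i: "i < n \<or> i = n" by auto
      show "?k i \<in> J" "?i i \<in> Hom C (s (?k i)) X" "?p i \<in> Hom C X (s (?k i))" "?p i \<star> ?i i = Idt C (s (?k i))"
        using i j f r rf by auto
      fix l assume "l < Suc n" "i \<noteq> l"
      then show "?p i \<star> ?i l = ZeroArr C (s (?k l)) (s (?k i))"
        using i orth \<pi>f r\<iota> by (auto simp: less_Suc_eq)
    qed
    with nmax show False by blast
  qed
  then have "Idt C X = h" by - (rule eq_if_diff_zero, simp_all add: e_def)
  then have "is_direct_sum C {..<n} (\<lambda>i. s (k i)) X \<iota> \<pi>"
    using orth by (intro direct_sumI) (simp_all add: h_def)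
  then show ?thesis using k by blast
qed

end

section \<open>Bases of simple objects\<close>

text \<open>Semisimplicity in terms of representatives of the simple objects. Unlike \<^const>\<open>simple\<close>, the
  conditions do not refer to monomorphisms, so they can be verified in the equivariantization, which
  is not known to be abelian beforehand.\<close>

locale schur_basis = linear_category C for C :: "('o, 'm, 'z) linear_cat_scheme" (structure) +
  fixes J :: "'j set" and s :: "'j \<Rightarrow> 'o"
  assumes finite_J: "finite J"
    and s_Obj [simp]: "j \<in> J \<Longrightarrow> s j \<in> Obj C"
    and s_nonzero: "j \<in> J \<Longrightarrow> \<not> zero_object C (s j)"
    and s_scalar: "j \<in> J \<Longrightarrow> f \<in> Hom C (s j) (s j) \<Longrightarrow> \<exists>a. f = ScaleArr C a (Idt C (s j))"
    and s_orthogonal: "i \<in> J \<Longrightarrow> j \<in> J \<Longrightarrow> i \<noteq> j \<Longrightarrow> f \<in> Hom C (s i) (s j) \<Longrightarrow> f = ZeroArr C (s i) (s j)"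
    and decomposition: "X \<in> Obj C \<Longrightarrow> \<exists>(n::nat) k \<iota> \<pi>. (\<forall>i<n. k i \<in> J) \<and> is_direct_sum C {..<n} (\<lambda>i. s (k i)) X \<iota> \<pi>"
begin

lemma Idt_s_nonzero: "j \<in> J \<Longrightarrow> Idt C (s j) \<noteq> ZeroArr C (s j) (s j)"
  using s_nonzero by (simp add: zero_object_def)

lemma hom_s:
  assumes "i \<in> J" "j \<in> J"
  shows "hom_fin (s i) (s j)" "hom_dim C (s i) (s j) = (if i = j then 1 else 0)"
proof -
  have "hom_fin (s i) (s j) \<and> hom_dim C (s i) (s j) = (if i = j then 1 else 0)"
  proof (cases "i = j")
    case True
    show ?thesis
      using hom_dim_one[of "Idt C (s j)" "s j" "s j"] s_scalar[OF assms(2)] Idt_s_nonzero assms True by simp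
  next
    case False
    have "Hom C (s i) (s j) = {ZeroArr C (s i) (s j)}"
    proof
      show "Hom C (s i) (s j) \<subseteq> {ZeroArr C (s i) (s j)}"
        using s_orthogonal[OF assms False] by blast
    qed (use assms in simp)
    then show ?thesis using hom_dim_zero[of "s i" "s j"] assms False by simp
  qed
  then show "hom_fin (s i) (s j)" "hom_dim C (s i) (s j) = (if i = j then 1 else 0)" by auto
qed

lemma hom_fin_s:
  assumes X: "X \<in> Obj C" and j: "j \<in> J"
  shows "hom_fin (s j) X" "hom_fin X (s j)"
proof -
  obtain n :: nat and k \<iota> \<pi> where k': "\<forall>i<n. k i \<in> J"
    and ds: "is_direct_sum C {..<n} (\<lambda>i. s (k i)) X \<iota> \<pi>"
    using decomposition[OF X] by blast
  have k: "k i \<in> J" if "i < n" for i using k' that by blast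
  show "hom_fin (s j) X"
    using hom_dim_direct_sum(1)[OF ds s_Obj[OF j]] hom_s(1)[OF j k] by simp
  show "hom_fin X (s j)"
    using hom_dim_direct_sum'(1)[OF ds s_Obj[OF j]] hom_s(1)[OF k j] by simp
qed

lemma hom_fin:
  assumes X: "X \<in> Obj C" and Y: "Y \<in> Obj C"
  shows "hom_fin X Y"
proof -
  obtain n :: nat and k \<iota> \<pi> where k': "\<forall>i<n. k i \<in> J"
    and ds: "is_direct_sum C {..<n} (\<lambda>i. s (k i)) Y \<iota> \<pi>"
    using decomposition[OF Y] by blast
  have k: "k i \<in> J" if "i < n" for i using k' that by blast
  show ?thesis
    using hom_dim_direct_sum(1)[OF ds X] hom_fin_s(2)[OF X k] by simp
qed

lemma hom_dim_sum:
  assumes ds: "is_direct_sum C I F X \<iota> \<pi>" and Z: "Z \<in> Obj C"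
  shows "hom_dim C Z X = (\<Sum>i\<in>I. hom_dim C Z (F i))" "hom_dim C X Z = (\<Sum>i\<in>I. hom_dim C (F i) Z)"
  using hom_dim_direct_sum(2)[OF ds Z] hom_dim_direct_sum'(2)[OF ds Z] hom_fin[OF Z] hom_fin[OF _ Z]
    direct_sumD(3)[OF ds] by simp_all

lemma hom_dim_iso:
  assumes "isomorphic C X Y" "Z \<in> Obj C"
  shows "hom_dim C Z X = hom_dim C Z Y" "hom_dim C X Z = hom_dim C Y Z"
proof -
  obtain f where f: "iso_arr f" "Dom C f = X" "Cod C f = Y" using assms(1) by (rule isomorphicE)
  show "hom_dim C Z X = hom_dim C Z Y" "hom_dim C X Z = hom_dim C Y Z"
    using hom_dim_sum[OF direct_sum_single[OF f(1)] assms(2)] f(2,3) by simp_all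
qed

lemma hom_dim_multiplicity:
  assumes ds: "is_direct_sum C I (\<lambda>i. s (k i)) X \<iota> \<pi>" and k: "\<And>i. i \<in> I \<Longrightarrow> k i \<in> J" and j: "j \<in> J"
  shows "hom_dim C (s j) X = card {i \<in> I. k i = j}" "hom_dim C X (s j) = card {i \<in> I. k i = j}"
proof -
  note fin = direct_sumD(1)[OF ds]
  have "hom_dim C (s j) X = (\<Sum>i\<in>I. if k i = j then 1 else 0)"
    using hom_dim_sum(1)[OF ds s_Obj[OF j]] hom_s(2)[OF j k] by simp (rule sum.cong, auto)
  then show "hom_dim C (s j) X = card {i \<in> I. k i = j}"
    using fin by (simp add: sum.If_cases Int_def)
  have "hom_dim C X (s j) = (\<Sum>i\<in>I. if k i = j then 1 else 0)"
    using hom_dim_sum(2)[OF ds s_Obj[OF j]] hom_s(2)[OF k j] by simp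
  then show "hom_dim C X (s j) = card {i \<in> I. k i = j}"
    using fin by (simp add: sum.If_cases Int_def)
qed

text \<open>Both dimensions count how often \<open>s j\<close> occurs in a decomposition of
  \<open>X\<close>.\<close>

lemma hom_dim_sym:
  assumes X: "X \<in> Obj C" and j: "j \<in> J"
  shows "hom_dim C X (s j) = hom_dim C (s j) X"
proof -
  obtain n :: nat and k \<iota> \<pi> where k': "\<forall>i<n. k i \<in> J"
    and ds: "is_direct_sum C {..<n} (\<lambda>i. s (k i)) X \<iota> \<pi>"
    using decomposition[OF X] by blast
  have k: "k i \<in> J" if "i < n" for i using k' that by blast
  show ?thesis using hom_dim_multiplicity[OF ds _ j] k by simp
qed

text \<open>An arrow that vanishes on all summands of its source is zero, so a nonzero one is
  detected by some inclusion.\<close>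

lemma nonzero_component:
  assumes "f \<in> Arr C" "f \<noteq> ZeroArr C (Dom C f) (Cod C f)"
  obtains j g where "j \<in> J" "g \<in> Hom C (s j) (Dom C f)" "f \<star> g \<noteq> ZeroArr C (s j) (Cod C f)"
proof -
  obtain n :: nat and k \<iota> \<pi> where k': "\<forall>i<n. k i \<in> J"
    and ds: "is_direct_sum C {..<n} (\<lambda>i. s (k i)) (Dom C f) \<iota> \<pi>"
    using decomposition[OF Dom_Obj[OF assms(1)]] by blast
  have k: "k i \<in> J" if "i < n" for i using k' that by blast
  note d [simp] = direct_sumD[OF ds]
  have "\<exists>i<n. f \<star> \<iota> i \<noteq> ZeroArr C (s (k i)) (Cod C f)"
  proof (rule ccontr)
    assume "\<not> ?thesis"
    then have "f = ZeroArr C (Dom C f) (Cod C f)"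
      using assms by - (rule direct_sum_ext'[OF ds], simp_all)
    with assms(2) show False by simp
  qed
  then obtain i where "i < n" "f \<star> \<iota> i \<noteq> ZeroArr C (s (k i)) (Cod C f)" by blast
  then show thesis using that[of "k i" "\<iota> i"] k by simp
qed

lemma s_simple:
  assumes j: "j \<in> J"
  shows "simple C (s j)"
  unfolding simple_def
proof (intro conjI allI impI)
  show "s j \<in> Obj C" "\<not> zero_object C (s j)" using j s_nonzero by simp_all
  fix m assume m: "monic C m \<and> Cod C m = s j"
  then have mA [simp]: "m \<in> Arr C" by (simp add: monic_def)
  show "zero_object C (Dom C m) \<or> m \<in> Isos C (Dom C m) (s j)"
  proof (cases "zero_object C (Dom C m)")
    case False
    \<comment> \<open>A nonzero source of \<open>m\<close> receives a nonzero arrow g from some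
      \<open>s i\<close>. Then m g is nonzero, so i = j and m g is a nonzero scalar, and a multiple
      of g is a section of \<open>m\<close>.\<close>
    have "Idt C (Dom C m) \<in> Arr C" "Idt C (Dom C m) \<noteq> ZeroArr C (Dom C (Idt C (Dom C m))) (Cod C (Idt C (Dom C m)))"
      using False by (simp_all add: zero_object_def)
    then obtain i g where g: "i \<in> J" "g \<in> Hom C (s i) (Dom C (Idt C (Dom C m)))"
      "Idt C (Dom C m) \<star> g \<noteq> ZeroArr C (s i) (Cod C (Idt C (Dom C m)))"
      by (rule nonzero_component)
    then have g': "g \<in> Hom C (s i) (Dom C m)" "g \<noteq> ZeroArr C (s i) (Dom C m)" by simp_all
    have mg: "m \<star> g \<noteq> ZeroArr C (s i) (s j)"
      using monic_comp_nonzero[OF conjunct1[OF m] g'] m by simp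
    have mgH: "m \<star> g \<in> Hom C (s i) (s j)" using g' m by simp
    have ij: "i = j" using s_orthogonal[OF g(1) j _ mgH] mg by blast
    obtain a where a: "m \<star> g = ScaleArr C a (Idt C (s j))"
      using s_scalar[OF j] mgH ij by blast
    have "a \<noteq> 0" using a mg j ij by auto
    then have "m \<star> ScaleArr C (inverse a) g = Idt C (Cod C m)"
      using a g' m j by simp
    then have "iso_arr m"
      using m g' ij by (intro monic_split_epic_iso[of m "ScaleArr C (inverse a) g"]) simp_all
    then show ?thesis using m by simp
  qed simp
qed

text \<open>The inclusion of a summand is a split monomorphism, so simplicity of \<open>X\<close>
  turns it into an isomorphism.\<close>

lemma simple_iso_s:
  assumes X: "simple C X"
  obtains j where "j \<in> J" "isomorphic C X (s j)"
proof -
  have XO: "X \<in> Obj C" and Xz: "\<not> zero_object C X" using X by (simp_all add: simple_def)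
  obtain n :: nat and k \<iota> \<pi> where k': "\<forall>i<n. k i \<in> J"
    and ds: "is_direct_sum C {..<n} (\<lambda>i. s (k i)) X \<iota> \<pi>"
    using decomposition[OF XO] by blast
  have k: "k i \<in> J" if "i < n" for i using k' that by blast
  note d [simp] = direct_sumD[OF ds]
  have n: "0 < n" using direct_sum_nonempty[OF ds Xz] by auto
  have "monic C (\<iota> 0)" by (rule split_monic[of _ "\<pi> 0"]) (use n in simp_all)
  then have "\<iota> 0 \<in> Isos C (s (k 0)) X"
    using X n s_nonzero[OF k[OF n]] d(5,6)[of 0] unfolding simple_def by (metis lessThan_iff)
  then have "isomorphic C (s (k 0)) X" using isomorphicI[of "\<iota> 0"] by simp
  then show thesis using that k[OF n] isomorphic_sym by blast
qed

lemma s_iso_iff: "i \<in> J \<Longrightarrow> j \<in> J \<Longrightarrow> isomorphic C (s i) (s j) \<longleftrightarrow> i = j"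
  using hom_dim_iso(1)[of "s i" "s j" "s i"] hom_s(2)[of i i] hom_s(2)[of i j] by (auto split: if_splits)

lemma inj_on_iso_class: "inj_on (\<lambda>j. iso_class C (s j)) J"
  by (rule inj_onI) (simp add: iso_class_eq_iff s_iso_iff)

lemma simple_classes_eq: "simple_classes C = (\<lambda>j. iso_class C (s j)) ` J"
proof
  show "simple_classes C \<subseteq> (\<lambda>j. iso_class C (s j)) ` J"
  proof
    fix c assume "c \<in> simple_classes C"
    then obtain X where X: "simple C X" "c = iso_class C X" by (auto simp: simple_classes_def)
    obtain j where j: "j \<in> J" "isomorphic C X (s j)" using simple_iso_s[OF X(1)] .
    then have "c = iso_class C (s j)"
      using X iso_class_eq_iff[of X "s j"] isomorphic_Obj(1) by blast
    then show "c \<in> (\<lambda>j. iso_class C (s j)) ` J" using j by blast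
  qed
qed (auto simp: simple_classes_def intro: s_simple)

lemma cat_rank_eq: "cat_rank C = card J"
  unfolding cat_rank_def simple_classes_eq by (rule card_image[OF inj_on_iso_class])

text \<open>The dimensions are the multiplicities in a decomposition: they allow exactly one
  summand, of type \<open>j\<close>.\<close>

lemma isomorphic_s_if_hom_dim:
  assumes X: "X \<in> Obj C" and j: "j \<in> J"
    and d: "\<And>i. i \<in> J \<Longrightarrow> hom_dim C (s i) X = (if i = j then 1 else 0)"
  shows "isomorphic C X (s j)"
proof -
  obtain n :: nat and k \<iota> \<pi> where k': "\<forall>i<n. k i \<in> J"
    and ds: "is_direct_sum C {..<n} (\<lambda>i. s (k i)) X \<iota> \<pi>"
    using decomposition[OF X] by blast
  have k: "k i \<in> J" if "i < n" for i using k' that by blast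
  have c: "card {l \<in> {..<n}. k l = i} = (if i = j then 1 else 0)" if "i \<in> J" for i
    using hom_dim_multiplicity(1)[OF ds _ that] k d[OF that] by simp
  have kj: "k l = j" if "l < n" for l
  proof (rule ccontr)
    assume "k l \<noteq> j"
    then have "{m \<in> {..<n}. k m = k l} = {}" using c[OF k[OF that]] by simp
    then show False using that by blast
  qed
  then have "{l \<in> {..<n}. k l = j} = {..<n}" by auto
  then have n: "n = 1" using c[OF j] by simp
  have "is_direct_sum C {0} (\<lambda>i. s (k i)) X \<iota> \<pi>" using ds n by (simp add: lessThan_Suc)
  then have "iso_arr (\<iota> 0)" by (rule direct_sum_singleD)
  then have "isomorphic C (s j) X"
    using isomorphicI[of "\<iota> 0"] direct_sumD(5,6)[OF ds, of 0] n kj[of 0] by simp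
  then show ?thesis by (rule isomorphic_sym)
qed

text \<open>The additive function on the Grothendieck group that takes the values \<open>w\<close>
  on the chosen simple objects.\<close>

definition weight :: "('j \<Rightarrow> nat) \<Rightarrow> 'o \<Rightarrow> nat" where
  "weight w X = (\<Sum>j\<in>J. w j * hom_dim C (s j) X)"

lemma weight_s: "i \<in> J \<Longrightarrow> weight w (s i) = w i"
proof -
  assume i: "i \<in> J"
  have "weight w (s i) = (\<Sum>j\<in>J. if j = i then w j else 0)"
    unfolding weight_def using hom_s(2)[OF _ i] by (intro sum.cong) simp_all
  then show ?thesis using i finite_J by simp
qed

lemma weight_iso: "isomorphic C X Y \<Longrightarrow> weight w X = weight w Y"
  unfolding weight_def using hom_dim_iso(1)[of X Y] by (intro sum.cong) simp_all

lemma weight_direct_sum: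
  assumes ds: "is_direct_sum C I F X \<iota> \<pi>"
  shows "weight w X = (\<Sum>i\<in>I. weight w (F i))"
proof -
  have "weight w X = (\<Sum>j\<in>J. \<Sum>i\<in>I. w j * hom_dim C (s j) (F i))"
    unfolding weight_def using hom_dim_sum(1)[OF ds] by (intro sum.cong) (simp_all add: sum_distrib_left)
  then show ?thesis unfolding weight_def by (subst sum.swap) simp
qed

text \<open>Positive integral weights leave room for a single summand in an object of weight
  1.\<close>

lemma weight_eq_1E:
  assumes X: "X \<in> Obj C" and w: "\<And>j. j \<in> J \<Longrightarrow> 0 < w j" and X1: "weight w X = 1"
  obtains j where "j \<in> J" "w j = 1" "isomorphic C X (s j)"
proof -
  have "\<exists>j\<in>J. w j * hom_dim C (s j) X \<noteq> 0"
  proof (rule ccontr)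
    assume "\<not> ?thesis"
    then have "weight w X = 0" unfolding weight_def by (intro sum.neutral) blast
    with X1 show False by simp
  qed
  then obtain j where j: "j \<in> J" "w j * hom_dim C (s j) X \<noteq> 0" by blast
  have "weight w X = w j * hom_dim C (s j) X + (\<Sum>i\<in>J - {j}. w i * hom_dim C (s i) X)"
    unfolding weight_def by (rule sum.remove[OF finite_J j(1)])
  then have s: "w j * hom_dim C (s j) X = 1" "(\<Sum>i\<in>J - {j}. w i * hom_dim C (s i) X) = 0"
    using X1 j(2) by linarith+
  have "hom_dim C (s i) X = 0" if "i \<in> J" "i \<noteq> j" for i
  proof -
    have "w i * hom_dim C (s i) X = 0" using s(2) finite_J that by (subst (asm) sum_eq_0_iff) blast+
    then show ?thesis using w[OF that(1)] by simp
  qed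
  then have "isomorphic C X (s j)"
    using s(1) j by (intro isomorphic_s_if_hom_dim[OF X j(1)]) simp
  then show thesis using that j s(1) by simp
qed

end

text \<open>The weights of the simple objects form a positive left eigenvector of the multiplication matrix,
  so their eigenvalue bounds all other non-negative ones.\<close>

lemma FPdim_eq_weight:
  fixes C :: "('o, 'm, 'z) monoidal_cat_scheme" (structure) and W :: "'o \<Rightarrow> nat"
  assumes "schur_basis C J s" and J: "J \<noteq> {}"
    and W_pos: "\<And>j. j \<in> J \<Longrightarrow> 0 < W (s j)"
    and W_sum: "\<And>Y. Y \<in> Obj C \<Longrightarrow> W Y = (\<Sum>j\<in>J. W (s j) * hom_dim C (s j) Y)"
    and W_mult: "\<And>X Y. X \<in> Obj C \<Longrightarrow> Y \<in> Obj C \<Longrightarrow> X \<boxdot> Y \<in> Obj C \<and> W (X \<boxdot> Y) = W X * W Y"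
    and X: "X \<in> Obj C"
  shows "FPdim C X = W X"
proof -
  interpret schur_basis C J s by fact
  define n e where "n = cat_rank C" and "e = simple_enumeration C"
  \<comment> \<open>An enumeration of the simple classes has to be exhibited first; its existence
    transfers the enumeration property to the one chosen by
    \<open>simple_enumeration\<close>.\<close>
  have "finite (simple_classes C)" using finite_J by (simp add: simple_classes_eq)
  then obtain h where h: "bij_betw h {0..<n} (simple_classes C)"
    using ex_bij_betw_nat_finite[of "simple_classes C"] by (auto simp: n_def cat_rank_def)
  have "\<forall>i\<in>{0..<n}. \<exists>Y. simple C Y \<and> h i = iso_class C Y"
    using bij_betwE[OF h] by (auto simp: simple_classes_def)
  then obtain e0 where e0: "\<forall>i\<in>{0..<n}. simple C (e0 i) \<and> h i = iso_class C (e0 i)"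
    by (rule bchoice[THEN exE])
  have "bij_betw (\<lambda>i. iso_class C (e0 i)) {..<n} (simple_classes C)"
    using h e0 by (subst bij_betw_cong[of _ _ h]) (auto simp: lessThan_atLeast0)
  with e0 have "\<exists>e. (\<forall>i<n. simple C (e i)) \<and> bij_betw (\<lambda>i. iso_class C (e i)) {..<n} (simple_classes C)"
    by (intro exI[of _ e0]) auto
  from someI_ex[OF this] have e: "\<And>i. i < n \<Longrightarrow> simple C (e i)"
    "bij_betw (\<lambda>i. iso_class C (e i)) {..<n} (simple_classes C)"
    unfolding e_def simple_enumeration_def n_def by blast+
  \<comment> \<open>The map \<sigma> matches the chosen enumeration with the representatives
    \<open>s\<close>, so that sums of weights can be formed in either indexing.\<close>
  have "\<forall>i\<in>{..<n}. \<exists>j. j \<in> J \<and> isomorphic C (e i) (s j)"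
  proof
    fix i assume "i \<in> {..<n}"
    then show "\<exists>j. j \<in> J \<and> isomorphic C (e i) (s j)" using simple_iso_s[OF e(1), of i] by blast
  qed
  then obtain \<sigma> where \<sigma>: "\<forall>i\<in>{..<n}. \<sigma> i \<in> J \<and> isomorphic C (e i) (s (\<sigma> i))"
    by (rule bchoice[THEN exE])
  have eO: "e i \<in> Obj C" if "i < n" for i using e(1)[OF that] by (simp add: simple_def)
  have cls: "iso_class C (e i) = iso_class C (s (\<sigma> i))" if "i < n" for i
    using iso_class_eq_iff[OF eO[OF that]] \<sigma> that by blast
  have inj: "inj_on \<sigma> {..<n}"
  proof (rule inj_onI)
    fix i j assume "i \<in> {..<n}" "j \<in> {..<n}" "\<sigma> i = \<sigma> j"
    then show "i = j" using cls[of i] cls[of j] e(2) by (auto simp: bij_betw_def inj_on_def)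
  qed
  have "\<sigma> ` {..<n} = J"
    using \<sigma> inj finite_J by (intro card_subset_eq) (auto simp: card_image n_def cat_rank_eq)
  with inj have \<sigma>bij: "bij_betw \<sigma> {..<n} J" by (simp add: bij_betw_def)
  have W_iso: "W Y = W Z" if "isomorphic C Y Z" for Y Z
    using W_sum[OF isomorphic_Obj(1)[OF that]] W_sum[OF isomorphic_Obj(2)[OF that]]
      hom_dim_iso(1)[OF that] by simp
  have We: "W (e i) = W (s (\<sigma> i))" if "i < n" for i using W_iso \<sigma> that by blast
  have W_pos': "0 < W (e i)" if "i < n" for i using We[OF that] W_pos \<sigma> that by simp
  have W_sum': "W Y = (\<Sum>i<n. W (e i) * hom_dim C (e i) Y)" if Y: "Y \<in> Obj C" for Y
  proof -
    have "W Y = (\<Sum>i<n. W (s (\<sigma> i)) * hom_dim C (s (\<sigma> i)) Y)"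
      unfolding W_sum[OF Y] by (rule sum.reindex_bij_betw[OF \<sigma>bij, symmetric])
    also have "\<dots> = (\<Sum>i<n. W (e i) * hom_dim C (e i) Y)"
    proof (rule sum.cong[OF refl])
      fix i assume i: "i \<in> {..<n}"
      then have "hom_dim C (e i) Y = hom_dim C (s (\<sigma> i)) Y"
        using hom_dim_iso(2)[of "e i" "s (\<sigma> i)" Y] \<sigma> Y by blast
      then show "W (s (\<sigma> i)) * hom_dim C (s (\<sigma> i)) Y = W (e i) * hom_dim C (e i) Y"
        using We[of i] i by simp
    qed
    finally show ?thesis .
  qed
  define M where "M = left_mult_matrix C X e n"
  have M [simp]: "M \<in> carrier_mat n n" "dim_row M = n" "dim_col M = n"
    by (simp_all add: M_def left_mult_matrix_def)
  have Mij: "M $$ (i, j) = real (hom_dim C (e i) (X \<boxdot> e j))" if "i < n" "j < n" for i j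
    using that by (simp add: M_def left_mult_matrix_def)
  \<comment> \<open>Multiplicativity of \<open>W\<close>, read off from the j-th column: the vector
    of weights is a left eigenvector of \<open>M\<close> with eigenvalue \<open>W X\<close>.\<close>
  have key: "(\<Sum>i<n. real (W (e i)) * M $$ (i, j)) = real (W X) * real (W (e j))" if j: "j < n" for j
  proof -
    have "(\<Sum>i<n. real (W (e i)) * M $$ (i, j)) = (\<Sum>i<n. real (W (e i) * hom_dim C (e i) (X \<boxdot> e j)))"
      using j by (intro sum.cong) (simp_all add: Mij)
    also have "\<dots> = real (W (X \<boxdot> e j))"
      using W_sum'[of "X \<boxdot> e j"] W_mult[OF X eO[OF j]] by simp
    finally show ?thesis using W_mult[OF X eO[OF j]] by simp
  qed
  have n0: "0 < n" using J finite_J by (simp add: n_def cat_rank_eq card_gt_0_iff)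
  define d where "d = vec n (\<lambda>i. real (W (e i)))"
  \<comment> \<open>A left eigenvector of \<open>M\<close> is an eigenvector of the transpose, and
    the transpose has the same characteristic polynomial.\<close>
  have "eigenvector (transpose_mat M) d (real (W X))"
    unfolding eigenvector_def
  proof (intro conjI)
    show "d \<in> carrier_vec (dim_row (transpose_mat M))" by (simp add: d_def)
    show "d \<noteq> 0\<^sub>v (dim_row (transpose_mat M))"
      using n0 W_pos'[OF n0] by (auto simp: d_def vec_eq_iff)
    show "transpose_mat M *\<^sub>v d = real (W X) \<cdot>\<^sub>v d"
    proof (rule eq_vecI)
      fix j assume "j < dim_vec (real (W X) \<cdot>\<^sub>v d)"
      then have j: "j < n" by (simp add: d_def)
      have "(transpose_mat M *\<^sub>v d) $ j = (\<Sum>i<n. M $$ (i, j) * real (W (e i)))"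
        using j by (simp add: scalar_prod_def d_def lessThan_atLeast0)
      then show "(transpose_mat M *\<^sub>v d) $ j = (real (W X) \<cdot>\<^sub>v d) $ j"
        using key[OF j] j by (simp add: d_def mult.commute)
    qed (simp add: d_def)
  qed
  then have "eigenvalue (transpose_mat M) (real (W X))" unfolding eigenvalue_def by blast
  then have ev: "eigenvalue M (real (W X))"
    by (simp add: eigenvalue_root_char_poly[of _ n] char_poly_transpose_mat[of M n])
  have le: "r \<le> real (W X)" if r: "0 \<le> r" "eigenvalue M r" for r
  proof -
    obtain v where v: "v \<in> carrier_vec n" "v \<noteq> 0\<^sub>v n" "M *\<^sub>v v = r \<cdot>\<^sub>v v"
      using r(2) by (auto simp: eigenvalue_def eigenvector_def)
    \<comment> \<open>The weighted l1-norm of the eigenvector \<open>v\<close>, with the weights of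
      the simple objects. Entries of \<open>M\<close> are nonnegative, so absolute values may be
      taken inside \<open>M v\<close>; pairing with the weights then gives r S \<le> W(X) S.\<close>
    define S where "S = (\<Sum>j<n. real (W (e j)) * \<bar>v $ j\<bar>)"
    obtain j0 where j0: "j0 < n" "v $ j0 \<noteq> 0"
      using v(1,2) by (metis carrier_vecD eq_vecI index_zero_vec(1) index_zero_vec(2))
    have "0 < real (W (e j0)) * \<bar>v $ j0\<bar>" using j0 W_pos'[OF j0(1)] by simp
    also have "\<dots> \<le> S" unfolding S_def using j0(1) by (intro member_le_sum) auto
    finally have S: "0 < S" .
    have "r * \<bar>v $ i\<bar> \<le> (\<Sum>j<n. M $$ (i, j) * \<bar>v $ j\<bar>)" if i: "i < n" for i
    proof -
      have "r * v $ i = (M *\<^sub>v v) $ i" using v i by simp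
      also have "\<dots> = (\<Sum>j<n. M $$ (i, j) * v $ j)"
        using i v(1) by (simp add: scalar_prod_def lessThan_atLeast0)
      finally have "\<bar>r * v $ i\<bar> \<le> (\<Sum>j<n. \<bar>M $$ (i, j) * v $ j\<bar>)" by (simp add: sum_abs)
      also have "\<dots> = (\<Sum>j<n. M $$ (i, j) * \<bar>v $ j\<bar>)"
        using i by (intro sum.cong) (simp_all add: Mij abs_mult)
      finally show ?thesis using r(1) by (simp add: abs_mult)
    qed
    then have "(\<Sum>i<n. real (W (e i)) * (r * \<bar>v $ i\<bar>))
        \<le> (\<Sum>i<n. real (W (e i)) * (\<Sum>j<n. M $$ (i, j) * \<bar>v $ j\<bar>))"
      by (intro sum_mono mult_left_mono) auto
    also have "\<dots> = (\<Sum>j<n. (\<Sum>i<n. real (W (e i)) * M $$ (i, j)) * \<bar>v $ j\<bar>)"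
    proof -
      have "(\<Sum>i<n. real (W (e i)) * (\<Sum>j<n. M $$ (i, j) * \<bar>v $ j\<bar>))
          = (\<Sum>i<n. \<Sum>j<n. real (W (e i)) * M $$ (i, j) * \<bar>v $ j\<bar>)"
        by (simp add: sum_distrib_left mult.assoc)
      also have "\<dots> = (\<Sum>j<n. \<Sum>i<n. real (W (e i)) * M $$ (i, j) * \<bar>v $ j\<bar>)"
        by (rule sum.swap)
      finally show ?thesis by (simp add: sum_distrib_right)
    qed
    also have "\<dots> = real (W X) * S"
      unfolding S_def sum_distrib_left using key by (intro sum.cong) (simp_all add: mult.assoc)
    also have "(\<Sum>i<n. real (W (e i)) * (r * \<bar>v $ i\<bar>)) = r * S"
      unfolding S_def sum_distrib_left by (intro sum.cong) simp_all
    finally show ?thesis using S by simp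
  qed
  show ?thesis
    unfolding FPdim_def
  proof (rule Greatest_equality)
    show "0 \<le> real (W X) \<and> eigenvalue (left_mult_matrix C X (simple_enumeration C) (cat_rank C)) (real (W X))"
      using ev by (simp add: M_def e_def n_def)
    show "y \<le> real (W X)"
      if "0 \<le> y \<and> eigenvalue (left_mult_matrix C X (simple_enumeration C) (cat_rank C)) y" for y
      using le that by (simp add: M_def e_def n_def)
  qed
qed

section \<open>Fusion categories\<close>

context linear_category
begin

text \<open>Inserts an equation between composites into a longer right-nested composite, where its
  left side is no longer visible as a subterm.\<close>

lemma comp_eq_extend:
  assumes "a \<star> b = c" "a \<in> Arr C" "b \<in> Arr C" "Cod C b = Dom C a" "t \<in> Arr C" "Cod C t = Dom C b"
  shows "a \<star> b \<star> t = c \<star> t"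
  using comp_assoc[of t b a] assms by simp

lemma iso_zero_arr:
  assumes "iso_arr f" "f = ZeroArr C (Dom C f) (Cod C f)"
  shows "zero_object C (Dom C f)" "zero_object C (Cod C f)"
  using retract_of_zero[of f "Inv C f"] retract_of_zero[of "Inv C f" f] assms by simp_all

text \<open>The value at \<open>f\<close> of the polynomial with the given coefficients, constant
  term first. Coefficient lists are used because the endomorphisms of an object do not form a
  type.\<close>

fun horner :: "'m \<Rightarrow> complex list \<Rightarrow> 'm" where
  "horner f [] = ZeroArr C (Dom C f) (Dom C f)"
| "horner f (a # as) = AddArr C (ScaleArr C a (Idt C (Dom C f))) (f \<star> horner f as)"

lemma horner_arr:
  assumes "f \<in> Arr C" "Cod C f = Dom C f"
  shows "horner f as \<in> Arr C \<and> Dom C (horner f as) = Dom C f \<and> Cod C (horner f as) = Dom C f"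
  using assms by (induction as) simp_all

lemmas horner_arr' [simp] = horner_arr[THEN conjunct1] horner_arr[THEN conjunct2, THEN conjunct1]
  horner_arr[THEN conjunct2, THEN conjunct2]

fun endo_pow :: "'m \<Rightarrow> nat \<Rightarrow> 'm" where
  "endo_pow f 0 = Idt C (Dom C f)"
| "endo_pow f (Suc n) = f \<star> endo_pow f n"

lemma endo_pow_arr:
  assumes "f \<in> Arr C" "Cod C f = Dom C f"
  shows "endo_pow f n \<in> Arr C \<and> Dom C (endo_pow f n) = Dom C f \<and> Cod C (endo_pow f n) = Dom C f"
  using assms by (induction n) simp_all

lemmas endo_pow_arr' [simp] = endo_pow_arr[THEN conjunct1] endo_pow_arr[THEN conjunct2, THEN conjunct1]
  endo_pow_arr[THEN conjunct2, THEN conjunct2]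

text \<open>Links Horner evaluation to linear combinations of powers, the shape in which linear
  dependence of the powers is obtained.\<close>

lemma horner_eq_hsum:
  assumes f: "f \<in> Arr C" "Cod C f = Dom C f"
  shows "hsum (Dom C f) (Dom C f) (\<lambda>i. ScaleArr C (as ! i) (endo_pow f i)) {..<length as} = horner f as"
proof (induction as)
  case Nil
  then show ?case using f by simp
next
  case (Cons a as)
  let ?X = "Dom C f"
  have X: "?X \<in> Obj C" using f by simp
  have "hsum ?X ?X (\<lambda>i. ScaleArr C ((a # as) ! i) (endo_pow f i)) (insert 0 (Suc ` {..<length as}))
      = AddArr C (ScaleArr C a (Idt C ?X))
          (hsum ?X ?X (\<lambda>i. ScaleArr C ((a # as) ! i) (endo_pow f i)) (Suc ` {..<length as}))"
    using f X by (subst hsum_insert) simp_all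
  also have "hsum ?X ?X (\<lambda>i. ScaleArr C ((a # as) ! i) (endo_pow f i)) (Suc ` {..<length as})
      = hsum ?X ?X (\<lambda>i. f \<star> ScaleArr C (as ! i) (endo_pow f i)) {..<length as}"
    using f X by (subst hsum_reindex) simp_all
  also have "\<dots> = f \<star> hsum ?X ?X (\<lambda>i. ScaleArr C (as ! i) (endo_pow f i)) {..<length as}"
    using f X by (subst comp_hsum_right) simp_all
  also have "hsum ?X ?X (\<lambda>i. ScaleArr C (as ! i) (endo_pow f i)) {..<length as} = horner f as"
    by (rule Cons.IH)
  finally show ?case by (simp add: lessThan_Suc_eq_insert_0)
qed

text \<open>Division by the linear polynomial with root \<open>x\<close>: the quotient is
  \<open>bs\<close>, the remainder the value at \<open>x\<close>. The last conjunct says that zero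
  quotient and zero remainder force all coefficients to vanish, which keeps quotients nontrivial
  when the division is iterated.\<close>

lemma horner_divide:
  assumes f: "f \<in> Arr C" "Cod C f = Dom C f" and "as \<noteq> []"
  shows "\<exists>bs. Suc (length bs) = length as \<and>
    horner f as = AddArr C (AddArr C f (ScaleArr C (- x) (Idt C (Dom C f))) \<star> horner f bs)
      (ScaleArr C (poly (Poly as) x) (Idt C (Dom C f))) \<and>
    ((\<forall>b\<in>set bs. b = 0) \<and> poly (Poly as) x = 0 \<longrightarrow> (\<forall>a\<in>set as. a = 0))"
  using assms(3)
proof (induction as)
  case (Cons a as)
  let ?I = "Idt C (Dom C f)" and ?g = "AddArr C f (ScaleArr C (- x) (Idt C (Dom C f)))"
  have I [simp]: "Dom C f \<in> Obj C" using f by simp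
  show ?case
  proof (cases "as = []")
    case True
    then show ?thesis using f by (intro exI[of _ "[]"]) simp
  next
    case False
    then obtain bs where bs: "Suc (length bs) = length as"
      "horner f as = AddArr C (?g \<star> horner f bs) (ScaleArr C (poly (Poly as) x) ?I)"
      "(\<forall>b\<in>set bs. b = 0) \<and> poly (Poly as) x = 0 \<longrightarrow> (\<forall>a\<in>set as. a = 0)"
      using Cons.IH by blast
    \<comment> \<open>If as = (X - x) bs + v, then a + X as = (X - x) (v + X bs) + (a + x v), so the
      new quotient is \<open>?v # bs\<close>.\<close>
    let ?v = "poly (Poly as) x" and ?h = "horner f bs"
    have g: "?g \<in> Arr C" "Dom C ?g = Dom C f" "Cod C ?g = Dom C f" using f by simp_all
    have comm: "f \<star> ?g = ?g \<star> f"
      using f by (simp add: comp_add_left comp_add_right)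
    have comm': "f \<star> ?g \<star> ?h = ?g \<star> f \<star> ?h"
      using comp_eq_extend[OF comm] comp_assoc[of ?h f ?g] f g by simp
    have H1: "horner f (a # as) = AddArr C (ScaleArr C a ?I) (f \<star> AddArr C (?g \<star> ?h) (ScaleArr C ?v ?I))"
      by (simp only: horner.simps bs(2))
    have H2: "f \<star> AddArr C (?g \<star> ?h) (ScaleArr C ?v ?I) = AddArr C (?g \<star> f \<star> ?h) (ScaleArr C ?v f)"
      using f g comm' by (subst comp_add_right) simp_all
    have H3: "ScaleArr C ?v f = AddArr C (ScaleArr C ?v ?g) (ScaleArr C (x * ?v) ?I)"
    proof -
      have "AddArr C (ScaleArr C ?v ?g) (ScaleArr C (x * ?v) ?I)
          = AddArr C (AddArr C (ScaleArr C ?v f) (ScaleArr C (- (x * ?v)) ?I)) (ScaleArr C (x * ?v) ?I)"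
        using f by (subst scale_add_right) (simp_all add: mult.commute)
      also have "\<dots> = AddArr C (ScaleArr C ?v f) (AddArr C (ScaleArr C (- (x * ?v)) ?I) (ScaleArr C (x * ?v) ?I))"
        using f by (intro add_assoc) simp_all
      also have "AddArr C (ScaleArr C (- (x * ?v)) ?I) (ScaleArr C (x * ?v) ?I) = ScaleArr C 0 ?I"
        using scale_add_left[of ?I "- (x * ?v)" "x * ?v"] by simp
      also have "AddArr C (ScaleArr C ?v f) (ScaleArr C 0 ?I) = ScaleArr C ?v f" using f by simp
      finally show ?thesis by (rule sym)
    qed
    have H4: "AddArr C (ScaleArr C a ?I) (AddArr C (?g \<star> f \<star> ?h) (AddArr C (ScaleArr C ?v ?g) (ScaleArr C (x * ?v) ?I)))
        = AddArr C (AddArr C (?g \<star> f \<star> ?h) (ScaleArr C ?v ?g)) (AddArr C (ScaleArr C (x * ?v) ?I) (ScaleArr C a ?I))"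
    proof -
      have "AddArr C (ScaleArr C a ?I) (AddArr C (?g \<star> f \<star> ?h) (AddArr C (ScaleArr C ?v ?g) (ScaleArr C (x * ?v) ?I)))
        = AddArr C (AddArr C (?g \<star> f \<star> ?h) (AddArr C (ScaleArr C ?v ?g) (ScaleArr C (x * ?v) ?I))) (ScaleArr C a ?I)"
        using f g by (intro add_comm) simp_all
      then show ?thesis using f g by (simp add: add_assoc)
    qed
    have H5: "AddArr C (ScaleArr C (x * ?v) ?I) (ScaleArr C a ?I) = ScaleArr C (poly (Poly (a # as)) x) ?I"
      using scale_add_left[of ?I "x * ?v" a] by (simp add: add.commute)
    have H6: "AddArr C (?g \<star> f \<star> ?h) (ScaleArr C ?v ?g) = ?g \<star> horner f (?v # bs)"
    proof -
      have "?g \<star> horner f (?v # bs) = AddArr C (?g \<star> ScaleArr C ?v ?I) (?g \<star> f \<star> ?h)"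
        using f g by (simp only: horner.simps, subst comp_add_right) simp_all
      also have "?g \<star> ScaleArr C ?v ?I = ScaleArr C ?v ?g"
        using g by (subst comp_scale_right) simp_all
      finally show ?thesis using f g add_comm[of "ScaleArr C ?v ?g" "?g \<star> f \<star> ?h"] by simp
    qed
    have H7: "horner f (a # as) = AddArr C (ScaleArr C a ?I) (AddArr C (?g \<star> f \<star> ?h) (ScaleArr C ?v f))"
      by (simp only: H1 H2)
    have H: "horner f (a # as) = AddArr C (?g \<star> horner f (?v # bs)) (ScaleArr C (poly (Poly (a # as)) x) ?I)"
      unfolding H7 by (subst H3) (simp only: H4 H5 H6)
    have "(\<forall>b\<in>set (?v # bs). b = 0) \<and> poly (Poly (a # as)) x = 0 \<longrightarrow> (\<forall>b\<in>set (a # as). b = 0)"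
    proof (intro impI, elim conjE)
      assume z: "\<forall>b\<in>set (?v # bs). b = 0" and p: "poly (Poly (a # as)) x = 0"
      have v: "?v = 0" by (rule bspec[OF z]) simp
      have b: "\<forall>b\<in>set bs. b = 0"
      proof
        fix b assume "b \<in> set bs"
        then show "b = 0" by (intro bspec[OF z]) simp
      qed
      have "a + x * ?v = 0" using p by simp
      then have "a = 0" unfolding v by simp
      moreover have "\<forall>b\<in>set as. b = 0" using bs(3) v b by blast
      ultimately show "\<forall>b\<in>set (a # as). b = 0" by (metis set_ConsD)
    qed
    moreover have "Suc (length (?v # bs)) = length (a # as)" using bs(1) by simp
    ultimately show ?thesis using H by blast
  qed
qed simp

end

section \<open>Schur's lemma and splittings\<close>

context fusion_category
begin

lemma kernel_monic:
  assumes "is_kernel C k f"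
  shows "monic C k"
  unfolding monic_def
proof (intro conjI allI ballI impI)
  note k = assms[unfolded is_kernel_def]
  show "k \<in> Arr C" using k by blast
  fix Z g h assume gh: "g \<in> Hom C Z (Dom C k)" "h \<in> Hom C Z (Dom C k)" "k \<star> g = k \<star> h"
  have kA: "k \<in> Arr C" "f \<in> Arr C" "Cod C k = Dom C f" using k by blast+
  have Z: "Z \<in> Obj C" using gh by auto
  have "f \<star> k \<star> g = ZeroArr C (Dom C k) (Cod C f) \<star> g"
    using k gh kA by (intro comp_eq_extend) simp_all
  then have "f \<star> (k \<star> g) = ZeroArr C Z (Cod C f)" using gh kA by simp
  moreover have "k \<star> g \<in> Hom C Z (Dom C f)" using gh kA by simp
  ultimately have "\<exists>!u. u \<in> Hom C Z (Dom C k) \<and> k \<star> u = k \<star> g" using k by blast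
  then show "g = h" using gh by metis
qed

text \<open>The kernel of \<open>f\<close> is a proper subobject of a simple object and hence zero.
  Two arrows with the same composite differ by an arrow that factors through this kernel.\<close>

lemma simple_nonzero_monic:
  assumes S: "simple C (Dom C f)" and f: "f \<in> Arr C" "f \<noteq> ZeroArr C (Dom C f) (Cod C f)"
  shows "monic C f"
proof -
  obtain k where k: "is_kernel C k f" using kernels[OF f(1)] by blast
  note kd = k[unfolded is_kernel_def]
  have kA: "k \<in> Arr C" "Cod C k = Dom C f" "f \<star> k = ZeroArr C (Dom C k) (Cod C f)"
    using kd by blast+
  have "\<not> iso_arr k"
  proof
    assume ik: "iso_arr k"
    have "f \<star> k \<star> Inv C k = ZeroArr C (Dom C k) (Cod C f) \<star> Inv C k"
      using f kA ik by (intro comp_eq_extend) simp_all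
    then have "f = ZeroArr C (Dom C f) (Cod C f)" using f(1) kA ik by simp
    then show False using f(2) by blast
  qed
  then have z: "zero_object C (Dom C k)"
    using S kernel_monic[OF k] kA(2) unfolding simple_def by auto
  show ?thesis
    unfolding monic_def
  proof (intro conjI allI ballI impI)
    fix Z g h assume gh: "g \<in> Hom C Z (Dom C f)" "h \<in> Hom C Z (Dom C f)" "f \<star> g = f \<star> h"
    let ?d = "AddArr C g (ScaleArr C (- 1) h)"
    have Z: "Z \<in> Obj C" using gh by auto
    have "f \<star> ?d = AddArr C (f \<star> g) (ScaleArr C (-1) (f \<star> h))"
      using gh f by (subst comp_add_right) simp_all
    also have "\<dots> = ZeroArr C Z (Cod C f)" unfolding gh(3) using gh f by simp
    finally have "f \<star> ?d = ZeroArr C Z (Cod C f)" .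
    moreover have "?d \<in> Hom C Z (Dom C f)" using gh by simp
    ultimately obtain u where u: "u \<in> Hom C Z (Dom C k)" "k \<star> u = ?d" using kd by blast
    have "u = ZeroArr C Z (Dom C k)" using zero_object_arr(2)[OF z, of u] u by simp
    have "k \<star> u = ZeroArr C Z (Dom C f)" unfolding \<open>u = ZeroArr C Z (Dom C k)\<close> using kA Z by simp
    then have "?d = ZeroArr C Z (Dom C f)" unfolding u(2) .
    then show "g = h" using gh by - (rule eq_if_diff_zero, simp_all)
  qed (use f in simp)
qed

lemma simple_nonzero_iso:
  assumes "simple C (Dom C f)" "simple C (Cod C f)" "f \<in> Arr C" "f \<noteq> ZeroArr C (Dom C f) (Cod C f)"
  shows "iso_arr f"
proof -
  have "monic C f" using simple_nonzero_monic assms by blast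
  then show ?thesis using assms unfolding simple_def by auto
qed

lemma simple_Obj: "simple C X \<Longrightarrow> X \<in> Obj C" and simple_nonzero: "simple C X \<Longrightarrow> \<not> zero_object C X"
  by (simp_all add: simple_def)

lemma hom_simple_zero:
  assumes "simple C X" "simple C Y" "\<not> isomorphic C X Y" "f \<in> Hom C X Y"
  shows "f = ZeroArr C X Y"
  using simple_nonzero_iso[of f] isomorphicI[of f] assms by auto

text \<open>Over the complex numbers an annihilating polynomial has a root x, and f - x is zero or
  invertible because the object is simple. In the second case it can be cancelled, and a shorter
  nontrivial polynomial annihilates \<open>f\<close>.\<close>

lemma endo_scalar_if_horner_zero:
  assumes S: "simple C (Dom C f)" and f: "f \<in> Arr C" "Cod C f = Dom C f"
  shows "horner f as = ZeroArr C (Dom C f) (Dom C f) \<Longrightarrow> \<exists>a\<in>set as. a \<noteq> 0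
    \<Longrightarrow> \<exists>a. f = ScaleArr C a (Idt C (Dom C f))"
proof (induction "length as" arbitrary: as)
  case 0
  then show ?case by simp
next
  case (Suc n)
  let ?X = "Dom C f"
  have X [simp]: "?X \<in> Obj C" using f by simp
  have Xnz: "Idt C ?X \<noteq> ZeroArr C ?X ?X" using S by (simp add: simple_def zero_object_def)
  have as: "as \<noteq> []" using Suc by auto
  have div: "\<exists>bs. Suc (length bs) = length as \<and>
    horner f as = AddArr C (AddArr C f (ScaleArr C (- x) (Idt C ?X)) \<star> horner f bs)
      (ScaleArr C (poly (Poly as) x) (Idt C ?X)) \<and>
    ((\<forall>b\<in>set bs. b = 0) \<and> poly (Poly as) x = 0 \<longrightarrow> (\<forall>a\<in>set as. a = 0))" for x
    by (rule horner_divide[OF f as])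
  \<comment> \<open>A constant annihilating polynomial would make the identity of a simple object
    vanish. Coefficient lists may end in zeros, so constancy means that all coefficients after the
    first are zero.\<close>
  have "\<not> constant (poly (Poly as))"
  proof
    assume c: "constant (poly (Poly as))"
    then have "degree (Poly as) = 0" by (simp add: constant_degree)
    then obtain a where a: "Poly as = [:a:]" using degree_eq_zeroE by blast
    obtain a0 as' where as': "as = a0 # as'" using as by (cases as) auto
    have "Poly as' = 0" using a as' by simp
    then obtain m where "as' = replicate m 0" unfolding Poly_eq_0 by blast
    then have z: "\<forall>b\<in>set as'. b = 0" by simp
    have "horner f bs = ZeroArr C ?X ?X" if "\<forall>b\<in>set bs. b = 0" for bs
      using that f by (induction bs) simp_all
    then have "horner f as = ScaleArr C a0 (Idt C ?X)" using z as' f by simp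
    then have "ScaleArr C a0 (Idt C ?X) = ZeroArr C ?X ?X" using Suc(3) by simp
    then have "a0 = 0" using Xnz scale_eq_zero_iff[of "Idt C ?X" ?X ?X a0] by simp
    then show False using Suc(4) z as' by auto
  qed
  then obtain x where x: "poly (Poly as) x = 0" using fundamental_theorem_of_algebra by blast
  obtain bs where bs': "Suc (length bs) = length as" and bs:
    "horner f as = AddArr C (AddArr C f (ScaleArr C (- x) (Idt C ?X)) \<star> horner f bs)
      (ScaleArr C (poly (Poly as) x) (Idt C ?X))"
    "(\<forall>b\<in>set bs. b = 0) \<and> poly (Poly as) x = 0 \<longrightarrow> (\<forall>a\<in>set as. a = 0)"
    using div[of x] by blast
  have len: "length bs = n" using bs' Suc(2) by simp
  let ?g = "AddArr C f (ScaleArr C (- x) (Idt C ?X))"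
  have g: "?g \<in> Arr C" "Dom C ?g = ?X" "Cod C ?g = ?X" using f by simp_all
  have gz: "?g \<star> horner f bs = ZeroArr C ?X ?X"
    using bs(1) Suc(3) x f g by simp
  show ?case
  proof (cases "?g = ZeroArr C ?X ?X")
    case True
    have "f = ScaleArr C x (Idt C ?X)"
      using True f by - (rule eq_if_diff_zero, simp_all)
    then show ?thesis by blast
  next
    case False
    then have ig: "iso_arr ?g" using S g by (intro simple_nonzero_iso) simp_all
    have "horner f bs = Inv C ?g \<star> ?g \<star> horner f bs" using ig g f by simp
    also have "\<dots> = ZeroArr C ?X ?X" unfolding gz using ig g by simp
    finally have hz: "horner f bs = ZeroArr C ?X ?X" .
    have "\<exists>a\<in>set bs. a \<noteq> 0" using bs(2) x Suc(4) by blast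
    then show ?thesis using Suc(1)[OF len[symmetric] hz] by blast
  qed
qed

lemma simple_endo_scalar:
  assumes S: "simple C X" and f: "f \<in> Hom C X X"
  shows "\<exists>a. f = ScaleArr C a (Idt C X)"
proof -
  have X: "X \<in> Obj C" using S by (rule simple_Obj)
  have fA: "f \<in> Arr C" "Dom C f = X" "Cod C f = X" using f by simp_all
  have V: "vectorspace (class_ring :: complex ring) (hom_space C X X)" by (rule Hom_vectorspace[OF X X])
  have fd: "hom_fin X X" by (rule Hom_fin_dim[OF X X])
  \<comment> \<open>One more power than the dimension of the endomorphism space, so the powers are
    linearly dependent.\<close>
  define N where "N = Suc (vectorspace.dim (class_ring :: complex ring) (hom_space C X X))"
  have pw: "endo_pow f \<in> {..<N} \<rightarrow> carrier (hom_space C X X)" using fA by simp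
  have "\<not> (\<forall>a. hsum X X (\<lambda>i. ScaleArr C (a i) (endo_pow f i)) {..<N} = ZeroArr C X X \<longrightarrow> (\<forall>i\<in>{..<N}. a i = 0))"
  proof
    assume ind: "\<forall>a. hsum X X (\<lambda>i. ScaleArr C (a i) (endo_pow f i)) {..<N} = ZeroArr C X X \<longrightarrow> (\<forall>i\<in>{..<N}. a i = 0)"
    have ind': "\<forall>i\<in>{..<N}. a i = \<zero>\<^bsub>class_ring\<^esub>"
      if "hsum X X (\<lambda>i. a i \<odot>\<^bsub>hom_space C X X\<^esub> endo_pow f i) {..<N} = \<zero>\<^bsub>hom_space C X X\<^esub>" for a
      using ind that by simp
    note li = vectorspace.lin_indpt_indexed[OF V finite_lessThan pw ind']
    have "card (endo_pow f ` {..<N}) \<le> vectorspace.dim (class_ring :: complex ring) (hom_space C X X)"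
      using pw by (intro vectorspace.li_le_dim(2)[OF V fd _ li(2)]) auto
    then show False using card_image[OF li(1)] by (simp add: N_def)
  qed
  then obtain a i where a: "hsum X X (\<lambda>i. ScaleArr C (a i) (endo_pow f i)) {..<N} = ZeroArr C X X"
    "i < N" "a i \<noteq> 0" by blast
  define as where "as = map a [0..<N]"
  have "horner f as = hsum X X (\<lambda>i. ScaleArr C (as ! i) (endo_pow f i)) {..<N}"
    using horner_eq_hsum[of f as] fA by (simp add: as_def)
  also have "\<dots> = hsum X X (\<lambda>i. ScaleArr C (a i) (endo_pow f i)) {..<N}"
    using X fA by (intro hsum_cong) (simp_all add: as_def)
  finally have "horner f as = ZeroArr C (Dom C f) (Dom C f)" using a(1) fA by simp
  moreover have "\<exists>a\<in>set as. a \<noteq> 0" using a(2,3) by (auto simp: as_def)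
  ultimately show ?thesis using endo_scalar_if_horner_zero[of f as] S fA by simp
qed

text \<open>Some simple summand of the source is mapped isomorphically onto the target; the inverse
  followed by the inclusion of that summand is the section.\<close>

lemma simple_section:
  assumes S: "simple C (Cod C f)" and f: "f \<in> Arr C" "f \<noteq> ZeroArr C (Dom C f) (Cod C f)"
  obtains s where "s \<in> Hom C (Cod C f) (Dom C f)" "f \<star> s = Idt C (Cod C f)"
proof -
  obtain n F \<iota> \<pi> where F: "\<forall>i<n. simple C (F i)" and ds: "is_direct_sum C {..<n::nat} F (Dom C f) \<iota> \<pi>"
    using semisimple[of "Dom C f"] f by auto
  note d [simp] = direct_sumD[OF ds]
  have "\<exists>i<n. f \<star> \<iota> i \<noteq> ZeroArr C (F i) (Cod C f)"
  proof (rule ccontr)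
    assume "\<not> ?thesis"
    then have "f = ZeroArr C (Dom C f) (Cod C f)"
      using f by - (rule direct_sum_ext'[OF ds], simp_all)
    with f show False by blast
  qed
  then obtain i where i: "i < n" "f \<star> \<iota> i \<noteq> ZeroArr C (F i) (Cod C f)" by blast
  then have "iso_arr (f \<star> \<iota> i)" using F S f by (intro simple_nonzero_iso) simp_all
  then have "f \<star> \<iota> i \<star> Inv C (f \<star> \<iota> i) = Idt C (Cod C f)"
    using f i by (subst comp_assoc[symmetric]) (simp_all del: comp_assoc)
  then show thesis
    using that[of "\<iota> i \<star> Inv C (f \<star> \<iota> i)"] \<open>iso_arr (f \<star> \<iota> i)\<close> f i by simp
qed

lemma simple_retraction:
  assumes S: "simple C (Dom C f)" and f: "f \<in> Arr C" "f \<noteq> ZeroArr C (Dom C f) (Cod C f)"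
  obtains r where "r \<in> Hom C (Cod C f) (Dom C f)" "r \<star> f = Idt C (Dom C f)"
proof -
  obtain n F \<iota> \<pi> where F: "\<forall>i<n. simple C (F i)" and ds: "is_direct_sum C {..<n::nat} F (Cod C f) \<iota> \<pi>"
    using semisimple[of "Cod C f"] f by auto
  note d [simp] = direct_sumD[OF ds]
  have "\<exists>i<n. \<pi> i \<star> f \<noteq> ZeroArr C (Dom C f) (F i)"
  proof (rule ccontr)
    assume "\<not> ?thesis"
    then have "f = ZeroArr C (Dom C f) (Cod C f)"
      using f by - (rule direct_sum_ext[OF ds], simp_all)
    with f show False by blast
  qed
  then obtain i where i: "i < n" "\<pi> i \<star> f \<noteq> ZeroArr C (Dom C f) (F i)" by blast
  then have iso: "iso_arr (\<pi> i \<star> f)" using F S f by (intro simple_nonzero_iso) simp_all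
  then have "(Inv C (\<pi> i \<star> f) \<star> \<pi> i) \<star> f = Idt C (Dom C f)"
    using Inv_simps(4)[of "\<pi> i \<star> f"] f i by simp
  then show thesis
    using that[of "Inv C (\<pi> i \<star> f) \<star> \<pi> i"] iso f i by simp
qed

end

section \<open>Tensor products, duals and adjunction\<close>

context monoidal_linear_category
begin

declare TObj_Obj [simp] Unit_Obj [simp] TArr_Idt [simp]

lemma tarr [simp]:
  assumes "f \<in> Arr C" "g \<in> Arr C"
  shows "f \<boxtimes> g \<in> Arr C" "Dom C (f \<boxtimes> g) = Dom C f \<boxdot> Dom C g" "Cod C (f \<boxtimes> g) = Cod C f \<boxdot> Cod C g"
  using TArr_Hom[of f "Dom C f" "Cod C f" g "Dom C g" "Cod C g"] assms by simp_all

lemma tarr_comp: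
  "f \<in> Arr C \<Longrightarrow> g \<in> Arr C \<Longrightarrow> f' \<in> Arr C \<Longrightarrow> g' \<in> Arr C \<Longrightarrow> Cod C f = Dom C g \<Longrightarrow> Cod C f' = Dom C g'
    \<Longrightarrow> (g \<boxtimes> g') \<star> (f \<boxtimes> f') = (g \<star> f) \<boxtimes> (g' \<star> f')"
  using TArr_Comp[of f "Dom C f" "Cod C f" g "Cod C g" f' "Dom C f'" "Cod C f'" g' "Cod C g'"] by simp

lemma tarr_scale [simp]: "f \<in> Arr C \<Longrightarrow> g \<in> Arr C \<Longrightarrow> ScaleArr C a f \<boxtimes> g = ScaleArr C a (f \<boxtimes> g)"
  "f \<in> Arr C \<Longrightarrow> g \<in> Arr C \<Longrightarrow> f \<boxtimes> ScaleArr C a g = ScaleArr C a (f \<boxtimes> g)"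
  by (simp_all add: TArr_scale_left TArr_scale_right)

lemma tarr_zero [simp]:
  assumes "X \<in> Obj C" "Y \<in> Obj C" "g \<in> Arr C"
  shows "ZeroArr C X Y \<boxtimes> g = ZeroArr C (X \<boxdot> Dom C g) (Y \<boxdot> Cod C g)"
    "g \<boxtimes> ZeroArr C X Y = ZeroArr C (Dom C g \<boxdot> X) (Cod C g \<boxdot> Y)"
proof -
  have "ZeroArr C X Y \<boxtimes> g = ScaleArr C 0 (ZeroArr C X Y) \<boxtimes> g" using assms by (subst scale_zero_arr) simp_all
  also have "\<dots> = ScaleArr C 0 (ZeroArr C X Y \<boxtimes> g)" using assms by (intro tarr_scale) simp_all
  also have "\<dots> = ZeroArr C (X \<boxdot> Dom C g) (Y \<boxdot> Cod C g)" using assms by (subst scale_zero) simp_all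
  finally show "ZeroArr C X Y \<boxtimes> g = ZeroArr C (X \<boxdot> Dom C g) (Y \<boxdot> Cod C g)" .
  have "g \<boxtimes> ZeroArr C X Y = g \<boxtimes> ScaleArr C 0 (ZeroArr C X Y)" using assms by (subst scale_zero_arr) simp_all
  also have "\<dots> = ScaleArr C 0 (g \<boxtimes> ZeroArr C X Y)" using assms by (intro tarr_scale) simp_all
  also have "\<dots> = ZeroArr C (Dom C g \<boxdot> X) (Cod C g \<boxdot> Y)" using assms by (subst scale_zero) simp_all
  finally show "g \<boxtimes> ZeroArr C X Y = ZeroArr C (Dom C g \<boxdot> X) (Cod C g \<boxdot> Y)" .
qed

lemma linear_map_tarr_left:
  assumes "g \<in> Arr C" "X \<in> Obj C" "Y \<in> Obj C"
  shows "linear_map (class_ring :: complex ring) (hom_space C X Y) (hom_space C (X \<boxdot> Dom C g) (Y \<boxdot> Cod C g)) (\<lambda>f. f \<boxtimes> g)"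
  using assms TArr_add_left[of _ X Y _ g "Dom C g" "Cod C g"]
  by (intro linear_map_hom_spacesI Hom_vectorspace) simp_all

lemma linear_map_tarr_right:
  assumes "g \<in> Arr C" "X \<in> Obj C" "Y \<in> Obj C"
  shows "linear_map (class_ring :: complex ring) (hom_space C X Y) (hom_space C (Dom C g \<boxdot> X) (Cod C g \<boxdot> Y)) (\<lambda>f. g \<boxtimes> f)"
  using assms TArr_add_right[of g "Dom C g" "Cod C g" _ X Y]
  by (intro linear_map_hom_spacesI Hom_vectorspace) simp_all

lemma direct_sum_tensor_right:
  assumes ds: "is_direct_sum C I F X \<iota> \<pi>" and Y [simp]: "Y \<in> Obj C"
  shows "is_direct_sum C I (\<lambda>i. F i \<boxdot> Y) (X \<boxdot> Y) (\<lambda>i. \<iota> i \<boxtimes> Idt C Y) (\<lambda>i. \<pi> i \<boxtimes> Idt C Y)"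
proof (rule direct_sumI)
  note d [simp] = direct_sumD[OF ds]
  have "hsum (X \<boxdot> Y) (X \<boxdot> Y) (\<lambda>i. (\<iota> i \<boxtimes> Idt C Y) \<star> (\<pi> i \<boxtimes> Idt C Y)) I
      = hsum (X \<boxdot> Y) (X \<boxdot> Y) (\<lambda>i. (\<iota> i \<star> \<pi> i) \<boxtimes> Idt C Y) I"
    by (intro hsum_cong) (simp_all add: tarr_comp)
  also have "\<dots> = hsum X X (\<lambda>i. \<iota> i \<star> \<pi> i) I \<boxtimes> Idt C Y"
    using linear_map.map_finsum[OF linear_map_tarr_left[of "Idt C Y" X X], of "\<lambda>i. \<iota> i \<star> \<pi> i" I] by simp
  finally show "hsum (X \<boxdot> Y) (X \<boxdot> Y) (\<lambda>i. (\<iota> i \<boxtimes> Idt C Y) \<star> (\<pi> i \<boxtimes> Idt C Y)) I = Idt C (X \<boxdot> Y)" by simp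
qed (use direct_sumD[OF ds] in \<open>simp_all add: tarr_comp\<close>)

lemma direct_sum_tensor_left:
  assumes ds: "is_direct_sum C I F X \<iota> \<pi>" and Y [simp]: "Y \<in> Obj C"
  shows "is_direct_sum C I (\<lambda>i. Y \<boxdot> F i) (Y \<boxdot> X) (\<lambda>i. Idt C Y \<boxtimes> \<iota> i) (\<lambda>i. Idt C Y \<boxtimes> \<pi> i)"
proof (rule direct_sumI)
  note d [simp] = direct_sumD[OF ds]
  have "hsum (Y \<boxdot> X) (Y \<boxdot> X) (\<lambda>i. (Idt C Y \<boxtimes> \<iota> i) \<star> (Idt C Y \<boxtimes> \<pi> i)) I
      = hsum (Y \<boxdot> X) (Y \<boxdot> X) (\<lambda>i. Idt C Y \<boxtimes> (\<iota> i \<star> \<pi> i)) I"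
    by (intro hsum_cong) (simp_all add: tarr_comp)
  also have "\<dots> = Idt C Y \<boxtimes> hsum X X (\<lambda>i. \<iota> i \<star> \<pi> i) I"
    using linear_map.map_finsum[OF linear_map_tarr_right[of "Idt C Y" X X], of "\<lambda>i. \<iota> i \<star> \<pi> i" I] by simp
  finally show "hsum (Y \<boxdot> X) (Y \<boxdot> X) (\<lambda>i. (Idt C Y \<boxtimes> \<iota> i) \<star> (Idt C Y \<boxtimes> \<pi> i)) I = Idt C (Y \<boxdot> X)" by simp
qed (use direct_sumD[OF ds] in \<open>simp_all add: tarr_comp\<close>)

lemma iso_arr_tarr [simp]: "iso_arr f \<Longrightarrow> iso_arr g \<Longrightarrow> iso_arr (f \<boxtimes> g)"
  by (rule iso_arrI[of _ "Inv C f \<boxtimes> Inv C g"]) (simp_all add: tarr_comp)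

lemma Inv_tarr [simp]: "iso_arr f \<Longrightarrow> iso_arr g \<Longrightarrow> Inv C (f \<boxtimes> g) = Inv C f \<boxtimes> Inv C g"
  by (rule Inv_eqI, rule inverse_pairI) (simp_all add: tarr_comp)

lemma isomorphic_tensor:
  assumes "isomorphic C X X'" "isomorphic C Y Y'"
  shows "isomorphic C (X \<boxdot> Y) (X' \<boxdot> Y')"
proof -
  obtain f g where "iso_arr f" "Dom C f = X" "Cod C f = X'" "iso_arr g" "Dom C g = Y" "Cod C g = Y'"
    using assms by (elim isomorphicE) blast
  then show ?thesis using isomorphicI[of "f \<boxtimes> g"] by simp
qed

lemma assoc_arr [simp]:
  assumes "X \<in> Obj C" "Y \<in> Obj C" "Z \<in> Obj C"
  shows "iso_arr (Assoc C X Y Z)" "Assoc C X Y Z \<in> Arr C"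
    "Dom C (Assoc C X Y Z) = (X \<boxdot> Y) \<boxdot> Z" "Cod C (Assoc C X Y Z) = X \<boxdot> Y \<boxdot> Z"
  using Assoc_Isos[OF assms] by simp_all

lemma unit_arr [simp]:
  assumes "X \<in> Obj C"
  shows "iso_arr (LUnit C X)" "LUnit C X \<in> Arr C" "Dom C (LUnit C X) = Unit C \<boxdot> X" "Cod C (LUnit C X) = X"
    "iso_arr (RUnit C X)" "RUnit C X \<in> Arr C" "Dom C (RUnit C X) = X \<boxdot> Unit C" "Cod C (RUnit C X) = X"
  using LUnit_Isos[OF assms] RUnit_Isos[OF assms] by simp_all

lemma isomorphic_assoc: "X \<in> Obj C \<Longrightarrow> Y \<in> Obj C \<Longrightarrow> Z \<in> Obj C \<Longrightarrow> isomorphic C ((X \<boxdot> Y) \<boxdot> Z) (X \<boxdot> Y \<boxdot> Z)"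
  using isomorphicI[of "Assoc C X Y Z"] by simp

lemma isomorphic_unit_left: "X \<in> Obj C \<Longrightarrow> isomorphic C (Unit C \<boxdot> X) X"
  using isomorphicI[of "LUnit C X"] by simp

lemma isomorphic_unit_right: "X \<in> Obj C \<Longrightarrow> isomorphic C (X \<boxdot> Unit C) X"
  using isomorphicI[of "RUnit C X"] by simp

lemma zero_object_tensor:
  assumes "zero_object C X" "Y \<in> Obj C"
  shows "zero_object C (X \<boxdot> Y)" "zero_object C (Y \<boxdot> X)"
proof -
  have X: "X \<in> Obj C" "Idt C X = ZeroArr C X X" using assms by (simp_all add: zero_object_def)
  have "Idt C X \<boxtimes> Idt C Y = ZeroArr C (X \<boxdot> Y) (X \<boxdot> Y)" "Idt C Y \<boxtimes> Idt C X = ZeroArr C (Y \<boxdot> X) (Y \<boxdot> X)"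
    using X(1) assms(2) by (subst X(2), simp)+
  then show "zero_object C (X \<boxdot> Y)" "zero_object C (Y \<boxdot> X)"
    using X(1) assms(2) by (simp_all add: zero_object_def)
qed

text \<open>The adjunction map from Hom(A, B \<otimes> X') to Hom(A \<otimes> X, B) given by
  evaluation.\<close>

definition dual_transpose :: "'o \<Rightarrow> 'o \<Rightarrow> 'm \<Rightarrow> 'o \<Rightarrow> 'm \<Rightarrow> 'm" where
  "dual_transpose X X' ev B f = RUnit C B \<star> (Idt C B \<boxtimes> ev) \<star> Assoc C B X' X \<star> (f \<boxtimes> Idt C X)"

text \<open>Transposing back with the coevaluation recovers \<open>f\<close> up to unit and
  associativity isomorphisms. The adjunction map is therefore injective, which is how it compares
  multiplicities.\<close>

lemma dual_transpose_back:
  assumes dual: "left_dual C X X' ev coev" and B [simp]: "B \<in> Obj C"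
    and f: "f \<in> Arr C" "Cod C f = B \<boxdot> X'"
  shows "(dual_transpose X X' ev B f \<boxtimes> Idt C X') \<star> Inv C (Assoc C (Dom C f) X X') \<star> (Idt C (Dom C f) \<boxtimes> coev)
    = ((Idt C B \<boxtimes> RUnit C X') \<star> Assoc C B X' (Unit C)) \<star> (f \<boxtimes> Idt C (Unit C))"
proof -
  let ?A = "Dom C f" and ?U = "Unit C"
  note dd = dual[unfolded left_dual_def]
  have XO [simp]: "X \<in> Obj C" "X' \<in> Obj C" and ev: "ev \<in> Arr C" "Dom C ev = X' \<boxdot> X" "Cod C ev = ?U"
    and co: "coev \<in> Arr C" "Dom C coev = ?U" "Cod C coev = X \<boxdot> X'"
    using dd by simp_all
  note [simp] = ev co f
  have AO [simp]: "?A \<in> Obj C" by simp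
  have zig: "LUnit C X' \<star> (ev \<boxtimes> Idt C X') \<star> Inv C (Assoc C X' X X') \<star> (Idt C X' \<boxtimes> coev) = RUnit C X'"
    using dd by simp
  \<comment> \<open>The facts \<open>nat1\<close>, \<open>nat2\<close> and \<open>nat3\<close> move
    arrows past associators by naturality; \<open>pent\<close> is the pentagon, solved for the
    associators that meet in the middle of the long composite.\<close>
  have nat1: "((f \<boxtimes> Idt C X) \<boxtimes> Idt C X') \<star> Inv C (Assoc C ?A X X') = Inv C (Assoc C (B \<boxdot> X') X X') \<star> (f \<boxtimes> Idt C (X \<boxdot> X'))"
  proof -
    let ?a = "Assoc C (B \<boxdot> X') X X'" and ?a' = "Assoc C ?A X X'"
    have "?a \<star> ((f \<boxtimes> Idt C X) \<boxtimes> Idt C X') = (f \<boxtimes> Idt C (X \<boxdot> X')) \<star> ?a'"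
      using Assoc_natural[of f ?A "B \<boxdot> X'" "Idt C X" X X "Idt C X'" X' X'] by simp
    then have "Inv C ?a \<star> (?a \<star> ((f \<boxtimes> Idt C X) \<boxtimes> Idt C X')) \<star> Inv C ?a'
        = Inv C ?a \<star> ((f \<boxtimes> Idt C (X \<boxdot> X')) \<star> ?a') \<star> Inv C ?a'" by simp
    then show ?thesis by simp
  qed
  have pent: "(Assoc C B X' X \<boxtimes> Idt C X') \<star> Inv C (Assoc C (B \<boxdot> X') X X')
      = Inv C (Assoc C B (X' \<boxdot> X) X') \<star> (Idt C B \<boxtimes> Inv C (Assoc C X' X X')) \<star> Assoc C B X' (X \<boxdot> X')"
  proof -
    let ?a = "Assoc C (B \<boxdot> X') X X'" and ?b = "Assoc C B X' X \<boxtimes> Idt C X'"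
      and ?c = "Assoc C B (X' \<boxdot> X) X'" and ?d = "Idt C B \<boxtimes> Assoc C X' X X'" and ?e = "Assoc C B X' (X \<boxdot> X')"
    have "?d \<star> ?c \<star> ?b = ?e \<star> ?a" using pentagon[of B X' X X'] by simp
    then have "Inv C ?c \<star> Inv C ?d \<star> (?d \<star> ?c \<star> ?b) \<star> Inv C ?a = Inv C ?c \<star> Inv C ?d \<star> (?e \<star> ?a) \<star> Inv C ?a" by simp
    then have "?b \<star> Inv C ?a = Inv C ?c \<star> Inv C ?d \<star> ?e" by (simp del: Inv_tarr)
    then show ?thesis by simp
  qed
  have nat2: "Assoc C B X' (X \<boxdot> X') \<star> (Idt C (B \<boxdot> X') \<boxtimes> coev) = (Idt C B \<boxtimes> Idt C X' \<boxtimes> coev) \<star> Assoc C B X' ?U"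
    using Assoc_natural[of "Idt C B" B B "Idt C X'" X' X' coev ?U "X \<boxdot> X'"] by simp
  have nat3: "((Idt C B \<boxtimes> ev) \<boxtimes> Idt C X') \<star> Inv C (Assoc C B (X' \<boxdot> X) X') = Inv C (Assoc C B ?U X') \<star> (Idt C B \<boxtimes> ev \<boxtimes> Idt C X')"
  proof -
    let ?a = "Assoc C B ?U X'" and ?a' = "Assoc C B (X' \<boxdot> X) X'"
    have "?a \<star> ((Idt C B \<boxtimes> ev) \<boxtimes> Idt C X') = (Idt C B \<boxtimes> ev \<boxtimes> Idt C X') \<star> ?a'"
      using Assoc_natural[of "Idt C B" B B ev "X' \<boxdot> X" ?U "Idt C X'" X' X'] by simp
    then have "Inv C ?a \<star> (?a \<star> ((Idt C B \<boxtimes> ev) \<boxtimes> Idt C X')) \<star> Inv C ?a'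
        = Inv C ?a \<star> ((Idt C B \<boxtimes> ev \<boxtimes> Idt C X') \<star> ?a') \<star> Inv C ?a'" by simp
    then show ?thesis by simp
  qed
  have tri: "(RUnit C B \<boxtimes> Idt C X') \<star> Inv C (Assoc C B ?U X') = Idt C B \<boxtimes> LUnit C X'"
    using triangle[of B X', symmetric] by simp
  have split: "dual_transpose X X' ev B f \<boxtimes> Idt C X'
      = (RUnit C B \<boxtimes> Idt C X') \<star> ((Idt C B \<boxtimes> ev) \<boxtimes> Idt C X') \<star> (Assoc C B X' X \<boxtimes> Idt C X') \<star> ((f \<boxtimes> Idt C X) \<boxtimes> Idt C X')"
    unfolding dual_transpose_def by (simp add: tarr_comp)
  have fco: "(f \<boxtimes> Idt C (X \<boxdot> X')) \<star> (Idt C ?A \<boxtimes> coev) = (Idt C (B \<boxdot> X') \<boxtimes> coev) \<star> (f \<boxtimes> Idt C ?U)"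
    by (simp add: tarr_comp)
  let ?R = "RUnit C B \<boxtimes> Idt C X'" and ?E = "(Idt C B \<boxtimes> ev) \<boxtimes> Idt C X'" and ?S = "Assoc C B X' X \<boxtimes> Idt C X'"
    and ?F = "(f \<boxtimes> Idt C X) \<boxtimes> Idt C X'" and ?V = "Inv C (Assoc C ?A X X')" and ?K = "Idt C ?A \<boxtimes> coev"
    and ?W = "Inv C (Assoc C (B \<boxdot> X') X X')" and ?G = "Idt C (B \<boxdot> X') \<boxtimes> coev" and ?f1 = "f \<boxtimes> Idt C ?U"
    and ?P = "Inv C (Assoc C B (X' \<boxdot> X) X')" and ?Q = "Idt C B \<boxtimes> Inv C (Assoc C X' X X')"
    and ?H = "Assoc C B X' (X \<boxdot> X')" and ?L = "Assoc C B X' ?U" and ?M = "Idt C B \<boxtimes> Idt C X' \<boxtimes> coev"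
    and ?N = "Idt C B \<boxtimes> ev \<boxtimes> Idt C X'" and ?T = "Inv C (Assoc C B ?U X')" and ?Z = "Idt C B \<boxtimes> LUnit C X'"
  have "(?R \<star> ?E \<star> ?S \<star> ?F) \<star> ?V \<star> ?K = ?R \<star> ?E \<star> ?S \<star> (?F \<star> ?V) \<star> ?K" by simp
  also have "\<dots> = ?R \<star> ?E \<star> ?S \<star> ?W \<star> (f \<boxtimes> Idt C (X \<boxdot> X')) \<star> ?K" unfolding nat1 by (simp del: TArr_Idt)
  also have "\<dots> = ?R \<star> ?E \<star> (?S \<star> ?W) \<star> ?G \<star> ?f1" unfolding fco by (simp del: TArr_Idt)
  also have "\<dots> = ?R \<star> (?E \<star> ?P) \<star> ?Q \<star> (?H \<star> ?G) \<star> ?f1" unfolding pent by (simp del: TArr_Idt)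
  also have "\<dots> = (?R \<star> ?T) \<star> ?N \<star> ?Q \<star> ?M \<star> ?L \<star> ?f1" unfolding nat2 nat3 by (simp del: TArr_Idt)
  also have "\<dots> = (?Z \<star> ?N \<star> ?Q \<star> ?M) \<star> ?L \<star> ?f1" unfolding tri by (simp del: TArr_Idt)
  \<comment> \<open>The left part of the composite is now \<open>B\<close> tensored with the duality
    equation for \<open>X'\<close>.\<close>
  also have "?Z \<star> ?N \<star> ?Q \<star> ?M = Idt C B \<boxtimes> RUnit C X'"
    unfolding zig[symmetric] by (simp add: tarr_comp)
  finally show ?thesis unfolding split by simp
qed

lemma dual_transpose_linear:
  assumes dual: "left_dual C X X' ev coev" and [simp]: "A \<in> Obj C" "B \<in> Obj C"
  shows "linear_map (class_ring :: complex ring) (hom_space C A (B \<boxdot> X')) (hom_space C (A \<boxdot> X) B) (dual_transpose X X' ev B)"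
proof -
  have [simp]: "X \<in> Obj C" "X' \<in> Obj C" "ev \<in> Arr C" "Dom C ev = X' \<boxdot> X" "Cod C ev = Unit C"
    using dual by (simp_all add: left_dual_def)
  have add: "AddArr C f g \<boxtimes> Idt C X = AddArr C (f \<boxtimes> Idt C X) (g \<boxtimes> Idt C X)"
    if "f \<in> Hom C A (B \<boxdot> X')" "g \<in> Hom C A (B \<boxdot> X')" for f g
    using TArr_add_left[OF that, of "Idt C X" X X] by simp
  show ?thesis
    unfolding dual_transpose_def
    by (intro linear_map_hom_spacesI Hom_vectorspace) (simp_all add: add comp_add_right)
qed

lemma dual_transpose_inj:
  assumes dual: "left_dual C X X' ev coev" and [simp]: "A \<in> Obj C" "B \<in> Obj C"
  shows "inj_on (dual_transpose X X' ev B) (Hom C A (B \<boxdot> X'))"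
proof (rule inj_onI)
  fix f g assume fg: "f \<in> Hom C A (B \<boxdot> X')" "g \<in> Hom C A (B \<boxdot> X')"
    and eq: "dual_transpose X X' ev B f = dual_transpose X X' ev B g"
  have X': "X' \<in> Obj C" using dual by (simp add: left_dual_def)
  let ?t = "(Idt C B \<boxtimes> RUnit C X') \<star> Assoc C B X' (Unit C)"
  have "?t \<star> (f \<boxtimes> Idt C (Unit C)) = ?t \<star> (g \<boxtimes> Idt C (Unit C))"
    using dual_transpose_back[OF dual assms(3), of f] dual_transpose_back[OF dual assms(3), of g] fg eq by simp
  then have "f \<boxtimes> Idt C (Unit C) = g \<boxtimes> Idt C (Unit C)"
    using fg X' by (subst (asm) iso_cancel_left) simp_all
  then have "f \<star> RUnit C A = g \<star> RUnit C A"
    using RUnit_natural[of f A "B \<boxdot> X'"] RUnit_natural[of g A "B \<boxdot> X'"] fg by simp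
  then show "f = g" using fg by (subst (asm) iso_cancel_right) simp_all
qed

lemma dual_transpose_nonzero:
  assumes dual: "left_dual C X X' ev coev" and f: "f \<in> Hom C A (B \<boxdot> X')" "f \<noteq> ZeroArr C A (B \<boxdot> X')"
    and B [simp]: "B \<in> Obj C"
  obtains g where "g \<in> Hom C (A \<boxdot> X) B" "g \<noteq> ZeroArr C (A \<boxdot> X) B"
proof -
  have A [simp]: "A \<in> Obj C" using f by auto
  have X' [simp]: "X' \<in> Obj C" using dual by (simp add: left_dual_def)
  note T = dual_transpose_linear[OF dual A B]
  have "dual_transpose X X' ev B (ZeroArr C A (B \<boxdot> X')) = ZeroArr C (A \<boxdot> X) B"
    using linear_map.T0_is_0[OF T] by simp
  then have "dual_transpose X X' ev B f \<noteq> ZeroArr C (A \<boxdot> X) B"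
    using inj_onD[OF dual_transpose_inj[OF dual A B], of f "ZeroArr C A (B \<boxdot> X')"] f by auto
  moreover have "dual_transpose X X' ev B f \<in> Hom C (A \<boxdot> X) B"
    using linear_map.T_im[OF T, of f] f by simp
  ultimately show thesis using that by blast
qed

text \<open>If evaluation or coevaluation vanished, a duality equation would make a unit isomorphism
  zero and with it the object.\<close>

lemma evaluation_nonzero:
  assumes dual: "left_dual C X X' ev coev"
  shows "\<not> zero_object C X' \<Longrightarrow> ev \<noteq> ZeroArr C (X' \<boxdot> X) (Unit C)"
    "\<not> zero_object C X \<Longrightarrow> coev \<noteq> ZeroArr C (Unit C) (X \<boxdot> X')"
proof -
  note d = dual[unfolded left_dual_def]
  have [simp]: "X \<in> Obj C" "X' \<in> Obj C" "ev \<in> Arr C" "Dom C ev = X' \<boxdot> X" "Cod C ev = Unit C"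
    "coev \<in> Arr C" "Dom C coev = Unit C" "Cod C coev = X \<boxdot> X'"
    using dual by (simp_all add: left_dual_def)
  show "ev \<noteq> ZeroArr C (X' \<boxdot> X) (Unit C)" if "\<not> zero_object C X'"
  proof
    assume z: "ev = ZeroArr C (X' \<boxdot> X) (Unit C)"
    have "RUnit C X' = LUnit C X' \<star> (ev \<boxtimes> Idt C X') \<star> Inv C (Assoc C X' X X') \<star> (Idt C X' \<boxtimes> coev)"
      using d by simp
    also have "\<dots> = ZeroArr C (X' \<boxdot> Unit C) X'" unfolding z by simp
    finally have eq: "RUnit C X' = ZeroArr C (X' \<boxdot> Unit C) X'" .
    have iso: "iso_arr (RUnit C X')" and DC: "Dom C (RUnit C X') = X' \<boxdot> Unit C" "Cod C (RUnit C X') = X'" by simp_all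
    show False using iso_zero_arr(2)[OF iso, unfolded DC, OF eq] that by blast
  qed
  show "coev \<noteq> ZeroArr C (Unit C) (X \<boxdot> X')" if "\<not> zero_object C X"
  proof
    assume z: "coev = ZeroArr C (Unit C) (X \<boxdot> X')"
    have "LUnit C X = RUnit C X \<star> (Idt C X \<boxtimes> ev) \<star> Assoc C X X' X \<star> (coev \<boxtimes> Idt C X)"
      using d by simp
    also have "\<dots> = ZeroArr C (Unit C \<boxdot> X) X" unfolding z by simp
    finally have eq: "LUnit C X = ZeroArr C (Unit C \<boxdot> X) X" .
    have iso: "iso_arr (LUnit C X)" and DC: "Dom C (LUnit C X) = Unit C \<boxdot> X" "Cod C (LUnit C X) = X" by simp_all
    show False using iso_zero_arr(2)[OF iso, unfolded DC, OF eq] that by blast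
  qed
qed

end

context fusion_category
begin

text \<open>Evaluation has a section, so the unit is a retract of X \<otimes> Z for a suitable dual
  Z. Hence Y is, up to isomorphism, a retract of (Y \<otimes> X) \<otimes> Z, which vanishes
  together with Y \<otimes> X.\<close>

lemma tensor_nonzero:
  assumes X: "X \<in> Obj C" "\<not> zero_object C X" and Y: "Y \<in> Obj C" "\<not> zero_object C Y"
  shows "\<not> zero_object C (Y \<boxdot> X)"
proof
  assume z: "zero_object C (Y \<boxdot> X)"
  obtain Z ev coev where dual: "left_dual C Z X ev coev" using right_duals[OF X(1)] by blast
  have [simp]: "Z \<in> Obj C" "ev \<in> Arr C" "Dom C ev = X \<boxdot> Z" "Cod C ev = Unit C"
    using dual by (simp_all add: left_dual_def)
  note [simp] = X(1) Y(1)
  obtain s where s: "s \<in> Hom C (Unit C) (X \<boxdot> Z)" "ev \<star> s = Idt C (Unit C)"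
    using simple_section[of ev] simple_Unit evaluation_nonzero(1)[OF dual X(2)] by auto
  have "zero_object C ((Y \<boxdot> X) \<boxdot> Z)" by (rule zero_object_tensor(1)[OF z]) simp
  then have "zero_object C (Y \<boxdot> X \<boxdot> Z)"
    using zero_object_iso[OF isomorphic_assoc[of Y X Z]] by simp
  then have "zero_object C (Dom C (Idt C Y \<boxtimes> s))"
    using s by (intro retract_of_zero[of "Idt C Y \<boxtimes> s" "Idt C Y \<boxtimes> ev"]) (simp_all add: tarr_comp)
  then have "zero_object C (Y \<boxdot> Unit C)" using s by simp
  then show False using zero_object_iso[OF isomorphic_unit_right[of Y]] Y by simp
qed

end

section \<open>Graded and crossed categories\<close>

lemma (in linear_category) hom_dim_pos:
  assumes "f \<in> Hom C X Y" "f \<noteq> ZeroArr C X Y" "hom_fin X Y"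
  shows "0 < hom_dim C X Y"
proof -
  have XY: "X \<in> Obj C" "Y \<in> Obj C" using assms(1) by auto
  note V = Hom_vectorspace[OF XY]
  have b: "(\<lambda>_. f) \<in> {()} \<rightarrow> carrier (hom_space C X Y)" using assms(1) by simp
  have li: "\<forall>i\<in>{()}. a i = \<zero>\<^bsub>class_ring\<^esub>"
    if "hsum X Y (\<lambda>i. a i \<odot>\<^bsub>hom_space C X Y\<^esub> f) {()} = \<zero>\<^bsub>hom_space C X Y\<^esub>" for a
  proof -
    have "hsum X Y (\<lambda>i. a i \<odot>\<^bsub>hom_space C X Y\<^esub> f) {()} = ScaleArr C (a ()) f"
      using assms(1) XY by (subst hsum_single[of _ _ _ "()"]) simp_all
    then show ?thesis using that assms(1,2) by (simp add: scale_eq_zero_iff)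
  qed
  have "lin_indpt_img": "LinearCombinations.module.lin_indpt (class_ring :: complex ring) (hom_space C X Y) {f}"
    using vectorspace.lin_indpt_indexed(2)[OF V _ b li] by simp
  have "card {f} \<le> vectorspace.dim (class_ring :: complex ring) (hom_space C X Y)"
    using assms(1) by (intro vectorspace.li_le_dim(2)[OF V assms(3) _ lin_indpt_img]) simp
  then show ?thesis by (simp add: hom_dim_def)
qed

text \<open>Additivity is asked for along decompositions of \<open>X\<close>, so the rule applies to
  functions such as the multiplicity of Z in X \<otimes> Y for fixed Y and Z.\<close>

lemma (in schur_basis) additive_expand:
  fixes \<phi> :: "'o \<Rightarrow> nat"
  assumes X: "X \<in> Obj C"
    and \<phi>: "\<And>n k \<iota> \<pi>. is_direct_sum C {..<n::nat} (\<lambda>i. s (k i)) X \<iota> \<pi> \<Longrightarrow> \<phi> X = (\<Sum>i<n. \<phi> (s (k i)))"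
  shows "\<phi> X = (\<Sum>j\<in>J. hom_dim C (s j) X * \<phi> (s j))"
proof -
  obtain n :: nat and k \<iota> \<pi> where k: "\<forall>i<n. k i \<in> J" and ds: "is_direct_sum C {..<n} (\<lambda>i. s (k i)) X \<iota> \<pi>"
    using decomposition[OF X] by blast
  have "\<phi> X = (\<Sum>i<n. \<phi> (s (k i)))" by (rule \<phi>[OF ds])
  also have "\<dots> = (\<Sum>j\<in>J. \<Sum>i\<in>{i \<in> {..<n}. k i = j}. \<phi> (s (k i)))"
    using k finite_J by (intro sum.group[symmetric]) auto
  also have "\<dots> = (\<Sum>j\<in>J. hom_dim C (s j) X * \<phi> (s j))"
    using hom_dim_multiplicity(1)[OF ds] k by (intro sum.cong) simp_all
  finally show ?thesis .
qed

context fusion_category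
begin

lemma simple_iso:
  assumes S: "simple C S" and iso: "isomorphic C S X"
  shows "simple C X"
  unfolding simple_def
proof (intro conjI allI impI)
  show "X \<in> Obj C" using iso by (rule isomorphic_Obj)
  show "\<not> zero_object C X" using zero_object_iso[OF iso] simple_nonzero[OF S] by simp
  fix m assume m: "monic C m \<and> Cod C m = X"
  then have mA: "m \<in> Arr C" "Cod C m = X" and mm: "monic C m" by (simp_all add: monic_def)
  obtain f where f: "iso_arr f" "Dom C f = X" "Cod C f = S" using isomorphic_sym[OF iso] by (rule isomorphicE)
  have "monic C (f \<star> m)"
    unfolding monic_def
  proof (intro conjI allI ballI impI)
    fix Z g h assume gh: "g \<in> Hom C Z (Dom C (f \<star> m))" "h \<in> Hom C Z (Dom C (f \<star> m))" "(f \<star> m) \<star> g = (f \<star> m) \<star> h"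
    then have gh': "g \<in> Hom C Z (Dom C m)" "h \<in> Hom C Z (Dom C m)" using mA f by simp_all
    have "f \<star> (m \<star> g) = f \<star> (m \<star> h)" using gh(3) gh' mA f by simp
    then have "m \<star> g = m \<star> h" using gh' mA f by (subst (asm) iso_cancel_left) simp_all
    then show "g = h" using mm gh' unfolding monic_def by blast
  qed (use mA f in simp)
  then have "zero_object C (Dom C m) \<or> iso_arr (f \<star> m)"
    using S mA f unfolding simple_def by auto
  moreover have "iso_arr m" if "iso_arr (f \<star> m)"
  proof -
    have "iso_arr (Inv C f \<star> (f \<star> m))" by (rule iso_arr_comp[OF that]) (use mA f in simp_all)
    moreover have "Inv C f \<star> (f \<star> m) = m" using mA f by simp
    ultimately show ?thesis by (simp only:)
  qed
  ultimately show "zero_object C (Dom C m) \<or> m \<in> Isos C (Dom C m) X" using mA by auto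
qed

text \<open>The endomorphisms \<open>\<iota> i \<star> \<pi> i\<close> of a simple object are
  nonzero scalars, while orthogonality makes the product of two different ones zero.\<close>

lemma simple_direct_sum_card:
  assumes S: "simple C X" and ds: "is_direct_sum C I F X \<iota> \<pi>" and nz: "\<And>i. i \<in> I \<Longrightarrow> \<not> zero_object C (F i)"
  shows "card I = 1"
proof -
  note d [simp] = direct_sumD[OF ds]
  have X: "Idt C X \<noteq> ZeroArr C X X" using S by (simp add: simple_def zero_object_def)
  have sc: "\<exists>a. \<iota> i \<star> \<pi> i = ScaleArr C a (Idt C X) \<and> a \<noteq> 0" if i: "i \<in> I" for i
  proof -
    obtain a where a: "\<iota> i \<star> \<pi> i = ScaleArr C a (Idt C X)"
      using simple_endo_scalar[OF S, of "\<iota> i \<star> \<pi> i"] i by auto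
    have "a \<noteq> 0"
    proof
      assume "a = 0"
      then have z: "\<iota> i \<star> \<pi> i = ZeroArr C X X" using a by simp
      have "\<pi> i \<star> (\<iota> i \<star> \<pi> i) \<star> \<iota> i = (\<pi> i \<star> \<iota> i) \<star> \<pi> i \<star> \<iota> i" using i by (simp del: d(10,11))
      also have "\<dots> = Idt C (F i)" using i by simp
      finally have "Idt C (F i) = \<pi> i \<star> (\<iota> i \<star> \<pi> i) \<star> \<iota> i" by (rule sym)
      also have "\<dots> = ZeroArr C (F i) (F i)" unfolding z using i by simp
      finally show False using nz[OF i] i by (simp add: zero_object_def)
    qed
    with a show ?thesis by blast
  qed
  have "i = j" if i: "i \<in> I" and j: "j \<in> I" for i j
  proof (rule ccontr)
    assume "i \<noteq> j"
    then have z: "\<pi> i \<star> \<iota> j = ZeroArr C (F j) (F i)" using i j by simp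
    obtain a b where ab: "\<iota> i \<star> \<pi> i = ScaleArr C a (Idt C X)" "a \<noteq> 0" "\<iota> j \<star> \<pi> j = ScaleArr C b (Idt C X)" "b \<noteq> 0"
      using sc i j by blast
    have "ScaleArr C (a * b) (Idt C X) = (\<iota> i \<star> \<pi> i) \<star> (\<iota> j \<star> \<pi> j)" unfolding ab using d(2) by (simp add: mult.commute)
    also have "\<dots> = \<iota> i \<star> (\<pi> i \<star> \<iota> j) \<star> \<pi> j" using i j by (simp del: d(10,11))
    also have "\<dots> = ZeroArr C X X" unfolding z using i j by simp
    finally show False using ab X scale_eq_zero_iff[of "Idt C X" X X "a * b"] by simp
  qed
  moreover have "I \<noteq> {}" using direct_sum_nonempty[OF ds] S by (simp add: simple_def)
  ultimately obtain i where "I = {i}" by blast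
  then show ?thesis by simp
qed

text \<open>In a fusion category an irredundant and complete list of simple objects suffices:
  Schur's lemma gives scalars and orthogonality, and the semisimple decomposition is transported
  along isomorphisms to the representatives.\<close>

lemma schur_basisI_simple:
  assumes J: "finite J" and s: "\<And>j. j \<in> J \<Longrightarrow> simple C (s j)"
    and inj: "\<And>i j. i \<in> J \<Longrightarrow> j \<in> J \<Longrightarrow> i \<noteq> j \<Longrightarrow> \<not> isomorphic C (s i) (s j)"
    and all: "\<And>X. simple C X \<Longrightarrow> \<exists>j\<in>J. isomorphic C X (s j)"
  shows "schur_basis C J s"
proof unfold_locales
  fix i j f assume ij: "i \<in> J" "j \<in> J" "i \<noteq> j" and f: "f \<in> Hom C (s i) (s j)"
  show "f = ZeroArr C (s i) (s j)"
  proof (rule ccontr)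
    assume "f \<noteq> ZeroArr C (s i) (s j)"
    then have "iso_arr f" using f s ij by (intro simple_nonzero_iso) auto
    then show False using isomorphicI[of f] inj[OF ij] f by simp
  qed
next
  fix X assume X: "X \<in> Obj C"
  obtain n F \<iota> \<pi> where F: "\<forall>i<n. simple C (F i)" and ds: "is_direct_sum C {..<n::nat} F X \<iota> \<pi>"
    using semisimple[OF X] by blast
  have "\<forall>i\<in>{..<n}. \<exists>j. j \<in> J \<and> isomorphic C (F i) (s j)" using F all by blast
  then obtain k where k: "\<forall>i\<in>{..<n}. k i \<in> J \<and> isomorphic C (F i) (s (k i))" by (rule bchoice[THEN exE])
  then have "\<forall>i\<in>{..<n}. \<exists>f. iso_arr f \<and> Dom C f = F i \<and> Cod C f = s (k i)" by (meson isomorphicE)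
  then obtain \<theta> where \<theta>: "\<forall>i\<in>{..<n}. iso_arr (\<theta> i) \<and> Dom C (\<theta> i) = F i \<and> Cod C (\<theta> i) = s (k i)"
    by (rule bchoice[THEN exE])
  have "is_direct_sum C {..<n} (\<lambda>i. s (k i)) X (\<lambda>i. \<iota> i \<star> Inv C (\<theta> i)) (\<lambda>i. \<theta> i \<star> \<pi> i)"
    using \<theta> by (intro direct_sum_change_summands[OF ds]) blast+
  then show "\<exists>(n::nat) k \<iota> \<pi>. (\<forall>i<n. k i \<in> J) \<and> is_direct_sum C {..<n} (\<lambda>i. s (k i)) X \<iota> \<pi>"
    using k by (metis lessThan_iff)
next
  fix j f assume "j \<in> J" "f \<in> Hom C (s j) (s j)"
  then show "\<exists>a. f = ScaleArr C a (Idt C (s j))" using simple_endo_scalar[OF s] by blast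
qed (use J s in \<open>simp_all add: simple_def\<close>)

lemma simple_summand:
  assumes X: "X \<in> Obj C" "\<not> zero_object C X"
  obtains S f where "simple C S" "f \<in> Hom C S X" "f \<noteq> ZeroArr C S X"
proof -
  obtain n F \<iota> \<pi> where F: "\<forall>i<n. simple C (F i)" and ds: "is_direct_sum C {..<n::nat} F X \<iota> \<pi>"
    using semisimple[OF X(1)] by blast
  note d [simp] = direct_sumD[OF ds]
  have n: "0 < n" using direct_sum_nonempty[OF ds X(2)] by auto
  have "\<iota> 0 \<noteq> ZeroArr C (F 0) X"
  proof
    assume "\<iota> 0 = ZeroArr C (F 0) X"
    moreover have "\<pi> 0 \<star> \<iota> 0 = Idt C (F 0)" "F 0 \<in> Obj C" "\<pi> 0 \<in> Arr C" "Dom C (\<pi> 0) = X" "Cod C (\<pi> 0) = F 0"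
      using n by simp_all
    ultimately have "zero_object C (F 0)" by (simp add: zero_object_def)
    then show False using F n by (simp add: simple_def)
  qed
  then show thesis using that[of "F 0" "\<iota> 0"] F n by simp
qed

end

section \<open>Homogeneous components\<close>

context graded_fusion_category
begin

lemma Deg_in_Obj: "g \<in> carrier G \<Longrightarrow> X \<in> Deg C g \<Longrightarrow> X \<in> Obj C"
  using Deg_Obj by blast

lemma Deg_hom_zero:
  assumes "g \<in> carrier G" "h \<in> carrier G" "X \<in> Deg C g" "Y \<in> Deg C h" "f \<in> Hom C X Y" "f \<noteq> ZeroArr C X Y"
  shows "g = h"
  using Deg_orthogonal[OF assms(1,2) _ assms(3,4)] assms(5,6) by (metis singletonD)

lemma Deg_unique:
  assumes "g \<in> carrier G" "h \<in> carrier G" "X \<in> Deg C g" "X \<in> Deg C h" "\<not> zero_object C X"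
  shows "g = h"
proof -
  have X: "X \<in> Obj C" using Deg_in_Obj[OF assms(1,3)] .
  show ?thesis
    using assms X by (intro Deg_hom_zero[of g h X X "Idt C X"]) (simp_all add: zero_object_def)
qed

text \<open>Some projection to a homogeneous component is nonzero. Its idempotent is a scalar on S,
  and this scalar must be 1, so S is isomorphic to that component.\<close>

lemma simple_homogeneous:
  assumes S: "simple C S"
  obtains g where "g \<in> carrier G" "S \<in> Deg C g"
proof -
  have SO: "S \<in> Obj C" by (rule simple_Obj[OF S])
  obtain F \<iota> \<pi> where F: "\<forall>g\<in>carrier G. F g \<in> Deg C g" and ds: "is_direct_sum C (carrier G) F S \<iota> \<pi>"
    using Deg_decomposition[OF SO] by blast
  note d [simp] = direct_sumD[OF ds]
  have "\<exists>g\<in>carrier G. \<pi> g \<noteq> ZeroArr C S (F g)"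
  proof (rule ccontr)
    assume n: "\<not> ?thesis"
    have "Idt C S = ZeroArr C S S"
      by (rule direct_sum_ext[OF ds]) (use n SO in simp_all)
    then show False using S by (simp add: simple_def zero_object_def)
  qed
  then obtain g where g: "g \<in> carrier G" "\<pi> g \<noteq> ZeroArr C S (F g)" by blast
  obtain a where a: "\<iota> g \<star> \<pi> g = ScaleArr C a (Idt C S)"
    using simple_endo_scalar[OF S, of "\<iota> g \<star> \<pi> g"] g by auto
  have p: "\<pi> g \<star> (\<iota> g \<star> \<pi> g) = \<pi> g"
  proof -
    have "\<pi> g \<star> (\<iota> g \<star> \<pi> g) = (\<pi> g \<star> \<iota> g) \<star> \<pi> g" using g by (intro comp_assoc[symmetric]) simp_all
    then show ?thesis using g by (simp del: comp_assoc)
  qed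
  then have "ScaleArr C a (\<pi> g) = ScaleArr C 1 (\<pi> g)" unfolding a using g SO by simp
  then have "a = 1" using g by (intro scale_cancel[of "\<pi> g"]) simp_all
  then have "iso_arr (\<pi> g)" using a g SO by (intro iso_arrI[of _ "\<iota> g"]) simp_all
  then have "isomorphic C (F g) S" using isomorphicI[of "\<pi> g"] isomorphic_sym g by simp
  then have "S \<in> Deg C g" using Deg_isomorphic[OF g(1)] F g(1) by blast
  then show thesis using that g(1) by blast
qed

end

section \<open>The group action\<close>

context braided_crossed_category
begin

declare ActO_Obj [simp] ActA_Idt [simp] ActA_scale [simp]

lemma act_arr [simp]:
  assumes "g \<in> carrier G" "f \<in> Arr C"
  shows "ActA C g f \<in> Arr C" "Dom C (ActA C g f) = ActO C g (Dom C f)" "Cod C (ActA C g f) = ActO C g (Cod C f)"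
  using ActA_Hom[OF assms(1), of f "Dom C f" "Cod C f"] assms by simp_all

lemma act_comp [simp]:
  "g \<in> carrier G \<Longrightarrow> f \<in> Arr C \<Longrightarrow> f' \<in> Arr C \<Longrightarrow> Cod C f = Dom C f' \<Longrightarrow> ActA C g (f' \<star> f) = ActA C g f' \<star> ActA C g f"
  using ActA_Comp[of g f "Dom C f" "Cod C f" f' "Cod C f'"] by simp

lemma act_add:
  "g \<in> carrier G \<Longrightarrow> f \<in> Arr C \<Longrightarrow> f' \<in> Arr C \<Longrightarrow> Dom C f' = Dom C f \<Longrightarrow> Cod C f' = Cod C f
    \<Longrightarrow> ActA C g (AddArr C f f') = AddArr C (ActA C g f) (ActA C g f')"
  using ActA_add[of g f "Dom C f" "Cod C f" f'] by simp

lemma act_zero [simp]: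
  assumes "g \<in> carrier G" "X \<in> Obj C" "Y \<in> Obj C"
  shows "ActA C g (ZeroArr C X Y) = ZeroArr C (ActO C g X) (ActO C g Y)"
proof -
  have "ActA C g (ZeroArr C X Y) = ActA C g (ScaleArr C 0 (ZeroArr C X Y))" using assms by (subst scale_zero_arr) simp_all
  also have "\<dots> = ScaleArr C 0 (ActA C g (ZeroArr C X Y))" using assms by (intro ActA_scale) simp_all
  also have "\<dots> = ZeroArr C (ActO C g X) (ActO C g Y)" using assms by (subst scale_zero) simp_all
  finally show ?thesis .
qed

lemma linear_map_act:
  assumes "g \<in> carrier G" "X \<in> Obj C" "Y \<in> Obj C"
  shows "linear_map (class_ring :: complex ring) (hom_space C X Y) (hom_space C (ActO C g X) (ActO C g Y)) (ActA C g)"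
  using assms by (intro linear_map_hom_spacesI Hom_vectorspace) (simp_all add: act_add)

lemma act_hsum:
  assumes "g \<in> carrier G" "X \<in> Obj C" "Y \<in> Obj C" "\<And>i. i \<in> I \<Longrightarrow> F i \<in> Hom C X Y"
  shows "ActA C g (hsum X Y F I) = hsum (ActO C g X) (ActO C g Y) (\<lambda>i. ActA C g (F i)) I"
  using linear_map.map_finsum[OF linear_map_act[OF assms(1-3)], of F I] assms(4) by (simp add: Pi_iff)

lemma act_iso [simp]: "g \<in> carrier G \<Longrightarrow> iso_arr f \<Longrightarrow> iso_arr (ActA C g f)"
  by (rule iso_arrI[of _ "ActA C g (Inv C f)"]) (simp_all flip: act_comp)

lemma act_Inv [simp]: "g \<in> carrier G \<Longrightarrow> iso_arr f \<Longrightarrow> Inv C (ActA C g f) = ActA C g (Inv C f)"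
  by (rule Inv_eqI, rule inverse_pairI) (simp_all flip: act_comp)

lemma act_isomorphic:
  assumes "g \<in> carrier G" "isomorphic C X Y"
  shows "isomorphic C (ActO C g X) (ActO C g Y)"
proof -
  obtain f where "iso_arr f" "Dom C f = X" "Cod C f = Y" using assms(2) by (rule isomorphicE)
  then show ?thesis using isomorphicI[of "ActA C g f"] assms(1) by simp
qed

lemma actM_arr [simp]:
  assumes "g \<in> carrier G" "h \<in> carrier G" "X \<in> Obj C"
  shows "iso_arr (ActM C g h X)" "ActM C g h X \<in> Arr C" "Dom C (ActM C g h X) = ActO C g (ActO C h X)"
    "Cod C (ActM C g h X) = ActO C (g \<otimes>\<^bsub>G\<^esub> h) X"
  using ActM_Isos[OF assms] by simp_all

lemma actI_arr [simp]:
  assumes "X \<in> Obj C"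
  shows "iso_arr (ActI C X)" "ActI C X \<in> Arr C" "Dom C (ActI C X) = X" "Cod C (ActI C X) = ActO C \<one>\<^bsub>G\<^esub> X"
  using ActI_Isos[OF assms] by simp_all

lemma actT_arr [simp]:
  assumes "g \<in> carrier G" "X \<in> Obj C" "Y \<in> Obj C"
  shows "iso_arr (ActT C g X Y)" "ActT C g X Y \<in> Arr C" "Dom C (ActT C g X Y) = ActO C g X \<boxdot> ActO C g Y"
    "Cod C (ActT C g X Y) = ActO C g (X \<boxdot> Y)"
  using ActT_Isos[OF assms] by simp_all

lemma actU_arr [simp]:
  assumes "g \<in> carrier G"
  shows "iso_arr (ActU C g)" "ActU C g \<in> Arr C" "Dom C (ActU C g) = Unit C" "Cod C (ActU C g) = ActO C g (Unit C)"
  using ActU_Isos[OF assms] by simp_all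

lemma act_isomorphic_comp: "g \<in> carrier G \<Longrightarrow> h \<in> carrier G \<Longrightarrow> X \<in> Obj C \<Longrightarrow> isomorphic C (ActO C g (ActO C h X)) (ActO C (g \<otimes>\<^bsub>G\<^esub> h) X)"
  using isomorphicI[of "ActM C g h X"] by simp

lemma act_isomorphic_one: "X \<in> Obj C \<Longrightarrow> isomorphic C X (ActO C \<one>\<^bsub>G\<^esub> X)"
  using isomorphicI[of "ActI C X"] by simp

lemma act_direct_sum:
  assumes ds: "is_direct_sum C I F X \<iota> \<pi>" and g [simp]: "g \<in> carrier G"
  shows "is_direct_sum C I (\<lambda>i. ActO C g (F i)) (ActO C g X) (\<lambda>i. ActA C g (\<iota> i)) (\<lambda>i. ActA C g (\<pi> i))"
proof (rule direct_sumI)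
  note d [simp] = direct_sumD[OF ds]
  have "hsum (ActO C g X) (ActO C g X) (\<lambda>i. ActA C g (\<iota> i) \<star> ActA C g (\<pi> i)) I
      = hsum (ActO C g X) (ActO C g X) (\<lambda>i. ActA C g (\<iota> i \<star> \<pi> i)) I"
    by (intro hsum_cong) simp_all
  also have "\<dots> = ActA C g (hsum X X (\<lambda>i. \<iota> i \<star> \<pi> i) I)" by (intro act_hsum[symmetric]) simp_all
  finally show "hsum (ActO C g X) (ActO C g X) (\<lambda>i. ActA C g (\<iota> i) \<star> ActA C g (\<pi> i)) I = Idt C (ActO C g X)" by simp
qed (use direct_sumD[OF ds] in \<open>simp_all flip: act_comp\<close>)

lemma act_inverse_iso: "g \<in> carrier G \<Longrightarrow> X \<in> Obj C \<Longrightarrow> isomorphic C X (ActO C (inv\<^bsub>G\<^esub> g) (ActO C g X))"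
  using act_isomorphic_comp[of "inv\<^bsub>G\<^esub> g" g X] act_isomorphic_one[of X] isomorphic_sym isomorphic_trans
  by (metis G.inv_closed G.l_inv)

lemma act_zero_object: "g \<in> carrier G \<Longrightarrow> zero_object C X \<Longrightarrow> zero_object C (ActO C g X)"
  unfolding zero_object_def by (metis ActA_Idt ActO_Obj act_zero)

text \<open>The inverse group element carries a decomposition of the translate back to a
  decomposition, with nonzero summands, of an object isomorphic to \<open>S\<close>. So there is
  just one summand.\<close>

lemma act_simple:
  assumes g: "g \<in> carrier G" and S: "simple C S"
  shows "simple C (ActO C g S)"
proof -
  have SO: "S \<in> Obj C" by (rule simple_Obj[OF S])
  obtain n F \<iota> \<pi> where F: "\<forall>i<n. simple C (F i)" and ds: "is_direct_sum C {..<n::nat} F (ActO C g S) \<iota> \<pi>"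
    using semisimple[of "ActO C g S"] g SO by auto
  let ?h = "inv\<^bsub>G\<^esub> g"
  have h: "?h \<in> carrier G" using g by simp
  note iso = act_inverse_iso[OF g SO]
  have S': "simple C (ActO C ?h (ActO C g S))" by (rule simple_iso[OF S iso])
  have nz: "\<not> zero_object C (ActO C ?h (F i))" if "i \<in> {..<n}" for i
  proof
    assume "zero_object C (ActO C ?h (F i))"
    then have "zero_object C (ActO C (inv\<^bsub>G\<^esub> ?h) (ActO C ?h (F i)))" by (rule act_zero_object[OF G.inv_closed[OF h]])
    moreover have "F i \<in> Obj C" "\<not> zero_object C (F i)" using F that by (simp_all add: simple_def)
    ultimately show False using zero_object_iso[OF act_inverse_iso[OF h]] by blast
  qed
  have "card {..<n} = 1" by (rule simple_direct_sum_card[OF S' act_direct_sum[OF ds h] nz])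
  then have "n = 1" by simp
  then have "is_direct_sum C {0} F (ActO C g S) \<iota> \<pi>" using ds by (simp add: lessThan_Suc)
  from direct_sum_singleD[OF this] have "isomorphic C (F 0) (ActO C g S)"
    using isomorphicI[of "\<iota> 0"] direct_sumD(5,6)[OF ds, of 0] \<open>n = 1\<close> by simp
  then show ?thesis using simple_iso F \<open>n = 1\<close> by simp
qed

lemma crossed_braiding_isomorphic:
  "g \<in> carrier G \<Longrightarrow> X \<in> Deg C g \<Longrightarrow> Y \<in> Obj C \<Longrightarrow> isomorphic C (X \<boxdot> Y) (ActO C g Y \<boxdot> X)"
  using isomorphicI[of "CBraid C g X Y"] CBraid_Isos[of g X Y] by simp

section \<open>Comparison with the trivial component\<close>

abbreviation trivC where "trivC \<equiv> trivial_component G C"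

lemma trivial_component_simps [simp]:
  "Obj trivC = Deg C \<one>\<^bsub>G\<^esub>" "Arr trivC = {f \<in> Arr C. Dom C f \<in> Deg C \<one>\<^bsub>G\<^esub> \<and> Cod C f \<in> Deg C \<one>\<^bsub>G\<^esub>}"
  "Dom trivC = Dom C" "Cod trivC = Cod C" "Idt trivC = Idt C" "Comp trivC = Comp C" "ZeroArr trivC = ZeroArr C"
  "TObj trivC = TObj C" "Unit trivC = Unit C"
  by (simp_all add: trivial_component_def)

lemma trivial_component_Hom: "X \<in> Deg C \<one>\<^bsub>G\<^esub> \<Longrightarrow> Y \<in> Deg C \<one>\<^bsub>G\<^esub> \<Longrightarrow> Hom trivC X Y = Hom C X Y"
  by (auto simp: Hom_def)

lemma trivial_component_inverse_pair:
  "f \<in> Arr trivC \<Longrightarrow> inverse_pair trivC f g \<longleftrightarrow> inverse_pair C f g"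
  by (auto simp: inverse_pair_def Hom_def)

lemma trivial_component_isomorphic:
  "isomorphic trivC X Y \<longleftrightarrow> isomorphic C X Y \<and> X \<in> Deg C \<one>\<^bsub>G\<^esub>"
proof
  assume i: "isomorphic trivC X Y"
  then have XY: "X \<in> Deg C \<one>\<^bsub>G\<^esub>" "Y \<in> Deg C \<one>\<^bsub>G\<^esub>" by (simp_all add: isomorphic_def)
  from i obtain f g where f: "f \<in> Hom trivC X Y" "inverse_pair trivC f g" by (auto simp: isomorphic_def Isos_def)
  then have "inverse_pair C f g" "f \<in> Hom C X Y"
    using trivial_component_inverse_pair[of f g] trivial_component_Hom[OF XY] by (auto simp: Hom_def)
  then show "isomorphic C X Y \<and> X \<in> Deg C \<one>\<^bsub>G\<^esub>"
    using XY Deg_in_Obj[of "\<one>\<^bsub>G\<^esub>"] unfolding isomorphic_def Isos_def by auto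
next
  assume i: "isomorphic C X Y \<and> X \<in> Deg C \<one>\<^bsub>G\<^esub>"
  then have XY: "X \<in> Deg C \<one>\<^bsub>G\<^esub>" "Y \<in> Deg C \<one>\<^bsub>G\<^esub>" using Deg_isomorphic[of "\<one>\<^bsub>G\<^esub>" X Y] by simp_all
  from i obtain f g where f: "f \<in> Hom C X Y" "inverse_pair C f g" by (auto simp: isomorphic_def Isos_def)
  then have "inverse_pair trivC f g" "f \<in> Hom trivC X Y"
    using trivial_component_inverse_pair[of f g] trivial_component_Hom[OF XY] XY by auto
  then show "isomorphic trivC X Y"
    using XY unfolding isomorphic_def Isos_def by auto
qed

text \<open>A monomorphism of the trivial component is tested only against objects of that
  component, so simplicity of \<open>S\<close> in the whole category does not apply at once. A
  simple summand of its source again lies in the neutral degree, is mapped nontrivially to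
  \<open>S\<close>, and so provides a section.\<close>

lemma simple_trivial_component:
  assumes "fusion_category trivC" and S: "simple C S" and S1: "S \<in> Deg C \<one>\<^bsub>G\<^esub>"
  shows "simple trivC S"
  unfolding simple_def
proof (intro conjI allI impI)
  interpret T: fusion_category trivC by fact
  show "S \<in> Obj trivC" "\<not> zero_object trivC S" using S S1 by (simp_all add: simple_def zero_object_def)
  fix m assume m: "monic trivC m \<and> Cod trivC m = S"
  then have mT: "m \<in> Arr trivC" unfolding monic_def by blast
  then have mA: "m \<in> Arr C" "Cod C m = S" "Dom C m \<in> Deg C \<one>\<^bsub>G\<^esub>" using m by auto
  show "zero_object trivC (Dom trivC m) \<or> m \<in> Isos trivC (Dom trivC m) S"
  proof (cases "zero_object C (Dom C m)")
    case True
    then show ?thesis using mA by (simp add: zero_object_def)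
  next
    case False
    obtain F f where f: "simple C F" "f \<in> Hom C F (Dom C m)" "f \<noteq> ZeroArr C F (Dom C m)"
      using simple_summand[OF _ False] mA by auto
    obtain g where g: "g \<in> carrier G" "F \<in> Deg C g" using simple_homogeneous[OF f(1)] by blast
    then have "g = \<one>\<^bsub>G\<^esub>" using Deg_hom_zero[OF g(1) _ g(2) mA(3) f(2,3)] by simp
    then have F1: "F \<in> Deg C \<one>\<^bsub>G\<^esub>" using g by simp
    have fT: "f \<in> Hom trivC F (Dom trivC m)" using f(2) mA F1 by simp
    have "m \<star>\<^bsub>trivC\<^esub> f \<noteq> ZeroArr trivC F (Cod trivC m)"
      by (rule T.monic_comp_nonzero[OF conjunct1[OF m] fT]) (use f(3) in simp)
    then have nz: "m \<star> f \<noteq> ZeroArr C F S" using mA by simp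
    have iso: "iso_arr (m \<star> f)" using f mA S nz by (intro simple_nonzero_iso) simp_all
    let ?r = "f \<star> Inv C (m \<star> f)"
    have r: "?r \<in> Arr C" "Dom C ?r = S" "Cod C ?r = Dom C m" using iso f mA by simp_all
    have "m \<star> ?r = (m \<star> f) \<star> Inv C (m \<star> f)" using iso f mA by (intro comp_assoc[symmetric]) simp_all
    also have "\<dots> = Idt C S" using iso f mA Inv_simps(5)[OF iso] by (simp del: comp_assoc)
    finally have "m \<star> ?r = Idt C S" .
    then have "T.iso_arr m"
      using m r mA S1 by (intro T.monic_split_epic_iso[of m ?r]) simp_all
    then show ?thesis using m by simp
  qed
qed

end

section \<open>The crossed extension\<close>

lemma power_mod_order:
  fixes x :: "'a::monoid_mult"
  assumes "x ^ p = 1"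
  shows "x ^ (n mod p) = x ^ n"
proof -
  have "x ^ n = x ^ (p * (n div p) + n mod p)" by simp
  also have "\<dots> = x ^ (n mod p)" by (simp only: power_add power_mult assms) simp
  finally show ?thesis by (rule sym)
qed

lemma power_ne_one_prime_order:
  fixes x :: "'a::monoid_mult"
  assumes p: "prime p" and x: "x ^ p = 1" "x \<noteq> 1" and k: "0 < k" "k < p"
  shows "x ^ k \<noteq> 1"
proof
  assume xk: "x ^ k = 1"
  \<comment> \<open>By Bezout, some power of \<open>x ^ k\<close> equals x times a power of
    \<open>x ^ p\<close>, that is, x itself.\<close>
  have "coprime k p" using k p by (metis coprime_commute nat_dvd_not_less prime_imp_coprime)
  then obtain a b where "k * a = p * b + 1" using bezout_nat[of k p] k by auto
  then have "(x ^ k) ^ a = (x ^ p) ^ b * x" by (simp flip: power_mult add: power_add power_commutes)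
  then show False using x xk by simp
qed

text \<open>The group remains a variable fixed by an equation, so the general facts on crossed
  categories apply to it directly. Degrees are the integers from 0 to p - 1, with neutral element
  0.\<close>

locale norm_extension = braided_crossed_category G C
  for G :: "int monoid" and C :: "(int, 'o, 'm, 'z) crossed_cat_scheme" (structure) +
  fixes p q :: nat and t :: "'a::{field, finite} \<Rightarrow> complex" and c :: 'a and \<delta> :: "'a \<Rightarrow> 'o"
  assumes G_eq: "G = integer_mod_group p"
    and p_prime: "prime p" and q_prime: "prime q" and p_dvd: "p dvd q + 1"
    and card_field: "card (UNIV :: 'a set) = q\<^sup>2"
    and c_ne_1: "c \<noteq> 1" and c_pow: "c ^ p = 1"
    and faithful: "faithfully_graded G C"
    and pointed: "pointed_category_of_metric_group t \<delta> (trivial_component G C)"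
    and generator_action: "isomorphic C (ActO C 1 (\<delta> v)) (\<delta> (c * v))"
begin

declare isomorphic_trans [trans]

lemma p_gt_1: "1 < p" using p_prime by (rule prime_gt_1_nat)

lemma G_carrier: "carrier G = {0..<int p}"
  using p_gt_1 by (simp add: G_eq carrier_integer_mod_group)

lemma in_G: "i \<in> carrier G \<longleftrightarrow> 0 \<le> i \<and> i < int p"
  by (simp add: G_carrier)

lemma G_one [simp]: "\<one>\<^bsub>G\<^esub> = 0"
  by (simp add: G_eq)

lemma G_mult: "i \<otimes>\<^bsub>G\<^esub> j = (i + j) mod int p"
  by (simp add: G_eq mult_integer_mod_group)

lemma zero_in_G [simp]: "0 \<in> carrier G"
  using p_gt_1 by (simp add: in_G)

lemma G_comm: "i \<otimes>\<^bsub>G\<^esub> j = j \<otimes>\<^bsub>G\<^esub> i"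
  by (simp add: G_mult add.commute)

lemma G_conj: "i \<in> carrier G \<Longrightarrow> j \<in> carrier G \<Longrightarrow> i \<otimes>\<^bsub>G\<^esub> j \<otimes>\<^bsub>G\<^esub> inv\<^bsub>G\<^esub> i = j"
  using G.m_assoc[of j i "inv\<^bsub>G\<^esub> i"] G.r_inv[of i] G.r_one[of j] G_comm[of i j] by simp

lemma c_pow_ne_1: "0 < k \<Longrightarrow> k < p \<Longrightarrow> c ^ k \<noteq> 1"
  by (rule power_ne_one_prime_order[OF p_prime c_pow c_ne_1])

lemma c_ne_0: "c \<noteq> 0"
  using c_pow p_gt_1 by (metis less_nat_zero_code linorder_neqE_nat one_neq_zero power_0_left)

section \<open>Invertible objects of degree zero\<close>

lemma trivC_fusion: "fusion_category trivC"
  using pointed by (simp add: pointed_category_of_metric_group_def braided_fusion_category_def)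

lemma \<delta>_Deg: "\<delta> a \<in> Deg C 0"
  using pointed by (simp add: pointed_category_of_metric_group_def)

lemma \<delta>_Obj [simp]: "\<delta> a \<in> Obj C"
  using Deg_in_Obj[OF zero_in_G \<delta>_Deg] .

lemma Unit_Deg: "Unit C \<in> Deg C 0"
  using trivC_fusion monoidal_linear_category.Unit_Obj[of trivC] by (simp add: fusion_category_def)

lemma \<delta>_tensor: "isomorphic C (\<delta> a \<boxdot> \<delta> b) (\<delta> (a + b))"
  using pointed trivial_component_isomorphic by (simp add: pointed_category_of_metric_group_def)

lemma \<delta>_inj:
  assumes "isomorphic C (\<delta> a) (\<delta> b)"
  shows "a = b"
proof -
  have "isomorphic trivC (\<delta> a) (\<delta> b)" using assms \<delta>_Deg trivial_component_isomorphic by simp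
  then have "iso_class trivC (\<delta> a) = iso_class trivC (\<delta> b)"
    using trivC_fusion linear_category.iso_class_eq_iff[of trivC "\<delta> a" "\<delta> b"] \<delta>_Deg
    by (simp add: fusion_category_def monoidal_linear_category_def)
  moreover have "inj (\<lambda>a. iso_class trivC (\<delta> a))"
    using pointed by (simp add: pointed_category_of_metric_group_def bij_betw_def)
  ultimately show ?thesis by (simp add: inj_def)
qed

lemma simple_Deg0:
  assumes S: "simple C S" "S \<in> Deg C 0"
  obtains a where "isomorphic C S (\<delta> a)"
proof -
  have "simple trivC S" using simple_trivial_component[OF trivC_fusion S(1)] S(2) by simp
  then have "invertible_object trivC S" using pointed by (simp add: pointed_category_of_metric_group_def)
  then have "iso_class trivC S \<in> (\<lambda>a. iso_class trivC (\<delta> a)) ` UNIV"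
    using pointed unfolding pointed_category_of_metric_group_def bij_betw_def by blast
  then obtain a where a: "iso_class trivC S = iso_class trivC (\<delta> a)" by blast
  then have "isomorphic trivC S (\<delta> a)"
    using trivC_fusion linear_category.iso_class_eq_iff[of trivC S "\<delta> a"] S(2)
    by (simp add: fusion_category_def monoidal_linear_category_def)
  then show thesis using that trivial_component_isomorphic by blast
qed

text \<open>The labelling by field elements is additive up to isomorphism, so the label e of the
  unit satisfies e + e = e.\<close>

lemma Unit_iso_\<delta>: "isomorphic C (Unit C) (\<delta> 0)"
proof -
  obtain e where e: "isomorphic C (Unit C) (\<delta> e)" using simple_Deg0[OF simple_Unit Unit_Deg] .
  have "isomorphic C (\<delta> (e + e)) (\<delta> e \<boxdot> \<delta> e)" by (rule isomorphic_sym[OF \<delta>_tensor])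
  also have "isomorphic C (\<delta> e \<boxdot> \<delta> e) (Unit C \<boxdot> \<delta> e)"
    by (rule isomorphic_tensor[OF isomorphic_sym[OF e] isomorphic_refl]) simp
  also have "isomorphic C (Unit C \<boxdot> \<delta> e) (\<delta> e)" by (rule isomorphic_unit_left) simp
  finally have "e + e = e" by (rule \<delta>_inj)
  then have "e = 0" by (metis add.right_neutral add_left_cancel)
  then show ?thesis using e by simp
qed

lemma \<delta>_cancel:
  assumes X: "X \<in> Obj C"
  shows "isomorphic C (\<delta> (- a) \<boxdot> \<delta> a \<boxdot> X) X"
proof -
  have "isomorphic C (\<delta> (- a) \<boxdot> \<delta> a \<boxdot> X) ((\<delta> (- a) \<boxdot> \<delta> a) \<boxdot> X)"
    by (rule isomorphic_sym[OF isomorphic_assoc]) (simp_all add: X)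
  also have "isomorphic C ((\<delta> (- a) \<boxdot> \<delta> a) \<boxdot> X) (\<delta> 0 \<boxdot> X)"
    using isomorphic_tensor[OF \<delta>_tensor[of "- a" a] isomorphic_refl[OF X]] by simp
  also have "isomorphic C (\<delta> 0 \<boxdot> X) (Unit C \<boxdot> X)"
    by (rule isomorphic_tensor[OF isomorphic_sym[OF Unit_iso_\<delta>] isomorphic_refl[OF X]])
  also have "isomorphic C (Unit C \<boxdot> X) X" by (rule isomorphic_unit_left[OF X])
  finally show ?thesis .
qed

lemma \<delta>_nonzero: "\<not> zero_object C (\<delta> a)"
proof
  assume z: "zero_object C (\<delta> a)"
  have "zero_object C (\<delta> (- a) \<boxdot> \<delta> a \<boxdot> Unit C)"
    by (intro zero_object_tensor z) simp_all
  then have "zero_object C (Unit C)" using zero_object_iso[OF \<delta>_cancel[of "Unit C" a]] by simp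
  then show False using simple_Unit by (simp add: simple_def)
qed

text \<open>The given data concern the trivial component, while simplicity is claimed in the whole
  category. Tensoring a decomposition with \<open>\<delta> (- a)\<close> turns it into one of an
  object isomorphic to the unit, with nonzero summands.\<close>

lemma \<delta>_simple: "simple C (\<delta> a)"
proof -
  obtain n F \<iota> \<pi> where F: "\<forall>i<n. simple C (F i)" and ds: "is_direct_sum C {..<n::nat} F (\<delta> a) \<iota> \<pi>"
    using semisimple[of "\<delta> a"] by auto
  have "isomorphic C (\<delta> a \<boxdot> \<delta> (- a)) (Unit C)"
    using isomorphic_trans[OF \<delta>_tensor[of a "- a"]] isomorphic_sym[OF Unit_iso_\<delta>] by simp
  then have S: "simple C (\<delta> a \<boxdot> \<delta> (- a))" using simple_iso[OF simple_Unit isomorphic_sym] by blast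
  have ds': "is_direct_sum C {..<n} (\<lambda>i. F i \<boxdot> \<delta> (- a)) (\<delta> a \<boxdot> \<delta> (- a))
      (\<lambda>i. \<iota> i \<boxtimes> Idt C (\<delta> (- a))) (\<lambda>i. \<pi> i \<boxtimes> Idt C (\<delta> (- a)))"
    by (rule direct_sum_tensor_right[OF ds]) simp
  have "card {..<n} = 1"
  proof (rule simple_direct_sum_card[OF S ds'])
    fix i assume "i \<in> {..<n}"
    then show "\<not> zero_object C (F i \<boxdot> \<delta> (- a))"
      using F \<delta>_nonzero by (intro tensor_nonzero) (simp_all add: simple_def)
  qed
  then have n: "n = 1" by simp
  then have "is_direct_sum C {0} F (\<delta> a) \<iota> \<pi>" using ds by (simp add: lessThan_Suc)
  from direct_sum_singleD[OF this] have "isomorphic C (F 0) (\<delta> a)"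
    using isomorphicI[of "\<iota> 0"] direct_sumD(5,6)[OF ds, of 0] n by simp
  then show ?thesis using simple_iso F n by simp
qed

text \<open>The generator is iterated: degree n + 1 acts as the generator after degree n, and below
  p the sum needs no reduction modulo p.\<close>

lemma action_on_\<delta>:
  assumes i: "i \<in> carrier G"
  shows "isomorphic C (ActO C i (\<delta> v)) (\<delta> (c ^ nat i * v))"
proof -
  have 1: "1 \<in> carrier G" using p_gt_1 by (simp add: in_G)
  have "isomorphic C (ActO C (int n) (\<delta> v)) (\<delta> (c ^ n * v))" if "n < p" for n
    using that
  proof (induction n)
    case 0
    then show ?case using isomorphic_sym[OF act_isomorphic_one[of "\<delta> v"]] by simp
  next
    case (Suc n)
    have n: "int n \<in> carrier G" using Suc by (simp add: in_G)
    have m: "1 \<otimes>\<^bsub>G\<^esub> int n = int (Suc n)" using Suc by (simp add: G_mult)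
    have "isomorphic C (ActO C (int (Suc n)) (\<delta> v)) (ActO C 1 (ActO C (int n) (\<delta> v)))"
      using isomorphic_sym[OF act_isomorphic_comp[OF 1 n, of "\<delta> v"]] by (simp only: m \<delta>_Obj)
    also have "isomorphic C (ActO C 1 (ActO C (int n) (\<delta> v))) (ActO C 1 (\<delta> (c ^ n * v)))"
      using Suc by (intro act_isomorphic[OF 1]) simp
    also have "isomorphic C (ActO C 1 (\<delta> (c ^ n * v))) (\<delta> (c * (c ^ n * v)))"
      by (rule generator_action)
    finally show ?case by (simp add: mult.assoc)
  qed
  from this[of "nat i"] show ?thesis using i by (simp add: in_G nat_less_iff)
qed

section \<open>Components of nonzero degree\<close>

lemma absorb_left:
  assumes i: "i \<in> carrier G" "i \<noteq> 0" and X: "X \<in> Deg C i"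
  shows "isomorphic C X (\<delta> b \<boxdot> X)" "isomorphic C X (X \<boxdot> \<delta> b)"
proof -
  have XO [simp]: "X \<in> Obj C" by (rule Deg_in_Obj[OF i(1) X])
  \<comment> \<open>Crossing an object of degree 0 involves only the action of the neutral element,
    so the crossed braiding is here an ordinary commutation.\<close>
  have comm: "isomorphic C (\<delta> a \<boxdot> X) (X \<boxdot> \<delta> a)" for a
  proof -
    have "isomorphic C (\<delta> a \<boxdot> X) (ActO C 0 X \<boxdot> \<delta> a)"
      by (rule crossed_braiding_isomorphic[OF zero_in_G \<delta>_Deg XO])
    also have "isomorphic C (ActO C 0 X \<boxdot> \<delta> a) (X \<boxdot> \<delta> a)"
      using isomorphic_tensor[OF isomorphic_sym[OF act_isomorphic_one[OF XO]] isomorphic_refl[OF \<delta>_Obj[of a]]] by simp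
    finally show ?thesis .
  qed
  have main: "isomorphic C X (\<delta> b \<boxdot> X)" for b
  proof -
    \<comment> \<open>The element \<open>?a\<close> solves c^i a - a = b: passing
      \<open>\<delta> ?a\<close> across \<open>X\<close> multiplies its label by c^i and so produces
      a surplus of exactly b.\<close>
    let ?u = "c ^ nat i" and ?a = "b / (c ^ nat i - 1)"
    have u: "?u \<noteq> 1" using i by (intro c_pow_ne_1) (auto simp: in_G)
    have "- x + y * x = (y - 1) * x" for x y :: 'a by (simp add: algebra_simps)
    then have "- ?a + ?u * ?a = (?u - 1) * ?a" .
    then have b: "- ?a + ?u * ?a = b" using u by simp
    have "isomorphic C X (\<delta> (- ?a) \<boxdot> \<delta> ?a \<boxdot> X)" by (rule isomorphic_sym[OF \<delta>_cancel[OF XO]])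
    also have "isomorphic C (\<delta> (- ?a) \<boxdot> \<delta> ?a \<boxdot> X) (\<delta> (- ?a) \<boxdot> \<delta> (?u * ?a) \<boxdot> X)"
    proof (rule isomorphic_tensor[OF isomorphic_refl[OF \<delta>_Obj]])
      have "isomorphic C (\<delta> ?a \<boxdot> X) (X \<boxdot> \<delta> ?a)" by (rule comm)
      also have "isomorphic C (X \<boxdot> \<delta> ?a) (ActO C i (\<delta> ?a) \<boxdot> X)"
        by (rule crossed_braiding_isomorphic[OF i(1) X \<delta>_Obj])
      also have "isomorphic C (ActO C i (\<delta> ?a) \<boxdot> X) (\<delta> (?u * ?a) \<boxdot> X)"
        by (rule isomorphic_tensor[OF action_on_\<delta>[OF i(1)] isomorphic_refl[OF XO]])
      finally show "isomorphic C (\<delta> ?a \<boxdot> X) (\<delta> (?u * ?a) \<boxdot> X)" .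
    qed
    also have "isomorphic C (\<delta> (- ?a) \<boxdot> \<delta> (?u * ?a) \<boxdot> X) ((\<delta> (- ?a) \<boxdot> \<delta> (?u * ?a)) \<boxdot> X)"
      by (rule isomorphic_sym[OF isomorphic_assoc]) simp_all
    also have "isomorphic C ((\<delta> (- ?a) \<boxdot> \<delta> (?u * ?a)) \<boxdot> X) (\<delta> (- ?a + ?u * ?a) \<boxdot> X)"
      by (rule isomorphic_tensor[OF \<delta>_tensor isomorphic_refl[OF XO]])
    finally show ?thesis by (simp only: b)
  qed
  show "isomorphic C X (\<delta> b \<boxdot> X)" by (rule main)
  show "isomorphic C X (X \<boxdot> \<delta> b)" by (rule isomorphic_trans[OF main comm])
qed

lemma dual_nonzero:
  assumes dual: "left_dual C X X' ev coev" and X: "\<not> zero_object C X"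
  shows "\<not> zero_object C X'"
proof
  assume "zero_object C X'"
  then have z: "zero_object C (X \<boxdot> X')" using dual by (intro zero_object_tensor) (simp_all add: left_dual_def)
  have "coev = ZeroArr C (Unit C) (X \<boxdot> X')"
    using zero_object_arr(2)[OF z, of coev] dual by (simp add: left_dual_def)
  then show False using evaluation_nonzero(2)[OF dual X] by simp
qed

text \<open>Transposition yields a nonzero arrow from S \<otimes> X to Y, and nonzero arrows between
  homogeneous objects preserve the degree.\<close>

lemma simple_summand_degree:
  assumes dual: "left_dual C X X' ev coev" and X: "i \<in> carrier G" "X \<in> Deg C i"
    and Y: "k \<in> carrier G" "Y \<in> Deg C k"
    and S: "j \<in> carrier G" "S \<in> Deg C j" and f: "f \<in> Hom C S (Y \<boxdot> X')" "f \<noteq> ZeroArr C S (Y \<boxdot> X')"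
  shows "(j + i) mod int p = k"
proof -
  obtain g where g: "g \<in> Hom C (S \<boxdot> X) Y" "g \<noteq> ZeroArr C (S \<boxdot> X) Y"
    using dual_transpose_nonzero[OF dual f] Deg_in_Obj[OF Y] by blast
  have "S \<boxdot> X \<in> Deg C (j \<otimes>\<^bsub>G\<^esub> i)" by (rule Deg_TObj[OF S(1) X(1) S(2) X(2)])
  then have "j \<otimes>\<^bsub>G\<^esub> i = k" using Deg_hom_zero[OF _ Y(1) _ Y(2) g] S(1) X(1) by simp
  then show ?thesis by (simp add: G_mult)
qed

text \<open>A simple summand S of Y \<otimes> X' has degree 0 and is therefore some
  \<open>\<delta> a\<close>. The transposed arrow runs from S \<otimes> X, which is isomorphic to X,
  to Y; both are simple, so it is an isomorphism.\<close>

lemma simple_Deg_unique: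
  assumes i: "i \<in> carrier G" "i \<noteq> 0" and X: "simple C X" "X \<in> Deg C i" and Y: "simple C Y" "Y \<in> Deg C i"
  shows "isomorphic C X Y"
proof -
  have O [simp]: "X \<in> Obj C" "Y \<in> Obj C" using X Y by (simp_all add: simple_def)
  obtain X' ev coev where dual: "left_dual C X X' ev coev" using left_duals[OF O(1)] by blast
  have [simp]: "X' \<in> Obj C" using dual by (simp add: left_dual_def)
  have "\<not> zero_object C (Y \<boxdot> X')"
    using dual_nonzero[OF dual] X(1) Y(1) by (intro tensor_nonzero) (simp_all add: simple_def)
  then obtain S f where S: "simple C S" and f: "f \<in> Hom C S (Y \<boxdot> X')" "f \<noteq> ZeroArr C S (Y \<boxdot> X')"
    using simple_summand[of "Y \<boxdot> X'"] by auto
  obtain j where j: "j \<in> carrier G" "S \<in> Deg C j" using simple_homogeneous[OF S] .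
  have "(j + i) mod int p = i" by (rule simple_summand_degree[OF dual i(1) X(2) i(1) Y(2) j f])
  then have "j = 0" using i j by (simp add: in_G) (smt (verit) mod_add_right_eq mod_pos_pos_trivial minus_mod_self2)
  then obtain a where a: "isomorphic C S (\<delta> a)" using simple_Deg0[OF S] j by blast
  obtain g where g: "g \<in> Hom C (S \<boxdot> X) Y" "g \<noteq> ZeroArr C (S \<boxdot> X) Y"
    using dual_transpose_nonzero[OF dual f O(2)] by blast
  have "isomorphic C X (S \<boxdot> X)"
    using isomorphic_trans[OF absorb_left(1)[OF i X(2), of a]]
      isomorphic_tensor[OF isomorphic_sym[OF a] isomorphic_refl[OF O(1)]] by blast
  moreover from this have "simple C (S \<boxdot> X)" by (rule simple_iso[OF X(1)])
  then have "iso_arr g" using g Y(1) by (intro simple_nonzero_iso) auto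
  then have "isomorphic C (S \<boxdot> X) Y" using isomorphicI[of g] g by simp
  ultimately show ?thesis by (rule isomorphic_trans)
qed

text \<open>In degree 0 this is merely some simple object; the index set \<open>J\<close> takes the
  objects \<open>\<delta> a\<close> there instead.\<close>

definition X\<^sub>s :: "int \<Rightarrow> 'o" where
  "X\<^sub>s i = (SOME S. simple C S \<and> S \<in> Deg C i)"

lemma X\<^sub>s:
  assumes i: "i \<in> carrier G"
  shows "simple C (X\<^sub>s i)" "X\<^sub>s i \<in> Deg C i"
proof -
  obtain Y where Y: "Y \<in> Deg C i" "\<not> zero_object C Y" using faithful i by (auto simp: faithfully_graded_def)
  obtain S f where S: "simple C S" and f: "f \<in> Hom C S Y" "f \<noteq> ZeroArr C S Y"
    using simple_summand[OF Deg_in_Obj[OF i Y(1)] Y(2)] .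
  obtain j where j: "j \<in> carrier G" "S \<in> Deg C j" using simple_homogeneous[OF S] .
  have "j = i" by (rule Deg_hom_zero[OF j(1) i j(2) Y(1) f])
  with S j have "\<exists>S. simple C S \<and> S \<in> Deg C i" by blast
  from someI_ex[OF this] show "simple C (X\<^sub>s i)" "X\<^sub>s i \<in> Deg C i" by (auto simp: X\<^sub>s_def)
qed

abbreviation G' where "G' \<equiv> carrier G - {0}"

definition J :: "('a + int) set" where "J = UNIV <+> G'"

definition s :: "'a + int \<Rightarrow> 'o" where "s = case_sum \<delta> X\<^sub>s"

definition deg :: "'a + int \<Rightarrow> int" where "deg = case_sum (\<lambda>_. 0) id"

lemma s_simps [simp]: "s (Inl a) = \<delta> a" "s (Inr i) = X\<^sub>s i" "deg (Inl a) = 0" "deg (Inr i) = i"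
  "Inl a \<in> J" "Inr i \<in> J \<longleftrightarrow> i \<in> G'"
  by (auto simp: s_def deg_def J_def)

lemma s_Deg: "j \<in> J \<Longrightarrow> deg j \<in> carrier G" "j \<in> J \<Longrightarrow> s j \<in> Deg C (deg j)" "j \<in> J \<Longrightarrow> simple C (s j)"
  using \<delta>_Deg X\<^sub>s \<delta>_simple by (cases j; simp)+

lemma s_iso_inj:
  assumes "i \<in> J" "j \<in> J" "isomorphic C (s i) (s j)"
  shows "i = j"
proof -
  have "s j \<in> Deg C (deg i)" using Deg_isomorphic s_Deg assms by blast
  then have d: "deg i = deg j"
    using Deg_unique[of "deg i" "deg j" "s j"] s_Deg[OF assms(1)] s_Deg[OF assms(2)] by (simp add: simple_def)
  show ?thesis using d assms \<delta>_inj by (cases i; cases j) auto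
qed

lemma simple_iso_s':
  assumes S: "simple C S"
  shows "\<exists>j\<in>J. isomorphic C S (s j)"
proof -
  obtain i where i: "i \<in> carrier G" "S \<in> Deg C i" using simple_homogeneous[OF S] .
  show ?thesis
  proof (cases "i = 0")
    case True
    then obtain a where "isomorphic C S (\<delta> a)" using simple_Deg0[OF S] i by blast
    then show ?thesis by (intro bexI[of _ "Inl a"]) simp_all
  next
    case False
    then have "isomorphic C S (X\<^sub>s i)" using simple_Deg_unique[OF i(1) _ S i(2)] X\<^sub>s[OF i(1)] by blast
    then show ?thesis using i False by (intro bexI[of _ "Inr i"]) simp_all
  qed
qed

lemma finite_J': "finite J"
  by (simp add: J_def G_carrier)

sublocale E: schur_basis C J s
  by (rule schur_basisI_simple[OF finite_J' s_Deg(3)]) (use s_iso_inj simple_iso_s' in blast)+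

lemma sum_J: "sum f J = (\<Sum>a\<in>UNIV. f (Inl a)) + (\<Sum>i\<in>G'. f (Inr i))"
  unfolding J_def using finite_J' by (subst sum.Plus) (simp_all add: G_carrier)

lemma s_hom_degree:
  assumes "j \<in> J" "i \<in> carrier G" "X \<in> Deg C i" "deg j \<noteq> i"
  shows "hom_dim C (s j) X = 0"
  using hom_dim_zero(2)[OF _ _ Deg_orthogonal[OF s_Deg(1)[OF assms(1)] assms(2,4) s_Deg(2)[OF assms(1)] assms(3)]]
    assms Deg_in_Obj by simp

section \<open>Multiplicities in tensor products\<close>

lemma hom_dim_tensor_left:
  assumes "X \<in> Obj C" "Y \<in> Obj C" "Z \<in> Obj C"
  shows "hom_dim C Z (X \<boxdot> Y) = (\<Sum>j\<in>J. hom_dim C (s j) X * hom_dim C Z (s j \<boxdot> Y))"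
  using E.hom_dim_sum(1)[OF direct_sum_tensor_right[OF _ assms(2)] assms(3)]
  by (intro E.additive_expand[OF assms(1)])

lemma hom_dim_tensor_right:
  assumes "X \<in> Obj C" "Y \<in> Obj C" "Z \<in> Obj C"
  shows "hom_dim C Z (X \<boxdot> Y) = (\<Sum>j\<in>J. hom_dim C (s j) Y * hom_dim C Z (X \<boxdot> s j))"
  using E.hom_dim_sum(1)[OF direct_sum_tensor_left[OF _ assms(1)] assms(3)]
  by (intro E.additive_expand[OF assms(2)])

text \<open>An inequality from injectivity of transposition; equality of two multiplicities is
  reached by applying it in both directions.\<close>

lemma hom_dim_transpose_le:
  assumes dual: "left_dual C X X' ev coev" and A: "A \<in> Obj C" and B: "B \<in> Obj C"
  shows "hom_dim C A (B \<boxdot> X') \<le> hom_dim C (A \<boxdot> X) B"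
proof -
  have "X \<in> Obj C" "X' \<in> Obj C" using dual by (simp_all add: left_dual_def)
  then show ?thesis
    using A B by (intro hom_dim_le[OF dual_transpose_linear[OF dual A B] dual_transpose_inj[OF dual A B]] E.hom_fin) simp_all
qed

definition neg :: "int \<Rightarrow> int" where "neg i = inv\<^bsub>G\<^esub> i"

lemma neg: "i \<in> G' \<Longrightarrow> neg i \<in> G'" "i \<in> carrier G \<Longrightarrow> neg i \<otimes>\<^bsub>G\<^esub> i = 0" "i \<in> carrier G \<Longrightarrow> i \<otimes>\<^bsub>G\<^esub> neg i = 0"
  "i \<in> carrier G \<Longrightarrow> neg i \<in> carrier G"
  using G.inv_eq_1_iff[of i] by (auto simp: neg_def G.l_inv G.r_inv simp flip: G_one simp del: G_one)

text \<open>In X_i \<otimes> X' every \<open>\<delta> a\<close> occurs exactly once: at most once by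
  transposition and absorption, at least once because coevaluation tensored with
  \<open>\<delta> a\<close> is nonzero. All summands of X' have degree -i, so X' consists of copies
  of X_{-i}, and the multiplicity 1 leaves a single copy.\<close>

lemma dual_of_X\<^sub>s:
  assumes i: "i \<in> G'" and dual: "left_dual C (X\<^sub>s i) X' ev coev"
  shows "isomorphic C X' (X\<^sub>s (neg i))" "hom_dim C (\<delta> a) (X\<^sub>s i \<boxdot> X\<^sub>s (neg i)) = 1"
proof -
  have iG: "i \<in> carrier G" "i \<noteq> 0" using i by auto
  note Xi = X\<^sub>s[OF iG(1)]
  have [simp]: "X\<^sub>s i \<in> Obj C" "X' \<in> Obj C" "coev \<in> Arr C" "Dom C coev = Unit C" "Cod C coev = X\<^sub>s i \<boxdot> X'"
    using dual by (simp_all add: left_dual_def)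
  have one: "hom_dim C (\<delta> a) (X\<^sub>s i \<boxdot> X') = 1" for a
  proof -
    have "hom_dim C (\<delta> a) (X\<^sub>s i \<boxdot> X') \<le> hom_dim C (\<delta> a \<boxdot> X\<^sub>s i) (X\<^sub>s i)"
      by (rule hom_dim_transpose_le[OF dual]) simp_all
    also have "\<dots> = hom_dim C (X\<^sub>s i) (X\<^sub>s i)"
      using E.hom_dim_iso(2)[OF absorb_left(1)[OF iG Xi(2)], of "X\<^sub>s i" a] by simp
    also have "\<dots> = 1" using E.hom_s(2)[of "Inr i" "Inr i"] i by simp
    finally have le: "hom_dim C (\<delta> a) (X\<^sub>s i \<boxdot> X') \<le> 1" .
    \<comment> \<open>A retraction of the coevaluation survives tensoring with
      \<open>\<delta> a\<close> and shows the tensored arrow to be nonzero.\<close>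
    obtain r where r: "r \<in> Hom C (X\<^sub>s i \<boxdot> X') (Unit C)" "r \<star> coev = Idt C (Unit C)"
      using simple_retraction[of coev] simple_Unit evaluation_nonzero(2)[OF dual] simple_nonzero[OF Xi(1)] by auto
    have nz: "Idt C (\<delta> a) \<boxtimes> coev \<noteq> ZeroArr C (\<delta> a \<boxdot> Unit C) (\<delta> a \<boxdot> X\<^sub>s i \<boxdot> X')"
    proof
      assume z: "Idt C (\<delta> a) \<boxtimes> coev = ZeroArr C (\<delta> a \<boxdot> Unit C) (\<delta> a \<boxdot> X\<^sub>s i \<boxdot> X')"
      have "Idt C (\<delta> a \<boxdot> Unit C) = (Idt C (\<delta> a) \<boxtimes> r) \<star> (Idt C (\<delta> a) \<boxtimes> coev)" using r by (simp add: tarr_comp)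
      also have "\<dots> = ZeroArr C (\<delta> a \<boxdot> Unit C) (\<delta> a \<boxdot> Unit C)" unfolding z using r by simp
      finally have "zero_object C (\<delta> a \<boxdot> Unit C)" by (simp add: zero_object_def)
      then show False using tensor_nonzero[of "Unit C" "\<delta> a"] \<delta>_nonzero simple_Unit by (simp add: simple_def)
    qed
    have "0 < hom_dim C (\<delta> a \<boxdot> Unit C) (\<delta> a \<boxdot> X\<^sub>s i \<boxdot> X')"
      by (rule hom_dim_pos[OF _ nz E.hom_fin]) simp_all
    also have "\<dots> = hom_dim C (\<delta> a) (\<delta> a \<boxdot> X\<^sub>s i \<boxdot> X')"
      by (rule E.hom_dim_iso(2)[OF isomorphic_unit_right]) simp_all
    also have "\<dots> = hom_dim C (\<delta> a) ((\<delta> a \<boxdot> X\<^sub>s i) \<boxdot> X')"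
      by (rule E.hom_dim_iso(1)[OF isomorphic_sym[OF isomorphic_assoc]]) simp_all
    also have "\<dots> = hom_dim C (\<delta> a) (X\<^sub>s i \<boxdot> X')"
      by (rule E.hom_dim_iso(1)[OF isomorphic_tensor[OF isomorphic_sym[OF absorb_left(1)[OF iG Xi(2)]]]]) simp_all
    finally show ?thesis using le by linarith
  qed
  obtain n :: nat and k \<iota> \<pi> where k: "\<forall>l<n. k l \<in> J" and ds: "is_direct_sum C {..<n} (\<lambda>l. s (k l)) X' \<iota> \<pi>"
    using E.decomposition[of X'] by auto
  note d [simp] = direct_sumD[OF ds]
  have kl: "k l = Inr (neg i)" if l: "l < n" for l
  proof -
    have kJ: "k l \<in> J" using k l by blast
    \<comment> \<open>The inclusion of the l-th summand, regarded as an arrow into 1 \<otimes> X' so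
      that the degree computation applies with Y = 1.\<close>
    let ?f = "Inv C (LUnit C X') \<star> \<iota> l"
    have f: "?f \<in> Hom C (s (k l)) (Unit C \<boxdot> X')" using l by simp
    have nz: "?f \<noteq> ZeroArr C (s (k l)) (Unit C \<boxdot> X')"
    proof
      assume z: "?f = ZeroArr C (s (k l)) (Unit C \<boxdot> X')"
      have "Idt C (s (k l)) = (\<pi> l \<star> LUnit C X') \<star> ?f" using l by simp
      also have "\<dots> = ZeroArr C (s (k l)) (s (k l))" unfolding z using l kJ by simp
      finally show False using E.Idt_s_nonzero[OF kJ] by simp
    qed
    have "(deg (k l) + i) mod int p = 0"
      by (rule simple_summand_degree[OF dual iG(1) Xi(2) zero_in_G Unit_Deg s_Deg(1,2)[OF kJ] f nz])
    then have "deg (k l) \<otimes>\<^bsub>G\<^esub> i = 0" by (simp add: G_mult)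
    then have "deg (k l) = neg i"
      unfolding neg_def using G.inv_equality[of "deg (k l)" i] s_Deg(1)[OF kJ] iG(1) by simp
    then show ?thesis using kJ neg(1)[OF i] by (cases "k l") auto
  qed
  \<comment> \<open>The multiplicity 1 is n times a natural number, whence n = 1.\<close>
  have "1 = hom_dim C (\<delta> 0) (X\<^sub>s i \<boxdot> X')" using one by simp
  also have "\<dots> = (\<Sum>l<n. hom_dim C (\<delta> 0) (X\<^sub>s i \<boxdot> s (k l)))"
    by (rule E.hom_dim_sum(1)[OF direct_sum_tensor_left[OF ds]]) simp_all
  also have "\<dots> = n * hom_dim C (\<delta> 0) (X\<^sub>s i \<boxdot> X\<^sub>s (neg i))" using kl by simp
  finally have n: "n = 1" by simp
  have "is_direct_sum C {0} (\<lambda>l. s (k l)) X' \<iota> \<pi>" using ds n by (simp add: lessThan_Suc)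
  from direct_sum_singleD[OF this] have "isomorphic C (X\<^sub>s (neg i)) X'"
    using isomorphicI[of "\<iota> 0"] n kl[of 0] d(5,6)[of 0] by simp
  then show iso: "isomorphic C X' (X\<^sub>s (neg i))" by (rule isomorphic_sym)
  show "hom_dim C (\<delta> a) (X\<^sub>s i \<boxdot> X\<^sub>s (neg i)) = 1"
    using E.hom_dim_iso(1)[OF isomorphic_tensor[OF isomorphic_refl iso], of "X\<^sub>s i" "\<delta> a"] one by simp
qed

lemma sum_J_single: "j \<in> J \<Longrightarrow> (\<And>i. i \<in> J \<Longrightarrow> i \<noteq> j \<Longrightarrow> f i = 0) \<Longrightarrow> sum f J = (f j :: nat)"
  using finite_J' sum.remove[of J j f] sum.neutral[of "J - {j}" f] by simp

lemma X\<^sub>s_Obj [simp]: "i \<in> carrier G \<Longrightarrow> X\<^sub>s i \<in> Obj C"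
  using X\<^sub>s(1) by (simp add: simple_def)

lemma X\<^sub>s_tensor_degree: "i \<in> carrier G \<Longrightarrow> j \<in> carrier G \<Longrightarrow> X\<^sub>s i \<boxdot> X\<^sub>s j \<in> Deg C (i \<otimes>\<^bsub>G\<^esub> j)"
  using Deg_TObj X\<^sub>s(2) by blast

text \<open>One half of the equality of the two multiplicities; the other half is the same
  inequality for the pair of degrees (i + j, -j).\<close>

lemma X\<^sub>s_fusion_le:
  assumes i: "i \<in> G'" and j: "j \<in> G'" and k: "i \<otimes>\<^bsub>G\<^esub> j \<noteq> 0"
  shows "hom_dim C (X\<^sub>s i) (X\<^sub>s (i \<otimes>\<^bsub>G\<^esub> j) \<boxdot> X\<^sub>s (neg j)) \<le> hom_dim C (X\<^sub>s (i \<otimes>\<^bsub>G\<^esub> j)) (X\<^sub>s i \<boxdot> X\<^sub>s j)"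
proof -
  let ?k = "i \<otimes>\<^bsub>G\<^esub> j"
  have G [simp]: "i \<in> carrier G" "j \<in> carrier G" "neg j \<in> carrier G" using i j neg by auto
  have kG: "?k \<in> carrier G" "Inr ?k \<in> J" using k by simp_all
  obtain X' ev coev where dual: "left_dual C (X\<^sub>s j) X' ev coev" using left_duals[of "X\<^sub>s j"] by auto
  note iso = dual_of_X\<^sub>s(1)[OF j dual]
  have "hom_dim C (X\<^sub>s i) (X\<^sub>s ?k \<boxdot> X\<^sub>s (neg j)) = hom_dim C (X\<^sub>s i) (X\<^sub>s ?k \<boxdot> X')"
    by (rule E.hom_dim_iso(1)[OF isomorphic_tensor[OF isomorphic_refl isomorphic_sym[OF iso]]]) simp_all
  also have "\<dots> \<le> hom_dim C (X\<^sub>s i \<boxdot> X\<^sub>s j) (X\<^sub>s ?k)"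
    by (rule hom_dim_transpose_le[OF dual]) simp_all
  also have "\<dots> = hom_dim C (X\<^sub>s ?k) (X\<^sub>s i \<boxdot> X\<^sub>s j)"
    using E.hom_dim_sym[OF _ kG(2), of "X\<^sub>s i \<boxdot> X\<^sub>s j"] by simp
  finally show ?thesis .
qed

lemma X\<^sub>s_fusion:
  assumes i: "i \<in> G'" and j: "j \<in> G'" and k: "i \<otimes>\<^bsub>G\<^esub> j \<noteq> 0"
  shows "hom_dim C (X\<^sub>s (i \<otimes>\<^bsub>G\<^esub> j)) (X\<^sub>s i \<boxdot> X\<^sub>s j) = q"
proof -
  let ?k = "i \<otimes>\<^bsub>G\<^esub> j" and ?l = "neg j"
  have G [simp]: "i \<in> carrier G" "j \<in> carrier G" "?l \<in> carrier G" using i j neg by auto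
  have kG: "?k \<in> carrier G" "Inr ?k \<in> J" "?k \<in> G'" using k by simp_all
  have l: "?l \<in> G'" by (rule neg(1)[OF j])
  have kl: "?k \<otimes>\<^bsub>G\<^esub> ?l = i" using neg(3)[of j] G.m_assoc[of i j ?l] G.r_one[of i] by simp
  have nn: "neg ?l = j" by (simp add: neg_def)
  let ?n = "hom_dim C (X\<^sub>s ?k) (X\<^sub>s i \<boxdot> X\<^sub>s j)" and ?m = "hom_dim C (X\<^sub>s i) (X\<^sub>s ?k \<boxdot> X\<^sub>s ?l)"
  have "?m \<le> ?n" by (rule X\<^sub>s_fusion_le[OF i j k])
  moreover have "?n \<le> ?m" using X\<^sub>s_fusion_le[OF kG(3) l] i by (simp add: kl nn)
  ultimately have mn: "?m = ?n" by simp
  \<comment> \<open>The multiplicity of X_i in X_i \<otimes> X_j \<otimes> X_{-j} is computed in two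
    ways: bracketed to the left it passes through X_{i+j} and is the square of the unknown;
    bracketed to the right it passes through the q^2 objects \<open>\<delta> a\<close>, each
    contributing 1.\<close>
  have "hom_dim C (X\<^sub>s i) ((X\<^sub>s i \<boxdot> X\<^sub>s j) \<boxdot> X\<^sub>s ?l)
      = (\<Sum>r\<in>J. hom_dim C (s r) (X\<^sub>s i \<boxdot> X\<^sub>s j) * hom_dim C (X\<^sub>s i) (s r \<boxdot> X\<^sub>s ?l))"
    by (rule hom_dim_tensor_left) simp_all
  also have "\<dots> = hom_dim C (s (Inr ?k)) (X\<^sub>s i \<boxdot> X\<^sub>s j) * hom_dim C (X\<^sub>s i) (s (Inr ?k) \<boxdot> X\<^sub>s ?l)"
  proof (rule sum_J_single[OF kG(2)])
    fix r assume r: "r \<in> J" "r \<noteq> Inr ?k"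
    then have "deg r \<noteq> ?k" using k by (cases r) auto
    then show "hom_dim C (s r) (X\<^sub>s i \<boxdot> X\<^sub>s j) * hom_dim C (X\<^sub>s i) (s r \<boxdot> X\<^sub>s ?l) = 0"
      using s_hom_degree[OF r(1) kG(1) X\<^sub>s_tensor_degree[of i j]] by simp
  qed
  also have "\<dots> = ?n * ?n" by (simp add: mn)
  finally have 1: "hom_dim C (X\<^sub>s i) ((X\<^sub>s i \<boxdot> X\<^sub>s j) \<boxdot> X\<^sub>s ?l) = ?n * ?n" .
  obtain X' ev coev where dual: "left_dual C (X\<^sub>s j) X' ev coev" using left_duals[of "X\<^sub>s j"] by auto
  have absorb: "hom_dim C (X\<^sub>s i) (X\<^sub>s i \<boxdot> \<delta> a) = 1" for a
  proof -
    have "hom_dim C (X\<^sub>s i) (X\<^sub>s i \<boxdot> \<delta> a) = hom_dim C (X\<^sub>s i) (X\<^sub>s i)"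
      using i by (intro E.hom_dim_iso(1)[OF isomorphic_sym[OF absorb_left(2)[OF _ _ X\<^sub>s(2)]]]) simp_all
    then show ?thesis using E.hom_s(2)[of "Inr i" "Inr i"] i by simp
  qed
  have "hom_dim C (X\<^sub>s i) ((X\<^sub>s i \<boxdot> X\<^sub>s j) \<boxdot> X\<^sub>s ?l) = hom_dim C (X\<^sub>s i) (X\<^sub>s i \<boxdot> X\<^sub>s j \<boxdot> X\<^sub>s ?l)"
    by (rule E.hom_dim_iso(1)[OF isomorphic_assoc]) simp_all
  also have "\<dots> = (\<Sum>r\<in>J. hom_dim C (s r) (X\<^sub>s j \<boxdot> X\<^sub>s ?l) * hom_dim C (X\<^sub>s i) (X\<^sub>s i \<boxdot> s r))"
    by (rule hom_dim_tensor_right) simp_all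
  also have "\<dots> = (\<Sum>a\<in>(UNIV :: 'a set). 1) + (\<Sum>r\<in>G'. 0)"
    unfolding sum_J
  proof (rule arg_cong2[of _ _ _ _ "(+)"]; rule sum.cong[OF refl])
    fix a :: 'a
    show "hom_dim C (s (Inl a)) (X\<^sub>s j \<boxdot> X\<^sub>s ?l) * hom_dim C (X\<^sub>s i) (X\<^sub>s i \<boxdot> s (Inl a)) = 1"
      using dual_of_X\<^sub>s(2)[OF j dual] absorb by simp
  next
    fix r assume r: "r \<in> G'"
    then have "hom_dim C (s (Inr r)) (X\<^sub>s j \<boxdot> X\<^sub>s ?l) = 0"
      using s_hom_degree[of "Inr r" 0 "X\<^sub>s j \<boxdot> X\<^sub>s ?l"] X\<^sub>s_tensor_degree[of j ?l] neg(3)[of j] by simp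
    then show "hom_dim C (s (Inr r)) (X\<^sub>s j \<boxdot> X\<^sub>s ?l) * hom_dim C (X\<^sub>s i) (X\<^sub>s i \<boxdot> s (Inr r)) = 0" by simp
  qed
  also have "\<dots> = q\<^sup>2" using card_field by simp
  finally have "?n * ?n = q\<^sup>2" using 1 by simp
  then show ?thesis by (metis power2_eq_square power2_eq_iff_nonneg zero_le)
qed

section \<open>A multiplicative weight on the extension\<close>

definition w :: "'a + int \<Rightarrow> nat" where "w = case_sum (\<lambda>_. 1) (\<lambda>_. q)"

lemma w_simps [simp]: "w (Inl a) = 1" "w (Inr i) = q"
  by (simp_all add: w_def)

abbreviation W where "W \<equiv> E.weight w"

lemma W_s: "j \<in> J \<Longrightarrow> W (s j) = w j"
  by (rule E.weight_s)

lemma W_s_tensor: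
  assumes j: "j \<in> J" and l: "l \<in> J"
  shows "W (s j \<boxdot> s l) = w j * w l"
proof (cases j; cases l)
  fix a b assume [simp]: "j = Inl a" "l = Inl b"
  show ?thesis using E.weight_iso[OF \<delta>_tensor[of a b], of w] W_s[of "Inl (a + b)"] by simp
next
  fix a i assume [simp]: "j = Inl a" "l = Inr i"
  have i: "i \<in> G'" using l by simp
  show ?thesis using E.weight_iso[OF absorb_left(1)[of i "X\<^sub>s i" a], of w] W_s[of "Inr i"] X\<^sub>s(2)[of i] i by simp
next
  fix a i assume [simp]: "j = Inr i" "l = Inl a"
  have i: "i \<in> G'" using j by simp
  show ?thesis using E.weight_iso[OF absorb_left(2)[of i "X\<^sub>s i" a], of w] W_s[of "Inr i"] X\<^sub>s(2)[of i] i by simp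
next
  fix i k assume [simp]: "j = Inr i" "l = Inr k"
  have ik: "i \<in> G'" "k \<in> G'" "i \<in> carrier G" "k \<in> carrier G" using j l by simp_all
  let ?m = "i \<otimes>\<^bsub>G\<^esub> k"
  have m: "?m \<in> carrier G" using ik by simp
  have deg: "hom_dim C (s r) (X\<^sub>s i \<boxdot> X\<^sub>s k) = 0" if "r \<in> J" "deg r \<noteq> ?m" for r
    by (rule s_hom_degree[OF that(1) m X\<^sub>s_tensor_degree[OF ik(3,4)] that(2)])
  show ?thesis
  proof (cases "?m = 0")
    case True
    \<comment> \<open>Opposite degrees: the tensor product contains the q^2 invertible objects once
      each, with weight 1.\<close>
    then have k: "k = neg i" unfolding neg_def using G.inv_equality[of k i] ik G_comm by simp
    obtain X' ev coev where dual: "left_dual C (X\<^sub>s i) X' ev coev" using left_duals[of "X\<^sub>s i"] ik by auto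
    have "W (X\<^sub>s i \<boxdot> X\<^sub>s k) = (\<Sum>a\<in>(UNIV :: 'a set). 1) + (\<Sum>r\<in>G'. 0)"
      unfolding E.weight_def sum_J
    proof (rule arg_cong2[of _ _ _ _ "(+)"]; rule sum.cong[OF refl])
      fix a :: 'a
      show "w (Inl a) * hom_dim C (s (Inl a)) (X\<^sub>s i \<boxdot> X\<^sub>s k) = 1"
        using dual_of_X\<^sub>s(2)[OF ik(1) dual] k by simp
    next
      fix r assume "r \<in> G'"
      then show "w (Inr r) * hom_dim C (s (Inr r)) (X\<^sub>s i \<boxdot> X\<^sub>s k) = 0"
        using deg[of "Inr r"] True by simp
    qed
    then show ?thesis using card_field by (simp add: power2_eq_square)
  next
    case False
    \<comment> \<open>Degrees that do not cancel: q copies of one simple object of weight q.\<close>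
    then have mJ: "Inr ?m \<in> J" using m by simp
    have "W (X\<^sub>s i \<boxdot> X\<^sub>s k) = w (Inr ?m) * hom_dim C (s (Inr ?m)) (X\<^sub>s i \<boxdot> X\<^sub>s k)"
      unfolding E.weight_def
    proof (rule sum_J_single[OF mJ])
      fix r assume "r \<in> J" "r \<noteq> Inr ?m"
      then show "w r * hom_dim C (s r) (X\<^sub>s i \<boxdot> X\<^sub>s k) = 0"
        using deg[of r] False by (cases r) auto
    qed
    then show ?thesis using X\<^sub>s_fusion[OF ik(1,2) False] by simp
  qed
qed

lemma W_mult:
  assumes X: "X \<in> Obj C" and Y: "Y \<in> Obj C"
  shows "W (X \<boxdot> Y) = W X * W Y"
proof -
  have sY: "W (s j \<boxdot> Y) = w j * W Y" if j: "j \<in> J" for j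
  proof -
    have "W (s j \<boxdot> Y) = (\<Sum>l\<in>J. hom_dim C (s l) Y * W (s j \<boxdot> s l))"
      using E.weight_direct_sum[OF direct_sum_tensor_left[OF _ E.s_Obj[OF j]]]
      by (intro E.additive_expand[OF Y])
    also have "\<dots> = (\<Sum>l\<in>J. w j * (w l * hom_dim C (s l) Y))"
      using W_s_tensor[OF j] by (intro sum.cong) simp_all
    also have "\<dots> = w j * W Y" by (simp only: E.weight_def sum_distrib_left)
    finally show ?thesis .
  qed
  have "W (X \<boxdot> Y) = (\<Sum>j\<in>J. hom_dim C (s j) X * W (s j \<boxdot> Y))"
    using E.weight_direct_sum[OF direct_sum_tensor_right[OF _ Y]]
    by (intro E.additive_expand[OF X])
  also have "\<dots> = (\<Sum>j\<in>J. w j * hom_dim C (s j) X * W Y)"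
    using sY by (intro sum.cong) simp_all
  also have "\<dots> = W X * W Y"
    unfolding sum_distrib_right[symmetric] by (simp add: E.weight_def)
  finally show ?thesis .
qed

text \<open>The group is commutative, so the action preserves degrees, and a nonzero degree has only
  one simple object.\<close>

lemma action_on_X\<^sub>s:
  assumes g: "g \<in> carrier G" and i: "i \<in> G'"
  shows "isomorphic C (ActO C g (X\<^sub>s i)) (X\<^sub>s i)"
proof -
  have iG: "i \<in> carrier G" "i \<noteq> 0" using i by auto
  have "ActO C g (X\<^sub>s i) \<in> Deg C i" using Act_Deg[OF g iG(1) X\<^sub>s(2)[OF iG(1)]] G_conj[OF g iG(1)] by simp
  then show ?thesis
    using simple_Deg_unique[OF iG act_simple[OF g X\<^sub>s(1)[OF iG(1)]] _ X\<^sub>s[OF iG(1)]] by blast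
qed

end

section \<open>The equivariantization\<close>

context braided_crossed_category
begin

abbreviation D where "D \<equiv> equivariantization G C"

text \<open>Equivariant arrows are triples of source, underlying arrow and target; this picks the
  underlying arrow.\<close>

abbreviation mid :: "'x \<times> 'y \<times> 'x \<Rightarrow> 'y" where "mid f \<equiv> fst (snd f)"

lemma D_simps [simp]:
  "Obj D = equivariant_objects G C" "Arr D = equivariant_arrows G C"
  "Dom D f = fst f" "Cod D f = snd (snd f)" "Idt D x = (x, Idt C (fst x), x)"
  "f' \<star>\<^bsub>D\<^esub> f = (fst f, mid f' \<star> mid f, snd (snd f'))"
  "ZeroArr D x y = (x, ZeroArr C (fst x) (fst y), y)"
  "AddArr D f g = (fst f, AddArr C (mid f) (mid g), snd (snd f))"
  "ScaleArr D a f = (fst f, ScaleArr C a (mid f), snd (snd f))"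
  "Unit D = (Unit C, unit_structure G C)" "TObj D x y = equivariant_tensor G C x y"
  by (simp_all add: equivariantization_def Let_def case_prod_beta)

lemma eobj:
  assumes "x \<in> equivariant_objects G C"
  shows "fst x \<in> Obj C"
    "g \<in> carrier G \<Longrightarrow> iso_arr (snd x g)" "g \<in> carrier G \<Longrightarrow> snd x g \<in> Arr C"
    "g \<in> carrier G \<Longrightarrow> Dom C (snd x g) = ActO C g (fst x)" "g \<in> carrier G \<Longrightarrow> Cod C (snd x g) = fst x"
    "g \<in> carrier G \<Longrightarrow> h \<in> carrier G \<Longrightarrow> snd x (g \<otimes>\<^bsub>G\<^esub> h) \<star> ActM C g h (fst x) = snd x g \<star> ActA C g (snd x h)"
    "snd x \<in> extensional (carrier G)"
  using assms by (auto simp: equivariant_objects_def)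

lemma eobjI:
  assumes "X \<in> Obj C" "u \<in> extensional (carrier G)"
    "\<And>g. g \<in> carrier G \<Longrightarrow> u g \<in> Isos C (ActO C g X) X"
    "\<And>g h. g \<in> carrier G \<Longrightarrow> h \<in> carrier G \<Longrightarrow> u (g \<otimes>\<^bsub>G\<^esub> h) \<star> ActM C g h X = u g \<star> ActA C g (u h)"
  shows "(X, u) \<in> equivariant_objects G C"
  using assms by (simp add: equivariant_objects_def)

definition eqv :: "('g \<Rightarrow> 'm) \<Rightarrow> ('g \<Rightarrow> 'm) \<Rightarrow> 'm \<Rightarrow> bool" where
  "eqv u v f \<longleftrightarrow> (\<forall>g\<in>carrier G. f \<star> u g = v g \<star> ActA C g f)"

lemma earr_iff:
  "f \<in> equivariant_arrows G C \<longleftrightarrow> fst f \<in> equivariant_objects G C \<and> snd (snd f) \<in> equivariant_objects G C \<and>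
    mid f \<in> Arr C \<and> Dom C (mid f) = fst (fst f) \<and> Cod C (mid f) = fst (snd (snd f)) \<and> eqv (snd (fst f)) (snd (snd (snd f))) (mid f)"
  by (cases f) (auto simp: equivariant_arrows_def eqv_def)

lemma eqvD: "eqv u v f \<Longrightarrow> g \<in> carrier G \<Longrightarrow> f \<star> u g = v g \<star> ActA C g f"
  by (simp add: eqv_def)

lemma eqv_comp:
  assumes x: "x \<in> equivariant_objects G C" and y: "y \<in> equivariant_objects G C" and z: "z \<in> equivariant_objects G C"
    and f: "f \<in> Hom C (fst x) (fst y)" "eqv (snd x) (snd y) f" and g: "g \<in> Hom C (fst y) (fst z)" "eqv (snd y) (snd z) g"
  shows "eqv (snd x) (snd z) (g \<star> f)"
  unfolding eqv_def
proof
  fix h assume h: "h \<in> carrier G"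
  note [simp] = h eobj[OF x] eobj[OF y] eobj[OF z]
  have "(g \<star> f) \<star> snd x h = g \<star> f \<star> snd x h" using f g by simp
  also have "\<dots> = (g \<star> snd y h) \<star> ActA C h f" unfolding eqvD[OF f(2) h] using f g by simp
  also have "\<dots> = snd z h \<star> ActA C h (g \<star> f)" unfolding eqvD[OF g(2) h] using f g by simp
  finally show "(g \<star> f) \<star> snd x h = snd z h \<star> ActA C h (g \<star> f)" .
qed

lemma eqv_idt: "x \<in> equivariant_objects G C \<Longrightarrow> eqv (snd x) (snd x) (Idt C (fst x))"
  by (simp add: eqv_def eobj)

lemma eqv_zero: "x \<in> equivariant_objects G C \<Longrightarrow> y \<in> equivariant_objects G C \<Longrightarrow> eqv (snd x) (snd y) (ZeroArr C (fst x) (fst y))"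
  by (simp add: eqv_def eobj)

lemma eqv_scale:
  assumes "x \<in> equivariant_objects G C" "y \<in> equivariant_objects G C" "f \<in> Hom C (fst x) (fst y)" "eqv (snd x) (snd y) f"
  shows "eqv (snd x) (snd y) (ScaleArr C a f)"
  using assms by (simp add: eqv_def eobj)

lemma eqv_add:
  assumes "x \<in> equivariant_objects G C" "y \<in> equivariant_objects G C" "f \<in> Hom C (fst x) (fst y)" "eqv (snd x) (snd y) f"
    "g \<in> Hom C (fst x) (fst y)" "eqv (snd x) (snd y) g"
  shows "eqv (snd x) (snd y) (AddArr C f g)"
  using assms by (simp add: eqv_def eobj comp_add_left comp_add_right act_add)

lemma D_Hom: "f \<in> Hom D x y \<longleftrightarrow> fst f = x \<and> snd (snd f) = y \<and> x \<in> equivariant_objects G C \<and> y \<in> equivariant_objects G C \<and>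
    mid f \<in> Arr C \<and> Dom C (mid f) = fst x \<and> Cod C (mid f) = fst y \<and> eqv (snd x) (snd y) (mid f)"
  by (auto simp: Hom_def[of D] earr_iff)

lemma D_vectorspace:
  assumes x: "x \<in> Obj D" and y: "y \<in> Obj D"
  shows "vectorspace (class_ring :: complex ring) (hom_space D x y)"
proof -
  have xy [simp]: "x \<in> equivariant_objects G C" "y \<in> equivariant_objects G C" using x y by simp_all
  note [simp] = eobj(1)[OF xy(1)] eobj(1)[OF xy(2)]
  have hs: "carrier (hom_space D x y) = Hom D x y" "zero (hom_space D x y) = ZeroArr D x y"
    "add (hom_space D x y) = AddArr D" "module.smult (hom_space D x y) = ScaleArr D"
    by (simp_all add: hom_space_def)
  have ab: "abelian_group (hom_space D x y)"
  proof (rule abelian_groupI; unfold hs)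
    show "\<exists>b\<in>Hom D x y. AddArr D b a = ZeroArr D x y" if "a \<in> Hom D x y" for a
      using that add_comm[of "ScaleArr C (-1) (mid a)" "mid a"]
      by (intro bexI[of _ "ScaleArr D (-1) a"]) (simp_all add: D_Hom eqv_scale)
  qed (auto simp: D_Hom add_assoc eqv_add eqv_zero intro!: add_comm)
  have cr: "cring (class_ring :: complex ring)"
    using class_field[where 'a = complex] by (simp add: field_def domain_def)
  have "Module.module (class_ring :: complex ring) (hom_space D x y)"
    by (rule moduleI[OF cr ab]; unfold hs) (auto simp: D_Hom eqv_scale scale_add_left scale_add_right)
  then show ?thesis using class_field[where 'a = complex] by (simp add: vectorspace_def)
qed

sublocale D: linear_category D
proof (rule linear_category.intro)
  fix x y assume "x \<in> Obj D" "y \<in> Obj D"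
  then show "vectorspace (class_ring :: complex ring) (hom_space D x y)" by (rule D_vectorspace)
next
  fix f x y g z
  assume fg: "f \<in> Hom D x y" "g \<in> Hom D y z"
  show "g \<star>\<^bsub>D\<^esub> f \<in> Hom D x z"
    using fg eqv_comp[of x y z "mid f" "mid g"] by (simp add: D_Hom)
qed (auto simp: D_Hom earr_iff eqv_idt eobj comp_add_left comp_add_right)

lemma mid_linear:
  assumes "x \<in> Obj D" "y \<in> Obj D"
  shows "linear_map (class_ring :: complex ring) (hom_space D x y) (hom_space C (fst x) (fst y)) mid"
  using assms by (intro linear_map_hom_spacesI Hom_vectorspace D.Hom_vectorspace) (simp_all add: earr_iff eobj)

lemma mid_hsum:
  assumes "x \<in> Obj D" "y \<in> Obj D" "\<And>i. i \<in> I \<Longrightarrow> F i \<in> Hom D x y"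
  shows "mid (D.hsum x y F I) = hsum (fst x) (fst y) (\<lambda>i. mid (F i)) I"
  using linear_map.map_finsum[OF mid_linear[OF assms(1,2)], of F I] assms(3) by (simp add: Pi_iff)

lemma direct_sum_mid:
  assumes ds: "is_direct_sum D I F x \<iota> \<pi>"
  shows "is_direct_sum C I (\<lambda>i. fst (F i)) (fst x) (\<lambda>i. mid (\<iota> i)) (\<lambda>i. mid (\<pi> i))"
proof (rule direct_sumI)
  note d = D.direct_sumD[OF ds]
  show "finite I" "fst x \<in> Obj C" using d eobj(1) by simp_all
  show "fst (F i) \<in> Obj C" if "i \<in> I" for i using d(3)[OF that] eobj(1) by simp
  have i: "\<iota> i \<in> Hom D (F i) x" "\<pi> i \<in> Hom D x (F i)" if "i \<in> I" for i
    using d that by simp_all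
  show "mid (\<iota> i) \<in> Hom C (fst (F i)) (fst x)" "mid (\<pi> i) \<in> Hom C (fst x) (fst (F i))" if "i \<in> I" for i
    using i[OF that] unfolding D_Hom by simp_all
  show "mid (\<pi> i) \<star> mid (\<iota> i) = Idt C (fst (F i))" if "i \<in> I" for i
    using arg_cong[OF d(10)[OF that], of mid] by simp
  show "mid (\<pi> i) \<star> mid (\<iota> j) = ZeroArr C (fst (F j)) (fst (F i))" if "i \<in> I" "j \<in> I" "i \<noteq> j" for i j
    using arg_cong[OF d(11)[OF that], of mid] by simp
  have "mid (D.hsum x x (\<lambda>i. \<iota> i \<star>\<^bsub>D\<^esub> \<pi> i) I) = hsum (fst x) (fst x) (\<lambda>i. mid (\<iota> i \<star>\<^bsub>D\<^esub> \<pi> i)) I"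
    by (rule mid_hsum) (use d(2) D.Comp_Hom[OF i(2) i(1)] in blast)+
  then show "hsum (fst x) (fst x) (\<lambda>i. mid (\<iota> i) \<star> mid (\<pi> i)) I = Idt C (fst x)"
    unfolding d(12) by simp
qed

lemma D_iso_arr_mid: "D.iso_arr f \<Longrightarrow> iso_arr (mid f)"
proof -
  assume f: "D.iso_arr f"
  have fA: "f \<in> Arr D" by (rule D.iso_arrD[OF f])
  have gA: "Inv D f \<in> Arr D" by (rule D.Inv_simps(1)[OF f])
  have g: "Dom D (Inv D f) = Cod D f" "Cod D (Inv D f) = Dom D f" "Inv D f \<star>\<^bsub>D\<^esub> f = Idt D (Dom D f)"
    "f \<star>\<^bsub>D\<^esub> Inv D f = Idt D (Cod D f)" by (rule D.Inv_simps[OF f])+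
  show "iso_arr (mid f)"
    using fA gA g arg_cong[OF g(3), of mid] arg_cong[OF g(4), of mid]
    by (intro iso_arrI[of _ "mid (Inv D f)"]) (simp_all add: earr_iff)
qed

text \<open>The inverse of an equivariant arrow is automatically equivariant, so invertibility can
  be tested on the underlying arrow.\<close>

lemma D_iso_arrI:
  assumes fA: "f \<in> Arr D" and f: "iso_arr (mid f)"
  shows "D.iso_arr f"
proof -
  have f': "fst f \<in> equivariant_objects G C" "snd (snd f) \<in> equivariant_objects G C" "mid f \<in> Arr C"
    "Dom C (mid f) = fst (fst f)" "Cod C (mid f) = fst (snd (snd f))" "eqv (snd (fst f)) (snd (snd (snd f))) (mid f)"
    using fA unfolding D_simps earr_iff by blast+
  note [simp] = f'(1-5) f eobj[OF f'(1)] eobj[OF f'(2)]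
  have "eqv (snd (snd (snd f))) (snd (fst f)) (Inv C (mid f))"
    unfolding eqv_def
  proof
    fix g assume g [simp]: "g \<in> carrier G"
    let ?u = "snd (fst f) g" and ?v = "snd (snd (snd f)) g"
    have "Inv C (mid f) \<star> ?v = Inv C (mid f) \<star> (?v \<star> ActA C g (mid f)) \<star> ActA C g (Inv C (mid f))"
      by (simp flip: act_comp)
    also have "\<dots> = Inv C (mid f) \<star> (mid f \<star> ?u) \<star> ActA C g (Inv C (mid f))"
      unfolding eqvD[OF f'(6) g] ..
    also have "\<dots> = ?u \<star> ActA C g (Inv C (mid f))" by simp
    finally show "Inv C (mid f) \<star> ?v = ?u \<star> ActA C g (Inv C (mid f))" .
  qed
  then have g: "(snd (snd f), Inv C (mid f), fst f) \<in> Arr D"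
    by (simp add: earr_iff)
  show ?thesis
    by (rule D.iso_arrI[OF fA g]) simp_all
qed

lemma D_isomorphic_fst: "isomorphic D x y \<Longrightarrow> isomorphic C (fst x) (fst y)"
proof (erule D.isomorphicE)
  fix f assume f: "D.iso_arr f" "Dom D f = x" "Cod D f = y"
  have "f \<in> Arr D" by (rule D.iso_arrD[OF f(1)])
  then show "isomorphic C (fst x) (fst y)"
    using isomorphicI[OF D_iso_arr_mid[OF f(1)]] f(2,3) by (simp add: earr_iff)
qed

lemma D_zero_object: "zero_object D x \<longleftrightarrow> x \<in> equivariant_objects G C \<and> zero_object C (fst x)"
  by (auto simp: zero_object_def eobj)

text \<open>The normalisation at the neutral element follows from the cocycle condition: at the pair
  (1, 1) one copy of u_1 cancels, and naturality of \<open>ActI\<close> then removes the remaining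
  application of T_1.\<close>

lemma equivariant_one:
  assumes x: "x \<in> equivariant_objects G C"
  shows "snd x \<one>\<^bsub>G\<^esub> \<star> ActI C (fst x) = Idt C (fst x)"
proof -
  note [simp] = eobj[OF x]
  let ?u = "snd x \<one>\<^bsub>G\<^esub>" and ?X = "fst x" and ?I = "ActI C (fst x)"
  have "?u \<star> ActM C \<one>\<^bsub>G\<^esub> \<one>\<^bsub>G\<^esub> ?X = ?u \<star> ActA C \<one>\<^bsub>G\<^esub> ?u"
    using eobj(6)[OF x, of "\<one>\<^bsub>G\<^esub>" "\<one>\<^bsub>G\<^esub>"] by simp
  then have "ActM C \<one>\<^bsub>G\<^esub> \<one>\<^bsub>G\<^esub> ?X = ActA C \<one>\<^bsub>G\<^esub> ?u"
    by (subst (asm) iso_cancel_left) simp_all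
  then have "ActA C \<one>\<^bsub>G\<^esub> (?u \<star> ?I) = Idt C (ActO C \<one>\<^bsub>G\<^esub> ?X)"
    using ActM_one_right[of "\<one>\<^bsub>G\<^esub>" ?X] by simp
  moreover have "?I \<star> (?u \<star> ?I) = ActA C \<one>\<^bsub>G\<^esub> (?u \<star> ?I) \<star> ?I"
    using ActI_natural[of "?u \<star> ?I" ?X ?X] by simp
  ultimately have "?I \<star> (?u \<star> ?I) = ?I \<star> Idt C ?X" by simp
  then show ?thesis by (subst (asm) iso_cancel_left) simp_all
qed

section \<open>Averaging over the group\<close>

definition conj_act where
  "conj_act x y g f = snd y g \<star> ActA C g f \<star> Inv C (snd x g)"

lemma conj_act_arr:
  assumes "x \<in> equivariant_objects G C" "y \<in> equivariant_objects G C" "g \<in> carrier G" "f \<in> Hom C (fst x) (fst y)"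
  shows "conj_act x y g f \<in> Hom C (fst x) (fst y)"
  using assms by (simp add: conj_act_def eobj)

lemma conj_act_one:
  assumes x: "x \<in> equivariant_objects G C" and y: "y \<in> equivariant_objects G C" and f: "f \<in> Hom C (fst x) (fst y)"
  shows "conj_act x y \<one>\<^bsub>G\<^esub> f = f"
proof -
  note [simp] = eobj(1-5)[OF x] eobj(1-5)[OF y] f[unfolded Hom_iff]
  let ?u = "snd x \<one>\<^bsub>G\<^esub>" and ?v = "snd y \<one>\<^bsub>G\<^esub>"
  have [simp]: "Dom C (ActI C (fst x)) = fst x" "Cod C (ActI C (fst x)) = ActO C \<one>\<^bsub>G\<^esub> (fst x)" "iso_arr (ActI C (fst x))"
    "Dom C (ActI C (fst y)) = fst y" "Cod C (ActI C (fst y)) = ActO C \<one>\<^bsub>G\<^esub> (fst y)" "iso_arr (ActI C (fst y))"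
    using actI_arr[of "fst x"] actI_arr[of "fst y"] by simp_all
  have u: "?u \<star> ActI C (fst x) = Idt C (fst x)" and v: "?v \<star> ActI C (fst y) = Idt C (fst y)"
    using equivariant_one[OF x] equivariant_one[OF y] by simp_all
  have nat: "ActI C (fst y) \<star> f = ActA C \<one>\<^bsub>G\<^esub> f \<star> ActI C (fst x)" using ActI_natural[of f "fst x" "fst y"] by simp
  have "ActI C (fst x) = Inv C ?u \<star> (?u \<star> ActI C (fst x))" by simp
  then have I: "Inv C ?u = ActI C (fst x)" unfolding u by simp
  have "conj_act x y \<one>\<^bsub>G\<^esub> f = ?v \<star> (ActA C \<one>\<^bsub>G\<^esub> f \<star> ActI C (fst x))" by (simp add: conj_act_def I)
  also have "\<dots> = (?v \<star> ActI C (fst y)) \<star> f" unfolding nat[symmetric] by simp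
  finally show ?thesis unfolding v by simp
qed

text \<open>The maps \<open>conj_act x y g\<close> form an action of the group on Hom(X, Y) whose
  invariants are the equivariant arrows. This is the multiplicativity of that action, with the
  inverse of \<open>snd x h\<close> moved to the other side.\<close>

lemma conj_act_shift:
  assumes x: "x \<in> equivariant_objects G C" and y: "y \<in> equivariant_objects G C"
    and g [simp]: "g \<in> carrier G" and h [simp]: "h \<in> carrier G" and f: "f \<in> Hom C (fst x) (fst y)"
  shows "snd y h \<star> ActA C h (conj_act x y g f) = conj_act x y (h \<otimes>\<^bsub>G\<^esub> g) f \<star> snd x h"
proof -
  note [simp] = eobj(1-5)[OF x] eobj(1-5)[OF y] f[unfolded Hom_iff]
  let ?X = "fst x" and ?Y = "fst y" and ?u = "snd x" and ?v = "snd y" and ?hg = "h \<otimes>\<^bsub>G\<^esub> g"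
  have hg [simp]: "?hg \<in> carrier G" by simp
  have mx: "ActM C h g ?X \<star> ActA C h (Inv C (?u g)) = Inv C (?u ?hg) \<star> ?u h"
  proof -
    have "Inv C (?u ?hg) \<star> (?u ?hg \<star> ActM C h g ?X) \<star> ActA C h (Inv C (?u g))
        = Inv C (?u ?hg) \<star> (?u h \<star> ActA C h (?u g)) \<star> ActA C h (Inv C (?u g))"
      by (simp only: eobj(6)[OF x h g])
    then show ?thesis by (simp flip: act_comp)
  qed
  have nat: "ActM C h g ?Y \<star> ActA C h (ActA C g f) = ActA C ?hg f \<star> ActM C h g ?X"
    by (rule ActM_natural) simp_all
  have "?v h \<star> ActA C h (conj_act x y g f)
      = (?v h \<star> ActA C h (?v g)) \<star> ActA C h (ActA C g f) \<star> ActA C h (Inv C (?u g))"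
    by (simp add: conj_act_def)
  also have "\<dots> = ?v ?hg \<star> (ActM C h g ?Y \<star> ActA C h (ActA C g f)) \<star> ActA C h (Inv C (?u g))"
    unfolding eobj(6)[OF y h g, symmetric] by simp
  also have "\<dots> = ?v ?hg \<star> ActA C ?hg f \<star> ActM C h g ?X \<star> ActA C h (Inv C (?u g))"
    unfolding nat by simp
  also have "\<dots> = conj_act x y ?hg f \<star> ?u h" unfolding mx by (simp add: conj_act_def)
  finally show ?thesis .
qed

text \<open>The sum over the group, without dividing by its order; the factor reappears in
  \<open>avg_of_eqv\<close>.\<close>

definition avg where
  "avg x y f = hsum (fst x) (fst y) (\<lambda>g. conj_act x y g f) (carrier G)"

lemma avg_arr:
  assumes "x \<in> equivariant_objects G C" "y \<in> equivariant_objects G C" "f \<in> Hom C (fst x) (fst y)"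
  shows "avg x y f \<in> Hom C (fst x) (fst y)"
  using hsum_arr[of "fst x" "fst y" "carrier G" "\<lambda>g. conj_act x y g f"] conj_act_arr[OF assms(1,2) _ assms(3)] assms(1,2)
  by (simp add: avg_def eobj)

text \<open>Left translation by \<open>h\<close> permutes the summands.\<close>

lemma avg_eqv:
  assumes x: "x \<in> equivariant_objects G C" and y: "y \<in> equivariant_objects G C" and f: "f \<in> Hom C (fst x) (fst y)"
  shows "eqv (snd x) (snd y) (avg x y f)"
  unfolding eqv_def
proof
  fix h assume h [simp]: "h \<in> carrier G"
  note [simp] = eobj(1-5)[OF x] eobj(1-5)[OF y]
  let ?X = "fst x" and ?Y = "fst y"
  have ca: "conj_act x y g f \<in> Hom C ?X ?Y" if "g \<in> carrier G" for g by (rule conj_act_arr[OF x y that f])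
  have inj: "inj_on ((\<otimes>\<^bsub>G\<^esub>) h) (carrier G)" and im: "(\<otimes>\<^bsub>G\<^esub>) h ` carrier G = carrier G"
    using G.inj_on_cmult[OF h] G.surj_const_mult[OF h] by simp_all
  have "snd y h \<star> ActA C h (avg x y f) = snd y h \<star> hsum (ActO C h ?X) (ActO C h ?Y) (\<lambda>g. ActA C h (conj_act x y g f)) (carrier G)"
    unfolding avg_def using ca by (subst act_hsum) simp_all
  also have "\<dots> = hsum (ActO C h ?X) ?Y (\<lambda>g. snd y h \<star> ActA C h (conj_act x y g f)) (carrier G)"
    using ca by (subst comp_hsum_right) simp_all
  also have "\<dots> = hsum (ActO C h ?X) ?Y (\<lambda>g. conj_act x y (h \<otimes>\<^bsub>G\<^esub> g) f \<star> snd x h) (carrier G)"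
    using conj_act_shift[OF x y _ h f] ca by (intro hsum_cong) simp_all
  also have "\<dots> = hsum (ActO C h ?X) ?Y (\<lambda>g. conj_act x y g f \<star> snd x h) ((\<otimes>\<^bsub>G\<^esub>) h ` carrier G)"
    using ca inj by (subst hsum_reindex) simp_all
  also have "\<dots> = avg x y f \<star> snd x h"
    unfolding im avg_def using ca by (subst comp_hsum_left) simp_all
  finally show "avg x y f \<star> snd x h = snd y h \<star> ActA C h (avg x y f)" by (rule sym)
qed

text \<open>An equivariant arrow passes through every conjugate and can therefore be taken out of
  the sum.\<close>

lemma avg_comp_left:
  assumes x: "x \<in> equivariant_objects G C" and y: "y \<in> equivariant_objects G C" and z: "z \<in> equivariant_objects G C"
    and f: "f \<in> Hom C (fst x) (fst y)" and b: "b \<in> Hom C (fst y) (fst z)" "eqv (snd y) (snd z) b"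
  shows "avg x z (b \<star> f) = b \<star> avg x y f"
proof -
  note [simp] = eobj(1-5)[OF x] eobj(1-5)[OF y] eobj(1-5)[OF z] f[unfolded Hom_iff] b(1)[unfolded Hom_iff]
  have "conj_act x z g (b \<star> f) = b \<star> conj_act x y g f" if [simp]: "g \<in> carrier G" for g
  proof -
    have "conj_act x z g (b \<star> f) = (snd z g \<star> ActA C g b) \<star> ActA C g f \<star> Inv C (snd x g)"
      by (simp add: conj_act_def)
    also have "\<dots> = b \<star> conj_act x y g f"
      unfolding eqvD[OF b(2) that, symmetric] by (simp add: conj_act_def)
    finally show ?thesis .
  qed
  then show ?thesis
    unfolding avg_def using conj_act_arr[OF x y _ f]
    by (subst comp_hsum_right) (auto intro!: hsum_cong)
qed

lemma avg_comp_right: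
  assumes x: "x \<in> equivariant_objects G C" and y: "y \<in> equivariant_objects G C" and z: "z \<in> equivariant_objects G C"
    and f: "f \<in> Hom C (fst y) (fst z)" and a: "a \<in> Hom C (fst x) (fst y)" "eqv (snd x) (snd y) a"
  shows "avg x z (f \<star> a) = avg y z f \<star> a"
proof -
  note [simp] = eobj(1-5)[OF x] eobj(1-5)[OF y] eobj(1-5)[OF z] f[unfolded Hom_iff] a(1)[unfolded Hom_iff]
  have "conj_act x z g (f \<star> a) = conj_act y z g f \<star> a" if [simp]: "g \<in> carrier G" for g
  proof -
    have "ActA C g a \<star> Inv C (snd x g) = Inv C (snd y g) \<star> (snd y g \<star> ActA C g a) \<star> Inv C (snd x g)" by simp
    also have "\<dots> = Inv C (snd y g) \<star> a" unfolding eqvD[OF a(2) that, symmetric] by simp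
    finally show ?thesis by (simp add: conj_act_def)
  qed
  then show ?thesis
    unfolding avg_def using conj_act_arr[OF y z _ f]
    by (subst comp_hsum_left) (auto intro!: hsum_cong)
qed

lemma avg_of_eqv:
  assumes x: "x \<in> equivariant_objects G C" and y: "y \<in> equivariant_objects G C"
    and f: "f \<in> Hom C (fst x) (fst y)" "eqv (snd x) (snd y) f"
  shows "avg x y f = ScaleArr C (of_nat (card (carrier G))) f"
proof -
  note [simp] = eobj(1-5)[OF x] eobj(1-5)[OF y] f(1)[unfolded Hom_iff]
  have "conj_act x y g f = ScaleArr C 1 f" if [simp]: "g \<in> carrier G" for g
  proof -
    have "conj_act x y g f = (snd y g \<star> ActA C g f) \<star> Inv C (snd x g)" by (simp add: conj_act_def)
    then show ?thesis unfolding eqvD[OF f(2) that, symmetric] by simp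
  qed
  then have "avg x y f = hsum (fst x) (fst y) (\<lambda>g. ScaleArr C 1 f) (carrier G)"
    unfolding avg_def by (intro hsum_cong) simp_all
  then show ?thesis using hsum_scale_sum[of f "carrier G" "\<lambda>_. 1"] finite_G by simp
qed

section \<open>Tensor products, twists and induced objects\<close>

lemma tensor_obj:
  assumes x: "x \<in> equivariant_objects G C" and y: "y \<in> equivariant_objects G C"
  shows "equivariant_tensor G C x y \<in> equivariant_objects G C"
    "fst (equivariant_tensor G C x y) = fst x \<boxdot> fst y"
proof -
  let ?X = "fst x" and ?Y = "fst y" and ?u = "snd x" and ?v = "snd y"
  let ?w = "\<lambda>g\<in>carrier G. (?u g \<boxtimes> ?v g) \<star> Inv C (ActT C g ?X ?Y)"
  have t: "equivariant_tensor G C x y = (?X \<boxdot> ?Y, ?w)"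
    by (simp add: equivariant_tensor_def case_prod_beta)
  note [simp] = eobj(1-5)[OF x] eobj(1-5)[OF y]
  show "fst (equivariant_tensor G C x y) = ?X \<boxdot> ?Y" by (simp add: t)
  show "equivariant_tensor G C x y \<in> equivariant_objects G C"
    unfolding t
  proof (rule eobjI)
    fix g h assume gh [simp]: "g \<in> carrier G" "h \<in> carrier G"
    let ?gh = "g \<otimes>\<^bsub>G\<^esub> h"
    let ?M = "ActM C g h (?X \<boxdot> ?Y)" and ?MM = "ActM C g h ?X \<boxtimes> ActM C g h ?Y"
      and ?T1 = "ActA C g (ActT C h ?X ?Y)" and ?T2 = "ActT C g (ActO C h ?X) (ActO C h ?Y)" and ?T3 = "ActT C ?gh ?X ?Y"
      and ?T4 = "ActT C g ?X ?Y"
    \<comment> \<open>Two identities of the action are solved for inverse tensor constraints, since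
      these are what the structure of the product contains: compatibility of \<open>ActM\<close>
      with \<open>ActT\<close>, and naturality of \<open>ActT\<close>.\<close>
    have "?M \<star> ?T1 \<star> ?T2 = ?T3 \<star> ?MM" using ActM_ActT[of g h ?X ?Y] by simp
    then have "Inv C ?T3 \<star> (?M \<star> ?T1 \<star> ?T2) \<star> Inv C ?T2 \<star> Inv C ?T1 = Inv C ?T3 \<star> (?T3 \<star> ?MM) \<star> Inv C ?T2 \<star> Inv C ?T1" by simp
    then have 1: "Inv C ?T3 \<star> ?M = ?MM \<star> Inv C ?T2 \<star> Inv C ?T1" by (simp del: act_Inv)
    have "?T4 \<star> (ActA C g (?u h) \<boxtimes> ActA C g (?v h)) = ActA C g (?u h \<boxtimes> ?v h) \<star> ?T2"
      using ActT_natural[of g "?u h" "ActO C h ?X" ?X "?v h" "ActO C h ?Y" ?Y] by simp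
    then have "Inv C ?T4 \<star> (?T4 \<star> (ActA C g (?u h) \<boxtimes> ActA C g (?v h))) \<star> Inv C ?T2 = Inv C ?T4 \<star> (ActA C g (?u h \<boxtimes> ?v h) \<star> ?T2) \<star> Inv C ?T2" by simp
    then have 2: "Inv C ?T4 \<star> ActA C g (?u h \<boxtimes> ?v h) = (ActA C g (?u h) \<boxtimes> ActA C g (?v h)) \<star> Inv C ?T2" by simp
    have "?w ?gh \<star> ?M = (?u ?gh \<boxtimes> ?v ?gh) \<star> Inv C ?T3 \<star> ?M" by simp
    also have "\<dots> = ((?u ?gh \<boxtimes> ?v ?gh) \<star> ?MM) \<star> Inv C ?T2 \<star> Inv C ?T1" unfolding 1 by simp
    also have "(?u ?gh \<boxtimes> ?v ?gh) \<star> ?MM = (?u g \<boxtimes> ?v g) \<star> (ActA C g (?u h) \<boxtimes> ActA C g (?v h))"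
      using eobj(6)[OF x gh] eobj(6)[OF y gh] by (simp add: tarr_comp)
    also have "((?u g \<boxtimes> ?v g) \<star> (ActA C g (?u h) \<boxtimes> ActA C g (?v h))) \<star> Inv C ?T2 \<star> Inv C ?T1
        = (?u g \<boxtimes> ?v g) \<star> ((ActA C g (?u h) \<boxtimes> ActA C g (?v h)) \<star> Inv C ?T2) \<star> Inv C ?T1" by simp
    also have "\<dots> = ?w g \<star> ActA C g (?w h)" unfolding 2[symmetric] by simp
    finally show "?w ?gh \<star> ?M = ?w g \<star> ActA C g (?w h)" .
  qed simp_all
qed

lemma unit_obj: "(Unit C, unit_structure G C) \<in> equivariant_objects G C"
proof (rule eobjI)
  fix g h assume gh [simp]: "g \<in> carrier G" "h \<in> carrier G"
  let ?M = "ActM C g h (Unit C)" and ?Uh = "ActA C g (ActU C h)" and ?gh = "g \<otimes>\<^bsub>G\<^esub> h"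
  have "?M \<star> ?Uh \<star> ActU C g = ActU C ?gh" using ActM_ActU[of g h] by simp
  then have "Inv C (ActU C ?gh) \<star> (?M \<star> ?Uh \<star> ActU C g) \<star> Inv C (ActU C g) \<star> Inv C ?Uh
      = Inv C (ActU C ?gh) \<star> ActU C ?gh \<star> Inv C (ActU C g) \<star> Inv C ?Uh" by simp
  then have "Inv C (ActU C ?gh) \<star> ?M = Inv C (ActU C g) \<star> Inv C ?Uh" by (simp del: act_Inv)
  then show "unit_structure G C ?gh \<star> ?M = unit_structure G C g \<star> ActA C g (unit_structure G C h)"
    by (simp add: unit_structure_def)
qed (simp_all add: unit_structure_def)

lemma character:
  assumes "\<chi> \<in> characters G" "g \<in> carrier G"
  shows "\<chi> g \<noteq> 0" "h \<in> carrier G \<Longrightarrow> \<chi> (g \<otimes>\<^bsub>G\<^esub> h) = \<chi> g * \<chi> h"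
proof -
  have "\<chi> g \<in> Units (class_ring :: complex ring)" using assms by (auto simp: characters_def hom_def units_of_def)
  then show "\<chi> g \<noteq> 0" by (auto simp: Units_def)
  show "h \<in> carrier G \<Longrightarrow> \<chi> (g \<otimes>\<^bsub>G\<^esub> h) = \<chi> g * \<chi> h"
    using assms by (auto simp: characters_def hom_def units_of_def)
qed

lemma twisted_obj:
  assumes x: "(X, u) \<in> equivariant_objects G C" and \<chi>: "\<chi> \<in> characters G"
  shows "(X, twisted_structure G C \<chi> u) \<in> equivariant_objects G C"
proof (rule eobjI)
  note e = eobj[OF x, simplified]
  note [simp] = e(1-5)
  show "X \<in> Obj C" by simp
  show "twisted_structure G C \<chi> u \<in> extensional (carrier G)" by (simp add: twisted_structure_def)
  show "twisted_structure G C \<chi> u g \<in> Isos C (ActO C g X) X" if "g \<in> carrier G" for g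
    using that character(1)[OF \<chi> that] by (simp add: twisted_structure_def)
  fix g h assume gh [simp]: "g \<in> carrier G" "h \<in> carrier G"
  show "twisted_structure G C \<chi> u (g \<otimes>\<^bsub>G\<^esub> h) \<star> ActM C g h X
      = twisted_structure G C \<chi> u g \<star> ActA C g (twisted_structure G C \<chi> u h)"
    using e(6)[OF gh] character(2)[OF \<chi> gh(1) gh(2)] by (simp add: twisted_structure_def mult.commute)
qed

text \<open>The structure of the source enters a conjugate through its inverse, hence the inverse of
  the character.\<close>

lemma conj_act_twisted:
  assumes x: "(X, u) \<in> equivariant_objects G C" and y: "y \<in> equivariant_objects G C" and \<chi>: "\<chi> \<in> characters G"
    and g: "g \<in> carrier G" and f: "f \<in> Hom C X (fst y)"
  shows "conj_act (X, twisted_structure G C \<chi> u) y g f = ScaleArr C (inverse (\<chi> g)) (conj_act (X, u) y g f)"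
  using eobj[OF x, simplified] eobj[OF y] character(1)[OF \<chi> g] g f
  by (simp add: conj_act_def twisted_structure_def)

text \<open>The induced object: \<open>T\<^sub>g\<close> permutes the summands \<open>T\<^sub>k Z\<close> by left translation.\<close>

lemma induced_obj:
  assumes Z: "Z \<in> Obj C" and ds: "is_direct_sum C (carrier G) (\<lambda>k. ActO C k Z) X \<iota> \<pi>"
  shows "\<exists>u. (X, u) \<in> equivariant_objects G C"
proof -
  note d [simp] = direct_sumD(1-9)[OF ds] and Z [simp]
  have "\<forall>g\<in>carrier G. \<exists>f. iso_arr f \<and> Dom C f = ActO C g X \<and> Cod C f = X \<and>
      (\<forall>k\<in>carrier G. f \<star> ActA C g (\<iota> k) = \<iota> (g \<otimes>\<^bsub>G\<^esub> k) \<star> ActM C g k Z)"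
  proof
    fix g assume g [simp]: "g \<in> carrier G"
    have bij: "bij_betw ((\<otimes>\<^bsub>G\<^esub>) g) (carrier G) (carrier G)"
      using G.inj_on_cmult[OF g] G.surj_const_mult[OF g] by (simp add: bij_betw_def)
    obtain f where "iso_arr f" "Dom C f = ActO C g X" "Cod C f = X"
      "\<And>k. k \<in> carrier G \<Longrightarrow> f \<star> ActA C g (\<iota> k) = \<iota> (g \<otimes>\<^bsub>G\<^esub> k) \<star> ActM C g k Z"
      by (rule direct_sum_iso[OF act_direct_sum[OF ds g] direct_sum_reindex[OF ds bij], of "\<lambda>k. ActM C g k Z"]) simp_all
    then show "\<exists>f. iso_arr f \<and> Dom C f = ActO C g X \<and> Cod C f = X \<and>
      (\<forall>k\<in>carrier G. f \<star> ActA C g (\<iota> k) = \<iota> (g \<otimes>\<^bsub>G\<^esub> k) \<star> ActM C g k Z)" by blast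
  qed
  then obtain u0 where u0: "\<forall>g\<in>carrier G. iso_arr (u0 g) \<and> Dom C (u0 g) = ActO C g X \<and> Cod C (u0 g) = X \<and>
      (\<forall>k\<in>carrier G. u0 g \<star> ActA C g (\<iota> k) = \<iota> (g \<otimes>\<^bsub>G\<^esub> k) \<star> ActM C g k Z)"
    by (rule bchoice[THEN exE])
  have u [simp]: "iso_arr (u0 g)" "Dom C (u0 g) = ActO C g X" "Cod C (u0 g) = X" if "g \<in> carrier G" for g
    using u0 that by blast+
  have ui: "u0 g \<star> ActA C g (\<iota> k) = \<iota> (g \<otimes>\<^bsub>G\<^esub> k) \<star> ActM C g k Z" if "g \<in> carrier G" "k \<in> carrier G" for g k
    using u0 that by blast
  have "(X, restrict u0 (carrier G)) \<in> equivariant_objects G C"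
  proof (rule eobjI)
    fix g h assume gh [simp]: "g \<in> carrier G" "h \<in> carrier G"
    let ?gh = "g \<otimes>\<^bsub>G\<^esub> h"
    \<comment> \<open>Both sides are compared on the summands of T_g T_h X, where the cocycle
      identity reduces to the associativity of \<open>ActM\<close>.\<close>
    have "u0 ?gh \<star> ActM C g h X = u0 g \<star> ActA C g (u0 h)"
    proof (rule direct_sum_ext'[OF act_direct_sum[OF act_direct_sum[OF ds gh(2)] gh(1)]])
      fix k assume k [simp]: "k \<in> carrier G"
      let ?i = "ActA C g (ActA C h (\<iota> k))"
      have "(u0 ?gh \<star> ActM C g h X) \<star> ?i = u0 ?gh \<star> (ActM C g h X \<star> ?i)" by simp
      also have "ActM C g h X \<star> ?i = ActA C ?gh (\<iota> k) \<star> ActM C g h (ActO C k Z)"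
        by (rule ActM_natural) simp_all
      also have "u0 ?gh \<star> ActA C ?gh (\<iota> k) \<star> ActM C g h (ActO C k Z) = (u0 ?gh \<star> ActA C ?gh (\<iota> k)) \<star> ActM C g h (ActO C k Z)" by simp
      also have "\<dots> = \<iota> (?gh \<otimes>\<^bsub>G\<^esub> k) \<star> (ActM C ?gh k Z \<star> ActM C g h (ActO C k Z))"
        by (subst ui) simp_all
      also have "ActM C ?gh k Z \<star> ActM C g h (ActO C k Z) = ActM C g (h \<otimes>\<^bsub>G\<^esub> k) Z \<star> ActA C g (ActM C h k Z)"
        using ActM_assoc[of g h k Z] by simp
      also have "\<iota> (?gh \<otimes>\<^bsub>G\<^esub> k) = \<iota> (g \<otimes>\<^bsub>G\<^esub> (h \<otimes>\<^bsub>G\<^esub> k))" by (simp add: G.m_assoc)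
      finally have 1: "(u0 ?gh \<star> ActM C g h X) \<star> ?i
        = \<iota> (g \<otimes>\<^bsub>G\<^esub> (h \<otimes>\<^bsub>G\<^esub> k)) \<star> ActM C g (h \<otimes>\<^bsub>G\<^esub> k) Z \<star> ActA C g (ActM C h k Z)" .
      have "(u0 g \<star> ActA C g (u0 h)) \<star> ?i = u0 g \<star> ActA C g (u0 h \<star> ActA C h (\<iota> k))" by simp
      also have "\<dots> = u0 g \<star> ActA C g (\<iota> (h \<otimes>\<^bsub>G\<^esub> k) \<star> ActM C h k Z)" by (subst ui) simp_all
      also have "\<dots> = (u0 g \<star> ActA C g (\<iota> (h \<otimes>\<^bsub>G\<^esub> k))) \<star> ActA C g (ActM C h k Z)" by simp
      also have "\<dots> = \<iota> (g \<otimes>\<^bsub>G\<^esub> (h \<otimes>\<^bsub>G\<^esub> k)) \<star> ActM C g (h \<otimes>\<^bsub>G\<^esub> k) Z \<star> ActA C g (ActM C h k Z)"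
        by (subst ui) (simp_all add: G.m_assoc)
      finally show "(u0 ?gh \<star> ActM C g h X) \<star> ?i = (u0 g \<star> ActA C g (u0 h)) \<star> ?i" using 1 by simp
    qed simp_all
    then show "restrict u0 (carrier G) ?gh \<star> ActM C g h X = restrict u0 (carrier G) g \<star> ActA C g (restrict u0 (carrier G) h)"
      by simp
  qed simp_all
  then show ?thesis by blast
qed

end

section \<open>Characters and orbits\<close>

context norm_extension
begin

text \<open>The function with value \<omega> at the generator; it is a character when \<omega> is a
  p-th root of unity.\<close>

definition \<chi>\<^sub>c :: "complex \<Rightarrow> int \<Rightarrow> complex" where
  "\<chi>\<^sub>c \<omega> = (\<lambda>i\<in>carrier G. \<omega> ^ nat i)"

lemma nat_G_mult: "i \<in> carrier G \<Longrightarrow> j \<in> carrier G \<Longrightarrow> nat (i \<otimes>\<^bsub>G\<^esub> j) = (nat i + nat j) mod p"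
  by (simp add: G_mult in_G nat_mod_distrib nat_add_distrib)

lemma \<chi>\<^sub>c_character:
  assumes "\<omega> ^ p = 1"
  shows "\<chi>\<^sub>c \<omega> \<in> characters G"
proof -
  have "\<omega> \<noteq> 0" using assms p_gt_1 by (auto simp: power_0_left)
  then have "\<omega> ^ n \<in> Units (class_ring :: complex ring)" for n
    by (auto simp: Units_def intro!: exI[of _ "inverse (\<omega> ^ n)"])
  then show ?thesis
    using power_mod_order[OF assms]
    by (auto simp: characters_def \<chi>\<^sub>c_def hom_def units_of_def nat_G_mult power_add)
qed

lemma characters_eq: "characters G = \<chi>\<^sub>c ` {\<omega>. \<omega> ^ p = 1}"
proof
  show "\<chi>\<^sub>c ` {\<omega>. \<omega> ^ p = 1} \<subseteq> characters G" using \<chi>\<^sub>c_character by blast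
  show "characters G \<subseteq> \<chi>\<^sub>c ` {\<omega>. \<omega> ^ p = 1}"
  proof
    fix \<chi> assume \<chi>: "\<chi> \<in> characters G"
    have 1: "1 \<in> carrier G" using p_gt_1 by (simp add: in_G)
    have zero: "\<chi> 0 = 1" using character(1)[OF \<chi> zero_in_G] character(2)[OF \<chi> zero_in_G zero_in_G] by (simp add: G_mult)
    have pow: "\<chi> (int n) = \<chi> 1 ^ n" if "n < p" for n
      using that
    proof (induction n)
      case (Suc n)
      then have "\<chi> (1 \<otimes>\<^bsub>G\<^esub> int n) = \<chi> 1 * \<chi> (int n)" by (intro character(2)[OF \<chi> 1]) (simp add: in_G)
      then show ?case using Suc by (simp add: G_mult add.commute)
    qed (simp add: zero)
    \<comment> \<open>One step beyond p - 1 the group law wraps around to 0, which makes the value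
      at 1 a p-th root of unity.\<close>
    have "\<chi> 1 ^ p = \<chi> 1 * \<chi> (int (p - 1))" using pow[of "p - 1"] p_gt_1 by (simp flip: power_Suc)
    also have "\<dots> = \<chi> (1 \<otimes>\<^bsub>G\<^esub> int (p - 1))" using p_gt_1 by (intro character(2)[OF \<chi> 1, symmetric]) (simp add: in_G)
    also have "\<dots> = 1" using zero p_gt_1 by (simp add: G_mult of_nat_diff)
    finally have "\<chi> 1 ^ p = 1" .
    moreover have "\<chi> = \<chi>\<^sub>c (\<chi> 1)"
    proof
      fix i
      show "\<chi> i = \<chi>\<^sub>c (\<chi> 1) i"
      proof (cases "i \<in> carrier G")
        case True
        then show ?thesis using pow[of "nat i"] by (simp add: \<chi>\<^sub>c_def in_G nat_less_iff)
      next
        case False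
        then show ?thesis using \<chi> by (simp add: \<chi>\<^sub>c_def characters_def extensional_def)
      qed
    qed
    ultimately show "\<chi> \<in> \<chi>\<^sub>c ` {\<omega>. \<omega> ^ p = 1}" by blast
  qed
qed

lemma inj_\<chi>\<^sub>c: "inj_on \<chi>\<^sub>c A"
proof (rule inj_onI)
  fix x y assume "\<chi>\<^sub>c x = \<chi>\<^sub>c y"
  then have "\<chi>\<^sub>c x 1 = \<chi>\<^sub>c y 1" by simp
  then show "x = y" using p_gt_1 by (simp add: \<chi>\<^sub>c_def in_G)
qed

lemma card_characters: "card (characters G) = p"
  unfolding characters_eq using card_image[OF inj_\<chi>\<^sub>c] card_roots_unity_eq p_gt_1 by simp

lemma finite_characters: "finite (characters G)"
  using card_characters p_gt_1 by (intro card_ge_0_finite) simp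

text \<open>For nonzero g there is a p-th root of unity z with z^g different from 1. Multiplication
  by z permutes the roots of unity and scales the sum by a factor other than 1, so the sum
  vanishes.\<close>

lemma character_orthogonality:
  assumes g: "g \<in> carrier G"
  shows "(\<Sum>\<chi>\<in>characters G. inverse (\<chi> g)) = (if g = 0 then of_nat p else 0)"
proof -
  let ?R = "{\<omega>::complex. \<omega> ^ p = 1}" and ?k = "nat g"
  have sum: "(\<Sum>\<chi>\<in>characters G. inverse (\<chi> g)) = (\<Sum>\<omega>\<in>?R. inverse (\<omega> ^ ?k))"
    unfolding characters_eq using g by (subst sum.reindex[OF inj_\<chi>\<^sub>c]) (simp add: \<chi>\<^sub>c_def)
  show ?thesis
  proof (cases "g = 0")
    case True
    then show ?thesis using sum card_roots_unity_eq[of p] p_gt_1 by simp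
  next
    case False
    have "\<not> ?R \<subseteq> {1}" using card_mono[of "{1::complex}" ?R] card_roots_unity_eq[of p] p_gt_1 by auto
    then obtain z :: complex where z: "z ^ p = 1" "z \<noteq> 1" by blast
    have z0: "z \<noteq> 0" using z p_gt_1 by (auto simp: power_0_left)
    have zk: "z ^ ?k \<noteq> 1"
      using False g by (intro power_ne_one_prime_order[OF p_prime z]) (auto simp: in_G)
    let ?S = "\<Sum>\<omega>\<in>?R. inverse (\<omega> ^ ?k)"
    have bij: "bij_betw ((*) z) ?R ?R"
      using z z0 by (intro bij_betwI[where g = "\<lambda>x. x / z"]) (auto simp: power_mult_distrib power_divide)
    have "?S = (\<Sum>\<omega>\<in>?R. inverse ((z * \<omega>) ^ ?k))" by (rule sum.reindex_bij_betw[OF bij, symmetric])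
    also have "\<dots> = inverse (z ^ ?k) * ?S" by (simp add: sum_distrib_left power_mult_distrib)
    finally have "?S * (1 - inverse (z ^ ?k)) = 0" by (simp add: algebra_simps)
    then have "?S = 0" using zk z0 by (auto simp: field_simps)
    then show ?thesis using sum False by simp
  qed
qed

lemma zero_G_mult [simp]: "g \<in> carrier G \<Longrightarrow> 0 \<otimes>\<^bsub>G\<^esub> g = g"
  by (simp add: G_mult in_G)

text \<open>The second cohomology group of \<open>\<int>/p\<close> with values in \<open>\<complex>\<^sup>*\<close> vanishes: iterating an isomorphism
  \<open>h : T\<^sub>1 X \<rightarrow> X\<close> gives isomorphisms \<open>F h n : T\<^sub>n X \<rightarrow> X\<close>, and rescaling \<open>h\<close> by a \<open>p\<close>-th root makes \<open>F h p\<close> equal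
  to \<open>F h 0\<close>, so that \<open>F h n\<close> depends on \<open>n\<close> modulo \<open>p\<close> only.\<close>

lemma cyclic_equivariant_structure:
  assumes X: "simple C X" and iso: "isomorphic C (ActO C 1 X) X"
  shows "\<exists>u. (X, u) \<in> equivariant_objects G C"
proof -
  have XO [simp]: "X \<in> Obj C" by (rule simple_Obj[OF X])
  \<comment> \<open>The iteration runs over the natural numbers; \<open>e n\<close> is the group
    element acting at stage n.\<close>
  define e :: "nat \<Rightarrow> int" where "e n = int (n mod p)" for n
  have e [simp]: "e n \<in> carrier G" for n using p_gt_1 by (simp add: e_def in_G)
  have e_mult: "e m \<otimes>\<^bsub>G\<^esub> e n = e (m + n)" for m n
    by (simp add: e_def G_mult mod_add_eq flip: of_nat_add of_nat_mod)
  have e0 [simp]: "e 0 = 0" by (simp add: e_def)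
  have ep: "e (n + p) = e n" for n by (simp add: e_def)
  have e1: "e (Suc 0) = 1" using p_gt_1 by (simp add: e_def)
  have eS: "e (Suc 0) \<otimes>\<^bsub>G\<^esub> e n = e (Suc n)" for n by (simp add: e_mult)
  let ?I = "ActI C X"
  have I [simp]: "Cod C ?I = ActO C 0 X" "Dom C ?I = X" using actI_arr[OF XO] by simp_all
  obtain f where f0: "iso_arr f" "Dom C f = ActO C 1 X" "Cod C f = X" using iso by (rule isomorphicE)
  \<comment> \<open>From stage n to n + 1: undo the isomorphism from T_1 T_n X to T_{n+1} X, apply
    T_1 to the arrow of stage n, then \<open>h\<close>. Stage 0 inverts the unit constraint of the
    action.\<close>
  define F where "F h = rec_nat (Inv C ?I) (\<lambda>n k. (h \<star> ActA C (e (Suc 0)) k) \<star> Inv C (ActM C (e (Suc 0)) (e n) X))" for h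
  have F0: "F h 0 = Inv C ?I" and FS: "F h (Suc n) = (h \<star> ActA C (e (Suc 0)) (F h n)) \<star> Inv C (ActM C (e (Suc 0)) (e n) X)" for h n
    by (simp_all add: F_def)
  have F: "iso_arr (F h n) \<and> Dom C (F h n) = ActO C (e n) X \<and> Cod C (F h n) = X"
    if "iso_arr h" "Dom C h = ActO C 1 X" "Cod C h = X" for h n
    using that by (induction n) (simp_all add: F0 FS eS e1[symmetric] del: One_nat_def)
  \<comment> \<open>Going once around the group compares \<open>F f p\<close> with
    \<open>F f 0\<close>; since X is simple, the discrepancy is a scalar a.\<close>
  define a' where "a' = F f p \<star> ?I"
  have a'i: "iso_arr a'" "Dom C a' = X" "Cod C a' = X"
    using F[OF f0, of p] ep[of 0] by (simp_all add: a'_def)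
  obtain a where a: "a' = ScaleArr C a (Idt C X)" using simple_endo_scalar[OF X, of a'] a'i by auto
  have "a \<noteq> 0"
  proof
    assume "a = 0"
    then have "a' = ZeroArr C X X" using a by simp
    then have "Idt C X = ZeroArr C X X" using Inv_simps[OF a'i(1)] a'i by (metis Inv_simps comp_zero_right XO)
    then show False using simple_nonzero[OF X] by (simp add: zero_object_def)
  qed
  \<comment> \<open>Rescaling \<open>f\<close> by z multiplies stage p by z^p, so z is chosen as a
    p-th root of 1/a.\<close>
  then have "card {z. z ^ p = inverse a} = p" using card_nth_roots[of "inverse a" p] p_gt_1 by simp
  then have "{z. z ^ p = inverse a} \<noteq> {}" using p_gt_1 by (intro notI) simp
  then obtain z where z: "z ^ p = inverse a" by blast
  then have z0: "z \<noteq> 0" using \<open>a \<noteq> 0\<close> p_gt_1 by (auto simp: power_0_left)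
  define h where "h = ScaleArr C z f"
  have h: "iso_arr h" "Dom C h = ActO C 1 X" "Cod C h = X" using f0 z0 by (simp_all add: h_def)
  let ?\<phi> = "F h"
  have \<phi> [simp]: "iso_arr (?\<phi> n)" "Dom C (?\<phi> n) = ActO C (e n) X" "Cod C (?\<phi> n) = X" for n
    using F[OF h] by blast+
  have Ff [simp]: "iso_arr (F f n)" "Dom C (F f n) = ActO C (e n) X" "Cod C (F f n) = X" for n
    using F[OF f0] by blast+
  have f [simp]: "iso_arr f" "Dom C f = ActO C (e (Suc 0)) X" "Cod C f = X" using f0 e1 by simp_all
  have hh [simp]: "iso_arr h" "Dom C h = ActO C (e (Suc 0)) X" "Cod C h = X" using h e1 by simp_all
  have scale: "?\<phi> n = ScaleArr C (z ^ n) (F f n)" for n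
    by (induction n) (simp_all add: F0 FS h_def eS mult.commute)
  have "?\<phi> p \<star> ?I = Idt C X"
    using z \<open>a \<noteq> 0\<close> a ep[of 0] by (simp add: scale a'_def)
  then have "(?\<phi> p \<star> ?I) \<star> Inv C ?I = Inv C ?I" by simp
  then have \<phi>p: "?\<phi> p = ?\<phi> 0" using ep[of 0] by (simp add: F0)
  have \<phi>np: "?\<phi> (n + p) = ?\<phi> n" for n
    by (induction n) (simp_all add: \<phi>p FS ep)
  have \<phi>mod: "?\<phi> (n mod p) = ?\<phi> n" for n
  proof -
    have "?\<phi> (m + p * k) = ?\<phi> m" for m k
      by (induction k) (simp_all add: \<phi>np add.assoc[symmetric] add.commute[of p] add.left_commute)
    from this[of "n mod p" "n div p"] show ?thesis by simp
  qed
  \<comment> \<open>The cocycle condition for stages, by induction on m: the base case is the unit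
    law of the action, the step its associativity law.\<close>
  have coc: "?\<phi> (m + n) \<star> ActM C (e m) (e n) X = ?\<phi> m \<star> ActA C (e m) (?\<phi> n)" for m n
  proof (induction m)
    case 0
    have M: "ActM C 0 (e n) X \<star> ActI C (ActO C (e n) X) = Idt C (ActO C (e n) X)"
      using ActM_one_left[of "e n" X] by simp
    have I': "iso_arr (ActI C (ActO C (e n) X))" "Cod C (ActI C (ActO C (e n) X)) = ActO C 0 (ActO C (e n) X)"
      using actI_arr[of "ActO C (e n) X"] by simp_all
    have nat: "?I \<star> ?\<phi> n = ActA C 0 (?\<phi> n) \<star> ActI C (ActO C (e n) X)"
      using ActI_natural[of "?\<phi> n" "ActO C (e n) X" X] by simp
    have "(?\<phi> n \<star> ActM C 0 (e n) X) \<star> ActI C (ActO C (e n) X) = ?\<phi> n"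
      using I' M by simp
    also have "\<dots> = Inv C ?I \<star> (?I \<star> ?\<phi> n)" by simp
    also have "\<dots> = (Inv C ?I \<star> ActA C 0 (?\<phi> n)) \<star> ActI C (ActO C (e n) X)" unfolding nat using I' by simp
    finally show ?case using I' by (subst (asm) iso_cancel_right) (simp_all add: F0)
  next
    case (Suc m)
    let ?o = "e (Suc 0)"
    have [simp]: "?o \<otimes>\<^bsub>G\<^esub> e m = e (Suc m)" "?o \<otimes>\<^bsub>G\<^esub> e (m + n) = e (Suc (m + n))" "e m \<otimes>\<^bsub>G\<^esub> e n = e (m + n)"
      "e (Suc m) \<otimes>\<^bsub>G\<^esub> e n = e (Suc (m + n))" by (simp_all add: e_mult)
    let ?N = "ActM C ?o (e (m + n)) X" and ?K = "ActM C ?o (e m) (ActO C (e n) X)" and ?L = "ActM C ?o (e m) X"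
    have assoc: "ActM C (e (Suc m)) (e n) X \<star> ?K = ?N \<star> ActA C ?o (ActM C (e m) (e n) X)"
      using ActM_assoc[of ?o "e m" "e n" X] by simp
    have nat: "?L \<star> ActA C ?o (ActA C (e m) (?\<phi> n)) = ActA C (e (Suc m)) (?\<phi> n) \<star> ?K"
      using ActM_natural[of ?o "e m" "?\<phi> n" "ActO C (e n) X" X] by simp
    have "(?\<phi> (Suc m + n) \<star> ActM C (e (Suc m)) (e n) X) \<star> ?K
        = ?\<phi> (Suc m + n) \<star> (ActM C (e (Suc m)) (e n) X \<star> ?K)" by simp
    also have "\<dots> = h \<star> ActA C ?o (?\<phi> (m + n) \<star> ActM C (e m) (e n) X)" unfolding assoc by (simp add: FS)
    also have "\<dots> = h \<star> ActA C ?o (?\<phi> m) \<star> ActA C ?o (ActA C (e m) (?\<phi> n))" unfolding Suc by simp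
    also have "\<dots> = ?\<phi> (Suc m) \<star> (?L \<star> ActA C ?o (ActA C (e m) (?\<phi> n)))" by (simp add: FS)
    also have "\<dots> = (?\<phi> (Suc m) \<star> ActA C (e (Suc m)) (?\<phi> n)) \<star> ?K" unfolding nat by simp
    finally show ?case by (subst (asm) iso_cancel_right) simp_all
  qed
  have en: "e (nat g) = g" if "g \<in> carrier G" for g using that by (simp add: e_def in_G nat_less_iff)
  have "(X, \<lambda>g\<in>carrier G. ?\<phi> (nat g)) \<in> equivariant_objects G C"
  proof (rule eobjI)
    show "(\<lambda>g\<in>carrier G. ?\<phi> (nat g)) g \<in> Isos C (ActO C g X) X" if "g \<in> carrier G" for g
      using that by (simp add: en)
    fix g h assume gh: "g \<in> carrier G" "h \<in> carrier G"
    then show "(\<lambda>g\<in>carrier G. ?\<phi> (nat g)) (g \<otimes>\<^bsub>G\<^esub> h) \<star> ActM C g h X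
        = (\<lambda>g\<in>carrier G. ?\<phi> (nat g)) g \<star> ActA C g ((\<lambda>g\<in>carrier G. ?\<phi> (nat g)) h)"
      using coc[of "nat g" "nat h"] by (simp add: en nat_G_mult \<phi>mod)
  qed simp_all
  then show ?thesis by blast
qed

section \<open>Orbits of multiplication by c\<close>

definition orbit :: "'a \<Rightarrow> 'a set" where
  "orbit v = (\<lambda>k. c ^ nat k * v) ` carrier G"

lemma nonzero_orbits_eq: "nonzero_orbits p c = orbit ` (UNIV - {0})"
  unfolding nonzero_orbits_def orbit_def[abs_def] G_eq[symmetric] by blast

text \<open>The action on nonzero elements is free, because \<open>c ^ k\<close> differs from 1 for
  0 < k < p.\<close>

lemma orbit_bij:
  assumes v: "v \<noteq> 0"
  shows "bij_betw (\<lambda>k. c ^ nat k * v) (carrier G) (orbit v)"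
proof -
  have "i = j" if ij: "i \<in> carrier G" "j \<in> carrier G" and le: "nat i \<le> nat j" and eq: "c ^ nat i * v = c ^ nat j * v" for i j
  proof (rule ccontr)
    assume ne: "i \<noteq> j"
    have "c ^ nat j = c ^ nat i * c ^ (nat j - nat i)" using le by (simp flip: power_add)
    then have "c ^ (nat j - nat i) = 1" using eq v c_ne_0 by simp
    moreover have "0 < nat j - nat i" "nat j - nat i < p" using ij le ne by (auto simp: in_G)
    ultimately show False using c_pow_ne_1 by blast
  qed
  then have "inj_on (\<lambda>k. c ^ nat k * v) (carrier G)" by (intro inj_onI) (metis nle_le)
  then show ?thesis by (simp add: bij_betw_def orbit_def)
qed

lemma card_carrier_G: "card (carrier G) = p"
  by (simp add: G_carrier)

lemma card_orbit: "v \<noteq> 0 \<Longrightarrow> card (orbit v) = p"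
  using bij_betw_same_card[OF orbit_bij] card_carrier_G by simp

lemma orbit_shift: "k \<in> carrier G \<Longrightarrow> orbit (c ^ nat k * v) = orbit v"
proof -
  have sub: "orbit (c ^ n * v) \<subseteq> orbit v" for n v
  proof
    fix x assume "x \<in> orbit (c ^ n * v)"
    then obtain k where "k \<in> carrier G" "x = c ^ (nat k + n) * v" by (auto simp: orbit_def power_add)
    then have "x = c ^ nat (int ((nat k + n) mod p)) * v" using power_mod_order[OF c_pow] by simp
    then show "x \<in> orbit v"
      unfolding orbit_def using p_gt_1 by - (rule image_eqI[of _ _ "int ((nat k + n) mod p)"], simp_all add: in_G)
  qed
  assume k: "k \<in> carrier G"
  \<comment> \<open>The complementary power leads back to \<open>v\<close>, which turns one
    inclusion of orbits into the reverse one.\<close>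
  have "c ^ (p - nat k) * (c ^ nat k * v) = v"
    using k c_pow by (simp add: in_G nat_le_iff flip: power_add mult.assoc)
  then have "orbit v \<subseteq> orbit (c ^ nat k * v)" using sub[of "p - nat k" "c ^ nat k * v"] by (simp only:)
  then show ?thesis using sub by blast
qed

lemma orbit_self: "v \<in> orbit v"
  unfolding orbit_def by (rule image_eqI[of _ _ 0]) simp_all

lemma orbit_eq: "x \<in> orbit v \<Longrightarrow> orbit x = orbit v"
  using orbit_shift by (auto simp: orbit_def[of v])

lemma orbit_nonzero: "\<O> \<in> nonzero_orbits p c \<Longrightarrow> v \<in> \<O> \<Longrightarrow> v \<noteq> 0 \<and> \<O> = orbit v"
proof -
  assume "\<O> \<in> nonzero_orbits p c" and v: "v \<in> \<O>"
  then obtain x where x: "x \<noteq> 0" "\<O> = orbit x" by (auto simp: nonzero_orbits_eq)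
  have "v \<noteq> 0" using v x c_ne_0 by (auto simp: orbit_def)
  then show "v \<noteq> 0 \<and> \<O> = orbit v" using orbit_eq[of v x] v x by simp
qed

lemma orbit_connected:
  assumes "\<O> \<in> nonzero_orbits p c" "a \<in> \<O>" "b \<in> \<O>"
  obtains k where "k \<in> carrier G" "b = c ^ nat k * a"
  using orbit_nonzero[OF assms(1,2)] assms(3) that by (auto simp: orbit_def)

lemma card_nonzero_orbits: "card (nonzero_orbits p c) = (q\<^sup>2 - 1) div p"
proof -
  have "p * card (nonzero_orbits p c) = card (\<Union> (nonzero_orbits p c))"
  proof (rule card_partition)
    show "finite (nonzero_orbits p c)" "finite (\<Union> (nonzero_orbits p c))" by simp_all
    show "card A = p" if "A \<in> nonzero_orbits p c" for A using that card_orbit by (auto simp: nonzero_orbits_eq)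
    fix A B assume "A \<in> nonzero_orbits p c" "B \<in> nonzero_orbits p c" "A \<noteq> B"
    then show "A \<inter> B = {}" using orbit_nonzero by blast
  qed
  also have "\<Union> (nonzero_orbits p c) = UNIV - {0}"
  proof
    show "\<Union> (nonzero_orbits p c) \<subseteq> UNIV - {0}" using orbit_nonzero by blast
    show "UNIV - {0} \<subseteq> \<Union> (nonzero_orbits p c)" using orbit_self by (auto simp: nonzero_orbits_eq)
  qed
  also have "card (UNIV - {0::'a}) = q\<^sup>2 - 1" using card_field by (subst card_Diff_subset) simp_all
  finally show ?thesis using p_gt_1 by (metis nonzero_mult_div_cancel_left not_less_zero)
qed

text \<open>The object induced from \<open>\<delta> v\<close> is the sum of the translates T_k
  \<open>(\<delta> v)\<close>, that is, of the \<open>\<delta> (c ^ k * v)\<close>. As the orbit is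
  free, these summands can be indexed by the elements of the orbit.\<close>

lemma orbit_object:
  assumes \<O>: "\<O> \<in> nonzero_orbits p c"
  shows "\<exists>X \<iota> \<pi> u. is_direct_sum C \<O> \<delta> X \<iota> \<pi> \<and> (X, u) \<in> equivariant_objects G C"
proof -
  obtain v where v: "v \<noteq> 0" "\<O> = orbit v" using \<O> by (auto simp: nonzero_orbits_eq)
  let ?T = "\<lambda>k. ActO C k (\<delta> v)" and ?f = "\<lambda>k. c ^ nat k * v"
  obtain X \<iota> \<pi> where ds0: "is_direct_sum C {..<p} (\<lambda>i. ?T (int i)) X \<iota> \<pi>"
    using direct_sums[of p "\<lambda>i. ?T (int i)"] by (auto simp: in_G)
  \<comment> \<open>Direct sums exist by assumption over initial segments of the natural numbers;
    the index set is moved to the group.\<close>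
  have bij: "bij_betw nat (carrier G) {..<p}"
    by (rule bij_betwI[where g = int]) (auto simp: in_G nat_less_iff)
  from direct_sum_reindex[OF ds0 bij]
  have "is_direct_sum C (carrier G) ?T X (\<lambda>k. \<iota> (nat k)) (\<lambda>k. \<pi> (nat k))"
    by (rule direct_sum_cong) (simp add: in_G)
  moreover from this obtain u where u: "(X, u) \<in> equivariant_objects G C" using induced_obj[OF \<delta>_Obj] by blast
  have "\<forall>k\<in>carrier G. \<exists>h. iso_arr h \<and> Dom C h = ?T k \<and> Cod C h = \<delta> (?f k)"
    using action_on_\<delta> by (metis isomorphicE)
  then obtain \<theta> where \<theta>: "\<forall>k\<in>carrier G. iso_arr (\<theta> k) \<and> Dom C (\<theta> k) = ?T k \<and> Cod C (\<theta> k) = \<delta> (?f k)"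
    by (rule bchoice[THEN exE])
  ultimately have "is_direct_sum C (carrier G) (\<lambda>k. \<delta> (?f k)) X (\<lambda>k. \<iota> (nat k) \<star> Inv C (\<theta> k)) (\<lambda>k. \<theta> k \<star> \<pi> (nat k))"
    by (intro direct_sum_change_summands) simp_all
  moreover have h: "bij_betw (the_inv_into (carrier G) ?f) \<O> (carrier G)"
    using bij_betw_the_inv_into[OF orbit_bij[OF v(1)]] v(2) by simp
  ultimately have "\<exists>\<iota> \<pi>. is_direct_sum C \<O> (\<lambda>a. \<delta> (?f (the_inv_into (carrier G) ?f a))) X \<iota> \<pi>"
    using direct_sum_reindex by blast
  then obtain \<iota>' \<pi>' where "is_direct_sum C \<O> (\<lambda>a. \<delta> (?f (the_inv_into (carrier G) ?f a))) X \<iota>' \<pi>'" by blast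
  then have "is_direct_sum C \<O> \<delta> X \<iota>' \<pi>'"
    by (rule direct_sum_cong) (use f_the_inv_into_f_bij_betw[OF orbit_bij[OF v(1)]] v(2) in simp)
  then show ?thesis using u by blast
qed

section \<open>Simple objects of the equivariantization\<close>

text \<open>A fixed equivariant object in every degree, from which the others arise by twisting. In
  degree 0 the unit carries its canonical structure, so that its twists are the objects (1,
  \<chi>).\<close>

definition base :: "int \<Rightarrow> 'o \<times> (int \<Rightarrow> 'm)" where
  "base i = (if i = 0 then (Unit C, unit_structure G C) else (X\<^sub>s i, SOME u. (X\<^sub>s i, u) \<in> equivariant_objects G C))"

lemma base:
  assumes i: "i \<in> carrier G"
  shows "base i \<in> equivariant_objects G C" "simple C (fst (base i))" "fst (base i) \<in> Deg C i"
proof -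
  have "(X\<^sub>s i, SOME u. (X\<^sub>s i, u) \<in> equivariant_objects G C) \<in> equivariant_objects G C" if "i \<noteq> 0"
  proof (rule someI_ex[OF cyclic_equivariant_structure])
    show "simple C (X\<^sub>s i)" by (rule X\<^sub>s(1)[OF i])
    show "isomorphic C (ActO C 1 (X\<^sub>s i)) (X\<^sub>s i)" using that i p_gt_1 by (intro action_on_X\<^sub>s) (auto simp: in_G)
  qed
  then show "base i \<in> equivariant_objects G C" "simple C (fst (base i))" "fst (base i) \<in> Deg C i"
    using unit_obj X\<^sub>s[OF i] simple_Unit Unit_Deg by (simp_all add: base_def)
qed

text \<open>The degree excludes the objects X_i, and the nonzero label excludes the unit.\<close>

lemma base_not_iso_\<delta>:
  assumes i: "i \<in> carrier G" and a: "a \<noteq> 0"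
  shows "\<not> isomorphic C (fst (base i)) (\<delta> a)"
proof
  assume iso: "isomorphic C (fst (base i)) (\<delta> a)"
  have "\<delta> a \<in> Deg C i" by (rule Deg_isomorphic[OF i base(3)[OF i] iso])
  then have "i = 0" using Deg_unique[OF i zero_in_G _ \<delta>_Deg \<delta>_nonzero] by blast
  then have "isomorphic C (Unit C) (\<delta> a)" using iso by (simp add: base_def)
  from isomorphic_trans[OF isomorphic_sym[OF this] Unit_iso_\<delta>] show False using \<delta>_inj a by blast
qed

definition twist :: "int \<Rightarrow> (int \<Rightarrow> complex) \<Rightarrow> 'o \<times> (int \<Rightarrow> 'm)" where
  "twist i \<chi> = (fst (base i), twisted_structure G C \<chi> (snd (base i)))"

lemma fst_twist [simp]: "fst (twist i \<chi>) = fst (base i)" by (simp add: twist_def)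

lemma snd_twist: "g \<in> carrier G \<Longrightarrow> snd (twist i \<chi>) g = ScaleArr C (\<chi> g) (snd (base i) g)"
  by (simp add: twist_def twisted_structure_def)

lemma twist_obj: "i \<in> carrier G \<Longrightarrow> \<chi> \<in> characters G \<Longrightarrow> twist i \<chi> \<in> equivariant_objects G C"
  unfolding twist_def using twisted_obj[of "fst (base i)" "snd (base i)"] base(1)[of i] by simp

definition orbit_obj :: "'a set \<Rightarrow> 'o \<times> (int \<Rightarrow> 'm)" where
  "orbit_obj \<O> = (SOME x. x \<in> equivariant_objects G C \<and> (\<exists>\<iota> \<pi>. is_direct_sum C \<O> \<delta> (fst x) \<iota> \<pi>))"

lemma orbit_obj:
  assumes \<O>: "\<O> \<in> nonzero_orbits p c"
  shows "orbit_obj \<O> \<in> equivariant_objects G C" "\<exists>\<iota> \<pi>. is_direct_sum C \<O> \<delta> (fst (orbit_obj \<O>)) \<iota> \<pi>"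
proof -
  have "\<exists>x. x \<in> equivariant_objects G C \<and> (\<exists>\<iota> \<pi>. is_direct_sum C \<O> \<delta> (fst x) \<iota> \<pi>)"
    using orbit_object[OF \<O>] by fastforce
  from someI_ex[OF this]
  show "orbit_obj \<O> \<in> equivariant_objects G C" "\<exists>\<iota> \<pi>. is_direct_sum C \<O> \<delta> (fst (orbit_obj \<O>)) \<iota> \<pi>"
    by (simp_all add: orbit_obj_def)
qed

text \<open>Different labels give non-isomorphic simple objects, so every component of
  \<open>g\<close> other than the one at \<open>a\<close> vanishes, and that one is a
  scalar.\<close>

lemma orbit_component:
  assumes ds: "is_direct_sum C \<O> \<delta> X \<iota> \<pi>" and a: "a \<in> \<O>" and g: "g \<in> Hom C (\<delta> a) X"
  shows "\<exists>z. g = ScaleArr C z (\<iota> a)"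
proof -
  note d [simp] = direct_sumD[OF ds] and g' [simp] = g[unfolded Hom_iff] and a [simp]
  obtain z where z: "\<pi> a \<star> g = ScaleArr C z (Idt C (\<delta> a))" using simple_endo_scalar[OF \<delta>_simple, of "\<pi> a \<star> g" a] by auto
  have "g = ScaleArr C z (\<iota> a)"
  proof (rule direct_sum_ext[OF ds])
    fix b assume b [simp]: "b \<in> \<O>"
    show "\<pi> b \<star> g = \<pi> b \<star> ScaleArr C z (\<iota> a)"
    proof (cases "b = a")
      case False
      have "\<pi> b \<star> g = ZeroArr C (\<delta> a) (\<delta> b)"
        using False \<delta>_inj by (intro hom_simple_zero \<delta>_simple) auto
      then show ?thesis using False by simp
    qed (simp add: z)
  qed simp_all
  then show ?thesis by blast
qed

text \<open>The group permutes the summands of an orbit sum transitively, so an equivariant arrow is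
  determined by its restriction to a single one.\<close>

lemma orbit_eqv_zero:
  assumes \<O>: "\<O> \<in> nonzero_orbits p c" and ds: "is_direct_sum C \<O> \<delta> (fst x) \<iota> \<pi>"
    and x: "x \<in> equivariant_objects G C" and y: "y \<in> equivariant_objects G C"
    and h: "h \<in> Hom C (fst x) (fst y)" "eqv (snd x) (snd y) h" and a: "a \<in> \<O>" and ha: "h \<star> \<iota> a = ZeroArr C (\<delta> a) (fst y)"
  shows "h = ZeroArr C (fst x) (fst y)"
proof (rule direct_sum_ext'[OF ds])
  note d [simp] = direct_sumD[OF ds] and h' [simp] = h(1)[unfolded Hom_iff] and a [simp]
  note [simp] = eobj(1-5)[OF x] eobj(1-5)[OF y]
  fix b assume b [simp]: "b \<in> \<O>"
  obtain k where k [simp]: "k \<in> carrier G" and bk: "b = c ^ nat k * a" by (rule orbit_connected[OF \<O> a b])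
  obtain \<theta> where \<theta> [simp]: "iso_arr \<theta>" "Dom C \<theta> = ActO C k (\<delta> a)" "Cod C \<theta> = \<delta> b"
    using action_on_\<delta>[OF k, of a] unfolding bk[symmetric] by (rule isomorphicE)
  \<comment> \<open>The translate by k of the inclusion at \<open>a\<close>, made an arrow from
    \<open>\<delta> b\<close>; it is a nonzero multiple of the inclusion at
    \<open>b\<close>.\<close>
  let ?g = "snd x k \<star> ActA C k (\<iota> a) \<star> Inv C \<theta>"
  obtain z where z: "?g = ScaleArr C z (\<iota> b)" using orbit_component[OF ds b, of ?g] by auto
  have "z \<noteq> 0"
  proof
    assume "z = 0"
    then have "?g = ZeroArr C (\<delta> b) (fst x)" using z by simp
    then have "(ActA C k (\<pi> a) \<star> Inv C (snd x k)) \<star> ?g = ZeroArr C (\<delta> b) (ActO C k (\<delta> a))" by (simp del: comp_assoc)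
    moreover have "(ActA C k (\<pi> a) \<star> Inv C (snd x k)) \<star> ?g = ActA C k (\<pi> a \<star> \<iota> a) \<star> Inv C \<theta>"
      by (simp del: d(10) add: act_comp)
    ultimately have "Inv C \<theta> = ZeroArr C (\<delta> b) (ActO C k (\<delta> a))" by simp
    then have "\<theta> \<star> Inv C \<theta> = ZeroArr C (\<delta> b) (\<delta> b)" by simp
    then show False using \<delta>_nonzero[of b] by (simp add: zero_object_def)
  qed
  have "h \<star> ?g = (h \<star> snd x k) \<star> ActA C k (\<iota> a) \<star> Inv C \<theta>" by simp
  also have "\<dots> = snd y k \<star> ActA C k (h \<star> \<iota> a) \<star> Inv C \<theta>" unfolding eqvD[OF h(2) k] by simp
  also have "\<dots> = ZeroArr C (\<delta> b) (fst y)" unfolding ha by simp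
  finally have "ScaleArr C z (h \<star> \<iota> b) = ZeroArr C (\<delta> b) (fst y)" unfolding z by simp
  then have "h \<star> \<iota> b = ZeroArr C (\<delta> b) (fst y)" using \<open>z \<noteq> 0\<close> scale_eq_zero_iff[of "h \<star> \<iota> b" "\<delta> b" "fst y" z] by simp
  then show "h \<star> \<iota> b = ZeroArr C (fst x) (fst y) \<star> \<iota> b" by simp
qed (use eobj(1)[OF x] eobj(1)[OF y] h(1) in simp_all)

text \<open>The difference of \<open>h\<close> and z times the identity is equivariant and vanishes
  on one summand.\<close>

lemma orbit_scalar:
  assumes \<O>: "\<O> \<in> nonzero_orbits p c" and ds: "is_direct_sum C \<O> \<delta> (fst x) \<iota> \<pi>"
    and x: "x \<in> equivariant_objects G C"
    and h: "h \<in> Hom C (fst x) (fst x)" "eqv (snd x) (snd x) h" and a: "a \<in> \<O>" and ha: "h \<star> \<iota> a = ScaleArr C z (\<iota> a)"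
  shows "h = ScaleArr C z (Idt C (fst x))"
proof -
  note d [simp] = direct_sumD[OF ds] and h' [simp] = h(1)[unfolded Hom_iff] and a [simp]
  let ?I = "ScaleArr C (- z) (Idt C (fst x))"
  have I: "eqv (snd x) (snd x) ?I" by (intro eqv_scale x eqv_idt) simp
  have "AddArr C h ?I = ZeroArr C (fst x) (fst x)"
  proof (rule orbit_eqv_zero[OF \<O> ds x x _ _ a])
    show "eqv (snd x) (snd x) (AddArr C h ?I)" by (intro eqv_add x h I) simp
    show "AddArr C h ?I \<star> \<iota> a = ZeroArr C (\<delta> a) (fst x)"
      using ha scale_add_left[of "\<iota> a" z "- z"] by (simp add: comp_add_left)
  qed simp
  then show ?thesis using eq_if_diff_zero[of h "ScaleArr C z (Idt C (fst x))"] by simp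
qed

text \<open>The term of the average at k \<noteq> 0 factors through an arrow from
  \<open>\<delta> a\<close> to T_k \<open>(\<delta> a)\<close>. The latter has the label c^k a,
  which differs from a, so only the neutral term survives.\<close>

lemma avg_factor_\<delta>:
  assumes x: "x \<in> equivariant_objects G C" and y: "y \<in> equivariant_objects G C" and a: "a \<noteq> 0"
    and r: "r \<in> Hom C (fst x) (\<delta> a)" and b: "b \<in> Hom C (\<delta> a) (fst y)" and g: "g \<in> Hom C (\<delta> a) (fst x)"
  shows "avg x y (b \<star> r) \<star> g = b \<star> r \<star> g"
proof -
  note [simp] = eobj(1-5)[OF x] eobj(1-5)[OF y] r[unfolded Hom_iff] b[unfolded Hom_iff] g[unfolded Hom_iff]
  have br: "b \<star> r \<in> Hom C (fst x) (fst y)" by simp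
  have ca [simp]: "conj_act x y k (b \<star> r) \<in> Arr C" "Dom C (conj_act x y k (b \<star> r)) = fst x"
    "Cod C (conj_act x y k (b \<star> r)) = fst y" if "k \<in> carrier G" for k
    using conj_act_arr[OF x y that br] by simp_all
  have "avg x y (b \<star> r) \<star> g = hsum (\<delta> a) (fst y) (\<lambda>k. conj_act x y k (b \<star> r) \<star> g) (carrier G)"
    unfolding avg_def by (subst comp_hsum_left) simp_all
  also have "\<dots> = conj_act x y 0 (b \<star> r) \<star> g"
  proof (rule hsum_single)
    fix k assume k [simp]: "k \<in> carrier G" and "k \<noteq> 0"
    let ?m = "ActA C k r \<star> Inv C (snd x k) \<star> g"
    have "?m = ZeroArr C (\<delta> a) (ActO C k (\<delta> a))"
    proof (rule hom_simple_zero[OF \<delta>_simple act_simple[OF k \<delta>_simple]])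
      show "\<not> isomorphic C (\<delta> a) (ActO C k (\<delta> a))"
      proof
        assume "isomorphic C (\<delta> a) (ActO C k (\<delta> a))"
        from \<delta>_inj[OF isomorphic_trans[OF this action_on_\<delta>[OF k]]] have "c ^ nat k = 1" using a by simp
        then show False using c_pow_ne_1[of "nat k"] k \<open>k \<noteq> 0\<close> by (auto simp: in_G nat_less_iff)
      qed
    qed simp
    then have "snd y k \<star> ActA C k b \<star> ?m = ZeroArr C (\<delta> a) (fst y)" by (simp del: comp_assoc)
    then show "conj_act x y k (b \<star> r) \<star> g = ZeroArr C (\<delta> a) (fst y)" by (simp add: conj_act_def)
  qed (use finite_G in simp_all)
  also have "conj_act x y 0 (b \<star> r) = b \<star> r" using conj_act_one[OF x y br] by simp
  finally show ?thesis by simp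
qed

text \<open>Maschke's argument: averaging a retraction and dividing by the group order p makes it
  equivariant.\<close>

lemma avg_retraction:
  assumes x: "x \<in> equivariant_objects G C" and z: "z \<in> equivariant_objects G C"
    and f: "f \<in> Hom C (fst z) (fst x)" "eqv (snd z) (snd x) f" and r: "r \<in> Hom C (fst x) (fst z)" "r \<star> f = Idt C (fst z)"
  obtains r' where "r' \<in> Hom C (fst x) (fst z)" "eqv (snd x) (snd z) r'" "r' \<star> f = Idt C (fst z)"
proof
  note [simp] = eobj(1)[OF x] eobj(1)[OF z] f(1)[unfolded Hom_iff] r(1)[unfolded Hom_iff]
  note a = avg_arr[OF x z r(1)]
  then have a' [simp]: "avg x z r \<in> Arr C" "Dom C (avg x z r) = fst x" "Cod C (avg x z r) = fst z" by simp_all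
  have "avg x z r \<star> f = ScaleArr C (of_nat p) (Idt C (fst z))"
    using avg_comp_right[OF z x z r(1) f] avg_of_eqv[OF z z _ eqv_idt[OF z]] r(2) card_carrier_G by simp
  then show "ScaleArr C (inverse (of_nat p)) (avg x z r) \<star> f = Idt C (fst z)" using p_gt_1 by simp
  show "ScaleArr C (inverse (of_nat p)) (avg x z r) \<in> Hom C (fst x) (fst z)" by simp
  show "eqv (snd x) (snd z) (ScaleArr C (inverse (of_nat p)) (avg x z r))"
    by (rule eqv_scale[OF x z a avg_eqv[OF x z r(1)]])
qed

text \<open>Summing the averages over all characters leaves p times the term at the neutral element,
  that is, p times \<open>g\<close>, by orthogonality. So the average for at least one character is
  nonzero.\<close>

lemma twist_hom:
  assumes x: "x \<in> equivariant_objects G C" and i: "i \<in> carrier G" and g: "g \<in> Hom C (fst (base i)) (fst x)"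
    "g \<noteq> ZeroArr C (fst (base i)) (fst x)"
  obtains \<chi> where "\<chi> \<in> characters G" "avg (twist i \<chi>) x g \<noteq> ZeroArr C (fst (base i)) (fst x)"
proof -
  note B = base(1)[OF i]
  note [simp] = eobj(1)[OF x] eobj(1)[OF B] g(1)[unfolded Hom_iff]
  let ?B = "fst (base i)" and ?a = "\<lambda>k. conj_act (base i) x k g"
  have ca [simp]: "?a k \<in> Arr C" "Dom C (?a k) = ?B" "Cod C (?a k) = fst x" if "k \<in> carrier G" for k
    using conj_act_arr[OF B x that g(1)] by simp_all
  have avg: "avg (twist i \<chi>) x g = hsum ?B (fst x) (\<lambda>k. ScaleArr C (inverse (\<chi> k)) (?a k)) (carrier G)"
    if "\<chi> \<in> characters G" for \<chi>
    unfolding avg_def fst_twist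
  proof (rule hsum_cong)
    fix k assume k: "k \<in> carrier G"
    show "conj_act (twist i \<chi>) x k g = ScaleArr C (inverse (\<chi> k)) (?a k)"
      using conj_act_twisted[of ?B "snd (base i)" x \<chi> k g] B x that k by (simp add: twist_def)
  qed simp_all
  have "hsum ?B (fst x) (\<lambda>\<chi>. avg (twist i \<chi>) x g) (characters G)
      = hsum ?B (fst x) (\<lambda>\<chi>. hsum ?B (fst x) (\<lambda>k. ScaleArr C (inverse (\<chi> k)) (?a k)) (carrier G)) (characters G)"
    by (rule hsum_cong) (simp_all add: avg)
  also have "\<dots> = hsum ?B (fst x) (\<lambda>k. hsum ?B (fst x) (\<lambda>\<chi>. ScaleArr C (inverse (\<chi> k)) (?a k)) (characters G)) (carrier G)"
    by (rule hsum_swap) (simp_all add: finite_G finite_characters)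
  also have "\<dots> = hsum ?B (fst x) (\<lambda>k. ScaleArr C (if k = 0 then of_nat p else 0) (?a k)) (carrier G)"
  proof (rule hsum_cong)
    fix k assume k: "k \<in> carrier G"
    then show "hsum ?B (fst x) (\<lambda>\<chi>. ScaleArr C (inverse (\<chi> k)) (?a k)) (characters G)
        = ScaleArr C (if k = 0 then of_nat p else 0) (?a k)"
      using hsum_scale_sum[of "?a k" "characters G" "\<lambda>\<chi>. inverse (\<chi> k)"] finite_characters
      by (simp add: character_orthogonality)
  qed simp_all
  also have "\<dots> = ScaleArr C (if (0::int) = 0 then of_nat p else 0) (?a 0)"
    by (rule hsum_single) (simp_all add: finite_G)
  also have "?a 0 = g" using conj_act_one[OF B x g(1)] by simp
  finally have sum: "hsum ?B (fst x) (\<lambda>\<chi>. avg (twist i \<chi>) x g) (characters G) = ScaleArr C (of_nat p) g" by simp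
  have "\<exists>\<chi>\<in>characters G. avg (twist i \<chi>) x g \<noteq> ZeroArr C ?B (fst x)"
  proof (rule ccontr)
    assume "\<not> ?thesis"
    then have "hsum ?B (fst x) (\<lambda>\<chi>. avg (twist i \<chi>) x g) (characters G) = ZeroArr C ?B (fst x)"
      by (intro hsum_zero) simp_all
    then show False using sum scale_eq_zero_iff[of g ?B "fst x" "of_nat p"] g(2) p_gt_1 by simp
  qed
  then show thesis using that by blast
qed

section \<open>The list of equivariant objects and its completeness\<close>

definition J\<^sub>D :: "((int \<times> (int \<Rightarrow> complex)) + 'a set) set" where
  "J\<^sub>D = (carrier G \<times> characters G) <+> nonzero_orbits p c"

definition s\<^sub>D :: "(int \<times> (int \<Rightarrow> complex)) + 'a set \<Rightarrow> 'o \<times> (int \<Rightarrow> 'm)" where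
  "s\<^sub>D = case_sum (\<lambda>(i, \<chi>). twist i \<chi>) orbit_obj"

lemma s\<^sub>D_simps [simp]: "s\<^sub>D (Inl (i, \<chi>)) = twist i \<chi>" "s\<^sub>D (Inr \<O>) = orbit_obj \<O>"
  "Inl (i, \<chi>) \<in> J\<^sub>D \<longleftrightarrow> i \<in> carrier G \<and> \<chi> \<in> characters G" "Inr \<O> \<in> J\<^sub>D \<longleftrightarrow> \<O> \<in> nonzero_orbits p c"
  by (auto simp: s\<^sub>D_def J\<^sub>D_def)

lemma J\<^sub>D_cases:
  assumes "j \<in> J\<^sub>D"
  obtains i \<chi> where "j = Inl (i, \<chi>)" "i \<in> carrier G" "\<chi> \<in> characters G" | \<O> where "j = Inr \<O>" "\<O> \<in> nonzero_orbits p c"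
  using assms unfolding J\<^sub>D_def by auto

lemma s\<^sub>D_obj: "j \<in> J\<^sub>D \<Longrightarrow> s\<^sub>D j \<in> equivariant_objects G C"
  by (erule J\<^sub>D_cases) (simp_all add: twist_obj orbit_obj(1))

lemma s\<^sub>D_nonzero:
  assumes j: "j \<in> J\<^sub>D"
  shows "\<not> zero_object C (fst (s\<^sub>D j))"
  using j
proof (cases rule: J\<^sub>D_cases)
  case (1 i \<chi>)
  then show ?thesis using simple_nonzero[OF base(2)] by simp
next
  case (2 \<O>)
  obtain \<iota> \<pi> where ds: "is_direct_sum C \<O> \<delta> (fst (orbit_obj \<O>)) \<iota> \<pi>" using orbit_obj(2)[OF 2(2)] by blast
  obtain a where "a \<in> \<O>" using 2(2) orbit_self by (auto simp: nonzero_orbits_eq)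
  then have "zero_object C (\<delta> a)" if "zero_object C (fst (orbit_obj \<O>))"
    using retract_of_zero[of "\<iota> a" "\<pi> a"] direct_sumD[OF ds] that by simp
  then show ?thesis using \<delta>_nonzero[of a] 2(1) by auto
qed

lemma s\<^sub>D_scalar:
  assumes j: "j \<in> J\<^sub>D" and f: "f \<in> Hom D (s\<^sub>D j) (s\<^sub>D j)"
  shows "\<exists>a. f = ScaleArr D a (Idt D (s\<^sub>D j))"
proof -
  note f' = f[unfolded D_Hom]
  have "\<exists>a. mid f = ScaleArr C a (Idt C (fst (s\<^sub>D j)))"
    using j
  proof (cases rule: J\<^sub>D_cases)
    case (1 i \<chi>)
    then show ?thesis using simple_endo_scalar[OF base(2)[OF 1(2)], of "mid f"] f' by simp
  next
    case (2 \<O>)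
    let ?x = "orbit_obj \<O>"
    obtain \<iota> \<pi> where ds: "is_direct_sum C \<O> \<delta> (fst ?x) \<iota> \<pi>" using orbit_obj(2)[OF 2(2)] by blast
    obtain a where a: "a \<in> \<O>" using 2(2) orbit_self by (auto simp: nonzero_orbits_eq)
    have m: "mid f \<in> Hom C (fst ?x) (fst ?x)" "eqv (snd ?x) (snd ?x) (mid f)" using f' 2(1) by simp_all
    obtain z where z: "mid f \<star> \<iota> a = ScaleArr C z (\<iota> a)"
      using orbit_component[OF ds a, of "mid f \<star> \<iota> a"] m(1) direct_sumD[OF ds] a by auto
    have "mid f = ScaleArr C z (Idt C (fst ?x))"
      by (rule orbit_scalar[OF 2(2) ds orbit_obj(1)[OF 2(2)] m a z])
    then show ?thesis using 2(1) by auto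
  qed
  then obtain a where "mid f = ScaleArr C a (Idt C (fst (s\<^sub>D j)))" by blast
  then have "f = ScaleArr D a (Idt D (s\<^sub>D j))" using f' by (intro prod_eqI) simp_all
  then show ?thesis by blast
qed

text \<open>A nonzero arrow preserves the degree and is then a nonzero scalar by Schur's lemma;
  equivariance compares the two characters at each group element.\<close>

lemma twist_orthogonal:
  assumes i: "i \<in> carrier G" and j: "j \<in> carrier G" and \<chi>: "\<chi> \<in> characters G" and \<psi>: "\<psi> \<in> characters G"
    and f: "f \<in> Hom C (fst (base i)) (fst (base j))" "eqv (snd (twist i \<chi>)) (snd (twist j \<psi>)) f"
    "f \<noteq> ZeroArr C (fst (base i)) (fst (base j))"
  shows "i = j" "\<chi> = \<psi>"
proof -
  show ij: "i = j" by (rule Deg_hom_zero[OF i j base(3)[OF i] base(3)[OF j] f(1,3)])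
  let ?B = "fst (base i)"
  note B [simp] = eobj(1-5)[OF base(1)[OF i]]
  obtain a where a: "f = ScaleArr C a (Idt C ?B)" using simple_endo_scalar[OF base(2)[OF i]] f(1) ij by blast
  have a0: "a \<noteq> 0" using a f(3) ij eobj(1)[OF base(1)[OF j]] by auto
  have "\<chi> g = \<psi> g" if g [simp]: "g \<in> carrier G" for g
  proof -
    let ?u = "snd (base i) g"
    have "f \<star> snd (twist i \<chi>) g = snd (twist i \<psi>) g \<star> ActA C g f" using eqvD[OF f(2) g] ij by simp
    then have "ScaleArr C (a * \<chi> g) ?u = ScaleArr C (a * \<psi> g) ?u" by (simp add: snd_twist a mult.commute)
    then have "ScaleArr C (a * \<chi> g) ?u \<star> Inv C ?u = ScaleArr C (a * \<psi> g) ?u \<star> Inv C ?u" by simp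
    then have eq: "ScaleArr C (a * \<chi> g) (Idt C ?B) = ScaleArr C (a * \<psi> g) (Idt C ?B)" by simp
    have "ScaleArr C (a * \<chi> g - a * \<psi> g) (Idt C ?B) = ZeroArr C ?B ?B"
      using scale_add_left[of "Idt C ?B" "a * \<chi> g" "- (a * \<psi> g)"] scale_add_left[of "Idt C ?B" "a * \<psi> g" "- (a * \<psi> g)"] eq
      by simp
    moreover have "Idt C ?B \<noteq> ZeroArr C ?B ?B" using simple_nonzero[OF base(2)[OF i]] by (simp add: zero_object_def)
    ultimately have "a * \<chi> g = a * \<psi> g" using scale_eq_zero_iff[of "Idt C ?B" ?B ?B] by simp
    then show ?thesis using a0 by simp
  qed
  then show "\<chi> = \<psi>" using \<chi> \<psi> by (intro extensionalityI[of _ "carrier G"]) (simp_all add: characters_def)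
qed

lemma orbit_not_0: "\<O> \<in> nonzero_orbits p c \<Longrightarrow> a \<in> \<O> \<Longrightarrow> a \<noteq> 0"
  using orbit_nonzero by blast

text \<open>Underlying objects of different members have no simple constituent in common, except for
  twists of the same base object, which the characters separate.\<close>

lemma s\<^sub>D_orthogonal:
  assumes i: "i \<in> J\<^sub>D" and j: "j \<in> J\<^sub>D" and ij: "i \<noteq> j" and f: "f \<in> Hom D (s\<^sub>D i) (s\<^sub>D j)"
  shows "f = ZeroArr D (s\<^sub>D i) (s\<^sub>D j)"
proof -
  have f': "mid f \<in> Hom C (fst (s\<^sub>D i)) (fst (s\<^sub>D j))" "eqv (snd (s\<^sub>D i)) (snd (s\<^sub>D j)) (mid f)"
    "fst f = s\<^sub>D i" "snd (snd f) = s\<^sub>D j" using f unfolding D_Hom by simp_all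
  note [simp] = f'(1)[unfolded Hom_iff]
  have [simp]: "fst (s\<^sub>D i) \<in> Obj C" "fst (s\<^sub>D j) \<in> Obj C" using eobj(1)[OF s\<^sub>D_obj] i j by simp_all
  have "mid f = ZeroArr C (fst (s\<^sub>D i)) (fst (s\<^sub>D j))"
    using i
  proof (cases rule: J\<^sub>D_cases)
    case i: (1 k \<chi>)
    show ?thesis
      using j
    proof (cases rule: J\<^sub>D_cases)
      case j: (1 l \<psi>)
      show ?thesis
      proof (rule ccontr)
        assume "mid f \<noteq> ZeroArr C (fst (s\<^sub>D i)) (fst (s\<^sub>D j))"
        then have "k = l" "\<chi> = \<psi>" using twist_orthogonal[OF i(2) j(2) i(3) j(3), of "mid f"] f'(1,2) i(1) j(1) by simp_all
        then show False using i(1) j(1) ij by simp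
      qed
    next
      case j: (2 \<O>)
      obtain \<iota> \<pi> where ds': "is_direct_sum C \<O> \<delta> (fst (orbit_obj \<O>)) \<iota> \<pi>" using orbit_obj(2)[OF j(2)] by blast
      then have ds: "is_direct_sum C \<O> \<delta> (fst (s\<^sub>D j)) \<iota> \<pi>" by (simp add: j(1))
      note d [simp] = direct_sumD[OF ds]
      show ?thesis
      proof (rule direct_sum_ext[OF ds])
        fix a assume a [simp]: "a \<in> \<O>"
        have "\<pi> a \<star> mid f = ZeroArr C (fst (s\<^sub>D i)) (\<delta> a)"
          using base(2)[OF i(2)] base_not_iso_\<delta>[OF i(2) orbit_not_0[OF j(2) a]] i(1)
          by (intro hom_simple_zero \<delta>_simple) simp_all
        then show "\<pi> a \<star> mid f = \<pi> a \<star> ZeroArr C (fst (s\<^sub>D i)) (fst (s\<^sub>D j))" by simp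
      qed simp_all
    qed
  next
    case i: (2 \<O>)
    obtain \<iota> \<pi> where ds': "is_direct_sum C \<O> \<delta> (fst (orbit_obj \<O>)) \<iota> \<pi>" using orbit_obj(2)[OF i(2)] by blast
    then have ds: "is_direct_sum C \<O> \<delta> (fst (s\<^sub>D i)) \<iota> \<pi>" by (simp add: i(1))
    note d [simp] = direct_sumD[OF ds]
    have "mid f \<star> \<iota> a = ZeroArr C (\<delta> a) (fst (s\<^sub>D j))" if a [simp]: "a \<in> \<O>" for a
      using j
    proof (cases rule: J\<^sub>D_cases)
      case j: (1 l \<psi>)
      show ?thesis
        using base(2)[OF j(2)] base_not_iso_\<delta>[OF j(2) orbit_not_0[OF i(2) a]] isomorphic_sym j(1)
        by (intro hom_simple_zero \<delta>_simple) auto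
    next
      case j: (2 \<Q>)
      obtain \<iota>' \<pi>' where ds'': "is_direct_sum C \<Q> \<delta> (fst (orbit_obj \<Q>)) \<iota>' \<pi>'" using orbit_obj(2)[OF j(2)] by blast
      then have ds': "is_direct_sum C \<Q> \<delta> (fst (s\<^sub>D j)) \<iota>' \<pi>'" by (simp add: j(1))
      note d' [simp] = direct_sumD[OF ds']
      show ?thesis
      proof (rule direct_sum_ext[OF ds'])
        fix b assume b [simp]: "b \<in> \<Q>"
        have "a \<noteq> b" using orbit_nonzero[OF i(2) a] orbit_nonzero[OF j(2) b] ij i(1) j(1) by auto
        then have "\<pi>' b \<star> mid f \<star> \<iota> a = ZeroArr C (\<delta> a) (\<delta> b)"
          using \<delta>_inj by (intro hom_simple_zero \<delta>_simple) auto
        then show "\<pi>' b \<star> mid f \<star> \<iota> a = \<pi>' b \<star> ZeroArr C (\<delta> a) (fst (s\<^sub>D j))" by simp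
      qed simp_all
    qed
    then show ?thesis by - (rule direct_sum_ext'[OF ds], simp_all)
  qed
  then show ?thesis using f'(3,4) by (intro prod_eqI) simp_all
qed

text \<open>The idempotent \<open>E\<close> stands in for a subobject: averaging an arrow whose
  image \<open>E\<close> fixes gives an equivariant arrow with the same property, and averaging a
  retraction splits it.\<close>

lemma standard_subobject:
  assumes x: "x \<in> equivariant_objects G C" and E: "E \<in> Hom C (fst x) (fst x)" "eqv (snd x) (snd x) E" "E \<star> E = E"
    and nz: "E \<noteq> ZeroArr C (fst x) (fst x)"
  shows "\<exists>j f r. j \<in> J\<^sub>D \<and> f \<in> Hom C (fst (s\<^sub>D j)) (fst x) \<and> eqv (snd (s\<^sub>D j)) (snd x) f \<and> E \<star> f = f \<and>
    r \<in> Hom C (fst x) (fst (s\<^sub>D j)) \<and> eqv (snd x) (snd (s\<^sub>D j)) r \<and> r \<star> f = Idt C (fst (s\<^sub>D j))"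
proof -
  note [simp] = eobj(1)[OF x] E(1)[unfolded Hom_iff]
  have base_case: ?thesis if i: "i \<in> carrier G" and g: "g \<in> Hom C (fst (base i)) (fst x)" "E \<star> g = g"
    "g \<noteq> ZeroArr C (fst (base i)) (fst x)" for i g
  proof -
    obtain \<chi> where \<chi>: "\<chi> \<in> characters G" and a0: "avg (twist i \<chi>) x g \<noteq> ZeroArr C (fst (base i)) (fst x)"
      by (rule twist_hom[OF x i g(1,3)])
    let ?z = "twist i \<chi>"
    note z = twist_obj[OF i \<chi>]
    have g': "g \<in> Hom C (fst ?z) (fst x)" using g(1) by simp
    note f = avg_arr[OF z x g'] avg_eqv[OF z x g']
    have Ef: "E \<star> avg ?z x g = avg ?z x g" using avg_comp_left[OF z x x g' E(1,2)] g(2) by simp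
    obtain r where r: "r \<in> Hom C (fst x) (fst ?z)" "r \<star> avg ?z x g = Idt C (fst ?z)"
      using simple_retraction[of "avg ?z x g"] base(2)[OF i] f(1) a0 by auto
    obtain r' where "r' \<in> Hom C (fst x) (fst ?z)" "eqv (snd x) (snd ?z) r'" "r' \<star> avg ?z x g = Idt C (fst ?z)"
      by (rule avg_retraction[OF x z f r])
    then show ?thesis using f Ef i \<chi> by (intro exI[of _ "Inl (i, \<chi>)"] exI[of _ "avg ?z x g"] exI[of _ r']) simp_all
  qed
  \<comment> \<open>A simple constituent of the underlying object on which \<open>E\<close> does not
    vanish. It is some X_i, or isomorphic to the unit, or some \<open>\<delta> a\<close> with a
    nonzero.\<close>
  obtain j g where j: "j \<in> J" and g: "g \<in> Hom C (s j) (fst x)" and Eg: "E \<star> g \<noteq> ZeroArr C (s j) (fst x)"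
    using E.nonzero_component[of E] nz by auto
  note g' [simp] = g[unfolded Hom_iff]
  have EEg: "E \<star> E \<star> g = E \<star> g" using E(3) comp_assoc[of g E E] by simp
  show ?thesis
  proof (cases j)
    case (Inr i)
    then have i: "i \<in> carrier G" "fst (base i) = s j" using j by (simp_all add: base_def)
    show ?thesis by (rule base_case[OF i(1), of "E \<star> g"]) (use i(2) EEg Eg in simp_all)
  next
    case (Inl a)
    show ?thesis
    proof (cases "a = 0")
      case True
      \<comment> \<open>The label 0 is replaced by the unit itself, whose twists belong to the
        list.\<close>
      obtain \<theta> where \<theta> [simp]: "iso_arr \<theta>" "Dom C \<theta> = Unit C" "Cod C \<theta> = s j"
        using Unit_iso_\<delta> Inl True by (auto elim: isomorphicE)
      have b: "fst (base 0) = Unit C" by (simp add: base_def)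
      have "E \<star> g \<star> \<theta> \<noteq> ZeroArr C (Unit C) (fst x)"
      proof
        assume z: "E \<star> g \<star> \<theta> = ZeroArr C (Unit C) (fst x)"
        have "E \<star> g = (E \<star> g \<star> \<theta>) \<star> Inv C \<theta>" by simp
        then show False unfolding z using Eg by simp
      qed
      moreover have "E \<star> E \<star> g \<star> \<theta> = E \<star> g \<star> \<theta>"
        using E(3) comp_assoc[of "g \<star> \<theta>" E E] by simp
      ultimately show ?thesis using base_case[OF zero_in_G, of "E \<star> g \<star> \<theta>"] b by simp
    next
      case a: False
      let ?O = "orbit a" and ?h = "E \<star> g"
      have \<O>: "?O \<in> nonzero_orbits p c" using a by (simp add: nonzero_orbits_eq)
      let ?z = "orbit_obj ?O"
      note z = orbit_obj(1)[OF \<O>] and aO [simp] = orbit_self[of a]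
      obtain \<iota> \<pi> where ds: "is_direct_sum C ?O \<delta> (fst ?z) \<iota> \<pi>" using orbit_obj(2)[OF \<O>] by blast
      note d [simp] = direct_sumD[OF ds]
      have h [simp]: "?h \<in> Arr C" "Dom C ?h = \<delta> a" "Cod C ?h = fst x" using Inl by simp_all
      obtain r where r: "r \<in> Hom C (fst x) (\<delta> a)" "r \<star> ?h = Idt C (\<delta> a)"
        using simple_retraction[of ?h] \<delta>_simple[of a] Eg Inl by auto
      note r' [simp] = r(1)[unfolded Hom_iff]
      \<comment> \<open>The arrow \<open>?h\<close> and its retraction are spread over the orbit by
        averaging. The composite \<open>?R \<star> ?F\<close> fixes the inclusion at
        \<open>a\<close>, so by equivariance it is the identity; thus no division by p occurs
        here.\<close>
      let ?F = "avg ?z x (?h \<star> \<pi> a)" and ?R = "avg x ?z (\<iota> a \<star> r)"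
      have h\<pi>: "?h \<star> \<pi> a \<in> Hom C (fst ?z) (fst x)" and \<iota>r: "\<iota> a \<star> r \<in> Hom C (fst x) (fst ?z)" by simp_all
      note F = avg_arr[OF z x h\<pi>] avg_eqv[OF z x h\<pi>] and R = avg_arr[OF x z \<iota>r] avg_eqv[OF x z \<iota>r]
      have F\<iota>: "?F \<star> \<iota> a = ?h"
        using avg_factor_\<delta>[OF z x a, of "\<pi> a" ?h "\<iota> a"] by (simp del: comp_assoc)
      have Rh: "?R \<star> ?h = \<iota> a"
        using avg_factor_\<delta>[OF x z a r(1), of "\<iota> a" ?h] r(2) by (simp del: comp_assoc)
      have RF: "?R \<star> ?F \<in> Hom C (fst ?z) (fst ?z)" using F(1) R(1) by simp
      have "(?R \<star> ?F) \<star> \<iota> a = ?R \<star> ?F \<star> \<iota> a" using F(1) R(1) by simp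
      also have "\<dots> = ScaleArr C 1 (\<iota> a)" unfolding F\<iota> Rh by simp
      finally have "?R \<star> ?F = ScaleArr C 1 (Idt C (fst ?z))"
        by (rule orbit_scalar[OF \<O> ds z RF eqv_comp[OF z x z F R] aO])
      moreover have "E \<star> ?F = ?F"
      proof -
        have "E \<star> ?h \<star> \<pi> a = (E \<star> ?h) \<star> \<pi> a" using Inl by (intro comp_assoc[symmetric]) simp_all
        then have "E \<star> ?h \<star> \<pi> a = ?h \<star> \<pi> a" unfolding EEg .
        then show ?thesis using avg_comp_left[OF z x x h\<pi> E(1,2)] by (simp only:)
      qed
      ultimately show ?thesis
        using F R \<O> by (intro exI[of _ "Inr ?O"] exI[of _ ?F] exI[of _ ?R]) simp
    qed
  qed
qed

lemma finite_J\<^sub>D: "finite J\<^sub>D"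
  by (simp add: J\<^sub>D_def finite_G finite_characters)

lemma D_decomposition:
  assumes x: "x \<in> Obj D"
  shows "\<exists>(n::nat) k \<iota> \<pi>. (\<forall>i<n. k i \<in> J\<^sub>D) \<and> is_direct_sum D {..<n} (\<lambda>i. s\<^sub>D (k i)) x \<iota> \<pi>"
proof (rule D.decomposition_by_idempotents[OF x])
  have xo: "x \<in> equivariant_objects G C" using x by simp
  show "s\<^sub>D j \<in> Obj D" if "j \<in> J\<^sub>D" for j using s\<^sub>D_obj[OF that] by simp
  fix n :: nat and k \<iota> \<pi>
  assume k: "\<And>i. i < n \<Longrightarrow> k i \<in> J\<^sub>D" and \<iota>: "\<And>i. i < n \<Longrightarrow> \<iota> i \<in> Hom D (s\<^sub>D (k i)) x"
    and \<pi>: "\<And>i. i < n \<Longrightarrow> \<pi> i \<in> Hom D x (s\<^sub>D (k i))" and 1: "\<And>i. i < n \<Longrightarrow> \<pi> i \<star>\<^bsub>D\<^esub> \<iota> i = Idt D (s\<^sub>D (k i))"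
    and 0: "\<And>i j. i < n \<Longrightarrow> j < n \<Longrightarrow> i \<noteq> j \<Longrightarrow> \<pi> i \<star>\<^bsub>D\<^esub> \<iota> j = ZeroArr D (s\<^sub>D (k j)) (s\<^sub>D (k i))"
  \<comment> \<open>The bound comes from the underlying object, whose endomorphism space is known to
    be finite-dimensional.\<close>
  show "n \<le> hom_dim C (fst x) (fst x)"
  proof (rule orthonormal_bound[where F = "\<lambda>i. fst (s\<^sub>D (k i))" and \<iota> = "\<lambda>i. mid (\<iota> i)" and \<pi> = "\<lambda>i. mid (\<pi> i)"])
    show "fst x \<in> Obj C" by (rule eobj(1)[OF xo])
    then show "hom_fin (fst x) (fst x)" by (intro E.hom_fin)
    show "\<not> zero_object C (fst (s\<^sub>D (k i)))" if "i < n" for i by (rule s\<^sub>D_nonzero[OF k[OF that]])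
    show "mid (\<iota> i) \<in> Hom C (fst (s\<^sub>D (k i))) (fst x)" if "i < n" for i using \<iota>[OF that] unfolding D_Hom by simp
    show "mid (\<pi> i) \<in> Hom C (fst x) (fst (s\<^sub>D (k i)))" if "i < n" for i using \<pi>[OF that] unfolding D_Hom by simp
    show "mid (\<pi> i) \<star> mid (\<iota> i) = Idt C (fst (s\<^sub>D (k i)))" if "i < n" for i
      using arg_cong[OF 1[OF that], of mid] by simp
    show "mid (\<pi> i) \<star> mid (\<iota> j) = ZeroArr C (fst (s\<^sub>D (k j))) (fst (s\<^sub>D (k i)))" if "i < n" "j < n" "i \<noteq> j" for i j
      using arg_cong[OF 0[OF that], of mid] by simp
  qed
next
  have xo: "x \<in> equivariant_objects G C" using x by simp
  fix e assume e: "e \<in> Hom D x x" and ee: "e \<star>\<^bsub>D\<^esub> e = e" and e0: "e \<noteq> ZeroArr D x x"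
  note e' = e[unfolded D_Hom]
  let ?E = "mid e"
  have E: "?E \<in> Hom C (fst x) (fst x)" "eqv (snd x) (snd x) ?E" using e' by simp_all
  have EE: "?E \<star> ?E = ?E" using arg_cong[OF ee, of mid] by simp
  have "?E \<noteq> ZeroArr C (fst x) (fst x)"
  proof
    assume "?E = ZeroArr C (fst x) (fst x)"
    then have "e = ZeroArr D x x" using e' by (intro prod_eqI) simp_all
    then show False using e0 by blast
  qed
  from standard_subobject[OF xo E EE this] obtain j f r where j: "j \<in> J\<^sub>D"
    and f: "f \<in> Hom C (fst (s\<^sub>D j)) (fst x)" "eqv (snd (s\<^sub>D j)) (snd x) f" "?E \<star> f = f"
    and r: "r \<in> Hom C (fst x) (fst (s\<^sub>D j))" "eqv (snd x) (snd (s\<^sub>D j)) r" "r \<star> f = Idt C (fst (s\<^sub>D j))" by blast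
  note jo = s\<^sub>D_obj[OF j]
  \<comment> \<open>Composing the retraction with the idempotent makes it absorb the idempotent,
    without changing its composite with \<open>f\<close>.\<close>
  have rE: "r \<star> ?E \<in> Hom C (fst x) (fst (s\<^sub>D j))" "eqv (snd x) (snd (s\<^sub>D j)) (r \<star> ?E)" "(r \<star> ?E) \<star> f = Idt C (fst (s\<^sub>D j))"
    "(r \<star> ?E) \<star> ?E = r \<star> ?E"
    using E r f EE eqv_comp[OF xo xo jo E r(1,2)] by simp_all
  have "(s\<^sub>D j, f, x) \<in> Hom D (s\<^sub>D j) x" "(x, r \<star> ?E, s\<^sub>D j) \<in> Hom D x (s\<^sub>D j)"
    unfolding D_Hom using f rE jo xo by simp_all
  moreover have "(x, r \<star> ?E, s\<^sub>D j) \<star>\<^bsub>D\<^esub> (s\<^sub>D j, f, x) = Idt D (s\<^sub>D j)" using rE(3) by simp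
  moreover have "e \<star>\<^bsub>D\<^esub> (s\<^sub>D j, f, x) = (s\<^sub>D j, f, x)" using f(3) e' by simp
  moreover have "(x, r \<star> ?E, s\<^sub>D j) \<star>\<^bsub>D\<^esub> e = (x, r \<star> ?E, s\<^sub>D j)" using rE(4) e' by simp
  ultimately show "\<exists>j f r. j \<in> J\<^sub>D \<and> f \<in> Hom D (s\<^sub>D j) x \<and> r \<in> Hom D x (s\<^sub>D j) \<and> r \<star>\<^bsub>D\<^esub> f = Idt D (s\<^sub>D j)
      \<and> e \<star>\<^bsub>D\<^esub> f = f \<and> r \<star>\<^bsub>D\<^esub> e = r"
    using j by blast
qed

lemma D_schur_basis: "schur_basis D J\<^sub>D s\<^sub>D"
proof (intro schur_basis.intro D.linear_category_axioms schur_basis_axioms.intro)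
  show "finite J\<^sub>D" by (rule finite_J\<^sub>D)
  show "s\<^sub>D j \<in> Obj D" if "j \<in> J\<^sub>D" for j using s\<^sub>D_obj[OF that] by simp
  show "\<not> zero_object D (s\<^sub>D j)" if "j \<in> J\<^sub>D" for j using s\<^sub>D_nonzero[OF that] by (simp add: D_zero_object)
  show "\<exists>a. f = ScaleArr D a (Idt D (s\<^sub>D j))" if "j \<in> J\<^sub>D" "f \<in> Hom D (s\<^sub>D j) (s\<^sub>D j)" for j f
    by (rule s\<^sub>D_scalar[OF that])
  show "f = ZeroArr D (s\<^sub>D i) (s\<^sub>D j)" if "i \<in> J\<^sub>D" "j \<in> J\<^sub>D" "i \<noteq> j" "f \<in> Hom D (s\<^sub>D i) (s\<^sub>D j)" for i j f
    by (rule s\<^sub>D_orthogonal[OF that])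
  show "\<exists>(n::nat) k \<iota> \<pi>. (\<forall>i<n. k i \<in> J\<^sub>D) \<and> is_direct_sum D {..<n} (\<lambda>i. s\<^sub>D (k i)) x \<iota> \<pi>" if "x \<in> Obj D" for x
    by (rule D_decomposition[OF that])
qed

sublocale D: schur_basis D J\<^sub>D s\<^sub>D by (rule D_schur_basis)

section \<open>Frobenius-Perron dimensions\<close>

definition w\<^sub>D :: "(int \<times> (int \<Rightarrow> complex)) + 'a set \<Rightarrow> nat" where
  "w\<^sub>D = case_sum (\<lambda>(i, \<chi>). if i = 0 then 1 else q) (\<lambda>_. p)"

lemma w\<^sub>D_simps [simp]: "w\<^sub>D (Inl (i, \<chi>)) = (if i = 0 then 1 else q)" "w\<^sub>D (Inr \<O>) = p"
  by (simp_all add: w\<^sub>D_def)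

lemma W_\<delta> [simp]: "W (\<delta> a) = 1"
  using W_s[of "Inl a"] by simp

lemma W_Unit [simp]: "W (Unit C) = 1"
  using E.weight_iso[OF Unit_iso_\<delta>, of w] by simp

lemma W_s\<^sub>D:
  assumes "j \<in> J\<^sub>D"
  shows "W (fst (s\<^sub>D j)) = w\<^sub>D j"
  using assms
proof (cases rule: J\<^sub>D_cases)
  case (1 i \<chi>)
  then show ?thesis using W_s[of "Inr i"] by (simp add: base_def)
next
  case (2 \<O>)
  obtain \<iota> \<pi> where ds: "is_direct_sum C \<O> \<delta> (fst (orbit_obj \<O>)) \<iota> \<pi>" using orbit_obj(2)[OF 2(2)] by blast
  have "W (fst (orbit_obj \<O>)) = card \<O>" using E.weight_direct_sum[OF ds, of w] by simp
  then show ?thesis using 2 card_orbit by (auto simp: nonzero_orbits_eq)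
qed

lemma w\<^sub>D_pos: "0 < w\<^sub>D j"
  using p_gt_1 prime_gt_0_nat[OF q_prime] by (cases j) (auto simp: w\<^sub>D_def)

text \<open>Forgetting the equivariant structure preserves direct sums, so weights can be computed
  on underlying objects, where multiplicativity is already established.\<close>

lemma D_weight: "x \<in> Obj D \<Longrightarrow> D.weight w\<^sub>D x = W (fst x)"
proof -
  assume "x \<in> Obj D"
  from D_decomposition[OF this] obtain n :: nat and k \<iota> \<pi>
    where k: "\<forall>i<n. k i \<in> J\<^sub>D" and ds: "is_direct_sum D {..<n} (\<lambda>i. s\<^sub>D (k i)) x \<iota> \<pi>" by blast
  have "D.weight w\<^sub>D x = (\<Sum>i<n. w\<^sub>D (k i))"
    using D.weight_direct_sum[OF ds, of w\<^sub>D] D.weight_s k by simp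
  also have "\<dots> = W (fst x)"
    using E.weight_direct_sum[OF direct_sum_mid[OF ds], of w] W_s\<^sub>D k by simp
  finally show ?thesis .
qed

lemma J\<^sub>D_nonempty: "J\<^sub>D \<noteq> {}"
proof -
  have "characters G \<noteq> {}" using card_characters p_gt_1 by (intro notI) simp
  then show ?thesis using zero_in_G unfolding J\<^sub>D_def by blast
qed

lemma D_FPdim:
  assumes x: "x \<in> Obj D"
  shows "FPdim D x = W (fst x)"
proof (rule FPdim_eq_weight[OF D_schur_basis J\<^sub>D_nonempty, where W = "\<lambda>x. W (fst x)"])
  show "0 < W (fst (s\<^sub>D j))" if "j \<in> J\<^sub>D" for j using W_s\<^sub>D[OF that] w\<^sub>D_pos by simp
  show "W (fst y) = (\<Sum>j\<in>J\<^sub>D. W (fst (s\<^sub>D j)) * hom_dim D (s\<^sub>D j) y)" if "y \<in> Obj D" for y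
    unfolding D_weight[OF that, symmetric] D.weight_def using W_s\<^sub>D by (intro sum.cong) simp_all
  show "y \<boxdot>\<^bsub>D\<^esub> z \<in> Obj D \<and> W (fst (y \<boxdot>\<^bsub>D\<^esub> z)) = W (fst y) * W (fst z)" if "y \<in> Obj D" "z \<in> Obj D" for y z
    using that W_mult[of "fst y" "fst z"] tensor_obj[of y z] by (simp add: eobj(1))
qed fact

lemma W_fst_iso: "isomorphic D x y \<Longrightarrow> W (fst x) = W (fst y)"
  by (rule E.weight_iso[OF D_isomorphic_fst])

text \<open>The dimension of an equivariant object is the weight of its underlying object, so
  sorting simple classes by dimension amounts to sorting the index set by weight.\<close>

lemma simple_classes_of_dim_bij:
  "bij_betw (\<lambda>j. iso_class D (s\<^sub>D j)) {j \<in> J\<^sub>D. w\<^sub>D j = d} (simple_classes_of_dim D (real d))"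
proof -
  have "simple_classes_of_dim D (real d) = (\<lambda>j. iso_class D (s\<^sub>D j)) ` {j \<in> J\<^sub>D. w\<^sub>D j = d}"
  proof
    show "simple_classes_of_dim D (real d) \<subseteq> (\<lambda>j. iso_class D (s\<^sub>D j)) ` {j \<in> J\<^sub>D. w\<^sub>D j = d}"
    proof
      fix A assume "A \<in> simple_classes_of_dim D (real d)"
      then obtain x where A: "A = iso_class D x" and x: "simple D x" "FPdim D x = d"
        unfolding simple_classes_of_dim_def by blast
      have xO: "x \<in> Obj D" using x(1) by (simp add: simple_def)
      obtain j where j: "j \<in> J\<^sub>D" "isomorphic D x (s\<^sub>D j)" by (rule D.simple_iso_s[OF x(1)])
      have "w\<^sub>D j = d" using W_s\<^sub>D[OF j(1)] W_fst_iso[OF j(2)] x(2) unfolding D_FPdim[OF xO] by simp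
      moreover have "A = iso_class D (s\<^sub>D j)" unfolding A using D.iso_class_eq_iff[OF xO] j(2) by blast
      ultimately show "A \<in> (\<lambda>j. iso_class D (s\<^sub>D j)) ` {j \<in> J\<^sub>D. w\<^sub>D j = d}" using j(1) by blast
    qed
    show "(\<lambda>j. iso_class D (s\<^sub>D j)) ` {j \<in> J\<^sub>D. w\<^sub>D j = d} \<subseteq> simple_classes_of_dim D (real d)"
    proof
      fix A assume "A \<in> (\<lambda>j. iso_class D (s\<^sub>D j)) ` {j \<in> J\<^sub>D. w\<^sub>D j = d}"
      then obtain j where j: "A = iso_class D (s\<^sub>D j)" "j \<in> J\<^sub>D" "w\<^sub>D j = d" by blast
      have "FPdim D (s\<^sub>D j) = real d" unfolding D_FPdim[OF D.s_Obj[OF j(2)]] W_s\<^sub>D[OF j(2)] j(3) ..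
      then show "A \<in> simple_classes_of_dim D (real d)"
        unfolding simple_classes_of_dim_def j(1) using D.s_simple[OF j(2)] by blast
    qed
  qed
  moreover have "inj_on (\<lambda>j. iso_class D (s\<^sub>D j)) {j \<in> J\<^sub>D. w\<^sub>D j = d}"
    by (rule inj_on_subset[OF D.inj_on_iso_class]) blast
  ultimately show ?thesis by (simp add: bij_betw_def)
qed

text \<open>Keeps the orbit objects of dimension p apart from the objects of dimension q.\<close>

lemma p_ne_q: "p \<noteq> q"
proof
  assume "p = q"
  then have "p dvd 1" using p_dvd by (metis dvd_add_triv_left_iff)
  then show False using p_gt_1 by simp
qed

lemma q_gt_1: "1 < q" using q_prime by (rule prime_gt_1_nat)

lemma J\<^sub>D_of_weight:
  "{j \<in> J\<^sub>D. w\<^sub>D j = 1} = (\<lambda>\<chi>. Inl (0, \<chi>)) ` characters G"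
  "{j \<in> J\<^sub>D. w\<^sub>D j = p} = Inr ` nonzero_orbits p c"
  "{j \<in> J\<^sub>D. w\<^sub>D j = q} = Inl ` (G' \<times> characters G)"
proof -
  note ne = less_imp_neq[OF p_gt_1] less_imp_neq[OF q_gt_1] p_ne_q
  have Inl_J: "Inl y \<in> J\<^sub>D \<longleftrightarrow> y \<in> carrier G \<times> characters G" "w\<^sub>D (Inl y) = (if fst y = 0 then 1 else q)" for y
    by (cases y; simp)+
  have a1: "j \<in> {j \<in> J\<^sub>D. w\<^sub>D j = 1} \<longleftrightarrow> j \<in> (\<lambda>\<chi>. Inl (0, \<chi>)) ` characters G" for j
  proof (cases j)
    case (Inl y)
    then show ?thesis using ne(2) by (cases y) (simp add: image_iff)
  next
    case (Inr \<O>)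
    then show ?thesis using ne(1) by (simp add: image_iff)
  qed
  show "{j \<in> J\<^sub>D. w\<^sub>D j = 1} = (\<lambda>\<chi>. Inl (0, \<chi>)) ` characters G" by (rule Set.set_eqI) (rule a1)
  have ap: "j \<in> {j \<in> J\<^sub>D. w\<^sub>D j = p} \<longleftrightarrow> j \<in> Inr ` nonzero_orbits p c" for j
  proof (cases j)
    case (Inl y)
    then show ?thesis using ne by (simp add: image_iff Inl_J)
  next
    case (Inr \<O>)
    then show ?thesis by (simp add: image_iff)
  qed
  show "{j \<in> J\<^sub>D. w\<^sub>D j = p} = Inr ` nonzero_orbits p c" by (rule Set.set_eqI) (rule ap)
  have aq: "j \<in> {j \<in> J\<^sub>D. w\<^sub>D j = q} \<longleftrightarrow> j \<in> Inl ` (G' \<times> characters G)" for j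
  proof (cases j)
    case (Inl y)
    then show ?thesis using ne(2) by (cases y) (simp add: image_iff)
  next
    case (Inr \<O>)
    then show ?thesis using ne(3) by (simp add: image_iff)
  qed
  show "{j \<in> J\<^sub>D. w\<^sub>D j = q} = Inl ` (G' \<times> characters G)" by (rule Set.set_eqI) (rule aq)
qed

section \<open>Counting the simple and the invertible objects\<close>

lemma invertible_bij: "bij_betw (\<lambda>\<chi>. iso_class D (twist 0 \<chi>)) (characters G) (simple_classes_of_dim D 1)"
proof -
  have "bij_betw (\<lambda>\<chi>. Inl (0, \<chi>)) (characters G) {j \<in> J\<^sub>D. w\<^sub>D j = 1}"
    unfolding J\<^sub>D_of_weight(1) by (rule inj_on_imp_bij_betw) (simp add: inj_on_def)
  from bij_betw_trans[OF this simple_classes_of_dim_bij] show ?thesis by (simp add: o_def)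
qed

lemma orbit_objects_bij:
  "bij_betw (\<lambda>\<O>. iso_class D (orbit_obj \<O>)) (nonzero_orbits p c) (simple_classes_of_dim D p)"
proof -
  have "bij_betw Inr (nonzero_orbits p c) {j \<in> J\<^sub>D. w\<^sub>D j = p}"
    unfolding J\<^sub>D_of_weight(2) by (rule inj_on_imp_bij_betw) simp
  from bij_betw_trans[OF this simple_classes_of_dim_bij] show ?thesis by (simp add: o_def)
qed

lemma twisted_objects_bij:
  "bij_betw (\<lambda>(i, \<chi>). iso_class D (twist i \<chi>)) (G' \<times> characters G) (simple_classes_of_dim D q)"
proof -
  have "bij_betw Inl (G' \<times> characters G) {j \<in> J\<^sub>D. w\<^sub>D j = q}"
    unfolding J\<^sub>D_of_weight(3) by (rule inj_on_imp_bij_betw) simp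
  from bij_betw_trans[OF this simple_classes_of_dim_bij]
  have "bij_betw ((\<lambda>j. iso_class D (s\<^sub>D j)) \<circ> Inl) (G' \<times> characters G) (simple_classes_of_dim D q)" .
  moreover have "(\<lambda>j. iso_class D (s\<^sub>D j)) \<circ> Inl = (\<lambda>(i, \<chi>). iso_class D (twist i \<chi>))" by (auto simp: fun_eq_iff)
  ultimately show ?thesis by simp
qed

lemma D_simple_classes:
  "simple_classes D = simple_classes_of_dim D 1 \<union> simple_classes_of_dim D p \<union> simple_classes_of_dim D q"
proof -
  have "w\<^sub>D j = 1 \<or> w\<^sub>D j = p \<or> w\<^sub>D j = q" for j
    by (cases j) (simp_all add: w\<^sub>D_def case_prod_beta)
  then have "J\<^sub>D = {j \<in> J\<^sub>D. w\<^sub>D j = 1} \<union> {j \<in> J\<^sub>D. w\<^sub>D j = p} \<union> {j \<in> J\<^sub>D. w\<^sub>D j = q}" by blast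
  then have "simple_classes D
      = (\<lambda>j. iso_class D (s\<^sub>D j)) ` ({j \<in> J\<^sub>D. w\<^sub>D j = 1} \<union> {j \<in> J\<^sub>D. w\<^sub>D j = p} \<union> {j \<in> J\<^sub>D. w\<^sub>D j = q})"
    unfolding D.simple_classes_eq by (rule arg_cong)
  then show ?thesis
    unfolding image_Un bij_betw_imp_surj_on[OF simple_classes_of_dim_bij] by simp
qed

lemma D_cat_rank: "cat_rank D = p\<^sup>2 + (q\<^sup>2 - 1) div p"
proof -
  have "card J\<^sub>D = card (carrier G \<times> characters G) + card (nonzero_orbits p c)"
    unfolding J\<^sub>D_def by (rule card_Plus) (simp_all add: finite_G finite_characters)
  then show ?thesis
    unfolding D.cat_rank_eq
    by (simp add: card_cartesian_product card_carrier_G card_characters card_nonzero_orbits power2_eq_square)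
qed

text \<open>The left unit constraint at the unit object is equivariant: the scalars of the two
  twists cancel, and T_g respects the unit constraint because it is a monoidal functor.\<close>

lemma twist_tensor_inverse:
  assumes \<chi>: "\<chi> \<in> characters G" and \<psi>: "\<psi> \<in> characters G" and inv: "\<And>g. g \<in> carrier G \<Longrightarrow> \<chi> g * \<psi> g = 1"
  shows "isomorphic D (equivariant_tensor G C (twist 0 \<chi>) (twist 0 \<psi>)) (Unit D)"
proof -
  let ?x = "twist 0 \<chi>" and ?y = "twist 0 \<psi>" and ?e = "Unit C" and ?l = "LUnit C (Unit C)"
  have b: "base 0 = (Unit C, unit_structure G C)" by (simp add: base_def)
  note x = twist_obj[OF zero_in_G \<chi>] and y = twist_obj[OF zero_in_G \<psi>]
  note t = tensor_obj[OF x y]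
  have l [simp]: "iso_arr ?l" "Dom C ?l = ?e \<boxdot> ?e" "Cod C ?l = ?e" using LUnit_Isos[of ?e] by simp_all
  have "eqv (snd (equivariant_tensor G C ?x ?y)) (unit_structure G C) ?l"
    unfolding eqv_def
  proof
    fix g assume g [simp]: "g \<in> carrier G"
    let ?U = "ActU C g" and ?T = "ActT C g ?e ?e" and ?X = "ActO C g ?e"
    have s: "snd (equivariant_tensor G C ?x ?y) g = (snd ?x g \<boxtimes> snd ?y g) \<star> Inv C ?T"
      by (simp add: equivariant_tensor_def case_prod_beta b)
    have xy: "snd ?x g \<boxtimes> snd ?y g = Inv C ?U \<boxtimes> Inv C ?U"
      using inv[OF g] by (simp add: snd_twist b unit_structure_def mult.commute)
    \<comment> \<open>The unit axiom of the monoidal functor T_g, taken at the unit object; the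
      other leg of the square is naturality of the left unit constraint.\<close>
    have A: "(ActA C g ?l \<star> ?T) \<star> (?U \<boxtimes> Idt C ?X) = LUnit C ?X" using Act_LUnit[OF g, of ?e] by simp
    have N: "LUnit C ?X \<star> (Idt C ?e \<boxtimes> ?U) = ?U \<star> ?l" using LUnit_natural[of ?U ?e ?X] by simp
    have "(ActA C g ?l \<star> ?T) \<star> (?U \<boxtimes> ?U) = ((ActA C g ?l \<star> ?T) \<star> (?U \<boxtimes> Idt C ?X)) \<star> (Idt C ?e \<boxtimes> ?U)"
      by (simp add: tarr_comp)
    also have "\<dots> = ?U \<star> ?l" unfolding A N ..
    finally have e: "ActA C g ?l \<star> ?T \<star> (?U \<boxtimes> ?U) = ?U \<star> ?l" by simp
    have "Inv C ?U \<star> (ActA C g ?l \<star> ?T \<star> (?U \<boxtimes> ?U)) \<star> (Inv C ?U \<boxtimes> Inv C ?U) \<star> Inv C ?T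
        = Inv C ?U \<star> (?U \<star> ?l) \<star> (Inv C ?U \<boxtimes> Inv C ?U) \<star> Inv C ?T"
      unfolding e ..
    moreover have "(?U \<boxtimes> ?U) \<star> (Inv C ?U \<boxtimes> Inv C ?U) \<star> Inv C ?T = Inv C ?T"
    proof -
      have "(?U \<boxtimes> ?U) \<star> (Inv C ?U \<boxtimes> Inv C ?U) = Idt C (?X \<boxdot> ?X)" by (simp add: tarr_comp)
      then have "((?U \<boxtimes> ?U) \<star> (Inv C ?U \<boxtimes> Inv C ?U)) \<star> Inv C ?T = Inv C ?T" by simp
      then show ?thesis by simp
    qed
    ultimately have "Inv C ?U \<star> ActA C g ?l = ?l \<star> (Inv C ?U \<boxtimes> Inv C ?U) \<star> Inv C ?T" by simp
    then show "?l \<star> snd (equivariant_tensor G C ?x ?y) g = unit_structure G C g \<star> ActA C g ?l"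
      unfolding s xy by (simp add: unit_structure_def)
  qed
  then have "(equivariant_tensor G C ?x ?y, ?l, Unit D) \<in> Arr D"
    using t unit_obj by (simp add: earr_iff b)
  then have "D.iso_arr (equivariant_tensor G C ?x ?y, ?l, Unit D)" by (rule D_iso_arrI) simp
  from D.isomorphicI[OF this] show ?thesis by simp
qed

lemma inverse_character:
  assumes "\<chi> \<in> characters G"
  obtains \<psi> where "\<psi> \<in> characters G" "\<And>g. g \<in> carrier G \<Longrightarrow> \<chi> g * \<psi> g = 1"
proof -
  obtain \<omega> where \<omega>: "\<omega> ^ p = 1" "\<chi> = \<chi>\<^sub>c \<omega>" using assms unfolding characters_eq by blast
  then have "\<omega> \<noteq> 0" using p_gt_1 by (auto simp: power_0_left)
  then have "\<chi>\<^sub>c \<omega> g * \<chi>\<^sub>c (inverse \<omega>) g = 1" if "g \<in> carrier G" for g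
    using that by (simp add: \<chi>\<^sub>c_def power_inverse)
  moreover have "\<chi>\<^sub>c (inverse \<omega>) \<in> characters G" using \<omega>(1) by (intro \<chi>\<^sub>c_character) (simp add: power_inverse)
  ultimately show thesis using that \<omega>(2) by blast
qed

lemma D_invertible_classes: "invertible_classes D = simple_classes_of_dim D 1"
proof
  show "invertible_classes D \<subseteq> simple_classes_of_dim D 1"
  proof
    fix A assume "A \<in> invertible_classes D"
    then obtain x y where A: "A = iso_class D x" and x: "x \<in> Obj D" and y: "y \<in> Obj D"
      and xy: "isomorphic D (x \<boxdot>\<^bsub>D\<^esub> y) (Unit D)"
      unfolding invertible_classes_def invertible_object_def by blast
    \<comment> \<open>Weights are natural numbers, so multiplicativity forces an invertible object
      to have weight 1.\<close>
    have "W (fst x) * W (fst y) = 1"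
      using W_fst_iso[OF xy] x y tensor_obj[of x y] W_mult[of "fst x" "fst y"] by (simp add: eobj(1))
    then have "D.weight w\<^sub>D x = 1" using D_weight[OF x] by simp
    from D.weight_eq_1E[OF x w\<^sub>D_pos this] obtain j where j: "j \<in> J\<^sub>D" "w\<^sub>D j = 1" "isomorphic D x (s\<^sub>D j)" by blast
    have "A = iso_class D (s\<^sub>D j)" unfolding A using D.iso_class_eq_iff[OF x] j(3) by blast
    then show "A \<in> simple_classes_of_dim D 1"
      using simple_classes_of_dim_bij[of 1] j(1,2) unfolding bij_betw_def by auto
  qed
  show "simple_classes_of_dim D 1 \<subseteq> invertible_classes D"
  proof
    fix A assume "A \<in> simple_classes_of_dim D 1"
    then obtain \<chi> where \<chi>: "\<chi> \<in> characters G" and A: "A = iso_class D (twist 0 \<chi>)"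
      using invertible_bij unfolding bij_betw_def by blast
    obtain \<psi> where \<psi>: "\<psi> \<in> characters G" "\<And>g. g \<in> carrier G \<Longrightarrow> \<chi> g * \<psi> g = 1" using inverse_character[OF \<chi>] by blast
    have "isomorphic D (twist 0 \<chi> \<boxdot>\<^bsub>D\<^esub> twist 0 \<psi>) (Unit D)" "isomorphic D (twist 0 \<psi> \<boxdot>\<^bsub>D\<^esub> twist 0 \<chi>) (Unit D)"
      using twist_tensor_inverse[OF \<chi> \<psi>] twist_tensor_inverse[OF \<psi>(1) \<chi>] \<psi>(2) by (simp_all add: mult.commute)
    then have "invertible_object D (twist 0 \<chi>)"
      unfolding invertible_object_def using twist_obj[OF zero_in_G] \<chi> \<psi>(1) by auto
    then show "A \<in> invertible_classes D" unfolding A invertible_classes_def by blast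
  qed
qed

end

theorem proposition4p2:
  fixes p q :: nat
    and c :: "'a::{field, finite}"
    and \<delta> :: "'a \<Rightarrow> 'o"
    and E :: "(int, 'o, 'm) crossed_cat"
    and G :: "int monoid"
    and D :: "('o \<times> (int \<Rightarrow> 'm), ('o \<times> (int \<Rightarrow> 'm)) \<times> 'm \<times> ('o \<times> (int \<Rightarrow> 'm))) braided_cat"
  assumes "prime p" "odd p" "prime q" "odd q" "p dvd q + 1"
    and "card (UNIV :: 'a set) = q\<^sup>2"
    and "c \<noteq> 1" "field_norm q c = 1" "c ^ p = 1"
    and "norm_crossed_extension p q c \<delta> E"
    and "G = integer_mod_group p"
    and "D = equivariantization G E"
  shows
    "cat_rank D = p\<^sup>2 + (q\<^sup>2 - 1) div p
     \<and> simple_classes D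
         = simple_classes_of_dim D 1 \<union> simple_classes_of_dim D p \<union> simple_classes_of_dim D q
     \<and> (card (simple_classes_of_dim D 1) = p
        \<and> invertible_classes D = simple_classes_of_dim D 1
        \<and> bij_betw (\<lambda>\<chi>. iso_class D (Unit E, twisted_structure G E \<chi> (unit_structure G E)))
            (characters G) (simple_classes_of_dim D 1))
     \<and> (card (simple_classes_of_dim D p) = (q\<^sup>2 - 1) div p
        \<and> (\<exists>XO u.
             (\<forall>\<O>\<in>nonzero_orbits p c. (\<exists>\<iota> \<pi>. is_direct_sum E \<O> \<delta> (XO \<O>) \<iota> \<pi>)
                \<and> (XO \<O>, u \<O>) \<in> equivariant_objects G E)
             \<and> bij_betw (\<lambda>\<O>. iso_class D (XO \<O>, u \<O>))
                 (nonzero_orbits p c) (simple_classes_of_dim D p)))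
     \<and> (card (simple_classes_of_dim D q) = (p - 1) * p
        \<and> (\<exists>X u.
             (\<forall>i\<in>carrier G - {0}. simple E (X i) \<and> X i \<in> Deg E i
                \<and> (\<forall>Y\<in>Deg E i. simple E Y \<longrightarrow> isomorphic E Y (X i))
                \<and> (X i, u i) \<in> equivariant_objects G E)
             \<and> bij_betw (\<lambda>(i, \<chi>). iso_class D (X i, twisted_structure G E \<chi> (u i)))
                 ((carrier G - {0}) \<times> characters G) (simple_classes_of_dim D q)))"
proof -
  \<comment> \<open>The norm form is the instance of the parameter \<open>t\<close>.\<close>
  have N: "norm_extension G E p q (norm_quadratic_form q) c \<delta>"
    using assms unfolding norm_crossed_extension_def norm_extension_def norm_extension_axioms_def by simp
  note bij1 = norm_extension.invertible_bij[OF N] and bijp = norm_extension.orbit_objects_bij[OF N]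
    and bijq = norm_extension.twisted_objects_bij[OF N]
  let ?orb = "norm_extension.orbit_obj G E \<delta>" and ?base = "norm_extension.base G E"
  have D: "equivariantization G E = D" using assms by simp
  have tw: "norm_extension.twist G E i \<chi> = (fst (?base i), twisted_structure G E \<chi> (snd (?base i)))" for i \<chi>
    by (rule norm_extension.twist_def[OF N])
  \<comment> \<open>Identifies the twists in degree 0 with the unit carrying a multiple of
    \<open>unit_structure\<close>, the form in which the invertible objects are claimed.\<close>
  have b0: "?base 0 = (Unit E, unit_structure G E)" using norm_extension.base_def[OF N, of 0] by simp
  have G: "card (carrier G - {0}) = p - 1"
    using norm_extension.card_carrier_G[OF N] norm_extension.zero_in_G[OF N] by (simp add: card_Diff_singleton_if)
  have 1: "bij_betw (\<lambda>\<chi>. iso_class D (Unit E, twisted_structure G E \<chi> (unit_structure G E)))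
            (characters G) (simple_classes_of_dim D 1)"
    using bij1 by (simp add: D tw b0)
  have p: "bij_betw (\<lambda>\<O>. iso_class D (fst (?orb \<O>), snd (?orb \<O>))) (nonzero_orbits p c) (simple_classes_of_dim D p)"
    using bijp by (simp add: D)
  have q: "bij_betw (\<lambda>(i, \<chi>). iso_class D (fst (?base i), twisted_structure G E \<chi> (snd (?base i))))
      ((carrier G - {0}) \<times> characters G) (simple_classes_of_dim D q)"
    using bijq by (simp add: D tw)
  show ?thesis
  proof (intro conjI)
    show "cat_rank D = p\<^sup>2 + (q\<^sup>2 - 1) div p" using norm_extension.D_cat_rank[OF N] by (simp add: D)
    show "simple_classes D = simple_classes_of_dim D 1 \<union> simple_classes_of_dim D p \<union> simple_classes_of_dim D q"
      using norm_extension.D_simple_classes[OF N] by (simp add: D)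
    show "card (simple_classes_of_dim D 1) = p"
      using bij_betw_same_card[OF 1] norm_extension.card_characters[OF N] by simp
    show "invertible_classes D = simple_classes_of_dim D 1"
      using norm_extension.D_invertible_classes[OF N] by (simp add: D)
    show "card (simple_classes_of_dim D p) = (q\<^sup>2 - 1) div p"
      using bij_betw_same_card[OF p] norm_extension.card_nonzero_orbits[OF N] by simp
    show "card (simple_classes_of_dim D q) = (p - 1) * p"
      using bij_betw_same_card[OF q] norm_extension.card_characters[OF N] G by (simp add: card_cartesian_product)
    show "\<exists>XO u. (\<forall>\<O>\<in>nonzero_orbits p c. (\<exists>\<iota> \<pi>. is_direct_sum E \<O> \<delta> (XO \<O>) \<iota> \<pi>)
          \<and> (XO \<O>, u \<O>) \<in> equivariant_objects G E)
        \<and> bij_betw (\<lambda>\<O>. iso_class D (XO \<O>, u \<O>)) (nonzero_orbits p c) (simple_classes_of_dim D p)"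
      using p norm_extension.orbit_obj[OF N]
      by (intro exI[of _ "\<lambda>\<O>. fst (?orb \<O>)"] exI[of _ "\<lambda>\<O>. snd (?orb \<O>)"]) simp
    show "\<exists>X u. (\<forall>i\<in>carrier G - {0}. simple E (X i) \<and> X i \<in> Deg E i
          \<and> (\<forall>Y\<in>Deg E i. simple E Y \<longrightarrow> isomorphic E Y (X i)) \<and> (X i, u i) \<in> equivariant_objects G E)
        \<and> bij_betw (\<lambda>(i, \<chi>). iso_class D (X i, twisted_structure G E \<chi> (u i)))
            ((carrier G - {0}) \<times> characters G) (simple_classes_of_dim D q)"
    proof (intro exI conjI ballI impI)
      fix i assume i: "i \<in> carrier G - {0}"
      then have iG: "i \<in> carrier G" "i \<noteq> 0" by simp_all
      note base = norm_extension.base[OF N iG(1)]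
      show "simple E (fst (?base i))" "fst (?base i) \<in> Deg E i" by (fact base)+
      show "isomorphic E Y (fst (?base i))" if "Y \<in> Deg E i" "simple E Y" for Y
        using norm_extension.simple_Deg_unique[OF N iG that(2,1) base(2,3)] .
      show "(fst (?base i), snd (?base i)) \<in> equivariant_objects G E" using base(1) by simp
    qed (rule q)
  qed (fact 1)
qed

end
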